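(* Let $k$ be an algebraically closed field of characteristic zero, $n$ a positive integer with $4\mid n$, $q\in k$ a primitive $n^2$-th root of unity, and $A=\mathrm{Qu}_q(\mathfrak{sl}_2)$, with the left $A$-modules $P_{2i,j},S_{2i,j}$ defined in the context. For $1\le i_1,i_2\le\frac{n^2}{2}$ and $0\le j_1,j_2\le1$ we have: (a) If $2i_1-1\ge n^2-2i_2+1$ and $i_1\le i_2$, then $$P_{2i_1,j_1}\otimes S_{2i_2,j_2}\cong\bigoplus_{l=0}^{n^2-2i_2}P_{n^2+2i_1-2i_2-2l,\overline{j_1+j_2+l}}.$$ (b) If $2i_1-1\ge n^2-2i_2+1$ and $i_1>i_2$, then $$P_{2i_1,j_1}\otimes S_{2i_2,j_2}\cong\bigoplus_{l=0}^{i_1-i_2-1}2P_{2i_1-2i_2-2l,\overline{j_1+j_2+l}}\oplus\bigoplus_{l=0}^{n^2-2i_1}P_{n^2-2i_1+2i_2-2l,\overline{j_1+j_2+l}}.$$ (c) If $2i_1-1<n^2-2i_2+1$ and $i_1\le i_2$, then $$P_{2i_1,j_1}\otimes S_{2i_2,j_2}\cong\bigoplus_{l=0}^{2i_1-2}P_{n^2+2i_1-2i_2-2l,\overline{j_1+j_2+l}}\oplus\bigoplus_{l=0}^{\frac{n^2}{2}-i_1-i_2}2P_{n^2-2i_1-2i_2+2-2l,\overline{j_1+j_2+l-1}}.$$ (d) If $2i_1-1<n^2-2i_2+1$ and $i_1>i_2$, then $$P_{2i_1,j_1}\otimes S_{2i_2,j_2}\cong\bigoplus_{l=0}^{i_1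-i_2-1}2P_{2i_1-2i_2-2l,\overline{j_1+j_2+l}}\oplus\bigoplus_{l=0}^{2i_2-2}P_{n^2-2i_1+2i_2-2l,\overline{j_1+j_2+l}}\oplus\bigoplus_{l=0}^{\frac{n^2}{2}-i_1-i_2}2P_{n^2-2i_1-2i_2+2-2l,\overline{j_1+j_2+l-1}}.$$
   Context: Here $\overline r\in\{0,1\}$ denotes the least non-negative residue of the integer $r$ modulo $2$, and $2P$ means $P\oplus P$. Let $\mathfrak q:=q^n$. The associative unital $k$-algebra $A=\mathrm{Qu}_q(\mathfrak{sl}_2)$ is generated by $\kappa,\hat\kappa,E,F$ with relations $\kappa^n=1$, $\hat\kappa^n=\kappa^{-2}$, $\kappa\hat\kappa=\hat\kappa\kappa$, $\kappa E\kappa^{-1}=\mathfrak qE$, $\kappa F\kappa^{-1}=\mathfrak q^{-1}F$, $\hat\kappa E\hat\kappa^{-1}=\mathfrak q q^{-2}E$, $\hat\kappa F\hat\kappa^{-1}=\mathfrak q^{-1}q^2F$, $E^{n^2}=F^{n^2}=0$, $FE-q^{-1}EF=1-\kappa^{-1}\hat\kappa$. Put $1_i=\frac1n\sum_{r=0}^{n-1}(\mathfrak q^{n-i})^r\kappa^r$ and $\flat=\sum_{i=0}^{n-1}q^{-i}1_i$. $A$ is a quasi-Hopf algebra with reassociator $\sum_{i,j,r=0}^{n-1}\mathfrak q^{-i[\frac{j+r}{n}]}1_i\otimes1_j\otimes1_r$ ($[\cdot]$ the integer part), comultiplication $\Delta(\kappa)=\kappa\otimes\kappa$, $\Delta(\hat\kappa)=\hat\kappa\otimes\hat\kappa$,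 $\Delta(E)=E\otimes\flat^{-1}+\kappa^{-1}\otimes1_0E+1\otimes\sum_{i=1}^{n-1}1_iE$, $\Delta(F)=F\otimes\flat+\kappa^{-1}\hat\kappa\otimes F\sum_{i=1}^{n-1}1_i+\hat\kappa\otimes F1_0$, and counit $\varepsilon(\kappa)=\varepsilon(\hat\kappa)=1$, $\varepsilon(E)=\varepsilon(F)=0$. For left $A$-modules $M,N$, the module $M\otimes N$ is $M\otimes_kN$ with $A$ acting through $\Delta$. Let $\mathbf u^0$ be the subalgebra generated by $\kappa,\hat\kappa$; one has $A=\bigoplus_{0\le a,b\le n^2-1}F^a\mathbf u^0E^b$. With $m=n/2$, put $\varphi_{2i}=\frac{1}{mn}\sum_{r=0}^{mn-1}q^{-2ir}(\kappa^{-1}\hat\kappa)^r$, $\mathbf 1_0=\frac12(1+\kappa\hat\kappa^{n/2})$, $\mathbf 1_1=\frac12(1-\kappa\hat\kappa^{n/2})$ (boldface, distinct from the $1_i$ above), $e_{2i,j}=\varphi_{2i}\mathbf 1_j$. For $1\le i\le\frac{n^2}{2}$, $j\in\{0,1\}$, put $\alpha_{2i,j}=F^{n^2-1}e_{2i,j}$, $\beta_{2i,j}=E^{2i-2}\alpha_{2i,j}$, $\widetilde\alpha_{2i,j}=E^{2i-1}\alpha_{2i,j}$, and let $\gamma_{2i,j}$ be the unique element of $\bigoplus_{0\le a\le n^2-2,\ 0\le b\le n^2-1}F^a\mathbf u^0E^b$ with $F\gamma_{2i,j}=\beta_{2i,j}$. Define $P_{2i,j}:=A\gamma_{2i,j}$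 and $S_{2i,j}:=\mathrm{Soc}(P_{2i,j})$ (spanned by $E^l\widetilde\alpha_{2i,j}$, $0\le l\le n^2-2i$). *)

theory Defs
  imports
    "HOL-Algebra.Algebraic_Closure_Type"
    "HOL-Algebra.QuotRing"
    "HOL-Algebra.Generated_Rings"
    "HOL-Algebra.Module"
    "HOL-Library.Poly_Mapping"
begin

section \<open>Left modules over a (possibly non-commutative) ring\<close>

text \<open>The locale \<^locale>\<open>module\<close> of HOL-Algebra requires a commutative base ring, but the record
  underlying it and the locale \<^locale>\<open>submodule\<close> do not. The ring-multiplication fields
  \<^term>\<open>monoid.mult\<close> and \<^term>\<open>monoid.one\<close> of that record play no role for modules.\<close>

definition regular_module :: "('a, 'r) ring_scheme \<Rightarrow> ('a, 'a) module" where
  "regular_module A = \<lparr>carrier = carrier A, monoid.mult = (\<otimes>\<^bsub>A\<^esub>), one = \<one>\<^bsub>A\<^esub>,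
     zero = \<zero>\<^bsub>A\<^esub>, add = (\<oplus>\<^bsub>A\<^esub>), module.smult = (\<otimes>\<^bsub>A\<^esub>)\<rparr>"

definition module_isomorphic ::
  "('a, 'r) ring_scheme \<Rightarrow> ('a, 'm) module \<Rightarrow> ('a, 'n) module \<Rightarrow> bool" where
  "module_isomorphic A M N \<longleftrightarrow> (\<exists>f. bij_betw f (carrier M) (carrier N) \<and>
     (\<forall>x\<in>carrier M. \<forall>y\<in>carrier M. f (x \<oplus>\<^bsub>M\<^esub> y) = f x \<oplus>\<^bsub>N\<^esub> f y) \<and>
     (\<forall>a\<in>carrier A. \<forall>x\<in>carrier M. f (a \<odot>\<^bsub>M\<^esub> x) = a \<odot>\<^bsub>N\<^esub> f x))"

definition simple_submodule ::
  "'m set \<Rightarrow> ('a, 'r) ring_scheme \<Rightarrow> ('a, 'm) module \<Rightarrow> bool" where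
  "simple_submodule H A M \<longleftrightarrow> submodule H A M \<and> H \<noteq> {\<zero>\<^bsub>M\<^esub>} \<and>
     (\<forall>K. submodule K A M \<and> K \<subseteq> H \<longrightarrow> K = {\<zero>\<^bsub>M\<^esub>} \<or> K = H)"

text \<open>The sum of all simple submodules, as the least submodule containing each of them.\<close>

definition socle :: "('a, 'r) ring_scheme \<Rightarrow> ('a, 'm) module \<Rightarrow> 'm set" where
  "socle A M = \<Inter> {H. submodule H A M \<and> (\<forall>K. simple_submodule K A M \<longrightarrow> K \<subseteq> H)}"

definition dsum :: "('a, 'm) module \<Rightarrow> ('a, 'n) module \<Rightarrow> ('a, 'm \<times> 'n) module"
    (infixr \<open>\<boxplus>\<close> 65) where
  "M \<boxplus> N = \<lparr>carrier = carrier M \<times> carrier N, monoid.mult = undefined, one = undefined,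
     zero = (\<zero>\<^bsub>M\<^esub>, \<zero>\<^bsub>N\<^esub>),
     add = (\<lambda>(x, y) (x', y'). (x \<oplus>\<^bsub>M\<^esub> x', y \<oplus>\<^bsub>N\<^esub> y')),
     module.smult = (\<lambda>a (x, y). (a \<odot>\<^bsub>M\<^esub> x, a \<odot>\<^bsub>N\<^esub> y))\<rparr>"

text \<open>Only used for finite \<open>I\<close>, where direct sum and direct product coincide.\<close>

definition dsum_family :: "'i set \<Rightarrow> ('i \<Rightarrow> ('a, 'm) module) \<Rightarrow> ('a, 'i \<Rightarrow> 'm) module" where
  "dsum_family I M = \<lparr>carrier = (\<Pi>\<^sub>E i\<in>I. carrier (M i)), monoid.mult = undefined, one = undefined,
     zero = (\<lambda>i\<in>I. \<zero>\<^bsub>M i\<^esub>),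
     add = (\<lambda>f g. \<lambda>i\<in>I. f i \<oplus>\<^bsub>M i\<^esub> g i),
     module.smult = (\<lambda>a f. \<lambda>i\<in>I. a \<odot>\<^bsub>M i\<^esub> f i)\<rparr>"

syntax
  "_dsum_family" :: "pttrn \<Rightarrow> 'i set \<Rightarrow> ('a, 'm) module \<Rightarrow> ('a, 'i \<Rightarrow> 'm) module"
    (\<open>(3DSUM _\<in>_./ _)\<close> [0, 0, 70] 70)
translations
  "DSUM i\<in>I. M" \<rightleftharpoons> "CONST dsum_family I (\<lambda>i. M)"


section \<open>Tensor products over the ground field\<close>

text \<open>
  A \<open>k\<close>-algebra is a ring \<open>A\<close> with a structure map \<open>\<eta> :: 'k \<Rightarrow> 'a\<close>; every left \<open>A\<close>-module is
  thereby a \<open>k\<close>-space. The tensor product of \<open>M\<close> and \<open>N\<close> over \<open>k\<close> is the quotient of the free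
  \<open>k\<close>-space on \<^term>\<open>carrier M \<times> carrier N\<close> by the bilinearity relations. The relators are closed
  under multiplication by \<open>k\<close>, so the additive subgroup they generate is a \<open>k\<close>-subspace.\<close>

definition formal_sums ::
  "('a, 'm) module \<Rightarrow> ('a, 'n) module \<Rightarrow> ('m \<times> 'n \<Rightarrow>\<^sub>0 'k::field) monoid" where
  "formal_sums M N = \<lparr>carrier = {z. Poly_Mapping.keys z \<subseteq> carrier M \<times> carrier N},
     monoid.mult = (+), one = 0\<rparr>"

definition tensor_relators ::
  "('k::field \<Rightarrow> 'a) \<Rightarrow> ('a, 'm) module \<Rightarrow> ('a, 'n) module \<Rightarrow> ('m \<times> 'n \<Rightarrow>\<^sub>0 'k) set" where
  "tensor_relators \<eta> M N =
     {Poly_Mapping.single (x \<oplus>\<^bsub>M\<^esub> x', y) c - Poly_Mapping.single (x, y) c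
        - Poly_Mapping.single (x', y) c | x x' y c.
        x \<in> carrier M \<and> x' \<in> carrier M \<and> y \<in> carrier N} \<union>
     {Poly_Mapping.single (x, y \<oplus>\<^bsub>N\<^esub> y') c - Poly_Mapping.single (x, y) c
        - Poly_Mapping.single (x, y') c | x y y' c.
        x \<in> carrier M \<and> y \<in> carrier N \<and> y' \<in> carrier N} \<union>
     {Poly_Mapping.single (\<eta> d \<odot>\<^bsub>M\<^esub> x, y) c - Poly_Mapping.single (x, y) (c * d) | x y c d.
        x \<in> carrier M \<and> y \<in> carrier N} \<union>
     {Poly_Mapping.single (x, \<eta> d \<odot>\<^bsub>N\<^esub> y) c - Poly_Mapping.single (x, y) (c * d) | x y c d.
        x \<in> carrier M \<and> y \<in> carrier N}"

definition tensor_null ::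
  "('k::field \<Rightarrow> 'a) \<Rightarrow> ('a, 'm) module \<Rightarrow> ('a, 'n) module \<Rightarrow> ('m \<times> 'n \<Rightarrow>\<^sub>0 'k) set" where
  "tensor_null \<eta> M N = generate (formal_sums M N) (tensor_relators \<eta> M N)"

definition tensor_class ::
  "('k::field \<Rightarrow> 'a) \<Rightarrow> ('a, 'm) module \<Rightarrow> ('a, 'n) module \<Rightarrow> ('m \<times> 'n \<Rightarrow>\<^sub>0 'k)
     \<Rightarrow> ('m \<times> 'n \<Rightarrow>\<^sub>0 'k) set" where
  "tensor_class \<eta> M N z = tensor_null \<eta> M N #>\<^bsub>formal_sums M N\<^esub> z"

definition tensor_space ::
  "('k::field \<Rightarrow> 'a) \<Rightarrow> ('a, 'm) module \<Rightarrow> ('a, 'n) module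
     \<Rightarrow> ('m \<times> 'n \<Rightarrow>\<^sub>0 'k) set monoid" where
  "tensor_space \<eta> M N = formal_sums M N Mod tensor_null \<eta> M N"

definition pure_tensor ::
  "('k::field \<Rightarrow> 'a) \<Rightarrow> ('a, 'm) module \<Rightarrow> ('a, 'n) module \<Rightarrow> 'm \<Rightarrow> 'n
     \<Rightarrow> ('m \<times> 'n \<Rightarrow>\<^sub>0 'k) set" where
  "pure_tensor \<eta> M N x y = tensor_class \<eta> M N (Poly_Mapping.single (x, y) 1)"

text \<open>
  The bilinear map from (A tensor A) and (M tensor N) to (M tensor N) that sends the pure tensors
  of \<open>(a, b)\<close> and \<open>(x, y)\<close> to the pure tensor of \<open>(a x, b y)\<close>, first on formal sums, then on classes.
  As in the library's \<^term>\<open>rcoset_mult\<close>, the result on classes is the union over all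
  representatives, all of which contribute the same class.\<close>

definition formal_act ::
  "('a, 'm) module \<Rightarrow> ('a, 'n) module \<Rightarrow> ('a \<times> 'a \<Rightarrow>\<^sub>0 'k::field) \<Rightarrow> ('m \<times> 'n \<Rightarrow>\<^sub>0 'k)
     \<Rightarrow> ('m \<times> 'n \<Rightarrow>\<^sub>0 'k)" where
  "formal_act M N t z =
     (\<Sum>(a, b)\<in>Poly_Mapping.keys t. \<Sum>(x, y)\<in>Poly_Mapping.keys z.
        Poly_Mapping.single (a \<odot>\<^bsub>M\<^esub> x, b \<odot>\<^bsub>N\<^esub> y)
          (Poly_Mapping.lookup t (a, b) * Poly_Mapping.lookup z (x, y)))"

definition tensor_act ::
  "('k::field \<Rightarrow> 'a) \<Rightarrow> ('a, 'm) module \<Rightarrow> ('a, 'n) module \<Rightarrow> ('a \<times> 'a \<Rightarrow>\<^sub>0 'k) set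
     \<Rightarrow> ('m \<times> 'n \<Rightarrow>\<^sub>0 'k) set \<Rightarrow> ('m \<times> 'n \<Rightarrow>\<^sub>0 'k) set" where
  "tensor_act \<eta> M N T Z = (\<Union>t\<in>T. \<Union>z\<in>Z. tensor_class \<eta> M N (formal_act M N t z))"

definition tensor_algebra ::
  "('k::field \<Rightarrow> 'a) \<Rightarrow> ('a, 'r) ring_scheme \<Rightarrow> ('a \<times> 'a \<Rightarrow>\<^sub>0 'k) set ring" where
  "tensor_algebra \<eta> A = (let R = regular_module A in
     \<lparr>carrier = carrier (tensor_space \<eta> R R), monoid.mult = tensor_act \<eta> R R,
      one = pure_tensor \<eta> R R \<one>\<^bsub>A\<^esub> \<one>\<^bsub>A\<^esub>,
      zero = \<one>\<^bsub>tensor_space \<eta> R R\<^esub>, add = monoid.mult (tensor_space \<eta> R R)\<rparr>)"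

text \<open>Here \<open>D\<close> is the comultiplication.\<close>

definition tensor_module ::
  "('k::field \<Rightarrow> 'a) \<Rightarrow> ('a \<Rightarrow> ('a \<times> 'a \<Rightarrow>\<^sub>0 'k) set) \<Rightarrow> ('a, 'm) module \<Rightarrow> ('a, 'n) module
     \<Rightarrow> ('a, ('m \<times> 'n \<Rightarrow>\<^sub>0 'k) set) module" where
  "tensor_module \<eta> D M N =
     \<lparr>carrier = carrier (tensor_space \<eta> M N), monoid.mult = undefined, one = undefined,
      zero = \<one>\<^bsub>tensor_space \<eta> M N\<^esub>, add = monoid.mult (tensor_space \<eta> M N),
      module.smult = (\<lambda>a. tensor_act \<eta> M N (D a))\<rparr>"


section \<open>The algebra\<close>

datatype qu_gen = Kappa | Kappa_hat | Gen_E | Gen_F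

datatype qu_word = Word (letters: "qu_gen list")

instantiation qu_word :: monoid_add
begin

definition zero_qu_word :: qu_word where
  "0 = Word []"

definition plus_qu_word :: "qu_word \<Rightarrow> qu_word \<Rightarrow> qu_word" where
  "u + v = Word (letters u @ letters v)"

instance
  by standard (simp_all add: zero_qu_word_def plus_qu_word_def)

end

text \<open>With concatenation as addition of words, the convolution product of
  \<^theory>\<open>HOL-Library.Poly_Mapping\<close> is the product of the free associative algebra.\<close>

type_synonym 'k free_qu = "qu_word \<Rightarrow>\<^sub>0 'k"

abbreviation free_qu :: "'k::field free_qu ring" where
  "free_qu \<equiv> ring_of_type_algebra"

definition fgen :: "qu_gen \<Rightarrow> 'k::field free_qu" where
  "fgen g = Poly_Mapping.single (Word [g]) 1"

definition fscalar :: "'k::field \<Rightarrow> 'k free_qu" where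
  "fscalar c = Poly_Mapping.single 0 c"

text \<open>
  Here \<open>\<kappa>'\<close> is kappa-hat and \<open>qq\<close> is \<open>q\<^sup>n\<close>. Since \<open>\<kappa>\<^sup>n = 1\<close> makes \<open>\<kappa>\<close>, and hence also \<open>\<kappa>'\<close>,
  invertible, inverses of these elements have been multiplied out, e.g. \<open>\<kappa> E \<kappa>\<^sup>-\<^sup>1 = q\<^sup>n E\<close> is
  written \<open>\<kappa> E - q\<^sup>n E \<kappa>\<close>; the inverse of \<open>\<kappa>\<close> in the last relator is \<open>\<kappa>\<^bsup>n-1\<^esup>\<close>.\<close>

definition qu_relators :: "nat \<Rightarrow> 'k::field \<Rightarrow> 'k free_qu set" where
  "qu_relators n q =
     (let \<kappa> = fgen Kappa; \<kappa>' = fgen Kappa_hat; E = fgen Gen_E; F = fgen Gen_F; qq = q ^ n in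
      {\<kappa> ^ n - 1,
       \<kappa>' ^ n * \<kappa> ^ 2 - 1,
       \<kappa> * \<kappa>' - \<kappa>' * \<kappa>,
       \<kappa> * E - fscalar qq * E * \<kappa>,
       \<kappa> * F - fscalar (inverse qq) * F * \<kappa>,
       \<kappa>' * E - fscalar (qq * inverse (q ^ 2)) * E * \<kappa>',
       \<kappa>' * F - fscalar (inverse qq * q ^ 2) * F * \<kappa>',
       E ^ (n ^ 2),
       F ^ (n ^ 2),
       (F * E - fscalar (inverse q) * E * F) - (1 - \<kappa> ^ (n - 1) * \<kappa>')})"

definition qu_ideal :: "nat \<Rightarrow> 'k::field \<Rightarrow> 'k free_qu set" where
  "qu_ideal n q = genideal free_qu (qu_relators n q)"

definition qu :: "nat \<Rightarrow> 'k::field \<Rightarrow> 'k free_qu set ring" where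
  "qu n q = free_qu Quot (qu_ideal n q)"

context
  fixes n :: nat and q :: "'k::field"
begin

abbreviation "Qu \<equiv> qu n q"

abbreviation qu_mult (infixl \<open>\<cdot>\<close> 70) where "x \<cdot> y \<equiv> x \<otimes>\<^bsub>Qu\<^esub> y"

definition qu_class :: "'k free_qu \<Rightarrow> 'k free_qu set" where
  "qu_class p = qu_ideal n q +>\<^bsub>free_qu\<^esub> p"

definition qu_unit :: "'k \<Rightarrow> 'k free_qu set" where
  "qu_unit c = qu_class (fscalar c)"

definition qu_scale :: "'k \<Rightarrow> 'k free_qu set \<Rightarrow> 'k free_qu set" (infixr \<open>\<star>\<close> 75) where
  "c \<star> a = qu_unit c \<cdot> a"

definition qu_kappa :: "'k free_qu set" where "qu_kappa = qu_class (fgen Kappa)"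
definition qu_kappa_hat :: "'k free_qu set" where "qu_kappa_hat = qu_class (fgen Kappa_hat)"
definition qu_E :: "'k free_qu set" where "qu_E = qu_class (fgen Gen_E)"
definition qu_F :: "'k free_qu set" where "qu_F = qu_class (fgen Gen_F)"

text \<open>The element \<open>1\<^sub>i\<close> (not to be confused with \<open>qu_bold_one\<close> below).\<close>

definition qu_idem :: "nat \<Rightarrow> 'k free_qu set" where
  "qu_idem i = (1 / of_nat n) \<star> (\<Oplus>\<^bsub>Qu\<^esub> r\<in>{..<n}. (((q ^ n) ^ (n - i)) ^ r) \<star> (qu_kappa [^]\<^bsub>Qu\<^esub> r))"

definition qu_flat :: "'k free_qu set" where
  "qu_flat = (\<Oplus>\<^bsub>Qu\<^esub> i\<in>{..<n}. (inverse q ^ i) \<star> qu_idem i)"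

abbreviation QuQu :: "('k free_qu set \<times> 'k free_qu set \<Rightarrow>\<^sub>0 'k) set ring" where
  "QuQu \<equiv> tensor_algebra qu_unit Qu"

abbreviation qu_tensor_elem (infixl \<open>\<otimes>\<^sub>A\<close> 68) where
  "a \<otimes>\<^sub>A b \<equiv> pure_tensor qu_unit (regular_module Qu) (regular_module Qu) a b"

text \<open>The unique homomorphism of \<open>k\<close>-algebras with the prescribed values on the generators.\<close>

definition qu_comult :: "'k free_qu set \<Rightarrow> ('k free_qu set \<times> 'k free_qu set \<Rightarrow>\<^sub>0 'k) set" where
  "qu_comult = (THE D. D \<in> extensional (carrier Qu) \<and> D \<in> ring_hom Qu QuQu \<and>
     (\<forall>c. D (qu_unit c) = qu_unit c \<otimes>\<^sub>A \<one>\<^bsub>Qu\<^esub>) \<and>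
     D qu_kappa = qu_kappa \<otimes>\<^sub>A qu_kappa \<and>
     D qu_kappa_hat = qu_kappa_hat \<otimes>\<^sub>A qu_kappa_hat \<and>
     D qu_E = qu_E \<otimes>\<^sub>A inv\<^bsub>Qu\<^esub> qu_flat \<oplus>\<^bsub>QuQu\<^esub> inv\<^bsub>Qu\<^esub> qu_kappa \<otimes>\<^sub>A (qu_idem 0 \<cdot> qu_E)
        \<oplus>\<^bsub>QuQu\<^esub> \<one>\<^bsub>Qu\<^esub> \<otimes>\<^sub>A (\<Oplus>\<^bsub>Qu\<^esub> i\<in>{1..n-1}. qu_idem i \<cdot> qu_E) \<and>
     D qu_F = qu_F \<otimes>\<^sub>A qu_flat
        \<oplus>\<^bsub>QuQu\<^esub> (inv\<^bsub>Qu\<^esub> qu_kappa \<cdot> qu_kappa_hat) \<otimes>\<^sub>A (qu_F \<cdot> (\<Oplus>\<^bsub>Qu\<^esub> i\<in>{1..n-1}. qu_idem i))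
        \<oplus>\<^bsub>QuQu\<^esub> qu_kappa_hat \<otimes>\<^sub>A (qu_F \<cdot> qu_idem 0))"

definition qu_tensor ::
  "('k free_qu set, 'm) module \<Rightarrow> ('k free_qu set, 'l) module
     \<Rightarrow> ('k free_qu set, ('m \<times> 'l \<Rightarrow>\<^sub>0 'k) set) module" where
  "qu_tensor M N = tensor_module qu_unit qu_comult M N"

text \<open>Below, the parameter \<open>s\<close> stands for the even index \<open>2i\<close>, and \<open>j\<close> is \<open>0\<close> or \<open>1\<close>.\<close>

definition qu_u0 :: "'k free_qu set set" where
  "qu_u0 = generate_ring Qu (range qu_unit \<union> {qu_kappa, qu_kappa_hat})"

definition qu_phi :: "nat \<Rightarrow> 'k free_qu set" where
  "qu_phi s = (let m = n div 2 in
     (1 / of_nat (m * n)) \<star> (\<Oplus>\<^bsub>Qu\<^esub> r\<in>{..<m * n}.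
        (inverse q ^ (s * r)) \<star> ((inv\<^bsub>Qu\<^esub> qu_kappa \<cdot> qu_kappa_hat) [^]\<^bsub>Qu\<^esub> r)))"

definition qu_bold_one :: "nat \<Rightarrow> 'k free_qu set" where
  "qu_bold_one j = (let g = qu_kappa \<cdot> qu_kappa_hat [^]\<^bsub>Qu\<^esub> (n div 2) in
     (1 / 2) \<star> (if j = 0 then \<one>\<^bsub>Qu\<^esub> \<oplus>\<^bsub>Qu\<^esub> g else \<one>\<^bsub>Qu\<^esub> \<ominus>\<^bsub>Qu\<^esub> g))"

definition qu_e_idem :: "nat \<Rightarrow> nat \<Rightarrow> 'k free_qu set" where
  "qu_e_idem s j = qu_phi s \<cdot> qu_bold_one j"

definition qu_alpha :: "nat \<Rightarrow> nat \<Rightarrow> 'k free_qu set" where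
  "qu_alpha s j = qu_F [^]\<^bsub>Qu\<^esub> (n ^ 2 - 1) \<cdot> qu_e_idem s j"

definition qu_beta :: "nat \<Rightarrow> nat \<Rightarrow> 'k free_qu set" where
  "qu_beta s j = qu_E [^]\<^bsub>Qu\<^esub> (s - 2) \<cdot> qu_alpha s j"

text \<open>The sum of all \<open>F\<^sup>a u\<^sup>0 E\<^sup>b\<close> with \<open>a \<le> n\<^sup>2 - 2\<close> and \<open>b \<le> n\<^sup>2 - 1\<close>.\<close>

definition qu_lower_span :: "'k free_qu set set" where
  "qu_lower_span =
     {\<Oplus>\<^bsub>Qu\<^esub> a\<in>{0..n ^ 2 - 2}. \<Oplus>\<^bsub>Qu\<^esub> b\<in>{0..n ^ 2 - 1}. qu_F [^]\<^bsub>Qu\<^esub> a \<cdot> u a b \<cdot> qu_E [^]\<^bsub>Qu\<^esub> b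
        | u :: nat \<Rightarrow> nat \<Rightarrow> 'k free_qu set. \<forall>a b. u a b \<in> qu_u0}"

definition qu_gamma :: "nat \<Rightarrow> nat \<Rightarrow> 'k free_qu set" where
  "qu_gamma s j = (THE g. g \<in> qu_lower_span \<and> qu_F \<cdot> g = qu_beta s j)"

definition qu_P :: "nat \<Rightarrow> nat \<Rightarrow> ('k free_qu set, 'k free_qu set) module" where
  "qu_P s j = (regular_module Qu)\<lparr>carrier := {a \<cdot> qu_gamma s j | a. a \<in> carrier Qu}\<rparr>"

definition qu_S :: "nat \<Rightarrow> nat \<Rightarrow> ('k free_qu set, 'k free_qu set) module" where
  "qu_S s j = (regular_module Qu)\<lparr>carrier := socle Qu (qu_P s j)\<rparr>"

end

definition residue2 :: "int \<Rightarrow> nat" where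
  "residue2 r = nat (r mod 2)"

definition primitive_root_of_unity :: "nat \<Rightarrow> 'k::field \<Rightarrow> bool" where
  "primitive_root_of_unity N q \<longleftrightarrow> N > 0 \<and> q ^ N = 1 \<and> (\<forall>m. 0 < m \<and> m < N \<longrightarrow> q ^ m \<noteq> 1)"

end

theory Submission
 imports Defs
begin

text \<open>A module is a direct sum of modules \<open>P\<close> as soon as it contains weight vectors \<open>\<alpha>\<close>, \<open>\<gamma>\<close> with the relations of those in \<open>P\<close>,
 the vectors \<open>\<alpha>\<close>, \<open>E\<^bsup>2i-1\<^esup> \<alpha>\<close> are independent and the dimensions agree. If \<open>S\<close> is spanned by \<open>E\<^sup>m s\<close>, \<open>m < d\<close>, a weight vector
 \<open>b\<close> of \<open>P\<close> with \<open>F\<^sup>d b = 0\<close> is the leading term of such an \<open>\<alpha>\<close> in \<open>P \<otimes> S\<close>, and \<open>\<gamma>\<close> exists since \<open>ker F\<^bsup>N-1\<^esup> = im F\<close> on \<open>P \<otimes> S\<close>.\<close>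

section \<open>Algebras over a field and their modules\<close>

text \<open>Two objects are given by definite descriptions, and each hides a problem of existence or
  uniqueness. For the comultiplication the relations must be verified in
  \<open>A \<otimes> A\<close>; the obstacle is that the idempotents \<open>1_i\<close> in
  \<Delta>(E) and \<Delta>(F) make the formulas jump whenever the \<kappa>-exponent of the second
  factor passes a multiple of n. Rescaling tensors of \<kappa>-eigenvectors by powers of q removes
  the jumps and leaves q-binomial computations. For \<gamma>, uniqueness rests on the independence
  of the \<open>F^a u E^b\<close>, which is read off from modules induced from characters of the
  torus. Put N = n^2. Weights are a sign and an integer modulo N/2. A leading term at position l of
  the string \<open>E^l \<alpha>\<close> or \<open>E^l \<gamma>\<close> of P gives a summand with
  parameter i fixed by its weight, and occupies the positions l and l + 2i - 1; these positions must
  all differ. The multiplicity 2 arises because terms with the same parameter are found twice, once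
  on each string.\<close>

locale kalg = ring A for A :: "('a, 'r) ring_scheme" (structure) and \<eta> :: "'k::field => 'a" +
 assumes unit_closed [simp, intro]: "\<eta> c \<in> carrier A"
  and unit_add: "\<eta> (c + d) = \<eta> c \<oplus> \<eta> d"
  and unit_mult: "\<eta> (c * d) = \<eta> c \<otimes> \<eta> d"
  and unit_one: "\<eta> 1 = \<one>"
  and unit_central: "x \<in> carrier A ==> x \<otimes> \<eta> c = \<eta> c \<otimes> x"

locale kmod = kalg A \<eta> + M: abelian_group M
 for A :: "('a, 'r) ring_scheme" (structure) and \<eta> :: "'k::field => 'a" and M :: "('a, 'm) module" +
 assumes act_closed [simp, intro]: "[|a \<in> carrier A; x \<in> carrier M|] ==> a \<odot>\<^bsub>M\<^esub> x \<in> carrier M"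
  and act_l_distr: "[|a \<in> carrier A; b \<in> carrier A; x \<in> carrier M|] ==>
   (a \<oplus> b) \<odot>\<^bsub>M\<^esub> x = a \<odot>\<^bsub>M\<^esub> x \<oplus>\<^bsub>M\<^esub> b \<odot>\<^bsub>M\<^esub> x"
  and act_r_distr: "[|a \<in> carrier A; x \<in> carrier M; y \<in> carrier M|] ==>
   a \<odot>\<^bsub>M\<^esub> (x \<oplus>\<^bsub>M\<^esub> y) = a \<odot>\<^bsub>M\<^esub> x \<oplus>\<^bsub>M\<^esub> a \<odot>\<^bsub>M\<^esub> y"
  and act_assoc: "[|a \<in> carrier A; b \<in> carrier A; x \<in> carrier M|] ==>
   (a \<otimes> b) \<odot>\<^bsub>M\<^esub> x = a \<odot>\<^bsub>M\<^esub> (b \<odot>\<^bsub>M\<^esub> x)"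
  and act_one [simp]: "x \<in> carrier M ==> \<one> \<odot>\<^bsub>M\<^esub> x = x"
begin

definition sc :: "'k => 'm => 'm" where "sc c x = \<eta> c \<odot>\<^bsub>M\<^esub> x"

lemma sc_closed [simp, intro]: "x \<in> carrier M ==> sc c x \<in> carrier M" by (simp add: sc_def)

lemma sc_add: "x \<in> carrier M ==> sc (c + d) x = sc c x \<oplus>\<^bsub>M\<^esub> sc d x"
 by (simp add: sc_def unit_add act_l_distr)

lemma sc_add_right: "[|x \<in> carrier M; y \<in> carrier M|] ==> sc c (x \<oplus>\<^bsub>M\<^esub> y) = sc c x \<oplus>\<^bsub>M\<^esub> sc c y"
 by (simp add: sc_def act_r_distr)

lemma sc_sc [simp]: "x \<in> carrier M ==> sc c (sc d x) = sc (c * d) x"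
 by (simp add: sc_def unit_mult act_assoc)

lemma sc_one [simp]: "x \<in> carrier M ==> sc 1 x = x" by (simp add: sc_def unit_one)

lemma act_zero_right [simp]: assumes "a \<in> carrier A" shows "a \<odot>\<^bsub>M\<^esub> \<zero>\<^bsub>M\<^esub> = \<zero>\<^bsub>M\<^esub>"
proof -
 have "a \<odot>\<^bsub>M\<^esub> \<zero>\<^bsub>M\<^esub> \<oplus>\<^bsub>M\<^esub> a \<odot>\<^bsub>M\<^esub> \<zero>\<^bsub>M\<^esub> = a \<odot>\<^bsub>M\<^esub> \<zero>\<^bsub>M\<^esub> \<oplus>\<^bsub>M\<^esub> \<zero>\<^bsub>M\<^esub>"
  using assms by (metis M.r_zero M.zero_closed act_closed act_r_distr)
 then show ?thesis using assms by (metis M.add.l_cancel M.zero_closed act_closed)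
qed

lemma act_zero_left [simp]: assumes "x \<in> carrier M" shows "\<zero> \<odot>\<^bsub>M\<^esub> x = \<zero>\<^bsub>M\<^esub>"
proof -
 have "\<zero> \<odot>\<^bsub>M\<^esub> x \<oplus>\<^bsub>M\<^esub> \<zero> \<odot>\<^bsub>M\<^esub> x = \<zero> \<odot>\<^bsub>M\<^esub> x \<oplus>\<^bsub>M\<^esub> \<zero>\<^bsub>M\<^esub>"
  using assms by (metis M.r_zero act_closed act_l_distr r_zero zero_closed)
 then show ?thesis using assms by (metis M.add.l_cancel M.zero_closed act_closed zero_closed)
qed

lemma sc_zero_right [simp]: "sc c \<zero>\<^bsub>M\<^esub> = \<zero>\<^bsub>M\<^esub>" by (simp add: sc_def)

lemma unit_zero: "\<eta> 0 = \<zero>"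
proof -
 have "\<eta> 0 \<oplus> \<eta> 0 = \<eta> 0 \<oplus> \<zero>" by (metis add_0 r_zero unit_add unit_closed)
 then show ?thesis by (metis add.l_cancel unit_closed zero_closed)
qed

lemma sc_zero [simp]: "x \<in> carrier M ==> sc 0 x = \<zero>\<^bsub>M\<^esub>" by (simp add: sc_def unit_zero)

lemma sc_minus_one: assumes "x \<in> carrier M" shows "sc (-1) x = \<ominus>\<^bsub>M\<^esub> x"
proof -
 have "sc (-1) x \<oplus>\<^bsub>M\<^esub> sc 1 x = \<zero>\<^bsub>M\<^esub>"
  using assms by (metis add.left_inverse sc_add sc_zero)
 then show ?thesis using assms by (simp add: M.minus_equality)
qed

lemma act_sc: "[|a \<in> carrier A; x \<in> carrier M|] ==> a \<odot>\<^bsub>M\<^esub> sc c x = sc c (a \<odot>\<^bsub>M\<^esub> x)"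
 unfolding sc_def by (metis act_assoc unit_central unit_closed)

lemma sc_cancel: assumes "x \<in> carrier M" "c \<noteq> 0" "sc c x = \<zero>\<^bsub>M\<^esub>" shows "x = \<zero>\<^bsub>M\<^esub>"
proof -
 have "x = sc (inverse c) (sc c x)" using assms(1,2) by simp
 also have "... = \<zero>\<^bsub>M\<^esub>" unfolding assms(3) by simp
 finally show ?thesis .
qed

lemma sc_eq_imp: assumes "x \<in> carrier M" "c \<noteq> 0" "sc c x = y" shows "x = sc (inverse c) y" using assms by auto

lemma act_finsum:
 assumes "finite I" "f \<in> I \<rightarrow> carrier M" "a \<in> carrier A"
 shows "a \<odot>\<^bsub>M\<^esub> finsum M f I = finsum M (\<lambda>i. a \<odot>\<^bsub>M\<^esub> f i) I" using assms
proof (induction I rule: finite_induct)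
 case (insert x F)
 then have "f \<in> F \<rightarrow> carrier M" "(\<lambda>i. a \<odot>\<^bsub>M\<^esub> f i) \<in> F \<rightarrow> carrier M" by auto
 with insert show ?case by (simp add: act_r_distr Pi_iff)
qed simp

lemma sc_finsum:
 assumes "finite I" "f \<in> I \<rightarrow> carrier M"
 shows "sc c (finsum M f I) = finsum M (\<lambda>i. sc c (f i)) I" unfolding sc_def by (rule act_finsum[OF assms]) simp

definition lc :: "'i set => ('i => 'm) => ('i => 'k) => 'm" where
 "lc I b c = finsum M (\<lambda>i. sc (c i) (b i)) I"

lemma lc_closed [simp, intro]: "b \<in> I \<rightarrow> carrier M ==> lc I b c \<in> carrier M"
 unfolding lc_def by (rule M.finsum_closed) auto

lemma lc_cong:
 "[|b \<in> I \<rightarrow> carrier M; \<And>i. i \<in> I ==> c i = c' i|] ==> lc I b c = lc I b c'"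
 unfolding lc_def by (rule M.finsum_cong') auto

lemma lc_empty [simp]: "lc {} b c = \<zero>\<^bsub>M\<^esub>" by (simp add: lc_def)

lemma lc_insert:
 "[|finite I; i \<notin> I; b i \<in> carrier M; b \<in> I \<rightarrow> carrier M|] ==>
  lc (insert i I) b c = sc (c i) (b i) \<oplus>\<^bsub>M\<^esub> lc I b c"
 unfolding lc_def by (subst M.finsum_insert) auto

lemma lc_add:
 assumes "finite I" "b \<in> I \<rightarrow> carrier M"
 shows "lc I b (\<lambda>i. c i + d i) = lc I b c \<oplus>\<^bsub>M\<^esub> lc I b d"
proof -
 have "lc I b (\<lambda>i. c i + d i) = finsum M (\<lambda>i. sc (c i) (b i) \<oplus>\<^bsub>M\<^esub> sc (d i) (b i)) I"
  unfolding lc_def using assms by (intro M.finsum_cong') (auto simp: sc_add Pi_iff)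
 then show ?thesis unfolding lc_def using assms by (subst (asm) M.finsum_addf) (auto simp: Pi_iff)
qed

lemma lc_sc: "[|finite I; b \<in> I \<rightarrow> carrier M|] ==> lc I b (\<lambda>i. a * c i) = sc a (lc I b c)"
 unfolding lc_def by (subst sc_finsum) (auto intro!: M.finsum_cong' simp: Pi_iff)

lemma lc_zero [simp]: assumes "b \<in> I \<rightarrow> carrier M" shows "lc I b (\<lambda>i. 0) = \<zero>\<^bsub>M\<^esub>"
proof -
 have "lc I b (\<lambda>i. 0) = finsum M (\<lambda>i. \<zero>\<^bsub>M\<^esub>) I"
  unfolding lc_def using assms by (intro M.finsum_cong') (auto simp: Pi_iff)
 then show ?thesis by simp
qed

lemma lc_act:
 "[|finite I; b \<in> I \<rightarrow> carrier M; a \<in> carrier A|] ==>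
  a \<odot>\<^bsub>M\<^esub> lc I b c = lc I (\<lambda>i. a \<odot>\<^bsub>M\<^esub> b i) c"
 unfolding lc_def by (subst act_finsum) (auto intro!: M.finsum_cong' simp: act_sc Pi_iff)

lemma lc_single:
 assumes "finite I" "b \<in> I \<rightarrow> carrier M" "j \<in> I"
 shows "lc I b (\<lambda>i. if i = j then a else 0) = sc a (b j)"
proof -
 have "lc (insert j (I - {j})) b (\<lambda>i. if i = j then a else 0)
   = sc a (b j) \<oplus>\<^bsub>M\<^esub> lc (I - {j}) b (\<lambda>i. if i = j then a else 0)"
  using assms by (subst lc_insert) auto
 also have "lc (I - {j}) b (\<lambda>i. if i = j then a else 0) = lc (I - {j}) b (\<lambda>i. 0)"
  using assms by (intro lc_cong) auto
 also have "... = \<zero>\<^bsub>M\<^esub>" using assms by (intro lc_zero) auto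
 finally show ?thesis using assms by (auto simp: insert_absorb Pi_iff)
qed

lemma lc_mono_neutral:
 assumes "finite J" "I \<subseteq> J" "b \<in> J \<rightarrow> carrier M" "\<And>i. i \<in> J - I ==> c i = 0"
 shows "lc J b c = lc I b c" unfolding lc_def using assms
 by (intro M.add.finprod_mono_neutral_cong_right) (auto simp: Pi_iff)

text \<open>Turns a linear operator into its matrix: with \<open>b'\<close> the images of the
  vectors \<open>b\<close>, coefficients transform by \<open>a\<close>.\<close>

lemma lc_matrix:
 assumes "finite I" "finite J" "b \<in> I \<rightarrow> carrier M"
  and "\<And>i. i \<in> J ==> b' i = lc I b (\<lambda>j. a j i)"
 shows "lc J b' c = lc I b (\<lambda>j. \<Sum>i\<in>J. a j i * c i)" using assms(2,4)
proof (induction J rule: finite_induct)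
 case empty then show ?case using assms by simp
next
 case (insert y F)
 have b': "b' \<in> F \<rightarrow> carrier M" "b' y \<in> carrier M" using insert assms by auto
 have "lc (insert y F) b' c = sc (c y) (b' y) \<oplus>\<^bsub>M\<^esub> lc F b' c" using insert b' by (intro lc_insert) auto
 also have "... = lc I b (\<lambda>j. c y * a j y) \<oplus>\<^bsub>M\<^esub> lc I b (\<lambda>j. \<Sum>i\<in>F. a j i * c i)"
  using insert assms by (simp add: lc_sc)
 also have "... = lc I b (\<lambda>j. c y * a j y + (\<Sum>i\<in>F. a j i * c i))" using assms by (simp add: lc_add)
 finally show ?case using insert by (simp add: mult.commute)
qed

definition kbasis :: "'i set => ('i => 'm) => bool" where
 "kbasis I b \<longleftrightarrow> finite I \<and> b \<in> I \<rightarrow> carrier M \<and> (\<forall>x\<in>carrier M. \<exists>c. x = lc I b c)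
  \<and> (\<forall>c. lc I b c = \<zero>\<^bsub>M\<^esub> \<longrightarrow> (\<forall>i\<in>I. c i = 0))"

lemma kbasisD:
 assumes "kbasis I b"
 shows "finite I" "b \<in> I \<rightarrow> carrier M" "\<And>x. x \<in> carrier M ==> \<exists>c. x = lc I b c"
  "\<And>c i. [|lc I b c = \<zero>\<^bsub>M\<^esub>; i \<in> I|] ==> c i = 0"
 using assms unfolding kbasis_def by blast+

lemma lc_diff:
 assumes "finite I" "b \<in> I \<rightarrow> carrier M" "lc I b c = lc I b d"
 shows "lc I b (\<lambda>i. c i - d i) = \<zero>\<^bsub>M\<^esub>"
proof -
 have "lc I b (\<lambda>i. c i + (-1) * d i) = lc I b c \<oplus>\<^bsub>M\<^esub> sc (-1) (lc I b d)"
  using assms(1,2) by (simp only: lc_add lc_sc)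
 also have "... = \<zero>\<^bsub>M\<^esub>" using assms by (simp add: sc_minus_one M.r_neg)
 finally show ?thesis by simp
qed

lemma kbasis_unique:
 assumes "kbasis I b" "lc I b c = lc I b d" "i \<in> I"
 shows "c i = d i" using kbasisD(4)[OF assms(1) lc_diff[OF kbasisD(1,2)[OF assms(1)] assms(2)] assms(3)] by simp

end

text \<open>Elimination of one unknown with the help of the equation \<open>j0\<close>. All
  dimension counting below goes through this lemma; dimensions themselves are never
  introduced.\<close>

lemma homogeneous_system:
 fixes a :: "'j => 'i => 'k::field"
 assumes "finite I" "finite J" "card I < card J"
 shows "\<exists>c. (\<exists>i\<in>J. c i \<noteq> 0) \<and> (\<forall>j\<in>I. (\<Sum>i\<in>J. a j i * c i) = 0)"
 using assms
proof (induction I arbitrary: J a rule: finite_induct)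
 case empty
 then have "J \<noteq> {}" by auto
 then show ?case by (intro exI[of _ "\<lambda>_. 1"]) auto
next
 case (insert j0 I)
 show ?case
 proof (cases "\<forall>i\<in>J. a j0 i = 0")
  case True
  from insert obtain c where "\<exists>i\<in>J. c i \<noteq> 0" "\<forall>j\<in>I. (\<Sum>i\<in>J. a j i * c i) = 0"
   by (metis Suc_lessD card_insert_disjoint)
  with True show ?thesis by (intro exI[of _ c]) auto
 next
  case False
  then obtain i0 where i0: "i0 \<in> J" "a j0 i0 \<noteq> 0" by auto
  have "card I < card (J - {i0})" using insert i0 by simp
  then obtain c where c: "\<exists>i\<in>J - {i0}. c i \<noteq> 0"
   "\<forall>j\<in>I. (\<Sum>i\<in>J - {i0}. (a j i - a j i0 * a j0 i / a j0 i0) * c i) = 0"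
   using insert.IH[of "J - {i0}" "\<lambda>j i. a j i - a j i0 * a j0 i / a j0 i0"] insert.prems by auto
  \<comment> \<open>The value of the eliminated unknown \<open>i0\<close> that solves the equation
    \<open>j0\<close>.\<close>
  define s where "s = - (\<Sum>i\<in>J - {i0}. a j0 i * c i) / a j0 i0"
  define c' where "c' = c(i0 := s)"
  have split: "(\<Sum>i\<in>J. a j i * c' i) = a j i0 * s + (\<Sum>i\<in>J - {i0}. a j i * c i)" for j
   using i0 insert.prems by (subst sum.remove[of _ i0]) (auto simp: c'_def intro!: sum.cong)
  have "(\<Sum>i\<in>J. a j i * c' i) = 0" if "j \<in> I" for j
  proof -
   have "(\<Sum>i\<in>J - {i0}. (a j i - a j i0 * a j0 i / a j0 i0) * c i)
    = (\<Sum>i\<in>J - {i0}. a j i * c i) - (a j i0 / a j0 i0) * (\<Sum>i\<in>J - {i0}. a j0 i * c i)"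
    by (simp add: sum_distrib_left sum_subtractf[symmetric] algebra_simps)
   with c(2) that have "(\<Sum>i\<in>J - {i0}. a j i * c i)
    = (a j i0 / a j0 i0) * (\<Sum>i\<in>J - {i0}. a j0 i * c i)" by simp
   then show ?thesis unfolding split s_def by simp
  qed
  moreover have "(\<Sum>i\<in>J. a j0 i * c' i) = 0" unfolding split s_def using i0 by simp
  moreover have "\<exists>i\<in>J. c' i \<noteq> 0" using c by (auto simp: c'_def)
  ultimately show ?thesis by blast
 qed
qed

text \<open>A vector x together with the family \<open>b'\<close> is one vector more than a basis
  has, hence dependent. Independence of \<open>b'\<close> makes the coefficient of x nonzero, so x
  can be solved for.\<close>

lemma (in kmod) kbasis_card:
 assumes b: "kbasis I b" and J: "finite J" "card J = card I" "b' \<in> J \<rightarrow> carrier M"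
  and ind: "\<And>c i. [|lc J b' c = \<zero>\<^bsub>M\<^esub>; i \<in> J|] ==> c i = 0"
 shows "kbasis J b'" unfolding kbasis_def
proof (intro conjI ballI allI impI)
 fix x assume x: "x \<in> carrier M"
 obtain u where u: "x = lc I b u" using kbasisD(3)[OF b x] by blast
 have "\<forall>i\<in>J. \<exists>c. b' i = lc I b c" using kbasisD(3)[OF b] J by auto
 then obtain a' where a': "\<And>i. i \<in> J ==> b' i = lc I b (a' i)" by metis
 \<comment> \<open>\<open>None\<close> stands for x and \<open>Some i\<close> for
   \<open>b' i\<close>.\<close>
 define Z where "Z = insert None (Some ` J)"
 define a where "a j z = (case z of None => u j | Some i => a' i j)" for j z
 have Z: "finite Z" "card I < card Z" using J unfolding Z_def by (auto simp: card_image)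
 obtain c where c: "\<exists>z\<in>Z. c z \<noteq> 0" "\<forall>j\<in>I. (\<Sum>z\<in>Z. a j z * c z) = 0"
  using homogeneous_system[OF kbasisD(1)[OF b] Z] by blast
 have sumZ: "(\<Sum>z\<in>Z. a j z * c z) = u j * c None + (\<Sum>i\<in>J. a' i j * c (Some i))" for j
  unfolding Z_def using J by (subst sum.insert) (auto simp: a_def sum.reindex)
 have Yc: "lc J b' (\<lambda>i. c (Some i)) = lc I b (\<lambda>j. \<Sum>i\<in>J. a' i j * c (Some i))"
  by (rule lc_matrix) (use kbasisD[OF b] J a' in auto)
 have "sc (c None) x \<oplus>\<^bsub>M\<^esub> lc J b' (\<lambda>i. c (Some i)) = lc I b (\<lambda>j. \<Sum>z\<in>Z. a j z * c z)"
  unfolding sumZ Yc u using kbasisD(1,2)[OF b] by (simp add: lc_add lc_sc[symmetric] mult.commute)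
 also have "... = lc I b (\<lambda>j. 0)" by (rule lc_cong) (use c kbasisD[OF b] in auto)
 finally have rel: "sc (c None) x \<oplus>\<^bsub>M\<^esub> lc J b' (\<lambda>i. c (Some i)) = \<zero>\<^bsub>M\<^esub>"
  using kbasisD(2)[OF b] by simp
 have nz: "c None \<noteq> 0"
 proof
  assume 0: "c None = 0"
  then have "lc J b' (\<lambda>i. c (Some i)) = \<zero>\<^bsub>M\<^esub>" using rel x J by simp
  then have "\<forall>i\<in>J. c (Some i) = 0" using ind by blast
  with c 0 show False by (auto simp: Z_def)
 qed
 have "sc (c None) x = \<ominus>\<^bsub>M\<^esub> lc J b' (\<lambda>i. c (Some i))"
  using rel x J by (simp add: M.minus_equality)
 then have "x = sc (inverse (c None)) (sc (-1) (lc J b' (\<lambda>i. c (Some i))))"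
  using sc_eq_imp[OF x nz] J by (simp only: sc_minus_one lc_closed)
 then have "x = lc J b' (\<lambda>i. inverse (c None) * (-1) * c (Some i))" using J by (subst lc_sc) auto
 then show "\<exists>c. x = lc J b' c" by blast
qed (use J ind in auto)

section \<open>Tensor products\<close>

lemma keys_diff_subset: "Poly_Mapping.keys (a - b) \<subseteq> Poly_Mapping.keys a \<union> Poly_Mapping.keys b"
 by (auto simp: in_keys_iff lookup_minus)

lemma poly_mapping_sum_single:
 fixes z :: "'i \<Rightarrow>\<^sub>0 'b::ab_group_add"
 shows "z = (\<Sum>p\<in>Poly_Mapping.keys z. Poly_Mapping.single p (Poly_Mapping.lookup z p))"
proof (rule poly_mapping_eqI)
 fix k
 show "Poly_Mapping.lookup z k = Poly_Mapping.lookup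
   (\<Sum>p\<in>Poly_Mapping.keys z. Poly_Mapping.single p (Poly_Mapping.lookup z p)) k"
  by (cases "k \<in> Poly_Mapping.keys z")
   (auto simp: lookup_sum lookup_single when_def in_keys_iff sum.delta)
qed

lemma poly_mapping_induct_on [consumes 1, case_names zero single add]:
 fixes z :: "'i \<Rightarrow>\<^sub>0 'b::ab_group_add"
 assumes "Poly_Mapping.keys z \<subseteq> K" "P 0" "\<And>p c. p \<in> K ==> P (Poly_Mapping.single p c)"
  and "\<And>u v. [|Poly_Mapping.keys u \<subseteq> K; Poly_Mapping.keys v \<subseteq> K; P u; P v|] ==> P (u + v)"
 shows "P z"
proof -
 have "finite B ==> B \<subseteq> K ==>
   Poly_Mapping.keys (\<Sum>p\<in>B. Poly_Mapping.single p (Poly_Mapping.lookup z p)) \<subseteq> K \<and>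
   P (\<Sum>p\<in>B. Poly_Mapping.single p (Poly_Mapping.lookup z p))" for B
 proof (induction B rule: finite_induct)
  case (insert p B)
  let ?u = "Poly_Mapping.single p (Poly_Mapping.lookup z p)"
  let ?v = "\<Sum>p\<in>B. Poly_Mapping.single p (Poly_Mapping.lookup z p)"
  have "Poly_Mapping.keys ?u \<subseteq> K" "Poly_Mapping.keys ?v \<subseteq> K" "P ?u" "P ?v"
   using insert assms(3) by auto
  then have "Poly_Mapping.keys (?u + ?v) \<subseteq> K" "P (?u + ?v)" using keys_add[of ?u ?v] assms(4) by blast+
  then show ?case using insert by simp
 qed (use assms in auto)
 from this[of "Poly_Mapping.keys z"] assms(1) poly_mapping_sum_single[of z] show ?thesis by simp
qed

definition formal_carrier :: "('a, 'm) module => ('a, 'l) module => ('m \<times> 'l \<Rightarrow>\<^sub>0 'k::field) set" where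
 "formal_carrier M N = {z. Poly_Mapping.keys z \<subseteq> carrier M \<times> carrier N}"

lemma formal_carrier_add [simp]:
 "[|u \<in> formal_carrier M N; v \<in> formal_carrier M N|] ==> u + v \<in> formal_carrier M N"
 unfolding formal_carrier_def using keys_add[of u v] by blast

lemma formal_carrier_diff [simp]:
 "[|u \<in> formal_carrier M N; v \<in> formal_carrier M N|] ==> u - v \<in> formal_carrier M N"
 unfolding formal_carrier_def using keys_diff_subset[of u v] by blast

lemma formal_carrier_uminus [simp]: "u \<in> formal_carrier M N ==> - u \<in> formal_carrier M N"
 unfolding formal_carrier_def by (auto simp: in_keys_iff)

lemma formal_carrier_zero [simp]: "0 \<in> formal_carrier M N" by (simp add: formal_carrier_def)

lemma formal_carrier_single [simp]:
 "[|x \<in> carrier M; y \<in> carrier N|] ==> Poly_Mapping.single (x, y) c \<in> formal_carrier M N"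
 by (auto simp: formal_carrier_def)

lemma formal_carrier_induct [consumes 1, case_names zero single add]:
 assumes "z \<in> formal_carrier M N" "P 0"
  and "\<And>x y c. [|x \<in> carrier M; y \<in> carrier N|] ==> P (Poly_Mapping.single (x, y) c)"
  and "\<And>u v. [|u \<in> formal_carrier M N; v \<in> formal_carrier M N; P u; P v|] ==> P (u + v)"
 shows "P z"
proof -
 have "Poly_Mapping.keys z \<subseteq> carrier M \<times> carrier N" using assms(1) by (simp add: formal_carrier_def)
 then show ?thesis by (induction rule: poly_mapping_induct_on) (use assms in \<open>auto simp: formal_carrier_def\<close>)
qed

lemma carrier_formal_sums [simp]: "carrier (formal_sums M N) = formal_carrier M N"
 and mult_formal_sums [simp]: "u \<otimes>\<^bsub>formal_sums M N\<^esub> v = u + v"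
 and one_formal_sums [simp]: "\<one>\<^bsub>formal_sums M N\<^esub> = 0"
 by (simp_all add: formal_sums_def formal_carrier_def)

lemma comm_group_formal_sums:
 fixes M :: "('a, 'm) module" and N :: "('a, 'l) module"
 shows "comm_group (formal_sums M N :: ('m \<times> 'l \<Rightarrow>\<^sub>0 'k::field) monoid)" (is "comm_group ?G")
proof (rule comm_groupI)
 fix x assume "x \<in> carrier ?G"
 then show "\<exists>y\<in>carrier ?G. y \<otimes>\<^bsub>?G\<^esub> x = \<one>\<^bsub>?G\<^esub>"
  by (intro bexI[of _ "- x"]) auto
qed (auto simp: add_ac)

lemma inv_formal_sums [simp]:
 assumes "u \<in> formal_carrier M N" shows "inv\<^bsub>formal_sums M N\<^esub> u = - u"
 using assms by (intro group.inv_equality comm_group.axioms(2)[OF comm_group_formal_sums]) auto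

text \<open>The sums in \<open>formal_act\<close> run over supports, which change under addition.
  Over fixed larger sets bilinearity can be checked term by term.\<close>

lemma formal_act_superset:
 assumes "finite K" "Poly_Mapping.keys t \<subseteq> K" "finite L" "Poly_Mapping.keys z \<subseteq> L"
 shows "formal_act M N t z = (\<Sum>(a, b)\<in>K. \<Sum>(x, y)\<in>L.
  Poly_Mapping.single (a \<odot>\<^bsub>M\<^esub> x, b \<odot>\<^bsub>N\<^esub> y) (Poly_Mapping.lookup t (a, b) * Poly_Mapping.lookup z (x, y)))"
proof -
 have "(\<Sum>(x, y)\<in>Poly_Mapping.keys z. Poly_Mapping.single (a \<odot>\<^bsub>M\<^esub> x, b \<odot>\<^bsub>N\<^esub> y) (c * Poly_Mapping.lookup z (x, y)))
  = (\<Sum>(x, y)\<in>L. Poly_Mapping.single (a \<odot>\<^bsub>M\<^esub> x, b \<odot>\<^bsub>N\<^esub> y) (c * Poly_Mapping.lookup z (x, y)))" for a b c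
  using assms by (intro sum.mono_neutral_left) (auto simp: in_keys_iff)
 then show ?thesis unfolding formal_act_def using assms by (simp, intro sum.mono_neutral_left) (auto simp: in_keys_iff)
qed

lemma formal_act_add_left: "formal_act M N (t + t') z = formal_act M N t z + formal_act M N t' z"
proof -
 let ?K = "Poly_Mapping.keys t \<union> Poly_Mapping.keys t'" and ?L = "Poly_Mapping.keys z"
 have *: "formal_act M N s z = (\<Sum>(a, b)\<in>?K. \<Sum>(x, y)\<in>?L.
  Poly_Mapping.single (a \<odot>\<^bsub>M\<^esub> x, b \<odot>\<^bsub>N\<^esub> y) (Poly_Mapping.lookup s (a, b) * Poly_Mapping.lookup z (x, y)))"
  if "Poly_Mapping.keys s \<subseteq> ?K" for s by (rule formal_act_superset) (use that in auto)
 show ?thesis by (subst (1 2 3) *)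
   (auto simp: keys_add lookup_add single_add distrib_right sum.distrib[symmetric] split_def
    simp del: sum.distrib intro!: sum.cong)
qed

lemma formal_act_add_right: "formal_act M N t (z + z') = formal_act M N t z + formal_act M N t z'"
proof -
 let ?L = "Poly_Mapping.keys z \<union> Poly_Mapping.keys z'" and ?K = "Poly_Mapping.keys t"
 have *: "formal_act M N t s = (\<Sum>(a, b)\<in>?K. \<Sum>(x, y)\<in>?L.
  Poly_Mapping.single (a \<odot>\<^bsub>M\<^esub> x, b \<odot>\<^bsub>N\<^esub> y) (Poly_Mapping.lookup t (a, b) * Poly_Mapping.lookup s (x, y)))"
  if "Poly_Mapping.keys s \<subseteq> ?L" for s by (rule formal_act_superset) (use that in auto)
 show ?thesis by (subst (1 2 3) *)
   (auto simp: keys_add lookup_add single_add distrib_left sum.distrib[symmetric] split_def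
    simp del: sum.distrib intro!: sum.cong)
qed

lemma formal_act_zero [simp]: "formal_act M N 0 z = 0" "formal_act M N t 0 = 0" by (simp_all add: formal_act_def)

lemma formal_act_single [simp]:
 "formal_act M N (Poly_Mapping.single (a, b) c) (Poly_Mapping.single (x, y) d)
  = Poly_Mapping.single (a \<odot>\<^bsub>M\<^esub> x, b \<odot>\<^bsub>N\<^esub> y) (c * d)"
 by (subst formal_act_superset[of "{(a, b)}" _ "{(x, y)}"]) auto

lemma formal_act_uminus_left: "formal_act M N (- t) z = - formal_act M N t z"
 using formal_act_add_left[of M N "- t" t z] by (simp add: eq_neg_iff_add_eq_0)

lemma formal_act_uminus_right: "formal_act M N t (- z) = - formal_act M N t z"
 using formal_act_add_right[of M N t "- z" z] by (simp add: eq_neg_iff_add_eq_0)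

lemma formal_act_diff_left: "formal_act M N (t - t') z = formal_act M N t z - formal_act M N t' z"
 using formal_act_add_left[of M N t "- t'" z] by (simp add: formal_act_uminus_left)

lemma formal_act_diff_right: "formal_act M N t (z - z') = formal_act M N t z - formal_act M N t z'"
 using formal_act_add_right[of M N t z "- z'"] by (simp add: formal_act_uminus_right)

lemma regular_module_simps [simp]:
 "carrier (regular_module A) = carrier A" "\<zero>\<^bsub>regular_module A\<^esub> = \<zero>\<^bsub>A\<^esub>"
 "x \<oplus>\<^bsub>regular_module A\<^esub> y = x \<oplus>\<^bsub>A\<^esub> y" "x \<odot>\<^bsub>regular_module A\<^esub> y = x \<otimes>\<^bsub>A\<^esub> y"
 by (simp_all add: regular_module_def)

lemma (in kalg) regular_kmod: "kmod A \<eta> (regular_module A)"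
proof (intro kmod.intro kmod_axioms.intro abelian_groupI)
 show "\<exists>y\<in>carrier (regular_module A). y \<oplus>\<^bsub>regular_module A\<^esub> x = \<zero>\<^bsub>regular_module A\<^esub>"
  if "x \<in> carrier (regular_module A)" for x using that by (intro bexI[of _ "\<ominus> x"]) (auto simp: l_neg)
qed (auto simp: l_distr r_distr m_assoc a_ac intro: kalg_axioms)

lemma
 assumes "x \<in> carrier M" "y \<in> carrier N"
 shows relator_add_left: "x' \<in> carrier M ==> Poly_Mapping.single (x \<oplus>\<^bsub>M\<^esub> x', y) c
   - Poly_Mapping.single (x, y) c - Poly_Mapping.single (x', y) c \<in> tensor_relators \<eta> M N"
  and relator_add_right: "y' \<in> carrier N ==> Poly_Mapping.single (x, y \<oplus>\<^bsub>N\<^esub> y') c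
   - Poly_Mapping.single (x, y) c - Poly_Mapping.single (x, y') c \<in> tensor_relators \<eta> M N"
  and relator_scale_left: "Poly_Mapping.single (\<eta> d \<odot>\<^bsub>M\<^esub> x, y) c
   - Poly_Mapping.single (x, y) (c * d) \<in> tensor_relators \<eta> M N"
  and relator_scale_right: "Poly_Mapping.single (x, \<eta> d \<odot>\<^bsub>N\<^esub> y) c
   - Poly_Mapping.single (x, y) (c * d) \<in> tensor_relators \<eta> M N"
 unfolding tensor_relators_def using assms by blast+

lemma tensor_relators_cases [consumes 1, case_names add_left add_right scale_left scale_right]:
 assumes "r \<in> tensor_relators \<eta> M N"
 obtains x x' y c where "x \<in> carrier M" "x' \<in> carrier M" "y \<in> carrier N"
   "r = Poly_Mapping.single (x \<oplus>\<^bsub>M\<^esub> x', y) c - Poly_Mapping.single (x, y) c - Poly_Mapping.single (x', y) c"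
 | x y y' c where "x \<in> carrier M" "y \<in> carrier N" "y' \<in> carrier N"
   "r = Poly_Mapping.single (x, y \<oplus>\<^bsub>N\<^esub> y') c - Poly_Mapping.single (x, y) c - Poly_Mapping.single (x, y') c"
 | x y c d where "x \<in> carrier M" "y \<in> carrier N"
   "r = Poly_Mapping.single (\<eta> d \<odot>\<^bsub>M\<^esub> x, y) c - Poly_Mapping.single (x, y) (c * d)"
 | x y c d where "x \<in> carrier M" "y \<in> carrier N"
   "r = Poly_Mapping.single (x, \<eta> d \<odot>\<^bsub>N\<^esub> y) c - Poly_Mapping.single (x, y) (c * d)"
 using assms unfolding tensor_relators_def by (elim UnE CollectE exE conjE) metis+

lemma UN_UN_const:
 assumes "t0 \<in> T" "z0 \<in> Z" "\<And>t z. [|t \<in> T; z \<in> Z|] ==> f t z = C"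
 shows "(\<Union>t\<in>T. \<Union>z\<in>Z. f t z) = C" using assms by blast

locale tens = M: kmod A \<eta> M + N: kmod A \<eta> N
 for A :: "('a, 'r) ring_scheme" (structure) and \<eta> :: "'k::field => 'a"
  and M :: "('a, 'm) module" and N :: "('a, 'l) module"
begin

abbreviation "FC \<equiv> formal_carrier M N :: ('m \<times> 'l \<Rightarrow>\<^sub>0 'k) set"
abbreviation "null \<equiv> tensor_null \<eta> M N"
abbreviation "cls \<equiv> tensor_class \<eta> M N"
abbreviation "pt \<equiv> pure_tensor \<eta> M N"
abbreviation "TS \<equiv> tensor_space \<eta> M N"

lemma relators_subset: "tensor_relators \<eta> M N \<subseteq> FC"
 unfolding tensor_relators_def by (auto intro!: formal_carrier_diff formal_carrier_single)

lemma null_subgroup: "subgroup null (formal_sums M N)" unfolding tensor_null_def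
 by (rule group.generate_is_subgroup[OF comm_group.axioms(2)[OF comm_group_formal_sums]])
  (simp add: relators_subset)

lemma null_normal: "null \<lhd> formal_sums M N"
 by (rule comm_group.subgroup_imp_normal[OF comm_group_formal_sums null_subgroup])

lemma null_subset: "u \<in> null ==> u \<in> FC" using subgroup.subset[OF null_subgroup] by auto

lemma null_closed [simp]: "[|u \<in> null; v \<in> null|] ==> u + v \<in> null"
 using subgroup.m_closed[OF null_subgroup] by simp

lemma null_zero [simp]: "0 \<in> null" using subgroup.one_closed[OF null_subgroup] by simp

lemma null_uminus [simp]: "u \<in> null ==> - u \<in> null"
 using subgroup.m_inv_closed[OF null_subgroup] null_subset by fastforce

lemma null_diff [simp]: "[|u \<in> null; v \<in> null|] ==> u - v \<in> null"
 using null_closed[of u "- v"] by simp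

lemma relator_null: "u \<in> tensor_relators \<eta> M N ==> u \<in> null"
 unfolding tensor_null_def by (rule generate.incl)

lemma null_induct [consumes 1, case_names zero relator uminus add]:
 assumes "u \<in> null" "P 0" "\<And>r. r \<in> tensor_relators \<eta> M N ==> P r"
  "\<And>r. r \<in> tensor_relators \<eta> M N ==> P r ==> P (- r)" "\<And>u v. P u ==> P v ==> P (u + v)"
 shows "P u" using assms(1) unfolding tensor_null_def
proof (induction rule: generate.induct)
 case (inv h)
 then have "h \<in> FC" using relators_subset by blast
 with inv assms show ?case by simp
qed (use assms in auto)

lemma cls_altdef: "cls z = (\<lambda>u. u + z) ` null" by (auto simp: tensor_class_def r_coset_def)

lemma cls_eq: "u - v \<in> null ==> cls u = cls v"
proof -
 assume *: "u - v \<in> null"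
 have "n + u \<in> cls v" if "n \<in> null" for n
  unfolding cls_altdef using null_closed[OF that *] by (intro image_eqI[of _ _ "n + (u - v)"]) auto
 moreover have "n + v \<in> cls u" if "n \<in> null" for n
  unfolding cls_altdef using null_diff[OF that *] by (intro image_eqI[of _ _ "n - (u - v)"]) auto
 ultimately show ?thesis unfolding cls_altdef[of u] cls_altdef[of v] by (auto simp: cls_altdef)
qed

lemma cls_eq_iff: "cls u = cls v \<longleftrightarrow> u - v \<in> null"
proof
 assume "cls u = cls v"
 then have "0 + u \<in> cls v" unfolding cls_altdef by auto
 then obtain n where "n \<in> null" "u = n + v" unfolding cls_altdef by auto
 then show "u - v \<in> null" by simp
qed (rule cls_eq)

lemma cls_self: "z \<in> cls z" unfolding cls_altdef by (rule image_eqI[of _ _ 0]) auto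

lemma carrier_TS: "carrier TS = cls ` FC" by (auto simp: tensor_space_def carrier_FactGroup tensor_class_def)

lemma cls_in_TS [simp]: "z \<in> FC ==> cls z \<in> carrier TS" by (auto simp: carrier_TS)

lemma TS_cases: assumes "T \<in> carrier TS" obtains z where "z \<in> FC" "T = cls z" using assms by (auto simp: carrier_TS)

lemma mult_TS [simp]: "[|u \<in> FC; v \<in> FC|] ==> cls u \<otimes>\<^bsub>TS\<^esub> cls v = cls (u + v)"
 using normal.rcos_sum[OF null_normal, of u v] by (simp add: tensor_space_def tensor_class_def)

lemma one_TS: "\<one>\<^bsub>TS\<^esub> = cls 0" by (simp add: tensor_space_def cls_altdef)

lemma comm_group_TS: "comm_group TS" unfolding tensor_space_def
 by (rule comm_group.abelian_FactGroup[OF comm_group_formal_sums null_subgroup])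

lemma pt_closed [simp, intro]: "[|x \<in> carrier M; y \<in> carrier N|] ==> pt x y \<in> carrier TS"
 by (simp add: pure_tensor_def)

lemma pt_add_left: "[|x \<in> carrier M; x' \<in> carrier M; y \<in> carrier N|] ==>
  pt (x \<oplus>\<^bsub>M\<^esub> x') y = pt x y \<otimes>\<^bsub>TS\<^esub> pt x' y"
 unfolding pure_tensor_def
 by (simp add: cls_eq_iff) (auto intro!: relator_null relator_add_left simp: diff_diff_eq[symmetric])

lemma pt_add_right: "[|x \<in> carrier M; y \<in> carrier N; y' \<in> carrier N|] ==>
  pt x (y \<oplus>\<^bsub>N\<^esub> y') = pt x y \<otimes>\<^bsub>TS\<^esub> pt x y'"
 unfolding pure_tensor_def
 by (simp add: cls_eq_iff) (auto intro!: relator_null relator_add_right simp: diff_diff_eq[symmetric])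

lemma cls_single: assumes "x \<in> carrier M" "y \<in> carrier N"
 shows "cls (Poly_Mapping.single (x, y) c) = pt (M.sc c x) y"
proof -
 have "Poly_Mapping.single (M.sc c x, y) 1 - Poly_Mapping.single (x, y) (1 * c) \<in> null"
  unfolding M.sc_def by (intro relator_null relator_scale_left assms)
 then show ?thesis unfolding pure_tensor_def by (metis cls_eq_iff mult_1)
qed

lemma pt_balanced: assumes "x \<in> carrier M" "y \<in> carrier N"
 shows "pt x (N.sc c y) = pt (M.sc c x) y"
proof -
 have "Poly_Mapping.single (x, N.sc c y) 1 - Poly_Mapping.single (x, y) (1 * c) \<in> null"
  unfolding N.sc_def by (intro relator_null relator_scale_right assms)
 then show ?thesis using cls_single[OF assms] unfolding pure_tensor_def by (metis cls_eq_iff mult_1)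
qed

lemma TS_induct [consumes 1, case_names zero pure add]:
 assumes "T \<in> carrier TS" "P \<one>\<^bsub>TS\<^esub>"
  and "\<And>x y. [|x \<in> carrier M; y \<in> carrier N|] ==> P (pt x y)"
  and "\<And>T U. [|T \<in> carrier TS; U \<in> carrier TS; P T; P U|] ==> P (T \<otimes>\<^bsub>TS\<^esub> U)"
 shows "P T"
proof -
 obtain z where z: "z \<in> FC" "T = cls z" using assms(1) by (rule TS_cases)
 have "P (cls z)" using z(1)
 proof (induction rule: formal_carrier_induct)
  case (single x y c) then show ?case using assms(3) by (simp add: cls_single)
 next
  case (add u v) then show ?case using assms(4)[of "cls u" "cls v"] by simp
 qed (use assms one_TS in auto)
 with z show ?thesis by simp
qed

text \<open>Universal property of the quotient: the linear extension of f to formal sums vanishes on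
  the relators, hence on the subgroup that they generate.\<close>

lemma bilinear_lift:
 fixes Q :: "('a, 'p) module"
 assumes Q: "kmod A \<eta> Q"
  and f: "\<And>x y. [|x \<in> carrier M; y \<in> carrier N|] ==> f x y \<in> carrier Q"
  and f_add: "\<And>x x' y. [|x \<in> carrier M; x' \<in> carrier M; y \<in> carrier N|] ==>
    f (x \<oplus>\<^bsub>M\<^esub> x') y = f x y \<oplus>\<^bsub>Q\<^esub> f x' y"
  and f_add2: "\<And>x y y'. [|x \<in> carrier M; y \<in> carrier N; y' \<in> carrier N|] ==>
    f x (y \<oplus>\<^bsub>N\<^esub> y') = f x y \<oplus>\<^bsub>Q\<^esub> f x y'"
  and f_sc: "\<And>c x y. [|x \<in> carrier M; y \<in> carrier N|] ==> f (M.sc c x) y = \<eta> c \<odot>\<^bsub>Q\<^esub> f x y"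
  and f_sc2: "\<And>c x y. [|x \<in> carrier M; y \<in> carrier N|] ==> f x (N.sc c y) = \<eta> c \<odot>\<^bsub>Q\<^esub> f x y"
 obtains \<phi> where "\<And>T. T \<in> carrier TS ==> \<phi> T \<in> carrier Q"
  "\<And>T U. [|T \<in> carrier TS; U \<in> carrier TS|] ==> \<phi> (T \<otimes>\<^bsub>TS\<^esub> U) = \<phi> T \<oplus>\<^bsub>Q\<^esub> \<phi> U"
  "\<And>x y. [|x \<in> carrier M; y \<in> carrier N|] ==> \<phi> (pt x y) = f x y"
proof -
 interpret Q: kmod A \<eta> Q by fact
 let ?b = "\<lambda>(x, y). f x y"
 define L where "L z = Q.lc (Poly_Mapping.keys z) ?b (Poly_Mapping.lookup z)" for z :: "'m \<times> 'l \<Rightarrow>\<^sub>0 'k"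
 have bK: "?b \<in> K \<rightarrow> carrier Q" if "K \<subseteq> carrier M \<times> carrier N" for K using that f by auto
 have L_super: "L z = Q.lc K ?b (Poly_Mapping.lookup z)"
  if "finite K" "Poly_Mapping.keys z \<subseteq> K" "K \<subseteq> carrier M \<times> carrier N" for K z
  unfolding L_def by (rule Q.lc_mono_neutral[symmetric]) (use that bK in \<open>auto simp: in_keys_iff\<close>)
 have L_closed: "L z \<in> carrier Q" if "z \<in> FC" for z unfolding L_def using that bK by (auto simp: formal_carrier_def)
 have L_add: "L (u + v) = L u \<oplus>\<^bsub>Q\<^esub> L v" if "u \<in> FC" "v \<in> FC" for u v
 proof -
  let ?K = "Poly_Mapping.keys u \<union> Poly_Mapping.keys v"
  have K: "finite ?K" "?K \<subseteq> carrier M \<times> carrier N" using that by (auto simp: formal_carrier_def)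
  have "L (u + v) = Q.lc ?K ?b (Poly_Mapping.lookup (u + v))" by (rule L_super) (use K keys_add[of u v] in auto)
  also have "... = Q.lc ?K ?b (Poly_Mapping.lookup u) \<oplus>\<^bsub>Q\<^esub> Q.lc ?K ?b (Poly_Mapping.lookup v)"
   using K bK by (simp add: lookup_add[abs_def] Q.lc_add)
  also have "... = L u \<oplus>\<^bsub>Q\<^esub> L v" using K by (simp add: L_super[of ?K])
  finally show ?thesis .
 qed
 have L_zero: "L 0 = \<zero>\<^bsub>Q\<^esub>" by (simp add: L_def)
 have L_single: "L (Poly_Mapping.single (x, y) c) = Q.sc c (f x y)"
  if "x \<in> carrier M" "y \<in> carrier N" for x y c
 proof -
  have "L (Poly_Mapping.single (x, y) c) = Q.lc {(x, y)} ?b (Poly_Mapping.lookup (Poly_Mapping.single (x, y) c))"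
   by (rule L_super) (use that in auto)
  also have "... = Q.lc {(x, y)} ?b (\<lambda>i. if i = (x, y) then c else 0)"
   by (rule Q.lc_cong) (use that f in \<open>auto simp: lookup_single\<close>)
  also have "... = Q.sc c (f x y)" using that f by (subst Q.lc_single) auto
  finally show ?thesis .
 qed
 have L_uminus: "L (- u) = \<ominus>\<^bsub>Q\<^esub> L u" if "u \<in> FC" for u
  using L_add[of "- u" u] that L_closed by (simp add: L_zero Q.M.minus_equality[symmetric])
 have L_diff: "L (u - v) = L u \<oplus>\<^bsub>Q\<^esub> \<ominus>\<^bsub>Q\<^esub> L v" if "u \<in> FC" "v \<in> FC" for u v
  using L_add[of u "- v"] that by (simp add: L_uminus)
 have L_rel: "L r = \<zero>\<^bsub>Q\<^esub>" if "r \<in> tensor_relators \<eta> M N" for r using that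
 proof (cases rule: tensor_relators_cases)
  case (add_left x x' y c)
  then show ?thesis by (simp add: L_diff L_single f f_add Q.sc_add_right Q.M.a_ac Q.M.r_neg Q.M.r_neg1 Q.M.r_neg2)
 next
  case (add_right x y y' c)
  then show ?thesis by (simp add: L_diff L_single f f_add2 Q.sc_add_right Q.M.a_ac Q.M.r_neg Q.M.r_neg1 Q.M.r_neg2)
 next
  case (scale_left x y c d)
  then show ?thesis by (simp add: L_diff L_single f f_sc[unfolded M.sc_def] Q.sc_def[symmetric] Q.M.r_neg)
 next
  case (scale_right x y c d)
  then show ?thesis by (simp add: L_diff L_single f f_sc2[unfolded N.sc_def] Q.sc_def[symmetric] Q.M.r_neg)
 qed
 have L_null: "r \<in> FC \<and> L r = \<zero>\<^bsub>Q\<^esub>" if "r \<in> null" for r using that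
 proof (induction rule: null_induct)
  case (relator r) then show ?case using L_rel relators_subset by auto
 next
  case (uminus r) then show ?case using L_uminus by simp
 next
  case (add u v) then show ?case by (simp add: L_add)
 qed (simp add: L_zero)
 have L_cong: "L u = L v" if "u \<in> FC" "v \<in> FC" "cls u = cls v" for u v
 proof -
  have "L ((u - v) + v) = L (u - v) \<oplus>\<^bsub>Q\<^esub> L v" using that by (intro L_add) auto
  then show ?thesis using that L_null[of "u - v"] L_closed by (simp add: cls_eq_iff)
 qed
 \<comment> \<open>Any representative of the class gives the same value, by
   \<open>L_cong\<close>.\<close>
 define \<phi> where "\<phi> T = L (SOME z. z \<in> FC \<and> T = cls z)" for T
 have \<phi>: "\<phi> (cls z) = L z" if "z \<in> FC" for z
 proof -
  have "(SOME u. u \<in> FC \<and> cls z = cls u) \<in> FC \<and> cls z = cls (SOME u. u \<in> FC \<and> cls z = cls u)"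
   by (rule someI[of "\<lambda>u. u \<in> FC \<and> cls z = cls u" z]) (use that in auto)
  from L_cong[OF conjunct1[OF this] that conjunct2[OF this, symmetric]] show ?thesis unfolding \<phi>_def .
 qed
 show ?thesis
 proof (rule that)
  show "\<phi> T \<in> carrier Q" if "T \<in> carrier TS" for T using that by (auto elim!: TS_cases simp: \<phi> L_closed)
  show "\<phi> (T \<otimes>\<^bsub>TS\<^esub> U) = \<phi> T \<oplus>\<^bsub>Q\<^esub> \<phi> U" if "T \<in> carrier TS" "U \<in> carrier TS" for T U
   using that by (auto elim!: TS_cases simp: \<phi> L_add)
  show "\<phi> (pt x y) = f x y" if "x \<in> carrier M" "y \<in> carrier N" for x y
   unfolding pure_tensor_def using that f by (simp add: \<phi> L_single)
 qed
qed

abbreviation "R \<equiv> regular_module A"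

lemma formal_act_closed:
 assumes "t \<in> formal_carrier R R" "z \<in> FC" shows "formal_act M N t z \<in> FC"
 using assms(1)
proof (induction rule: formal_carrier_induct)
 case (single a b c)
 from assms(2) show ?case
  by (induction rule: formal_carrier_induct) (use single in \<open>auto simp: formal_act_add_right\<close>)
qed (auto simp: formal_act_add_left)

text \<open>A pair (a, b) sends relators to relators because scalars are central in A. Together with
  \<open>formal_act_null_left\<close> this shows that the union over all representatives in
  \<open>tensor_act\<close> is a single class.\<close>

lemma formal_act_null_right:
 assumes "t \<in> formal_carrier R R" "z \<in> null" shows "formal_act M N t z \<in> null"
 using assms(1)
proof (induction rule: formal_carrier_induct)
 case (single a b c)
 then have ab: "a \<in> carrier A" "b \<in> carrier A" by auto
 have rel: "formal_act M N (Poly_Mapping.single (a, b) c) r \<in> null" if "r \<in> tensor_relators \<eta> M N" for r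
 proof -
  have m: "a \<odot>\<^bsub>M\<^esub> (\<eta> d \<odot>\<^bsub>M\<^esub> x) = \<eta> d \<odot>\<^bsub>M\<^esub> (a \<odot>\<^bsub>M\<^esub> x)" if "x \<in> carrier M" for d x
   using M.act_sc[OF ab(1) that] by (simp add: M.sc_def)
  have n: "b \<odot>\<^bsub>N\<^esub> (\<eta> d \<odot>\<^bsub>N\<^esub> x) = \<eta> d \<odot>\<^bsub>N\<^esub> (b \<odot>\<^bsub>N\<^esub> x)" if "x \<in> carrier N" for d x
   using N.act_sc[OF ab(2) that] by (simp add: N.sc_def)
  note closed = ab M.act_closed N.act_closed
  from that have "formal_act M N (Poly_Mapping.single (a, b) c) r \<in> tensor_relators \<eta> M N"
  proof (cases rule: tensor_relators_cases)
   case (add_left x x' y e)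
   then show ?thesis using relator_add_left[of "a \<odot>\<^bsub>M\<^esub> x" M "b \<odot>\<^bsub>N\<^esub> y" N "a \<odot>\<^bsub>M\<^esub> x'" "c * e"]
    by (simp add: formal_act_diff_right M.act_r_distr closed)
  next
   case (add_right x y y' e)
   then show ?thesis using relator_add_right[of "a \<odot>\<^bsub>M\<^esub> x" M "b \<odot>\<^bsub>N\<^esub> y" N "b \<odot>\<^bsub>N\<^esub> y'" "c * e"]
    by (simp add: formal_act_diff_right N.act_r_distr closed)
  next
   case (scale_left x y e d)
   then show ?thesis using relator_scale_left[of "a \<odot>\<^bsub>M\<^esub> x" M "b \<odot>\<^bsub>N\<^esub> y" N \<eta> d "c * e"]
    by (simp add: formal_act_diff_right m closed mult.assoc)
  next
   case (scale_right x y e d)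
   then show ?thesis using relator_scale_right[of "a \<odot>\<^bsub>M\<^esub> x" M "b \<odot>\<^bsub>N\<^esub> y" N \<eta> d "c * e"]
    by (simp add: formal_act_diff_right n closed mult.assoc)
  qed
  then show ?thesis by (rule relator_null)
 qed
 from assms(2) show ?case by (induction rule: null_induct) (auto simp: rel formal_act_add_right formal_act_uminus_right)
qed (auto simp: formal_act_add_left)

lemma formal_act_null_left:
 assumes "t \<in> tensor_null \<eta> R R" "z \<in> FC" shows "formal_act M N t z \<in> null"
 using assms(2)
proof (induction rule: formal_carrier_induct)
 case (single x y c)
 interpret RR: tens A \<eta> R R by (intro tens.intro M.regular_kmod)
 have rel: "formal_act M N r (Poly_Mapping.single (x, y) c) \<in> null" if "r \<in> tensor_relators \<eta> R R" for r
 proof -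
  from that have "formal_act M N r (Poly_Mapping.single (x, y) c) \<in> tensor_relators \<eta> M N"
  proof (cases rule: tensor_relators_cases)
   case (add_left a a' b e)
   then show ?thesis
    using relator_add_left[of "a \<odot>\<^bsub>M\<^esub> x" M "b \<odot>\<^bsub>N\<^esub> y" N "a' \<odot>\<^bsub>M\<^esub> x" "e * c"] single
    by (simp add: formal_act_diff_left M.act_l_distr)
  next
   case (add_right a b b' e)
   then show ?thesis
    using relator_add_right[of "a \<odot>\<^bsub>M\<^esub> x" M "b \<odot>\<^bsub>N\<^esub> y" N "b' \<odot>\<^bsub>N\<^esub> y" "e * c"] single
    by (simp add: formal_act_diff_left N.act_l_distr)
  next
   case (scale_left a b e d)
   then show ?thesis
    using relator_scale_left[of "a \<odot>\<^bsub>M\<^esub> x" M "b \<odot>\<^bsub>N\<^esub> y" N \<eta> d "e * c"] single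
    by (simp add: formal_act_diff_left M.act_assoc mult_ac)
  next
   case (scale_right a b e d)
   then show ?thesis
    using relator_scale_right[of "a \<odot>\<^bsub>M\<^esub> x" M "b \<odot>\<^bsub>N\<^esub> y" N \<eta> d "e * c"] single
    by (simp add: formal_act_diff_left N.act_assoc mult_ac)
  qed
  then show ?thesis by (rule relator_null)
 qed
 from assms(1) show ?case by (induction rule: RR.null_induct) (auto simp: rel formal_act_add_left formal_act_uminus_left)
qed (auto simp: formal_act_add_right)

lemma tensor_act_cls:
 assumes "t \<in> formal_carrier R R" "z \<in> FC"
 shows "tensor_act \<eta> M N (tensor_class \<eta> R R t) (cls z) = cls (formal_act M N t z)"
proof -
 interpret RR: tens A \<eta> R R by (intro tens.intro M.regular_kmod)
 have "cls (formal_act M N t' z') = cls (formal_act M N t z)" 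
  if mem: "t' \<in> RR.cls t" "z' \<in> cls z" for t' z'
 proof (rule cls_eq)
  obtain u v where u: "u \<in> RR.null" "t' = u + t" and v: "v \<in> null" "z' = v + z"
   using mem unfolding RR.cls_altdef cls_altdef by auto
  \<comment> \<open>Expansion of \<open>(u + t)(v + z) - t z\<close> into its three remaining
    terms.\<close>
  have "formal_act M N u v + formal_act M N t v + formal_act M N u z \<in> null"
   using u v assms null_subset by (intro null_closed formal_act_null_left formal_act_null_right) auto
  then show "formal_act M N t' z' - formal_act M N t z \<in> null"
   unfolding u v by (simp add: formal_act_add_left formal_act_add_right algebra_simps)
 qed
 then show ?thesis unfolding tensor_act_def by (rule UN_UN_const[OF RR.cls_self cls_self])
qed

lemma formal_act_assoc:
 assumes "t \<in> formal_carrier R R" "t' \<in> formal_carrier R R" "z \<in> FC"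
 shows "formal_act M N (formal_act R R t t') z = formal_act M N t (formal_act M N t' z)" using assms(1)
proof (induction rule: formal_carrier_induct)
 case s1: (single a b c)
 from assms(2) show ?case
 proof (induction rule: formal_carrier_induct)
  case s2: (single a' b' c')
  from assms(3) show ?case by (induction rule: formal_carrier_induct)
    (use s1 s2 in \<open>auto simp: formal_act_add_right M.act_assoc N.act_assoc mult.assoc\<close>)
 qed (auto simp: formal_act_add_left formal_act_add_right)
qed (auto simp: formal_act_add_left)

abbreviation "tact \<equiv> tensor_act \<eta> M N"

lemma tact_closed [simp]:
 assumes "t \<in> carrier (tensor_space \<eta> R R)" "T \<in> carrier TS" shows "tact t T \<in> carrier TS"
proof -
 interpret RR: tens A \<eta> R R by (intro tens.intro M.regular_kmod)
 show ?thesis using assms by (auto elim!: TS_cases RR.TS_cases simp: tensor_act_cls formal_act_closed)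
qed

lemma tact_pt [simp]:
 assumes "a \<in> carrier A" "b \<in> carrier A" "x \<in> carrier M" "y \<in> carrier N"
 shows "tact (pure_tensor \<eta> R R a b) (pt x y) = pt (a \<odot>\<^bsub>M\<^esub> x) (b \<odot>\<^bsub>N\<^esub> y)"
 unfolding pure_tensor_def using assms by (simp add: tensor_act_cls)

lemma tact_add_left:
 assumes "t \<in> carrier (tensor_space \<eta> R R)" "t' \<in> carrier (tensor_space \<eta> R R)" "T \<in> carrier TS"
 shows "tact (t \<otimes>\<^bsub>tensor_space \<eta> R R\<^esub> t') T = tact t T \<otimes>\<^bsub>TS\<^esub> tact t' T"
proof -
 interpret RR: tens A \<eta> R R by (intro tens.intro M.regular_kmod)
 show ?thesis using assms by (auto elim!: TS_cases RR.TS_cases simp: tensor_act_cls formal_act_closed formal_act_add_left)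
qed

lemma tact_add_right:
 assumes "t \<in> carrier (tensor_space \<eta> R R)" "T' \<in> carrier TS" "T \<in> carrier TS"
 shows "tact t (T \<otimes>\<^bsub>TS\<^esub> T') = tact t T \<otimes>\<^bsub>TS\<^esub> tact t T'"
proof -
 interpret RR: tens A \<eta> R R by (intro tens.intro M.regular_kmod)
 show ?thesis using assms by (auto elim!: TS_cases RR.TS_cases simp: tensor_act_cls formal_act_closed formal_act_add_right)
qed

lemma tact_assoc:
 assumes "t \<in> carrier (tensor_space \<eta> R R)" "t' \<in> carrier (tensor_space \<eta> R R)" "T \<in> carrier TS"
 shows "tact (tensor_act \<eta> R R t t') T = tact t (tact t' T)"
proof -
 interpret RR: tens A \<eta> R R by (intro tens.intro M.regular_kmod)
 show ?thesis using assms by (auto elim!: TS_cases RR.TS_cases simp: tensor_act_cls RR.tensor_act_cls RR.formal_act_closed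
    formal_act_closed formal_act_assoc)
qed

lemma tact_one:
 assumes "T \<in> carrier TS" shows "tact (pure_tensor \<eta> R R \<one> \<one>) T = T"
 using assms
proof (induction rule: TS_induct)
 case zero
 interpret RR: tens A \<eta> R R by (intro tens.intro M.regular_kmod)
 show ?case unfolding one_TS pure_tensor_def by (subst tensor_act_cls) auto
next
 case (add T U)
 interpret RR: tens A \<eta> R R by (intro tens.intro M.regular_kmod)
 from add show ?case by (subst tact_add_right) (auto intro!: RR.pt_closed)
qed simp

end

context kmod
begin

definition coord :: "'i set => ('i => 'm) => 'm => 'i => 'k" where
 "coord I b x = (SOME c. x = lc I b c)"

lemma lc_coord: "[|kbasis I b; x \<in> carrier M|] ==> lc I b (coord I b x) = x"
 unfolding coord_def using someI_ex[OF kbasisD(3)] by metis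

lemma coord_lc:
 assumes "kbasis I b" "i \<in> I" shows "coord I b (lc I b c) i = c i"
 using assms by (intro kbasis_unique[OF assms(1) lc_coord[OF assms(1)]]) (auto dest: kbasisD)

lemma coord_add:
 assumes "kbasis I b" "x \<in> carrier M" "y \<in> carrier M" "i \<in> I"
 shows "coord I b (x \<oplus>\<^bsub>M\<^esub> y) i = coord I b x i + coord I b y i"
proof -
 have "x \<oplus>\<^bsub>M\<^esub> y = lc I b (\<lambda>i. coord I b x i + coord I b y i)"
  using assms by (subst lc_add) (auto dest: kbasisD simp: lc_coord)
 with assms show ?thesis by (simp add: coord_lc)
qed

lemma coord_sc:
 assumes "kbasis I b" "x \<in> carrier M" "i \<in> I"
 shows "coord I b (sc a x) i = a * coord I b x i"
proof -
 have "sc a x = lc I b (\<lambda>i. a * coord I b x i)" using assms by (subst lc_sc) (auto dest: kbasisD simp: lc_coord)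
 with assms show ?thesis by (simp add: coord_lc)
qed

lemma coord_basis:
 assumes "kbasis I b" "j \<in> I" "i \<in> I"
 shows "coord I b (b j) i = (if i = j then 1 else 0)"
proof -
 have "b j = lc I b (\<lambda>i. if i = j then 1 else 0)"
  using assms kbasisD(1,2)[OF assms(1)] by (subst lc_single) (auto simp: Pi_iff)
 with assms show ?thesis by (simp add: coord_lc)
qed

end

abbreviation reg_tensor where
 "reg_tensor \<eta> A \<equiv> pure_tensor \<eta> (regular_module A) (regular_module A)"

lemma tensor_algebra_simps [simp]:
 "carrier (tensor_algebra \<eta> A) = carrier (tensor_space \<eta> (regular_module A) (regular_module A))"
 "x \<otimes>\<^bsub>tensor_algebra \<eta> A\<^esub> y = tensor_act \<eta> (regular_module A) (regular_module A) x y"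
 "x \<oplus>\<^bsub>tensor_algebra \<eta> A\<^esub> y = x \<otimes>\<^bsub>tensor_space \<eta> (regular_module A) (regular_module A)\<^esub> y"
 "\<zero>\<^bsub>tensor_algebra \<eta> A\<^esub> = \<one>\<^bsub>tensor_space \<eta> (regular_module A) (regular_module A)\<^esub>"
 "\<one>\<^bsub>tensor_algebra \<eta> A\<^esub> = reg_tensor \<eta> A \<one>\<^bsub>A\<^esub> \<one>\<^bsub>A\<^esub>"
 by (simp_all add: tensor_algebra_def Let_def)

text \<open>Nearly all ring axioms are the module axioms of the tensor action in the case where both
  modules are A itself.\<close>

lemma (in kalg) tensor_algebra_kalg:
 "kalg (tensor_algebra \<eta> A) (\<lambda>c. reg_tensor \<eta> A (\<eta> c) \<one>)"
proof -
 interpret RR: tens A \<eta> "regular_module A" "regular_module A" by (intro tens.intro regular_kmod)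
 interpret G: comm_group RR.TS by (rule RR.comm_group_TS)
 have one_right: "RR.tact T (RR.pt \<one> \<one>) = T" if "T \<in> carrier RR.TS" for T using that
 proof (induction rule: RR.TS_induct)
  case zero
  show ?case unfolding RR.one_TS pure_tensor_def by (subst RR.tensor_act_cls) auto
 next
  case (add T U) then show ?case by (subst RR.tact_add_left) auto
 qed simp
 have "ring (tensor_algebra \<eta> A)"
 proof (rule ringI)
  show "abelian_group (tensor_algebra \<eta> A)"
  proof (rule abelian_groupI)
   show "\<exists>y\<in>carrier (tensor_algebra \<eta> A). y \<oplus>\<^bsub>tensor_algebra \<eta> A\<^esub> x = \<zero>\<^bsub>tensor_algebra \<eta> A\<^esub>"
    if "x \<in> carrier (tensor_algebra \<eta> A)" for x
    using that by (intro bexI[of _ "inv\<^bsub>RR.TS\<^esub> x"]) auto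
  qed (auto simp: G.m_ac)
  show "monoid (tensor_algebra \<eta> A)" by (rule monoidI) (auto simp: RR.tact_assoc RR.tact_one one_right)
 qed (auto simp: RR.tact_add_left RR.tact_add_right)
 moreover have "kalg_axioms (tensor_algebra \<eta> A) (\<lambda>c. RR.pt (\<eta> c) \<one>)"
 proof (rule kalg_axioms.intro; simp)
  show "RR.pt (\<eta> (c + d)) \<one> = RR.pt (\<eta> c) \<one> \<otimes>\<^bsub>RR.TS\<^esub> RR.pt (\<eta> d) \<one>" for c d
   using RR.pt_add_left[of "\<eta> c" "\<eta> d" \<one>] by (simp add: unit_add)
  show "RR.tact x (RR.pt (\<eta> c) \<one>) = RR.tact (RR.pt (\<eta> c) \<one>) x" if "x \<in> carrier RR.TS" for x c
   using that
  proof (induction rule: RR.TS_induct)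
   case zero
   show ?case unfolding RR.one_TS pure_tensor_def by (subst (1 2) RR.tensor_act_cls) auto
  next
   case (pure a b) then show ?case by (simp add: unit_central)
  next
   case (add T U) then show ?case by (simp add: RR.tact_add_left RR.tact_add_right)
  qed
 qed (auto simp: unit_mult unit_one RR.pt_closed)
 ultimately show ?thesis by (rule kalg.intro)
qed

lemma tensor_module_simps [simp]:
 "carrier (tensor_module \<eta> D M N) = carrier (tensor_space \<eta> M N)"
 "x \<oplus>\<^bsub>tensor_module \<eta> D M N\<^esub> y = x \<otimes>\<^bsub>tensor_space \<eta> M N\<^esub> y"
 "\<zero>\<^bsub>tensor_module \<eta> D M N\<^esub> = \<one>\<^bsub>tensor_space \<eta> M N\<^esub>"
 "a \<odot>\<^bsub>tensor_module \<eta> D M N\<^esub> x = tensor_act \<eta> M N (D a) x"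
 by (simp_all add: tensor_module_def)

lemma (in tens) TS_mult_closed [simp]:
 "[|T \<in> carrier TS; U \<in> carrier TS|] ==> T \<otimes>\<^bsub>TS\<^esub> U \<in> carrier TS"
 using comm_group.axioms(1)[OF comm_group_TS] by (metis comm_group_TS comm_group.axioms(2) group.is_monoid monoid.m_closed)

locale tensmod = tens +
 fixes D
 assumes D_hom: "D \<in> ring_hom A (tensor_algebra \<eta> A)"
  and D_unit: "\<And>c. D (\<eta> c) = reg_tensor \<eta> A (\<eta> c) \<one>"
begin

abbreviation "W \<equiv> tensor_module \<eta> D M N"

lemma kmod_W: "kmod A \<eta> W"
proof -
 interpret G: comm_group TS by (rule comm_group_TS)
 have D: "D a \<in> carrier (tensor_space \<eta> R R)" if "a \<in> carrier A" for a
  using ring_hom_closed[OF D_hom that] by simp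
 have "abelian_group W"
 proof (rule abelian_groupI)
  show "\<exists>y\<in>carrier W. y \<oplus>\<^bsub>W\<^esub> x = \<zero>\<^bsub>W\<^esub>" if "x \<in> carrier W" for x
   using that by (intro bexI[of _ "inv\<^bsub>TS\<^esub> x"]) auto
 qed (auto simp: G.m_ac)
 moreover have "kmod_axioms A W" by (rule kmod_axioms.intro)
   (use ring_hom_add[OF D_hom] ring_hom_mult[OF D_hom] ring_hom_one[OF D_hom] in
    \<open>auto simp: D tact_add_left tact_add_right tact_assoc tact_one\<close>)
 ultimately show ?thesis by (intro kmod.intro M.kalg_axioms)
qed

sublocale W: kmod A \<eta> W by (rule kmod_W)

lemma sc_pt: "[|x \<in> carrier M; y \<in> carrier N|] ==> W.sc c (pt x y) = pt (M.sc c x) y"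
 by (simp add: W.sc_def D_unit M.sc_def)

lemma pt_sum_left:
 "[|x \<in> carrier M; x' \<in> carrier M; y \<in> carrier N|] ==> pt (x \<oplus>\<^bsub>M\<^esub> x') y = pt x y \<oplus>\<^bsub>W\<^esub> pt x' y"
 by (simp add: pt_add_left)

lemma pt_sum_right:
 "[|x \<in> carrier M; y \<in> carrier N; y' \<in> carrier N|] ==> pt x (y \<oplus>\<^bsub>N\<^esub> y') = pt x y \<oplus>\<^bsub>W\<^esub> pt x y'"
 by (simp add: pt_add_right)

lemma pt_zero_left [simp]: assumes "y \<in> carrier N" shows "pt \<zero>\<^bsub>M\<^esub> y = \<zero>\<^bsub>W\<^esub>"
 using sc_pt[of "\<zero>\<^bsub>M\<^esub>" y 0] assms W.sc_zero[of "pt \<zero>\<^bsub>M\<^esub> y"] by simp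

lemma pt_zero_right [simp]: assumes "x \<in> carrier M" shows "pt x \<zero>\<^bsub>N\<^esub> = \<zero>\<^bsub>W\<^esub>"
 using pt_balanced[of x "\<zero>\<^bsub>N\<^esub>" 0] assms by simp

lemma pt_lc:
 assumes "finite J" "s \<in> J \<rightarrow> carrier N" "x \<in> carrier M"
 shows "pt x (N.lc J s c) = finsum W (\<lambda>j. pt (M.sc (c j) x) (s j)) J" using assms
proof (induction J rule: finite_induct)
 case (insert j J)
 then have *: "(\<lambda>j. pt (M.sc (c j) x) (s j)) \<in> J \<rightarrow> carrier W" "pt (M.sc (c j) x) (s j) \<in> carrier W"
  "s j \<in> carrier N" "s \<in> J \<rightarrow> carrier N" by (auto simp: Pi_iff)
 have "pt x (N.lc (insert j J) s c) = pt x (N.sc (c j) (s j)) \<oplus>\<^bsub>W\<^esub> pt x (N.lc J s c)"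
  unfolding N.lc_insert[where b = s, OF insert(1,2) *(3,4)] using insert * by (intro pt_sum_right) auto
 also have "... = pt (M.sc (c j) x) (s j) \<oplus>\<^bsub>W\<^esub> finsum W (\<lambda>j. pt (M.sc (c j) x) (s j)) J"
  using insert * by (simp add: pt_balanced)
 also have "... = finsum W (\<lambda>j. pt (M.sc (c j) x) (s j)) (insert j J)"
  by (rule W.M.finsum_insert[symmetric]) (use insert * in auto)
 finally show ?case .
qed simp

text \<open>A basis of the second factor alone is used, with arbitrary coefficients in M. Together
  with \<open>tensor_expand_unique\<close> this identifies the tensor product with a power of M, and
  so gives sense to the leading term of a tensor.\<close>

lemma tensor_expand:
 assumes s: "N.kbasis J s" and T: "T \<in> carrier W"
 shows "\<exists>U\<in>J \<rightarrow> carrier M. T = finsum W (\<lambda>j. pt (U j) (s j)) J"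
proof -
 have J: "finite J" and sJ: "s \<in> J \<rightarrow> carrier N" using N.kbasisD[OF s] by auto
 from T have "T \<in> carrier TS" by simp
 then show ?thesis
 proof (induction rule: TS_induct)
  case zero
  have "finsum W (\<lambda>j. pt \<zero>\<^bsub>M\<^esub> (s j)) J = finsum W (\<lambda>j. \<zero>\<^bsub>W\<^esub>) J"
   using sJ W.M.zero_closed by (intro W.M.finsum_cong') (auto simp: Pi_iff)
  also have "... = \<zero>\<^bsub>W\<^esub>" by (rule W.M.finsum_zero)
  finally show ?case by (intro bexI[of _ "\<lambda>j. \<zero>\<^bsub>M\<^esub>"]) (simp_all only: tensor_module_simps Pi_I M.M.zero_closed)
 next
  case (pure x y)
  then show ?case using pt_lc[OF J sJ pure(1), of "N.coord J s y"] s
   by (intro bexI[of _ "\<lambda>j. M.sc (N.coord J s y j) x"]) (auto simp: N.lc_coord)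
 next
  case (add T T')
  then obtain U U' where U: "U \<in> J \<rightarrow> carrier M" "T = finsum W (\<lambda>j. pt (U j) (s j)) J"
   "U' \<in> J \<rightarrow> carrier M" "T' = finsum W (\<lambda>j. pt (U' j) (s j)) J" by blast
  have "T \<oplus>\<^bsub>W\<^esub> T' = finsum W (\<lambda>j. pt (U j) (s j) \<oplus>\<^bsub>W\<^esub> pt (U' j) (s j)) J"
   unfolding U(2,4) by (rule W.M.finsum_addf[symmetric]) (use U sJ in \<open>auto simp: Pi_iff\<close>)
  also have "... = finsum W (\<lambda>j. pt (U j \<oplus>\<^bsub>M\<^esub> U' j) (s j)) J"
   by (rule W.M.finsum_cong') (use U sJ in \<open>auto simp: Pi_iff pt_add_left\<close>)
  finally show ?case using U by (intro bexI[of _ "\<lambda>j. U j \<oplus>\<^bsub>M\<^esub> U' j"]) auto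
 qed
qed

text \<open>Contracting the second factor with its i-th coordinate functional gives a map \<phi> on
  the tensor product that sends the sum to \<open>U i\<close>.\<close>

lemma tensor_expand_unique:
 assumes s: "N.kbasis J s" and U: "U \<in> J \<rightarrow> carrier M"
  and 0: "finsum W (\<lambda>j. pt (U j) (s j)) J = \<zero>\<^bsub>W\<^esub>" and i: "i \<in> J"
 shows "U i = \<zero>\<^bsub>M\<^esub>"
proof -
 have J: "finite J" and sJ: "s \<in> J \<rightarrow> carrier N" using N.kbasisD[OF s] by auto
 obtain \<phi> where \<phi>: "\<And>T. T \<in> carrier TS ==> \<phi> T \<in> carrier M"
  "\<And>T U. [|T \<in> carrier TS; U \<in> carrier TS|] ==> \<phi> (T \<otimes>\<^bsub>TS\<^esub> U) = \<phi> T \<oplus>\<^bsub>M\<^esub> \<phi> U"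
  "\<And>x y. [|x \<in> carrier M; y \<in> carrier N|] ==> \<phi> (pt x y) = M.sc (N.coord J s y i) x"
  by (rule bilinear_lift[OF M.kmod_axioms, of "\<lambda>x y. M.sc (N.coord J s y i) x"])
   (use i in \<open>auto simp: M.sc_add_right M.sc_add N.coord_add[OF s] N.coord_sc[OF s] M.sc_def[symmetric]
    mult.commute\<close>)
 have \<phi>0: "\<phi> \<zero>\<^bsub>W\<^esub> = \<zero>\<^bsub>M\<^esub>"
 proof -
  have "\<phi> \<zero>\<^bsub>W\<^esub> \<oplus>\<^bsub>M\<^esub> \<phi> \<zero>\<^bsub>W\<^esub> = \<phi> \<zero>\<^bsub>W\<^esub>"
   using \<phi>(2)[of "\<zero>\<^bsub>W\<^esub>" "\<zero>\<^bsub>W\<^esub>"] W.M.l_zero[OF W.M.zero_closed] W.M.zero_closed by simp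
  moreover have "\<phi> \<zero>\<^bsub>W\<^esub> \<in> carrier M" using \<phi>(1) W.M.zero_closed by simp
  ultimately show ?thesis by (metis M.M.add.l_cancel_one)
 qed
 have sum: "\<phi> (finsum W f K) = finsum M (\<lambda>j. \<phi> (f j)) K" if "finite K" "f \<in> K \<rightarrow> carrier W" for f K
  using that
 proof (induction K rule: finite_induct)
  case (insert j K)
  then have *: "f j \<in> carrier W" "f \<in> K \<rightarrow> carrier W" by auto
  then have "finsum W f K \<in> carrier W" by (intro W.M.finsum_closed)
  then have "\<phi> (f j \<oplus>\<^bsub>W\<^esub> finsum W f K) = \<phi> (f j) \<oplus>\<^bsub>M\<^esub> finsum M (\<lambda>j. \<phi> (f j)) K"
   using insert * \<phi>(2) by simp
  moreover have "finsum W f (insert j K) = f j \<oplus>\<^bsub>W\<^esub> finsum W f K"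
   by (rule W.M.finsum_insert) (use insert * in auto)
  moreover have "finsum M (\<lambda>j. \<phi> (f j)) (insert j K) = \<phi> (f j) \<oplus>\<^bsub>M\<^esub> finsum M (\<lambda>j. \<phi> (f j)) K"
   by (rule M.M.finsum_insert) (use insert * \<phi>(1) in auto)
  ultimately show ?case by simp
 qed (simp add: \<phi>0[simplified])
 have "\<zero>\<^bsub>M\<^esub> = finsum M (\<lambda>j. \<phi> (pt (U j) (s j))) J"
  using sum[of J "\<lambda>j. pt (U j) (s j)"] 0 \<phi>0 J U sJ by (auto simp: Pi_iff)
 also have "... = finsum M (\<lambda>j. if i = j then U j else \<zero>\<^bsub>M\<^esub>) J"
  by (rule M.M.finsum_cong') (use U sJ i in \<open>auto simp: \<phi>(3) N.coord_basis[OF s] Pi_iff\<close>)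
 also have "... = U i" using M.M.finsum_singleton[OF i J U] by simp
 finally show ?thesis by simp
qed

end

section \<open>The presentation of the algebra\<close>

lemma free_simps [simp]:
 "carrier (ring_of_type_algebra :: 'b::ring_1 ring) = UNIV"
 "x \<otimes>\<^bsub>ring_of_type_algebra\<^esub> y = (x :: 'b) * y" "x \<oplus>\<^bsub>ring_of_type_algebra\<^esub> y = x + y"
 "\<one>\<^bsub>ring_of_type_algebra\<^esub> = (1 :: 'b)" "\<zero>\<^bsub>ring_of_type_algebra\<^esub> = (0 :: 'b)"
 by (simp_all add: ring_of_type_algebra_def)

lemma ring_free: "ring (ring_of_type_algebra :: 'b::ring_1 ring)"
proof -
 have "\<exists>y. x + y = 0" for x :: 'b using add.right_inverse by blast
 then show ?thesis unfolding ring_of_type_algebra_def using add.right_inverse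
  by unfold_locales (auto simp: algebra_simps Units_def)
qed

lemma fscalar_central: "p * fscalar c = fscalar c * (p :: 'k::field free_qu)"
proof -
 have "Poly_Mapping.keys p \<subseteq> UNIV" by simp
 then show ?thesis by (induction rule: poly_mapping_induct_on)
   (auto simp: fscalar_def mult_single distrib_left distrib_right mult.commute)
qed

lemma single_word_Cons:
 "Poly_Mapping.single (Word (x # w)) (c :: 'k::field) = fgen x * Poly_Mapping.single (Word w) c"
 by (simp add: fgen_def mult_single plus_qu_word_def)

lemma free_qu_induct [case_names scalar gen add mult]:
 fixes p :: "'k::field free_qu"
 assumes "\<And>c. P (fscalar c)" "\<And>x. P (fgen x)" "\<And>u v. P u ==> P v ==> P (u + v)"
  "\<And>u v. P u ==> P v ==> P (u * v)"
 shows "P p"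
proof -
 have *: "P (Poly_Mapping.single (Word w) c)" for w c
 proof (induction w)
  case Nil
  then show ?case using assms(1)[of c] by (simp add: fscalar_def zero_qu_word_def)
 next
  case (Cons x w) then show ?case unfolding single_word_Cons by (intro assms)
 qed
 have "Poly_Mapping.keys p \<subseteq> UNIV" by simp
 then show ?thesis
 proof (induction rule: poly_mapping_induct_on)
  case zero show ?case using assms(1)[of 0] by (simp add: fscalar_def)
 next
  case (single w c) then show ?case using *[of "letters w" c] by simp
 qed (use assms in auto)
qed

context kalg
begin

abbreviation "regm \<equiv> regular_module A"

definition word_prod :: "(qu_gen => 'a) => qu_word => 'a" where
 "word_prod g w = foldr (\<lambda>x y. g x \<otimes> y) (letters w) \<one>"

definition free_eval :: "(qu_gen => 'a) => 'k free_qu => 'a" where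
 "free_eval g p = kmod.lc \<eta> regm (Poly_Mapping.keys p) (word_prod g) (Poly_Mapping.lookup p)"

lemma word_prod_closed [simp]:
 assumes "\<And>x. g x \<in> carrier A" shows "word_prod g w \<in> carrier A"
proof -
 have "foldr (\<lambda>x y. g x \<otimes> y) l \<one> \<in> carrier A" for l by (induction l) (auto simp: assms)
 then show ?thesis by (simp add: word_prod_def)
qed

lemma word_prod_add:
 assumes "\<And>x. g x \<in> carrier A" shows "word_prod g (u + v) = word_prod g u \<otimes> word_prod g v"
proof -
 have *: "foldr (\<lambda>x y. g x \<otimes> y) l \<one> \<in> carrier A" for l by (induction l) (auto simp: assms)
 have "foldr (\<lambda>x y. g x \<otimes> y) (l @ l') \<one> = foldr (\<lambda>x y. g x \<otimes> y) l \<one> \<otimes> foldr (\<lambda>x y. g x \<otimes> y) l' \<one>"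
  for l l' by (induction l) (auto simp: assms * m_assoc simp del: foldr_append)
 then show ?thesis by (simp add: word_prod_def plus_qu_word_def)
qed

lemma
 assumes g: "\<And>x. g x \<in> carrier A"
 shows free_eval_hom: "free_eval g \<in> ring_hom free_qu A"
  and free_eval_fgen: "free_eval g (fgen x) = g x"
  and free_eval_fscalar: "free_eval g (fscalar c) = \<eta> c"
proof -
 interpret R: kmod A \<eta> regm by (rule regular_kmod)
 have wp: "word_prod g \<in> K \<rightarrow> carrier regm" for K using g by simp
 have super: "free_eval g p = R.lc K (word_prod g) (Poly_Mapping.lookup p)"
  if "finite K" "Poly_Mapping.keys p \<subseteq> K" for p K
  unfolding free_eval_def by (rule R.lc_mono_neutral[symmetric]) (use that wp in \<open>auto simp: in_keys_iff\<close>)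
 have single: "free_eval g (Poly_Mapping.single w c) = \<eta> c \<otimes> word_prod g w" for w c
 proof -
  have "free_eval g (Poly_Mapping.single w c) = R.lc {w} (word_prod g) (Poly_Mapping.lookup (Poly_Mapping.single w c))"
   by (rule super) auto
  also have "... = R.lc {w} (word_prod g) (\<lambda>i. if i = w then c else 0)" by (rule R.lc_cong) (use wp in auto)
  also have "... = \<eta> c \<otimes> word_prod g w" using wp g by (subst R.lc_single) (auto simp: R.sc_def)
  finally show ?thesis .
 qed
 have closed: "free_eval g p \<in> carrier A" for p using R.lc_closed[OF wp] unfolding free_eval_def by simp
 have add: "free_eval g (u + v) = free_eval g u \<oplus> free_eval g v" for u v
 proof -
  let ?K = "Poly_Mapping.keys u \<union> Poly_Mapping.keys v"
  have "free_eval g (u + v) = R.lc ?K (word_prod g) (Poly_Mapping.lookup (u + v))"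
   by (rule super) (use keys_add[of u v] in auto)
  also have "... = R.lc ?K (word_prod g) (Poly_Mapping.lookup u) \<oplus>\<^bsub>regm\<^esub> R.lc ?K (word_prod g) (Poly_Mapping.lookup v)"
   by (simp only: lookup_add[abs_def], rule R.lc_add) (use wp in auto)
  also have "... = free_eval g u \<oplus> free_eval g v" by (simp add: super[of ?K])
  finally show ?thesis .
 qed
 have zero: "free_eval g 0 = \<zero>" unfolding free_eval_def by simp
 have mult: "free_eval g (u * v) = free_eval g u \<otimes> free_eval g v" for u v
 proof -
  have "Poly_Mapping.keys u \<subseteq> UNIV" "Poly_Mapping.keys v \<subseteq> UNIV" by auto
  then show ?thesis
  proof (induction arbitrary: v rule: poly_mapping_induct_on)
   case (single w c)
   from single(2) show ?case
   proof (induction rule: poly_mapping_induct_on)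
    case (single w' c')
    have "\<eta> c \<otimes> (\<eta> c' \<otimes> (word_prod g w \<otimes> word_prod g w')) = \<eta> c \<otimes> (word_prod g w \<otimes> (\<eta> c' \<otimes> word_prod g w'))"
     using g unit_central[of "word_prod g w" c'] by (simp flip: m_assoc)
    then show ?case
     using g by (simp add: mult_single kalg.free_eval_def \<open>\<And>w c. free_eval g (Poly_Mapping.single w c) = \<eta> c \<otimes> word_prod g w\<close>
       word_prod_add unit_mult m_assoc)
   qed (use closed in \<open>auto simp: distrib_left add r_distr zero\<close>)
  qed (use closed in \<open>auto simp: distrib_right add l_distr zero\<close>)
 qed
 show scalar: "free_eval g (fscalar c) = \<eta> c" for c
  unfolding fscalar_def single by (simp add: word_prod_def zero_qu_word_def)
 show "free_eval g (fgen x) = g x" unfolding fgen_def single using g by (simp add: word_prod_def unit_one)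
 show "free_eval g \<in> ring_hom free_qu A"
  by (rule ring_hom_memI) (use closed add mult scalar[of 1] in \<open>auto simp: fscalar_def unit_one\<close>)
qed

end

lemma ideal_qu: "ideal (qu_ideal n q) (free_qu :: 'k::field free_qu ring)"
 unfolding qu_ideal_def by (rule ring.genideal_ideal[OF ring_free]) simp

lemma ring_qu: "ring (qu n q)" unfolding qu_def by (rule ideal.quotient_is_ring[OF ideal_qu])

lemma qu_class_hom: "qu_class n q \<in> ring_hom free_qu (qu n q)"
proof -
 have "qu_class n q = (+>\<^bsub>free_qu\<^esub>) (qu_ideal n q)" by (rule ext) (simp add: qu_class_def)
 then show ?thesis unfolding qu_def using ideal.rcos_ring_hom[OF ideal_qu] by metis
qed

lemma qu_class_simps:
 "qu_class n q p \<in> carrier (qu n q)"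
 "qu_class n q (p + r) = qu_class n q p \<oplus>\<^bsub>qu n q\<^esub> qu_class n q r"
 "qu_class n q (p * r) = qu_class n q p \<otimes>\<^bsub>qu n q\<^esub> qu_class n q r"
 "qu_class n q 1 = \<one>\<^bsub>qu n q\<^esub>"
 using ring_hom_closed[OF qu_class_hom] ring_hom_add[OF qu_class_hom] ring_hom_mult[OF qu_class_hom]
  ring_hom_one[OF qu_class_hom] by fastforce+

lemma qu_class_zero: "qu_class n q 0 = \<zero>\<^bsub>qu n q\<^esub>"
 using ring_hom_zero[OF qu_class_hom ring_free ring_qu] by simp

lemma qu_carrier_cases: assumes "x \<in> carrier (qu n q)" obtains p where "x = qu_class n q p"
 using assms unfolding qu_def qu_class_def by (auto simp: FactRing_def A_RCOSETS_defs a_r_coset_def)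

lemma qu_ideal_closed:
 shows qu_ideal_add: "[|u \<in> qu_ideal n q; v \<in> qu_ideal n q|] ==> u + v \<in> qu_ideal n q"
  and qu_ideal_uminus: "u \<in> qu_ideal n q ==> - u \<in> qu_ideal n q"
  and qu_ideal_zero: "0 \<in> qu_ideal n q" using additive_subgroup.a_closed[OF ideal.axioms(1)[OF ideal_qu], of u n q v]
  ideal.I_l_closed[OF ideal_qu, of u n q "-1"] additive_subgroup.zero_closed[OF ideal.axioms(1)[OF ideal_qu], of n q]
 by simp_all

lemma mem_qu_class: "r \<in> qu_class n q p \<longleftrightarrow> (\<exists>u\<in>qu_ideal n q. r = u + p)"
 by (auto simp: qu_class_def a_r_coset_def r_coset_def)

lemma qu_class_eq_zero:
 assumes "p \<in> qu_ideal n q" shows "qu_class n q p = \<zero>\<^bsub>qu n q\<^esub>"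
proof -
 have "r \<in> qu_class n q p \<longleftrightarrow> r \<in> qu_ideal n q" for r
  unfolding mem_qu_class using assms qu_ideal_add[of r n q "- p"] qu_ideal_uminus[of p n q]
  by (auto intro!: bexI[of _ "r + - p"] qu_ideal_add)
 then show ?thesis by (auto simp: qu_def FactRing_def)
qed

lemma qu_relator_zero: "r \<in> qu_relators n q ==> qu_class n q r = \<zero>\<^bsub>qu n q\<^esub>"
 by (rule qu_class_eq_zero, unfold qu_ideal_def) (use ring.genideal_self[OF ring_free] in fastforce)

lemma kalg_qu: "kalg (qu n q) (qu_unit n q)"
proof (intro kalg.intro ring_qu kalg_axioms.intro)
 show "qu_unit n q (c + d) = qu_unit n q c \<oplus>\<^bsub>qu n q\<^esub> qu_unit n q d" for c d
  by (simp add: qu_unit_def qu_class_simps(2)[symmetric] fscalar_def single_add)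
 show "qu_unit n q (c * d) = qu_unit n q c \<otimes>\<^bsub>qu n q\<^esub> qu_unit n q d" for c d
  by (simp add: qu_unit_def qu_class_simps(3)[symmetric] fscalar_def mult_single)
 show "qu_unit n q 1 = \<one>\<^bsub>qu n q\<^esub>" by (simp add: qu_unit_def qu_class_simps(4)[symmetric] fscalar_def)
 show "x \<otimes>\<^bsub>qu n q\<^esub> qu_unit n q c = qu_unit n q c \<otimes>\<^bsub>qu n q\<^esub> x" if "x \<in> carrier (qu n q)" for x c
  using that by (elim qu_carrier_cases)
   (simp add: qu_unit_def qu_class_simps(3)[symmetric] fscalar_central)
qed (simp add: qu_unit_def qu_class_simps)

fun qu_gen_class :: "nat => 'k::field => qu_gen => 'k free_qu set" where
 "qu_gen_class n q Kappa = qu_kappa n q"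
| "qu_gen_class n q Kappa_hat = qu_kappa_hat n q"
| "qu_gen_class n q Gen_E = qu_E n q"
| "qu_gen_class n q Gen_F = qu_F n q"

lemma qu_gen_class_altdef: "qu_gen_class n q x = qu_class n q (fgen x)"
 by (cases x) (simp_all add: qu_kappa_def qu_kappa_hat_def qu_E_def qu_F_def)

lemma qu_induct [consumes 1, case_names scalar kappa kappa_hat E F add mult]:
 assumes x: "x \<in> carrier (qu n q)"
  and "\<And>c. P (qu_unit n q c)" "P (qu_kappa n q)" "P (qu_kappa_hat n q)" "P (qu_E n q)" "P (qu_F n q)"
  and add: "\<And>u v. [|u \<in> carrier (qu n q); v \<in> carrier (qu n q); P u; P v|] ==> P (u \<oplus>\<^bsub>qu n q\<^esub> v)"
  and mult: "\<And>u v. [|u \<in> carrier (qu n q); v \<in> carrier (qu n q); P u; P v|] ==> P (u \<otimes>\<^bsub>qu n q\<^esub> v)"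
 shows "P x"
proof -
 have "P (qu_class n q p)" for p
 proof (induction p rule: free_qu_induct)
  case (scalar c) then show ?case using assms(2)[of c] by (simp add: qu_unit_def)
 next
  case (gen x)
  have "P (qu_gen_class n q x)" using assms(3-6) by (cases x) auto
  then show ?case by (simp add: qu_gen_class_altdef)
 qed (auto simp: qu_class_simps intro!: add mult)
 with x show ?thesis by (elim qu_carrier_cases) simp
qed

text \<open>Four elements of an arbitrary algebra that satisfy the defining relations. It is
  instantiated by the quotient itself, by its tensor square and by the endomorphisms of an induced
  module.\<close>

locale qu_relations = kalg A \<eta> for A :: "('a, 'r) ring_scheme" (structure) and \<eta> :: "'k::field => 'a" +
 fixes n :: nat and q :: 'k and g :: "qu_gen => 'a"
 assumes gen_closed [simp]: "g x \<in> carrier A"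
  and kappa_pow: "g Kappa [^] n = \<one>"
  and kappa_hat_pow: "g Kappa_hat [^] n \<otimes> g Kappa [^] (2::nat) = \<one>"
  and kappa_comm: "g Kappa \<otimes> g Kappa_hat = g Kappa_hat \<otimes> g Kappa"
  and kappa_E: "g Kappa \<otimes> g Gen_E = \<eta> (q ^ n) \<otimes> g Gen_E \<otimes> g Kappa"
  and kappa_F: "g Kappa \<otimes> g Gen_F = \<eta> (inverse (q ^ n)) \<otimes> g Gen_F \<otimes> g Kappa"
  and kappa_hat_E: "g Kappa_hat \<otimes> g Gen_E = \<eta> (q ^ n * inverse (q ^ 2)) \<otimes> g Gen_E \<otimes> g Kappa_hat"
  and kappa_hat_F: "g Kappa_hat \<otimes> g Gen_F = \<eta> (inverse (q ^ n) * q ^ 2) \<otimes> g Gen_F \<otimes> g Kappa_hat"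
  and E_pow: "g Gen_E [^] (n ^ 2) = \<zero>"
  and F_pow: "g Gen_F [^] (n ^ 2) = \<zero>"
  and FE: "g Gen_F \<otimes> g Gen_E = \<eta> (inverse q) \<otimes> g Gen_E \<otimes> g Gen_F \<oplus> (\<one> \<ominus> g Kappa [^] (n - 1) \<otimes> g Kappa_hat)"

lemma (in ring) minus_eq_zero_iff: "[|x \<in> carrier R; y \<in> carrier R|] ==> x \<ominus> y = \<zero> \<longleftrightarrow> x = y"
 by (metis add.inv_solve_right' a_minus_def l_zero r_neg r_right_minus_eq)

lemma qu_hom_diff:
 assumes "\<phi> \<in> ring_hom (free_qu :: 'k::field free_qu ring) B" "ring B"
 shows "\<phi> (p - r) = \<phi> p \<ominus>\<^bsub>B\<^esub> \<phi> r"
proof -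
 interpret ring B by fact
 have c: "\<phi> u \<in> carrier B" for u using ring_hom_closed[OF assms(1)] by simp
 have "\<phi> p = \<phi> (p - r) \<oplus>\<^bsub>B\<^esub> \<phi> r" using ring_hom_add[OF assms(1), of "p - r" r] by simp
 then show ?thesis using c by (simp add: a_minus_def a_assoc r_neg)
qed

lemma qu_hom_pow:
 assumes "\<phi> \<in> ring_hom (free_qu :: 'k::field free_qu ring) B" "ring B"
 shows "\<phi> (p ^ m) = \<phi> p [^]\<^bsub>B\<^esub> m"
proof -
 interpret ring B by fact
 have c: "\<phi> u \<in> carrier B" for u using ring_hom_closed[OF assms(1)] by simp
 show ?thesis by (induction m) (use ring_hom_one[OF assms(1)] ring_hom_mult[OF assms(1)] c in
   \<open>auto simp: power_commutes[symmetric] simp del: power_Suc simp add: power_Suc2\<close>)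
qed

lemma qu_relations_qu:
 assumes n: "n > 0"
 shows "qu_relations (qu n q) (qu_unit n q) n q (qu_gen_class n q)"
proof -
 interpret kalg "qu n q" "qu_unit n q" by (rule kalg_qu)
 note D = qu_hom_diff[OF qu_class_hom ring_qu] and P = qu_hom_pow[OF qu_class_hom ring_qu]
 have Z: "qu_class n q u = qu_class n q v" if "u - v \<in> qu_relators n q" for u v
  using qu_relator_zero[OF that] by (simp add: D minus_eq_zero_iff qu_class_simps)
 note simps = qu_class_simps P qu_unit_def[symmetric] qu_gen_class_altdef[symmetric]
 show ?thesis
 proof (intro qu_relations.intro kalg_qu qu_relations_axioms.intro)
  let ?k = "fgen Kappa :: 'a free_qu" and ?k' = "fgen Kappa_hat :: 'a free_qu"
   and ?E = "fgen Gen_E :: 'a free_qu" and ?F = "fgen Gen_F :: 'a free_qu"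
  show "qu_gen_class n q x \<in> carrier (qu n q)" for x by (simp add: qu_gen_class_altdef qu_class_simps)
  show "qu_gen_class n q Kappa [^]\<^bsub>qu n q\<^esub> n = \<one>\<^bsub>qu n q\<^esub>"
   using Z[of "?k ^ n" 1] by (simp only: simps) (simp add: qu_relators_def Let_def)
  show "qu_gen_class n q Kappa_hat [^]\<^bsub>qu n q\<^esub> n \<otimes>\<^bsub>qu n q\<^esub> qu_gen_class n q Kappa [^]\<^bsub>qu n q\<^esub> (2::nat) = \<one>\<^bsub>qu n q\<^esub>"
   using Z[of "?k' ^ n * ?k ^ 2" 1] by (simp only: simps) (simp add: qu_relators_def Let_def)
  show "qu_gen_class n q Kappa \<otimes>\<^bsub>qu n q\<^esub> qu_gen_class n q Kappa_hat = qu_gen_class n q Kappa_hat \<otimes>\<^bsub>qu n q\<^esub> qu_gen_class n q Kappa"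
   using Z[of "?k * ?k'" "?k' * ?k"] by (simp only: simps) (simp add: qu_relators_def Let_def)
  show "qu_gen_class n q Kappa \<otimes>\<^bsub>qu n q\<^esub> qu_gen_class n q Gen_E = qu_unit n q (q ^ n) \<otimes>\<^bsub>qu n q\<^esub> qu_gen_class n q Gen_E \<otimes>\<^bsub>qu n q\<^esub> qu_gen_class n q Kappa"
   using Z[of "?k * ?E" "fscalar (q ^ n) * ?E * ?k"] by (simp only: simps) (simp add: qu_relators_def Let_def)
  show "qu_gen_class n q Kappa \<otimes>\<^bsub>qu n q\<^esub> qu_gen_class n q Gen_F = qu_unit n q (inverse (q ^ n)) \<otimes>\<^bsub>qu n q\<^esub> qu_gen_class n q Gen_F \<otimes>\<^bsub>qu n q\<^esub> qu_gen_class n q Kappa"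
   using Z[of "?k * ?F" "fscalar (inverse (q ^ n)) * ?F * ?k"] by (simp only: simps) (simp add: qu_relators_def Let_def)
  show "qu_gen_class n q Kappa_hat \<otimes>\<^bsub>qu n q\<^esub> qu_gen_class n q Gen_E = qu_unit n q (q ^ n * inverse (q ^ 2)) \<otimes>\<^bsub>qu n q\<^esub> qu_gen_class n q Gen_E \<otimes>\<^bsub>qu n q\<^esub> qu_gen_class n q Kappa_hat"
   using Z[of "?k' * ?E" "fscalar (q ^ n * inverse (q ^ 2)) * ?E * ?k'"] by (simp only: simps) (simp add: qu_relators_def Let_def)
  show "qu_gen_class n q Kappa_hat \<otimes>\<^bsub>qu n q\<^esub> qu_gen_class n q Gen_F = qu_unit n q (inverse (q ^ n) * q ^ 2) \<otimes>\<^bsub>qu n q\<^esub> qu_gen_class n q Gen_F \<otimes>\<^bsub>qu n q\<^esub> qu_gen_class n q Kappa_hat"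
   using Z[of "?k' * ?F" "fscalar (inverse (q ^ n) * q ^ 2) * ?F * ?k'"] by (simp only: simps) (simp add: qu_relators_def Let_def)
  show "qu_gen_class n q Gen_E [^]\<^bsub>qu n q\<^esub> (n ^ 2) = \<zero>\<^bsub>qu n q\<^esub>"
   using Z[of "?E ^ (n ^ 2)" 0] by (simp only: simps qu_class_zero) (simp add: qu_relators_def Let_def)
  show "qu_gen_class n q Gen_F [^]\<^bsub>qu n q\<^esub> (n ^ 2) = \<zero>\<^bsub>qu n q\<^esub>"
   using Z[of "?F ^ (n ^ 2)" 0] by (simp only: simps qu_class_zero) (simp add: qu_relators_def Let_def)
  have "qu_class n q (?F * ?E) = qu_class n q (fscalar (inverse q) * ?E * ?F + (1 - ?k ^ (n - 1) * ?k'))"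
   by (rule Z) (simp add: qu_relators_def Let_def diff_diff_eq)
  then show "qu_gen_class n q Gen_F \<otimes>\<^bsub>qu n q\<^esub> qu_gen_class n q Gen_E = qu_unit n q (inverse q) \<otimes>\<^bsub>qu n q\<^esub> qu_gen_class n q Gen_E \<otimes>\<^bsub>qu n q\<^esub> qu_gen_class n q Gen_F
   \<oplus>\<^bsub>qu n q\<^esub> (\<one>\<^bsub>qu n q\<^esub> \<ominus>\<^bsub>qu n q\<^esub> qu_gen_class n q Kappa [^]\<^bsub>qu n q\<^esub> (n - 1) \<otimes>\<^bsub>qu n q\<^esub> qu_gen_class n q Kappa_hat)"
   by (simp only: simps D)
 qed
qed

text \<open>Universal property of the presentation: evaluation of the free algebra kills the
  relators, hence the ideal, and is therefore constant on cosets.\<close>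

lemma (in qu_relations) qu_hom_exists:
 obtains \<phi> where "\<phi> \<in> ring_hom (qu n q) A" "\<And>c. \<phi> (qu_unit n q c) = \<eta> c"
  "\<phi> (qu_kappa n q) = g Kappa" "\<phi> (qu_kappa_hat n q) = g Kappa_hat"
  "\<phi> (qu_E n q) = g Gen_E" "\<phi> (qu_F n q) = g Gen_F"
proof -
 let ?e = "free_eval g"
 note hom = free_eval_hom[of g, OF gen_closed]
 note D = qu_hom_diff[OF hom ring_axioms] and P = qu_hom_pow[OF hom ring_axioms]
 have M: "?e (p * r) = ?e p \<otimes> ?e r" and c: "?e p \<in> carrier A" and one: "?e 1 = \<one>" for p r
  using ring_hom_mult[OF hom] ring_hom_closed[OF hom] ring_hom_one[OF hom] by auto
 have zero: "?e 0 = \<zero>" using ring_hom_zero[OF hom ring_free ring_axioms] by simp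
 have ker: "ideal (a_kernel free_qu A ?e) free_qu"
  by (rule ring_hom_ring.kernel_is_ideal, rule ring_hom_ringI2[OF ring_free ring_axioms hom])
 have "?e r = \<zero>" if "r \<in> qu_relators n q" for r using that unfolding qu_relators_def Let_def
  by (elim insertE emptyE; hypsubst)
   (simp_all add: D P M one c free_eval_fgen free_eval_fscalar kappa_pow kappa_hat_pow kappa_comm
    kappa_E kappa_F kappa_hat_E kappa_hat_F E_pow F_pow FE minus_eq_zero_iff,
   simp_all add: a_minus_def a_ac r_neg1 r_neg2 r_neg minus_add)
 then have "qu_ideal n q \<subseteq> a_kernel free_qu A ?e"
  unfolding qu_ideal_def by (intro ring.genideal_minimal[OF ring_free ker]) (auto simp: a_kernel_def kernel_def)
 then have null: "?e p = \<zero>" if "p \<in> qu_ideal n q" for p using that by (auto simp: a_kernel_def kernel_def)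
 define \<phi> where "\<phi> T = ?e (SOME p. p \<in> T)" for T
 have \<phi>: "\<phi> (qu_class n q p) = ?e p" for p
 proof -
  note mem = mem_qu_class[of _ n q p]
  have "0 \<in> qu_ideal n q" by (rule qu_ideal_zero)
  then have "\<exists>r. r \<in> qu_class n q p" unfolding mem by blast
  then have "(SOME r. r \<in> qu_class n q p) \<in> qu_class n q p" by (rule someI_ex)
  then obtain u where "u \<in> qu_ideal n q" "(SOME r. r \<in> qu_class n q p) = u + p" unfolding mem by blast
  then show ?thesis unfolding \<phi>_def using ring_hom_add[OF hom, of u p] null[of u] c by simp
 qed
 show ?thesis
 proof (rule that)
  show "\<phi> \<in> ring_hom (qu n q) A"
  proof (rule ring_hom_memI)
   show "\<phi> x \<in> carrier A" if "x \<in> carrier (qu n q)" for x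
    using that c by (elim qu_carrier_cases) (simp add: \<phi>)
   show "\<phi> (x \<otimes>\<^bsub>qu n q\<^esub> y) = \<phi> x \<otimes> \<phi> y" "\<phi> (x \<oplus>\<^bsub>qu n q\<^esub> y) = \<phi> x \<oplus> \<phi> y"
    if "x \<in> carrier (qu n q)" "y \<in> carrier (qu n q)" for x y
    using that M ring_hom_add[OF hom] by (elim qu_carrier_cases; simp add: \<phi> qu_class_simps(2,3)[symmetric])+
   show "\<phi> \<one>\<^bsub>qu n q\<^esub> = \<one>" using one by (simp add: \<phi> qu_class_simps(4)[symmetric])
  qed
 qed (simp_all add: qu_unit_def qu_kappa_def qu_kappa_hat_def qu_E_def qu_F_def \<phi> free_eval_fgen free_eval_fscalar)
qed

section \<open>Spectral projections\<close>

context kalg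
begin

lemma unit_mult_left: "x \<in> carrier A ==> \<eta> c \<otimes> (\<eta> d \<otimes> x) = \<eta> (c * d) \<otimes> x"
 by (simp add: unit_mult m_assoc)

lemma unit_left_comm: "[|x \<in> carrier A; y \<in> carrier A|] ==> x \<otimes> (\<eta> c \<otimes> y) = \<eta> c \<otimes> (x \<otimes> y)"
 using unit_central[of x c] by (simp flip: m_assoc)

text \<open>For \<open>y^m = 1\<close> and \<open>c^m = 1\<close> this is the projection onto the
  eigenspace of y with eigenvalue \<open>inverse c\<close>. The elements \<open>1_i\<close> (for
  \<kappa>) and \<open>\<phi>_(2i)\<close> (for K) are both of this form.\<close>

definition proj :: "nat => 'a => 'k => 'a" where
 "proj m y c = \<eta> (1 / of_nat m) \<otimes> (\<Oplus>r\<in>{..<m}. \<eta> (c ^ r) \<otimes> y [^] r)"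

lemma proj_closed [simp]: "y \<in> carrier A ==> proj m y c \<in> carrier A"
 unfolding proj_def by (intro m_closed unit_closed finsum_closed) auto

text \<open>Both sides are the sum of all \<open>z^r\<close> with r from 0 to m; the telescoping
  identity is written without subtraction.\<close>

lemma power_sum_shift:
 assumes "z \<in> carrier A"
 shows "z \<otimes> (\<Oplus>r\<in>{..<m}. z [^] (r::nat)) \<oplus> \<one> = (\<Oplus>r\<in>{..<m}. z [^] r) \<oplus> z [^] m"
proof (induction m)
 case (Suc m)
 let ?s = "\<lambda>m. \<Oplus>r\<in>{..<m}. z [^] (r::nat)"
 have s: "?s m \<in> carrier A" using assms by (intro finsum_closed) auto
 have step: "?s (Suc m) = z [^] m \<oplus> ?s m" unfolding lessThan_Suc using assms by (subst finsum_insert) auto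
 have zc: "z \<otimes> z [^] m = z [^] m \<otimes> z" using nat_pow_Suc2[of z m] assms by simp
 obtain S where S: "S = ?s m" "S \<in> carrier A" using s by blast
 obtain w where w: "w = z [^] m" "w \<in> carrier A" using assms by blast
 have "z \<otimes> ?s (Suc m) \<oplus> \<one> = w \<otimes> z \<oplus> (z \<otimes> S \<oplus> \<one>)"
  unfolding step S(1)[symmetric] w(1)[symmetric] using assms S(2) w(2) zc w(1) by (simp add: r_distr a_assoc)
 also have "... = (w \<oplus> S) \<oplus> w \<otimes> z" using Suc S w assms by (simp add: a_ac)
 also have "... = ?s (Suc m) \<oplus> z [^] Suc m" unfolding step S(1)[symmetric] w(1)[symmetric] using w by simp
 finally show ?case .
qed (use assms in simp)

lemma scaled_pow: "y \<in> carrier A ==> (\<eta> c \<otimes> y) [^] (r::nat) = \<eta> (c ^ r) \<otimes> y [^] r"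
proof (induction r)
 case (Suc r)
 note y = \<open>y \<in> carrier A\<close>
 have "(\<eta> c \<otimes> y) [^] Suc r = \<eta> (c ^ r) \<otimes> (y [^] r \<otimes> (\<eta> c \<otimes> y))"
  using Suc y by (simp add: m_assoc)
 also have "... = \<eta> (c ^ r) \<otimes> (\<eta> c \<otimes> (y [^] r \<otimes> y))"
  using y by (simp add: unit_left_comm[of "y [^] r" y])
 finally show ?case using y by (simp add: unit_mult_left mult.commute)
qed (simp add: unit_one)

lemma proj_eigen:
 assumes y: "y \<in> carrier A" "y [^] m = \<one>" and c: "c ^ m = 1" "c \<noteq> 0"
 shows "y \<otimes> proj m y c = \<eta> (inverse c) \<otimes> proj m y c"
proof -
 let ?z = "\<eta> c \<otimes> y"
 define S where "S = (\<Oplus>r\<in>{..<m}. \<eta> (c ^ r) \<otimes> y [^] r)"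
 have S: "S \<in> carrier A" unfolding S_def using y by (intro finsum_closed) auto
 have eq: "S = (\<Oplus>r\<in>{..<m}. ?z [^] r)" unfolding S_def using y by (intro finsum_cong') (auto simp: scaled_pow)
 have "?z [^] m = \<one>" using y c by (simp add: scaled_pow unit_one)
 then have "?z \<otimes> S \<oplus> \<one> = S \<oplus> \<one>" using power_sum_shift[of ?z m, folded eq] y by simp
 moreover have "?z \<otimes> S \<in> carrier A" using y S by blast
 ultimately have "?z \<otimes> S = S" using S by simp
 then have zs: "\<eta> c \<otimes> (y \<otimes> S) = S" using y S by (simp add: m_assoc)
 have "y \<otimes> S = \<eta> (inverse c) \<otimes> (\<eta> c \<otimes> (y \<otimes> S))"
  using y S c by (simp add: unit_mult_left unit_one)
 then have yS: "y \<otimes> S = \<eta> (inverse c) \<otimes> S" by (simp add: zs)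
 have "y \<otimes> (\<eta> (1 / of_nat m) \<otimes> S) = \<eta> (inverse c) \<otimes> (\<eta> (1 / of_nat m) \<otimes> S)"
  using y S by (simp add: unit_left_comm[of y S] yS unit_mult_left mult.commute)
 then show ?thesis unfolding proj_def S_def .
qed

text \<open>Interchanging the two sums leaves at \<open>y^r\<close> the r-th power sum of the
  \<open>c i\<close>, which by assumption survives for r = 0 only.\<close>

lemma proj_complete:
 assumes y: "y \<in> carrier A" and m: "m > 0" "of_nat m \<noteq> (0 :: 'k)"
  and c: "\<And>r. r < m ==> (\<Sum>i\<in>J. c i ^ r) = (if r = 0 then of_nat m else 0)"
  and J: "finite J"
 shows "(\<Oplus>i\<in>J. proj m y (c i)) = \<one>"
proof -
 interpret R: kmod A \<eta> regm by (rule regular_kmod)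
 have b: "(\<lambda>r. y [^] r) \<in> {..<m} \<rightarrow> carrier regm" using y by auto
 have finsum_regm: "finsum regm f K = finsum A f K" for f :: "'x => 'a" and K
  by (simp add: finsum_def regular_module_def finprod_def)
 have p: "proj m y (c i) = R.lc {..<m} (\<lambda>r. y [^] r) (\<lambda>r. c i ^ r / of_nat m)" for i
 proof -
  have "R.lc {..<m} (\<lambda>r. y [^] r) (\<lambda>r. 1 / of_nat m * c i ^ r)
    = R.sc (1 / of_nat m) (R.lc {..<m} (\<lambda>r. y [^] r) (\<lambda>r. c i ^ r))"
   by (rule R.lc_sc) (use b in auto)
  then show ?thesis by (simp add: proj_def R.lc_def R.sc_def finsum_regm)
 qed
 have "(\<Oplus>i\<in>J. proj m y (c i)) = R.lc J (\<lambda>i. proj m y (c i)) (\<lambda>i. 1)"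
  unfolding R.lc_def finsum_regm using y by (intro finsum_cong') (auto simp: R.sc_def unit_one)
 also have "... = R.lc {..<m} (\<lambda>r. y [^] r) (\<lambda>r. \<Sum>i\<in>J. c i ^ r / of_nat m * 1)"
  by (rule R.lc_matrix) (use J b p in auto)
 also have "... = R.lc {..<m} (\<lambda>r. y [^] r) (\<lambda>r. if r = 0 then 1 else 0)"
  using m c by (intro R.lc_cong[OF b]) (auto simp: sum_divide_distrib[symmetric])
 also have "... = \<one>" using b m by (subst R.lc_single) (auto simp: R.sc_def unit_one)
 finally show ?thesis .
qed

end

lemma geometric_sum_root:
 fixes c :: "'k::field"
 assumes "c ^ m = 1" "c \<noteq> 1"
 shows "(\<Sum>r<m. c ^ r) = 0" using geometric_sum[of c m] assms by simp

context kmod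
begin

lemma act_finsum_left:
 assumes "finite I" "f \<in> I \<rightarrow> carrier A" "x \<in> carrier M"
 shows "finsum A f I \<odot>\<^bsub>M\<^esub> x = finsum M (\<lambda>i. f i \<odot>\<^bsub>M\<^esub> x) I" using assms
proof (induction I rule: finite_induct)
 case (insert i I)
 then have "f \<in> I \<rightarrow> carrier A" "(\<lambda>i. f i \<odot>\<^bsub>M\<^esub> x) \<in> I \<rightarrow> carrier M" by auto
 with insert show ?case by (simp add: act_l_distr Pi_iff)
qed simp

lemma finsum_sc:
 assumes "finite I" "x \<in> carrier M"
 shows "finsum M (\<lambda>i. sc (c i) x) I = sc (\<Sum>i\<in>I. c i) x"
 using assms(1) by (induction I rule: finite_induct) (use assms(2) in \<open>auto simp: sc_add\<close>)

lemma pow_act_eigen: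
 assumes "y \<in> carrier A" "x \<in> carrier M" "y \<odot>\<^bsub>M\<^esub> x = sc a x"
 shows "(y [^] (r::nat)) \<odot>\<^bsub>M\<^esub> x = sc (a ^ r) x"
 by (induction r) (use assms in \<open>simp_all add: act_assoc act_sc mult.commute\<close>)

lemma unit_act: "[|a \<in> carrier A; x \<in> carrier M|] ==> (\<eta> c \<otimes> a) \<odot>\<^bsub>M\<^esub> x = sc c (a \<odot>\<^bsub>M\<^esub> x)"
 by (simp add: act_assoc sc_def)

lemma proj_act:
 assumes y: "y \<in> carrier A" and x: "x \<in> carrier M" "y \<odot>\<^bsub>M\<^esub> x = sc a x"
  and "a ^ m = 1" "c ^ m = 1" "of_nat m \<noteq> (0 :: 'k)"
 shows "proj m y c \<odot>\<^bsub>M\<^esub> x = (if a * c = 1 then x else \<zero>\<^bsub>M\<^esub>)"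
proof -
 have "(\<Oplus>r\<in>{..<m}. \<eta> (c ^ r) \<otimes> y [^] r) \<odot>\<^bsub>M\<^esub> x = finsum M (\<lambda>r. (\<eta> (c ^ r) \<otimes> y [^] r) \<odot>\<^bsub>M\<^esub> x) {..<m}"
  using y x by (intro act_finsum_left) auto
 also have "... = finsum M (\<lambda>r. sc ((a * c) ^ r) x) {..<m}"
  using y x by (intro M.finsum_cong') (auto simp: unit_act pow_act_eigen[OF y x] power_mult_distrib mult.commute)
 also have "... = sc (\<Sum>r<m. (a * c) ^ r) x" using x by (simp add: finsum_sc)
 finally have "proj m y c \<odot>\<^bsub>M\<^esub> x = sc (1 / of_nat m) (sc (\<Sum>r<m. (a * c) ^ r) x)"
  unfolding proj_def using x y by (subst unit_act) (auto intro!: finsum_closed)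
 moreover have "(\<Sum>r<m. (a * c) ^ r) = (if a * c = 1 then of_nat m else 0)"
 proof (cases "a * c = 1")
  case False
  then show ?thesis using geometric_sum_root[of "a * c" m] assms(4,5) by (simp add: power_mult_distrib[of a c m])
 qed simp
 ultimately show ?thesis using x assms by auto
qed

end

section \<open>Modules over the algebra\<close>

locale qparam =
 fixes n :: nat and q :: "'k::field_char_0"
 assumes n_pos: "n > 0" and four_dvd: "4 dvd n" and primitive: "primitive_root_of_unity (n ^ 2) q"
begin

abbreviation "N \<equiv> n ^ 2"
abbreviation "A \<equiv> qu n q"
abbreviation "\<eta> \<equiv> qu_unit n q"
abbreviation "\<kappa> \<equiv> qu_kappa n q"
abbreviation "\<kappa>h \<equiv> qu_kappa_hat n q"
abbreviation "E \<equiv> qu_E n q"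
abbreviation "F \<equiv> qu_F n q"
abbreviation amult (infixl \<open>\<cdot>\<close> 70) where "x \<cdot> y \<equiv> x \<otimes>\<^bsub>A\<^esub> y"
abbreviation apow (infixr \<open>\<up>\<close> 75) where "x \<up> (r::nat) \<equiv> x [^]\<^bsub>A\<^esub> r"
abbreviation "\<kappa>i \<equiv> inv\<^bsub>A\<^esub> \<kappa>"
abbreviation "K \<equiv> \<kappa>i \<cdot> \<kappa>h"

lemma q_pow_N: "q ^ N = 1" and q_nonzero [simp]: "q \<noteq> 0" and N_pos: "N > 0"
 using primitive n_pos unfolding primitive_root_of_unity_def by (auto simp: power_0_left)

lemma q_pow_eq_1_iff: "q ^ m = 1 \<longleftrightarrow> N dvd m"
proof
 assume 1: "q ^ m = 1"
 have "q ^ m = (q ^ N) ^ (m div N) * q ^ (m mod N)" by (simp flip: power_add power_mult)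
 then have "q ^ (m mod N) = 1" using 1 q_pow_N by simp
 moreover have "m mod N < N" using N_pos by simp
 ultimately show "N dvd m" using primitive unfolding primitive_root_of_unity_def by (metis dvd_eq_mod_eq_0 gr0I)
next
 assume "N dvd m"
 then show "q ^ m = 1" using q_pow_N by (auto simp: dvd_def power_mult)
qed

lemma q_powi_eq_1_iff: "q powi m = 1 \<longleftrightarrow> int N dvd m"
proof (cases "m \<ge> 0")
 case True
 then have "q powi m = q ^ nat m" by (simp add: power_int_def)
 then show ?thesis using True q_pow_eq_1_iff[of "nat m"] by (simp add: nat_dvd_iff int_dvd_int_iff[symmetric] del: int_dvd_int_iff)
next
 case False
 then have "q powi m = inverse (q ^ nat (- m))" by (simp add: power_int_def power_inverse)
 then show ?thesis using False q_pow_eq_1_iff[of "nat (- m)"] by (simp add: int_dvd_int_iff[symmetric] del: int_dvd_int_iff)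
qed

lemma q_powi_eq_iff: "q powi a = q powi b \<longleftrightarrow> int N dvd a - b"
 using q_powi_eq_1_iff[of "a - b"] by (simp add: power_int_diff)

lemma q_powi_n_eq_iff: "q powi (int n * a) = q powi (int n * b) \<longleftrightarrow> int n dvd a - b"
proof -
 have "int N = int n * int n" by (simp add: power2_eq_square)
 then show ?thesis unfolding q_powi_eq_iff using n_pos by (simp add: right_diff_distrib[symmetric])
qed

sublocale qu: qu_relations A \<eta> n q "qu_gen_class n q"
 by (rule qu_relations_qu[OF n_pos])

lemma gens_closed [simp]: "\<kappa> \<in> carrier A" "\<kappa>h \<in> carrier A" "E \<in> carrier A" "F \<in> carrier A"
 using qu.gen_closed[of Kappa] qu.gen_closed[of Kappa_hat] qu.gen_closed[of Gen_E] qu.gen_closed[of Gen_F] by simp_all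

lemmas rels = qu.kappa_pow qu.kappa_hat_pow qu.kappa_comm qu.kappa_E qu.kappa_F qu.kappa_hat_E
 qu.kappa_hat_F qu.E_pow qu.F_pow qu.FE

lemma kappa_Units: "\<kappa> \<in> Units A" and kappa_inv: "\<kappa>i = \<kappa> \<up> (n - 1)"
proof -
 let ?y = "\<kappa> \<up> (n - 1)"
 have y: "?y \<in> carrier A" by (rule qu.nat_pow_closed) simp
 have "Suc (n - 1) = n" using n_pos by simp
 then have l: "?y \<cdot> \<kappa> = \<one>\<^bsub>A\<^esub>" and r: "\<kappa> \<cdot> ?y = \<one>\<^bsub>A\<^esub>"
  using qu.kappa_pow qu.nat_pow_Suc[of \<kappa> "n - 1"] qu.nat_pow_Suc2[OF gens_closed(1), of "n - 1"] by simp_all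
 show "\<kappa> \<in> Units A" unfolding Units_def using l r y by auto
 show "\<kappa>i = ?y" using qu.inv_unique'[OF gens_closed(1) y r l] by simp
qed

lemma kappa_inv_closed [simp]: "\<kappa>i \<in> carrier A" using kappa_Units by simp

lemma kappa_inv_cancel [simp]: "\<kappa> \<cdot> \<kappa>i = \<one>\<^bsub>A\<^esub>" "\<kappa>i \<cdot> \<kappa> = \<one>\<^bsub>A\<^esub>"
 using kappa_Units by simp_all

end

locale qmod = qparam n q + kmod "qu n q" "qu_unit n q" M
 for n :: nat and q :: "'k::field_char_0" and M :: "('k free_qu set, 'm) module" (structure)
begin

definition "opk x = \<kappa> \<odot> x"
definition "opki x = \<kappa>i \<odot> x"
definition "opkh x = \<kappa>h \<odot> x"
definition "opE x = E \<odot> x"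
definition "opF x = F \<odot> x"
definition "opK x = K \<odot> x"

lemmas op_defs = opk_def opki_def opkh_def opE_def opF_def opK_def

lemma op_closed [simp]:
 assumes "x \<in> carrier M"
 shows "opk x \<in> carrier M" "opki x \<in> carrier M" "opkh x \<in> carrier M" "opE x \<in> carrier M"
  "opF x \<in> carrier M" "opK x \<in> carrier M" using assms by (simp_all add: op_defs)

lemma op_add:
 assumes "x \<in> carrier M" "y \<in> carrier M"
 shows "opk (x \<oplus> y) = opk x \<oplus> opk y" "opki (x \<oplus> y) = opki x \<oplus> opki y"
  "opkh (x \<oplus> y) = opkh x \<oplus> opkh y" "opE (x \<oplus> y) = opE x \<oplus> opE y"
  "opF (x \<oplus> y) = opF x \<oplus> opF y" "opK (x \<oplus> y) = opK x \<oplus> opK y"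
 using assms by (simp_all add: op_defs act_r_distr)

lemma op_sc:
 assumes "x \<in> carrier M"
 shows "opk (sc c x) = sc c (opk x)" "opki (sc c x) = sc c (opki x)" "opkh (sc c x) = sc c (opkh x)"
  "opE (sc c x) = sc c (opE x)" "opF (sc c x) = sc c (opF x)" "opK (sc c x) = sc c (opK x)"
 using assms by (simp_all add: op_defs act_sc)

lemma op_zero [simp]: "opk \<zero> = \<zero>" "opki \<zero> = \<zero>" "opkh \<zero> = \<zero>" "opE \<zero> = \<zero>"
  "opF \<zero> = \<zero>" "opK \<zero> = \<zero>" by (simp_all add: op_defs)

lemma opki_cancel [simp]: assumes "x \<in> carrier M" shows "opk (opki x) = x" "opki (opk x) = x"
 using assms by (simp_all add: op_defs act_assoc[symmetric])

lemma opK_altdef: "x \<in> carrier M ==> opK x = opki (opkh x)" by (simp add: op_defs act_assoc)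

lemma opk_opK: "x \<in> carrier M ==> opk (opK x) = opkh x" by (simp add: opK_altdef)

lemma opk_opkh: assumes "x \<in> carrier M" shows "opk (opkh x) = opkh (opk x)"
 using qu.kappa_comm assms by (simp add: op_defs act_assoc[symmetric])

lemma opk_opE: assumes "x \<in> carrier M" shows "opk (opE x) = sc (q ^ n) (opE (opk x))"
 using arg_cong[OF qu.kappa_E, of "\<lambda>a. a \<odot> x"] assms by (simp add: op_defs act_assoc sc_def)

lemma opk_opF: assumes "x \<in> carrier M" shows "opk (opF x) = sc (inverse (q ^ n)) (opF (opk x))"
 using arg_cong[OF qu.kappa_F, of "\<lambda>a. a \<odot> x"] assms by (simp add: op_defs act_assoc sc_def)

lemma opkh_opE: assumes "x \<in> carrier M" shows "opkh (opE x) = sc (q ^ n * inverse (q ^ 2)) (opE (opkh x))"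
 using arg_cong[OF qu.kappa_hat_E, of "\<lambda>a. a \<odot> x"] assms by (simp add: op_defs act_assoc sc_def)

lemma opkh_opF: assumes "x \<in> carrier M" shows "opkh (opF x) = sc (inverse (q ^ n) * q ^ 2) (opF (opkh x))"
 using arg_cong[OF qu.kappa_hat_F, of "\<lambda>a. a \<odot> x"] assms by (simp add: op_defs act_assoc sc_def)

lemma opk_inj: "[|opk x = opk y; x \<in> carrier M; y \<in> carrier M|] ==> x = y"
 using opki_cancel by metis

lemma opki_opE: assumes "x \<in> carrier M" shows "opki (opE x) = sc (inverse (q ^ n)) (opE (opki x))"
 by (rule opk_inj) (use assms in \<open>simp_all add: op_sc opk_opE\<close>)

lemma opki_opF: assumes "x \<in> carrier M" shows "opki (opF x) = sc (q ^ n) (opF (opki x))"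
 by (rule opk_inj) (use assms in \<open>simp_all add: op_sc opk_opF\<close>)

lemma opK_opE: assumes "x \<in> carrier M" shows "opK (opE x) = sc (inverse (q ^ 2)) (opE (opK x))"
 using assms by (simp add: opK_altdef opkh_opE op_sc opki_opE field_simps)

lemma opK_opF: assumes "x \<in> carrier M" shows "opK (opF x) = sc (q ^ 2) (opF (opK x))"
 using assms by (simp add: opK_altdef opkh_opF op_sc opki_opF field_simps)

lemma opF_opE: assumes x: "x \<in> carrier M"
 shows "opF (opE x) = sc (inverse q) (opE (opF x)) \<oplus> (x \<oplus> sc (-1) (opK x))"
proof -
 have K: "\<one>\<^bsub>A\<^esub> \<ominus>\<^bsub>A\<^esub> K = \<one>\<^bsub>A\<^esub> \<oplus>\<^bsub>A\<^esub> \<eta> (-1) \<cdot> K"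
 proof -
  interpret R: kmod A \<eta> qu.regm by (rule qu.regular_kmod)
  have "\<ominus>\<^bsub>qu.regm\<^esub> K = \<ominus>\<^bsub>A\<^esub> K"
   by (simp add: a_inv_def m_inv_def regular_module_def)
  then show ?thesis using R.sc_minus_one[of K] by (simp add: R.sc_def a_minus_def)
 qed
 show ?thesis using arg_cong[OF qu.FE, of "\<lambda>a. a \<odot> x"] x unfolding kappa_inv[symmetric] qu_gen_class.simps K
  by (simp add: op_defs act_assoc act_l_distr sc_def)
qed

lemma pow_act: assumes "a \<in> carrier A" "x \<in> carrier M"
 shows "(a \<up> (r::nat)) \<odot> x = ((\<lambda>y. a \<odot> y) ^^ r) x" using assms(2)
proof (induction r arbitrary: x)
 case (Suc r) then show ?case using assms(1) by (simp add: act_assoc funpow_swap1)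
qed simp

lemma opE_fun: "opE = (\<lambda>x. E \<odot> x)" and opF_fun: "opF = (\<lambda>x. F \<odot> x)" by (auto simp: op_defs)

lemma opE_pow_N: "x \<in> carrier M ==> (opE ^^ N) x = \<zero>"
 using pow_act[of E x N] qu.E_pow by (simp add: opE_fun)

lemma opF_pow_N: "x \<in> carrier M ==> (opF ^^ N) x = \<zero>"
 using pow_act[of F x N] qu.F_pow by (simp add: opF_fun)

lemma funpow_closed [simp]: "x \<in> carrier M ==> (opE ^^ r) x \<in> carrier M"
  "x \<in> carrier M ==> (opF ^^ r) x \<in> carrier M" "x \<in> carrier M ==> (opK ^^ r) x \<in> carrier M"
 by (induction r) auto

lemma funpow_sc: "x \<in> carrier M ==> (opE ^^ r) (sc c x) = sc c ((opE ^^ r) x)"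
  "x \<in> carrier M ==> (opF ^^ r) (sc c x) = sc c ((opF ^^ r) x)" by (induction r) (auto simp: op_sc)

lemma funpow_zero [simp]: "(opE ^^ r) \<zero> = \<zero>" "(opF ^^ r) \<zero> = \<zero>" by (induction r) auto

lemma funpow_add: assumes "x \<in> carrier M" "y \<in> carrier M"
 shows "(opE ^^ r) (x \<oplus> y) = (opE ^^ r) x \<oplus> (opE ^^ r) y"
  "(opF ^^ r) (x \<oplus> y) = (opF ^^ r) x \<oplus> (opF ^^ r) y"
 by (induction r) (use assms in \<open>auto simp: op_add\<close>)

text \<open>The eigenvalue fixes the exponent a modulo n only. The integer is nevertheless kept as a
  parameter, because the rescaling of tensors below depends on its quotient by n.\<close>

definition kev :: "int => 'm => bool" where
 "kev a x \<longleftrightarrow> x \<in> carrier M \<and> opk x = sc (q powi (int n * a)) x"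

lemma kev_closed [dest]: "kev a x ==> x \<in> carrier M" by (simp add: kev_def)

lemma kev_opE: "kev a x ==> kev (a + 1) (opE x)"
 by (auto simp: kev_def opk_opE op_sc distrib_left power_int_add mult.commute)

lemma kev_opF: "kev a x ==> kev (a - 1) (opF x)"
 by (auto simp: kev_def opk_opF op_sc right_diff_distrib power_int_diff field_simps)

lemma kev_opK: assumes "kev a x" shows "kev a (opK x)"
proof -
 have "opk (opK x) = opK (opk x)" using assms by (auto simp: opk_opK opK_altdef opk_opkh[symmetric])
 with assms show ?thesis by (auto simp: kev_def op_sc)
qed

lemma kev_opki: "kev a x ==> opki x = sc (q powi (- int n * a)) x"
 by (rule opk_inj) (auto simp: kev_def op_sc power_int_minus)

lemma kev_opk: "kev a x ==> kev a (opk x)" by (auto simp: kev_def op_sc)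

lemma kev_opkh: "kev a x ==> kev a (opkh x)" using kev_opk[OF kev_opK, of a x] by (auto simp: opk_opK)

lemma idem_act:
 assumes "kev a x" "i < n"
 shows "qu_idem n q i \<odot> x = (if a mod int n = int i then x else \<zero>)"
proof -
 have eq: "qu_idem n q i = qu.proj n \<kappa> ((q ^ n) ^ (n - i))" by (simp add: qu_idem_def qu.proj_def qu_scale_def)
 \<comment> \<open>The constant in \<open>1_i\<close> is the inverse of the eigenvalue that is
   selected.\<close>
 have c: "(q ^ n) ^ (n - i) = q powi (int n * - int i)"
 proof -
  have "(q ^ n) ^ (n - i) = q powi (int n * int (n - i))" by (simp add: power_int_def nat_mult_distrib power_mult)
  also have "... = q powi (int n * - int i)" unfolding q_powi_n_eq_iff using assms(2) by (simp add: of_nat_diff)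
  finally show ?thesis .
 qed
 have pw: "(q powi (int n * b)) ^ n = 1" for b
 proof -
  have "(q powi (int n * b)) ^ n = q powi (int n * (b * int n))" by (metis mult.assoc power_int_mult power_int_of_nat)
  then show ?thesis using q_powi_n_eq_iff[of "b * int n" 0] by simp
 qed
 have "q powi (int n * a) * q powi (int n * - int i) = 1 \<longleftrightarrow> int n dvd a - int i"
  using q_powi_n_eq_iff[of "a - int i" 0] by (simp add: right_diff_distrib power_int_diff power_int_minus divide_inverse)
 also have "... \<longleftrightarrow> a mod int n = int i"
  using assms(2) by (metis mod_eq_dvd_iff of_nat_0_le_iff of_nat_less_iff mod_pos_pos_trivial)
 finally show ?thesis unfolding eq using assms n_pos
  by (subst proj_act[where a = "q powi (int n * a)"]) (auto simp: kev_def opk_def c pw pw[of "- int i", simplified])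
qed

end

section \<open>The action of the comultiplication on tensors of eigenvectors\<close>

text \<open>The Gauss binomial coefficient in the variable c, by its Pascal rule.\<close>

fun gbinom :: "'k::field => nat => nat => 'k" where
 "gbinom c 0 i = (if i = 0 then 1 else 0)"
| "gbinom c (Suc r) 0 = 1"
| "gbinom c (Suc r) (Suc i) = c ^ (r - i) * gbinom c r i + gbinom c r (Suc i)"

lemma gbinom_zero [simp]: "r < i ==> gbinom c r i = 0" by (induction c r i rule: gbinom.induct) auto

lemma gbinom_zero_right [simp]: "gbinom c r 0 = 1" by (cases r) auto

text \<open>The quotient of neighbouring coefficients, in product form since at a root of unity
  \<open>1 - c^(i+1)\<close> may vanish.\<close>

lemma gbinom_ratio: "i \<le> r ==> (1 - c ^ Suc i) * gbinom c r (Suc i) = (1 - c ^ (r - i)) * gbinom c r i"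
proof (induction r arbitrary: i)
 case (Suc r)
 show ?case
 proof (cases "i = Suc r")
  case False
  then have i: "i \<le> r" using Suc by simp
  have L: "(1 - c ^ Suc i) * gbinom c (Suc r) (Suc i) = (1 - c ^ Suc r) * gbinom c r i"
  proof -
   have "(1 - c ^ Suc i) * gbinom c (Suc r) (Suc i)
     = (1 - c ^ Suc i) * c ^ (r - i) * gbinom c r i + (1 - c ^ (r - i)) * gbinom c r i"
    unfolding Suc.IH[OF i, symmetric] by (simp add: distrib_left mult.assoc del: power_Suc)
   also have "... = (1 - c ^ (Suc i + (r - i))) * gbinom c r i" unfolding power_add by (simp add: algebra_simps)
   finally show ?thesis using i by simp
  qed
  show ?thesis
  proof (cases i)
   case (Suc i')
   have i': "i' \<le> r" "r - i' + i = Suc r" using Suc i by auto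
   have "(1 - c ^ (r - i')) * gbinom c (Suc r) i
     = c ^ (r - i') * ((1 - c ^ (r - i')) * gbinom c r i') + (1 - c ^ (r - i')) * gbinom c r i"
    unfolding Suc by (simp add: algebra_simps)
   also have "... = c ^ (r - i') * ((1 - c ^ i) * gbinom c r i) + (1 - c ^ (r - i')) * gbinom c r i"
    using Suc.IH[OF i'(1)] Suc by simp
   also have "... = (1 - c ^ (r - i' + i)) * gbinom c r i" unfolding power_add by (simp add: algebra_simps)
   finally show ?thesis using L Suc i'(2) by simp
  qed (use L in simp)
 qed simp
qed simp

text \<open>One Pascal step applied to the ratio formula produces the factor \<open>1 - c^m\<close>.
  The vanishing of the inner coefficients is what makes the m-th power of a q-commuting sum
  additive.\<close>

lemma gbinom_root:
 assumes "c ^ m = 1" "c ^ Suc i \<noteq> 1" "Suc i < m"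
 shows "gbinom c m (Suc i) = 0"
proof -
 obtain r where r: "m = Suc r" using assms by (cases m) auto
 have i: "i \<le> r" using assms r by simp
 have "(1 - c ^ Suc i) * gbinom c (Suc r) (Suc i)
   = (1 - c ^ Suc i) * c ^ (r - i) * gbinom c r i + (1 - c ^ (r - i)) * gbinom c r i"
  unfolding gbinom_ratio[OF i, symmetric] by (simp add: distrib_left mult.assoc del: power_Suc)
 also have "... = (1 - c ^ (Suc i + (r - i))) * gbinom c r i" unfolding power_add by (simp add: algebra_simps)
 also have "... = 0" using assms(1) r i by simp
 finally show ?thesis using assms(2) r by simp
qed

text \<open>The q-binomial theorem for an operator: \<open>V r i\<close> plays the role of
  \<open>X^i Y^(r-i)\<close> applied to a start vector, and T the role of \<open>X + Y\<close>. Only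
  the effect of T on these vectors is required, so X and Y need not exist as operators.\<close>

lemma (in kmod) q_binomial:
 assumes V: "\<And>r i. V r i \<in> carrier M"
  and closed: "\<And>x. x \<in> carrier M ==> T x \<in> carrier M"
  and add: "\<And>x y. [|x \<in> carrier M; y \<in> carrier M|] ==> T (x \<oplus>\<^bsub>M\<^esub> y) = T x \<oplus>\<^bsub>M\<^esub> T y"
  and sc: "\<And>c x. x \<in> carrier M ==> T (sc c x) = sc c (T x)"
  and step: "\<And>r i. i \<le> r ==> T (V r i) = sc (x * c ^ (r - i)) (V (Suc r) (Suc i)) \<oplus>\<^bsub>M\<^esub> V (Suc r) i"
 shows "(T ^^ r) (V 0 0) = lc {..r} (V r) (\<lambda>i. x ^ i * gbinom c r i)"
proof (induction r)
 case 0
 have "lc {..0} (V 0) (\<lambda>i. x ^ i * gbinom c 0 i) = lc {0} (V 0) (\<lambda>i. if i = 0 then 1 else 0)"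
  using V by (auto intro!: lc_cong)
 then show ?case using V by (subst (asm) lc_single) auto
next
 case (Suc r)
 have T_zero: "T \<zero>\<^bsub>M\<^esub> = \<zero>\<^bsub>M\<^esub>" using sc[of "\<zero>\<^bsub>M\<^esub>" 0] closed by simp
 have T_lc: "T (lc I b d) = lc I (\<lambda>i. T (b i)) d" if "finite I" "\<And>i. b i \<in> carrier M" for I d and b :: "nat => 'm"
  using that(1)
 proof (induction I rule: finite_induct)
  case (insert i I)
  then show ?case using that closed by (subst (1 2) lc_insert) (auto simp: add sc)
 qed (simp add: T_zero)
 let ?a = "\<lambda>j i. if j = Suc i then x * c ^ (r - i) else if j = i then 1 else 0"
 have TV: "T (V r i) = lc {..Suc r} (V (Suc r)) (\<lambda>j. ?a j i)" if "i \<in> {..r}" for i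
 proof -
  have "lc {..Suc r} (V (Suc r)) (\<lambda>j. ?a j i)
   = lc {..Suc r} (V (Suc r)) (\<lambda>j. (if j = Suc i then x * c ^ (r - i) else 0) + (if j = i then 1 else 0))"
   using V by (intro lc_cong) auto
  also have "... = sc (x * c ^ (r - i)) (V (Suc r) (Suc i)) \<oplus>\<^bsub>M\<^esub> V (Suc r) i"
   using V that by (subst lc_add, simp, simp, subst (1 2) lc_single) auto
  finally show ?thesis using step that by simp
 qed
 have "(T ^^ Suc r) (V 0 0) = lc {..r} (\<lambda>i. T (V r i)) (\<lambda>i. x ^ i * gbinom c r i)"
  using Suc V by (simp add: T_lc)
 also have "... = lc {..Suc r} (V (Suc r)) (\<lambda>j. \<Sum>i\<in>{..r}. ?a j i * (x ^ i * gbinom c r i))"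
  by (rule lc_matrix) (use V TV in auto)
 also have "... = lc {..Suc r} (V (Suc r)) (\<lambda>i. x ^ i * gbinom c (Suc r) i)"
 proof (rule lc_cong)
  fix j assume j: "j \<in> {..Suc r}"
  have "(\<Sum>i\<in>{..r}. ?a j i * (x ^ i * gbinom c r i))
   = (\<Sum>i\<in>{..r}. (if i = j then x ^ i * gbinom c r i else 0))
    + (\<Sum>i\<in>{..r}. (if Suc i = j then x * c ^ (r - i) * (x ^ i * gbinom c r i) else 0))"
   unfolding sum.distrib[symmetric] by (rule sum.cong) auto
  also have "(\<Sum>i\<in>{..r}. (if i = j then x ^ i * gbinom c r i else 0)) = x ^ j * gbinom c r j"
   using j by (cases "j = Suc r") (auto simp: sum.delta)
  also have "x ^ j * gbinom c r j + (\<Sum>i\<in>{..r}. (if Suc i = j then x * c ^ (r - i) * (x ^ i * gbinom c r i) else 0))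
    = x ^ j * gbinom c (Suc r) j"
   using j by (cases j) (auto simp: sum.delta algebra_simps)
  finally show "(\<Sum>i\<in>{..r}. ?a j i * (x ^ i * gbinom c r i)) = x ^ j * gbinom c (Suc r) j" .
 qed (use V in auto)
 finally show ?case .
qed

lemma (in kmod) q_binomial_root:
 assumes V: "\<And>r i. V r i \<in> carrier M"
  and closed: "\<And>x. x \<in> carrier M ==> T x \<in> carrier M"
  and add: "\<And>x y. [|x \<in> carrier M; y \<in> carrier M|] ==> T (x \<oplus>\<^bsub>M\<^esub> y) = T x \<oplus>\<^bsub>M\<^esub> T y"
  and sc: "\<And>c x. x \<in> carrier M ==> T (sc c x) = sc c (T x)"
  and step: "\<And>r i. i \<le> r ==> T (V r i) = sc (x * c ^ (r - i)) (V (Suc r) (Suc i)) \<oplus>\<^bsub>M\<^esub> V (Suc r) i"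
  and c: "c ^ m = 1" "\<And>i. [|0 < i; i < m|] ==> c ^ i \<noteq> 1"
  and ends: "V m 0 = \<zero>\<^bsub>M\<^esub>" "V m m = \<zero>\<^bsub>M\<^esub>"
 shows "(T ^^ m) (V 0 0) = \<zero>\<^bsub>M\<^esub>"
proof -
 have "finsum M (\<lambda>i. sc (x ^ i * gbinom c m i) (V m i)) {..m} = finsum M (\<lambda>i. \<zero>\<^bsub>M\<^esub>) {..m}"
 proof (rule M.finsum_cong')
  fix i assume i: "i \<in> {..m}"
  consider "i = 0" | "i = m" | j where "i = Suc j" "Suc j < m" using i by (cases i) fastforce+
  then show "sc (x ^ i * gbinom c m i) (V m i) = \<zero>\<^bsub>M\<^esub>"
   by cases (use ends c gbinom_root[of c m] V in \<open>auto simp del: power_Suc\<close>)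
 qed auto
 then have "(T ^^ m) (V 0 0) = finsum M (\<lambda>i. \<zero>\<^bsub>M\<^esub>) {..m}"
  using q_binomial[OF V closed add sc step, of m] unfolding lc_def by simp
 then show ?thesis by simp
qed

declare tensor_module_simps [simp del] tensor_algebra_simps [simp del]

text \<open>Before the comultiplication is known to exist, the tensor product needs some module
  structure that provides its addition and scalars. The action on the left factor serves this
  purpose while the candidates \<open>dE\<close> and \<open>dF\<close> are studied.\<close>

lemma (in kalg) left_factor_hom: "(\<lambda>a. reg_tensor \<eta> A a \<one>) \<in> ring_hom A (tensor_algebra \<eta> A)"
proof -
 interpret RR: tens A \<eta> regm regm by (intro tens.intro regular_kmod)
 show ?thesis by (rule ring_hom_memI) (auto simp: tensor_algebra_simps RR.pt_closed RR.pt_add_left[simplified])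
qed

section \<open>The candidates for the comultiplication and the idempotents of \<kappa>\<close>

context qparam
begin

definition "dK = reg_tensor \<eta> A \<kappa> \<kappa>"
definition "dKh = reg_tensor \<eta> A \<kappa>h \<kappa>h"
definition "dE = reg_tensor \<eta> A E (inv\<^bsub>A\<^esub> (qu_flat n q))
 \<oplus>\<^bsub>tensor_algebra \<eta> A\<^esub> reg_tensor \<eta> A \<kappa>i (qu_idem n q 0 \<cdot> E)
 \<oplus>\<^bsub>tensor_algebra \<eta> A\<^esub> reg_tensor \<eta> A \<one>\<^bsub>A\<^esub> (\<Oplus>\<^bsub>A\<^esub> i\<in>{1..n-1}. qu_idem n q i \<cdot> E)"
definition "dF = reg_tensor \<eta> A F (qu_flat n q)
 \<oplus>\<^bsub>tensor_algebra \<eta> A\<^esub> reg_tensor \<eta> A K (F \<cdot> (\<Oplus>\<^bsub>A\<^esub> i\<in>{1..n-1}. qu_idem n q i))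
 \<oplus>\<^bsub>tensor_algebra \<eta> A\<^esub> reg_tensor \<eta> A \<kappa>h (F \<cdot> qu_idem n q 0)"

lemma idem_proj: "qu_idem n q i = qu.proj n \<kappa> ((q ^ n) ^ (n - i))" by (simp add: qu_idem_def qu.proj_def qu_scale_def)

lemma idem_closed [simp]: "qu_idem n q i \<in> carrier A" by (simp add: idem_proj)

lemma idem_sum_closed [simp]: "(\<Oplus>\<^bsub>A\<^esub> i\<in>I. qu_idem n q i) \<in> carrier A"
 "(\<Oplus>\<^bsub>A\<^esub> i\<in>I. qu_idem n q i \<cdot> E) \<in> carrier A" by (intro qu.finsum_closed; auto)+

lemma flat_closed [simp]: "qu_flat n q \<in> carrier A" unfolding qu_flat_def qu_scale_def by (intro qu.finsum_closed) auto

lemma qn_pow: "(q ^ n) ^ r = 1 \<longleftrightarrow> n dvd r"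
 using q_pow_eq_1_iff[of "n * r"] n_pos by (simp add: power_mult power2_eq_square)

lemma qn_pow_n: "((q ^ n) ^ r) ^ n = 1" using qn_pow[of "r * n"] by (simp flip: power_mult add: mult.assoc)

lemma sum_idem: "(\<Oplus>\<^bsub>A\<^esub> i\<in>{..<n}. qu_idem n q i) = \<one>\<^bsub>A\<^esub>"
proof -
 have "(\<Sum>i<n. ((q ^ n) ^ (n - i)) ^ r) = (if r = 0 then of_nat n else 0)" if r: "r < n" for r
 proof (cases "r = 0")
  case False
  have "(\<Sum>i<n. ((q ^ n) ^ (n - i)) ^ r) = (\<Sum>i<n. ((q ^ n) ^ Suc i) ^ r)"
   by (subst sum.nat_diff_reindex[symmetric]) (auto intro!: sum.cong)
  also have "... = (\<Sum>i<n. (q ^ n) ^ r * ((q ^ n) ^ r) ^ i)"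
   by (intro sum.cong refl) (simp flip: power_mult power_add add: algebra_simps)
  also have "... = (q ^ n) ^ r * (\<Sum>i<n. ((q ^ n) ^ r) ^ i)" by (simp add: sum_distrib_left)
  also have "(\<Sum>i<n. ((q ^ n) ^ r) ^ i) = 0"
  proof (rule geometric_sum_root)
   show "((q ^ n) ^ r) ^ n = 1" by (rule qn_pow_n)
   show "(q ^ n) ^ r \<noteq> 1" unfolding qn_pow using r False by (auto dest: dvd_imp_le)
  qed
  finally show ?thesis using False by simp
 qed simp
 then show ?thesis unfolding idem_proj using n_pos by (intro qu.proj_complete) auto
qed

sublocale R: qmod n q "regular_module A"
 by (intro qmod.intro qparam_axioms qu.regular_kmod)

lemma kev_idem: assumes "i < n" shows "R.kev (int i) (qu_idem n q i)"
proof -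
 let ?c = "(q ^ n) ^ (n - i)"
 have "inverse ?c = q powi (int n * int i)"
 proof -
  have "q powi (int n * int i) = q ^ (n * i)" by (simp flip: of_nat_mult)
  moreover have "?c * q ^ (n * i) = q ^ (n * (n - i + i))" by (simp only: distrib_left power_add power_mult)
  moreover have "... = 1" using assms q_pow_N by (simp add: power2_eq_square)
  ultimately show ?thesis by (metis inverse_unique)
 qed
 moreover have "\<kappa> \<cdot> qu_idem n q i = \<eta> (inverse ?c) \<cdot> qu_idem n q i"
  unfolding idem_proj by (rule qu.proj_eigen) (use qu.kappa_pow qn_pow_n in auto)
 ultimately show ?thesis by (simp add: R.kev_def R.opk_def R.sc_def)
qed

text \<open>The unit is the sum of the \<open>1_i\<close>, which are \<kappa>-eigenvectors, so an
  element is determined by left multiplication on such vectors.\<close>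

lemma A_eqI:
 assumes "a \<in> carrier A" "b \<in> carrier A" "\<And>c x. R.kev c x ==> a \<cdot> x = b \<cdot> x"
 shows "a = b"
proof -
 have *: "u = (\<Oplus>\<^bsub>A\<^esub> i\<in>{..<n}. u \<cdot> qu_idem n q i)" if "u \<in> carrier A" for u
  using sum_idem qu.finsum_rdistr[of "{..<n}" u "qu_idem n q"] that by auto
 have "(\<Oplus>\<^bsub>A\<^esub> i\<in>{..<n}. a \<cdot> qu_idem n q i) = (\<Oplus>\<^bsub>A\<^esub> i\<in>{..<n}. b \<cdot> qu_idem n q i)"
  using assms kev_idem by (intro qu.finsum_cong') auto
 then show ?thesis using * assms by simp
qed

end

context qmod
begin

lemma scaled_idem_sum_act:
 assumes v: "kev a x"
 shows "(\<Oplus>\<^bsub>A\<^esub> i\<in>{..<n}. \<eta> (c i) \<cdot> qu_idem n q i) \<odot> x = sc (c (nat (a mod int n))) x"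
proof -
 let ?i = "nat (a mod int n)"
 have i: "?i \<in> {..<n}" "a mod int n = int ?i" using n_pos by (auto simp: nat_less_iff)
 have x: "x \<in> carrier M" using v by auto
 have "(\<Oplus>\<^bsub>A\<^esub> i\<in>{..<n}. \<eta> (c i) \<cdot> qu_idem n q i) \<odot> x
   = finsum M (\<lambda>i. (\<eta> (c i) \<cdot> qu_idem n q i) \<odot> x) {..<n}"
  using x by (intro act_finsum_left) auto
 also have "... = finsum M (\<lambda>i. if ?i = i then sc (c i) x else \<zero>) {..<n}"
  using x i by (intro M.finsum_cong') (auto simp: unit_act idem_act[OF v])
 also have "... = sc (c ?i) x" using x i by (intro M.finsum_singleton) auto
 finally show ?thesis .
qed

lemma flat_act: assumes "kev a x" shows "qu_flat n q \<odot> x = sc (q powi (- (a mod int n))) x"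
proof -
 have "inverse q ^ nat (a mod int n) = q powi (- (a mod int n))"
  using n_pos by (simp add: power_int_def power_int_minus power_inverse)
 then show ?thesis
  unfolding qu_flat_def qu_scale_def using scaled_idem_sum_act[OF assms, of "\<lambda>i. inverse q ^ i"] by simp
qed

lemma idem_tail_act: assumes v: "kev a x"
 shows "(\<Oplus>\<^bsub>A\<^esub> i\<in>{1..n-1}. qu_idem n q i) \<odot> x = (if a mod int n = 0 then \<zero> else x)"
proof -
 have x: "x \<in> carrier M" using v by auto
 have *: "(\<Oplus>\<^bsub>A\<^esub> i\<in>{1..n-1}. qu_idem n q i) = (\<Oplus>\<^bsub>A\<^esub> i\<in>{..<n}. \<eta> (if i = 0 then 0 else 1) \<cdot> qu_idem n q i)"
  by (intro qu.add.finprod_mono_neutral_cong_left) (auto simp: R.unit_zero qu.unit_one)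
 have "nat (a mod int n) = 0 \<longleftrightarrow> a mod int n = 0" using n_pos by (simp add: nat_eq_iff)
 then show ?thesis unfolding * scaled_idem_sum_act[OF v] using x by auto
qed

lemma idem_tail_E_act: assumes v: "kev a x"
 shows "(\<Oplus>\<^bsub>A\<^esub> i\<in>{1..n-1}. qu_idem n q i \<cdot> E) \<odot> x = (if (a + 1) mod int n = 0 then \<zero> else opE x)"
proof -
 have x: "x \<in> carrier M" using v by auto
 have "(\<Oplus>\<^bsub>A\<^esub> i\<in>{1..n-1}. qu_idem n q i \<cdot> E) = (\<Oplus>\<^bsub>A\<^esub> i\<in>{1..n-1}. qu_idem n q i) \<cdot> E"
  by (rule qu.finsum_ldistr[symmetric]) auto
 then show ?thesis using idem_tail_act[OF kev_opE[OF v]] x by (simp add: act_assoc opE_def)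
qed

end

context qparam
begin

text \<open>The inverse is the sum of the \<open>q^i 1_i\<close>. Both products are tested on
  eigenvectors, where each factor is a scalar.\<close>

lemma flat_Units: "qu_flat n q \<in> Units A"
proof -
 let ?f = "\<Oplus>\<^bsub>A\<^esub> i\<in>{..<n}. \<eta> (q ^ i) \<cdot> qu_idem n q i"
 have f: "?f \<in> carrier A" by (intro qu.finsum_closed) auto
 have f_act: "?f \<cdot> x = \<eta> (q powi (a mod int n)) \<cdot> x" if "R.kev a x" for a x
  using R.scaled_idem_sum_act[OF that, of "\<lambda>i. q ^ i"] n_pos by (simp add: R.sc_def power_int_def)
 have flat: "qu_flat n q \<cdot> x = \<eta> (q powi (- (a mod int n))) \<cdot> x" if "R.kev a x" for a x
  using R.flat_act[OF that] by (simp add: R.sc_def)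
 have "qu_flat n q \<cdot> ?f = \<one>\<^bsub>A\<^esub>" "?f \<cdot> qu_flat n q = \<one>\<^bsub>A\<^esub>"
 proof (rule_tac [!] A_eqI)
  fix c x assume k: "R.kev c x"
  then have x: "x \<in> carrier A" by (auto dest: R.kev_closed)
  show "qu_flat n q \<cdot> ?f \<cdot> x = \<one>\<^bsub>A\<^esub> \<cdot> x" "?f \<cdot> qu_flat n q \<cdot> x = \<one>\<^bsub>A\<^esub> \<cdot> x"
   using x f k by (simp_all add: qu.m_assoc f_act flat qu.unit_left_comm[OF flat_closed x]
     qu.unit_left_comm[OF f x] qu.unit_mult_left power_int_minus qu.unit_one)
 qed (use f in auto)
 then show ?thesis unfolding Units_def using f by auto
qed

lemma flat_inv_closed [simp]: "inv\<^bsub>A\<^esub> (qu_flat n q) \<in> carrier A" using flat_Units by simp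

end

lemma (in qmod) flat_inv_act: assumes "kev a x"
 shows "inv\<^bsub>A\<^esub> (qu_flat n q) \<odot> x = sc (q powi (a mod int n)) x"
proof -
 have x: "x \<in> carrier M" using assms by auto
 have "x = inv\<^bsub>A\<^esub> (qu_flat n q) \<odot> (qu_flat n q \<odot> x)" using x flat_Units by (simp flip: act_assoc)
 also have "... = sc (q powi (- (a mod int n))) (inv\<^bsub>A\<^esub> (qu_flat n q) \<odot> x)"
  using x by (simp add: flat_act[OF assms] act_sc)
 finally have "sc (q powi (a mod int n)) x = sc (q powi (a mod int n)) (sc (q powi (- (a mod int n))) (inv\<^bsub>A\<^esub> (qu_flat n q) \<odot> x))"
  by simp
 then show ?thesis using x by (simp add: power_int_minus)
qed

context qparam
begin

sublocale QQ: kalg "tensor_algebra \<eta> A" "\<lambda>c. reg_tensor \<eta> A (\<eta> c) \<one>\<^bsub>A\<^esub>"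
 by (rule qu.tensor_algebra_kalg)

lemma reg_tensor_closed [simp]:
 assumes "a \<in> carrier A" "b \<in> carrier A" shows "reg_tensor \<eta> A a b \<in> carrier (tensor_algebra \<eta> A)"
proof -
 interpret RR: tens A \<eta> "regular_module A" "regular_module A" by (intro tens.intro qu.regular_kmod)
 show ?thesis using assms RR.pt_closed by (simp add: tensor_algebra_simps)
qed

lemma d_closed [simp]: "dK \<in> carrier (tensor_algebra \<eta> A)" "dKh \<in> carrier (tensor_algebra \<eta> A)"
 "dE \<in> carrier (tensor_algebra \<eta> A)" "dF \<in> carrier (tensor_algebra \<eta> A)"
 unfolding dK_def dKh_def dE_def dF_def by (intro QQ.a_closed reg_tensor_closed; simp)+

end

section \<open>Twisted tensors of \<kappa>-eigenvectors\<close>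

locale qtens = qparam n q + M: qmod n q M + L: qmod n q L + tens "qu n q" "qu_unit n q" M L
 for n :: nat and q :: "'k::field_char_0" and M :: "('k free_qu set, 'm) module" and L :: "('k free_qu set, 'l) module"
begin

sublocale T: tensmod A \<eta> M L "\<lambda>a. reg_tensor \<eta> A a \<one>\<^bsub>A\<^esub>"
 by (intro tensmod.intro tens_axioms tensmod_axioms.intro qu.left_factor_hom refl)

abbreviation "W \<equiv> T.W"
abbreviation "scW \<equiv> T.W.sc"
abbreviation "QQ \<equiv> tensor_algebra \<eta> A"

lemma ptW_closed [simp]: "[|x \<in> carrier M; y \<in> carrier L|] ==> pt x y \<in> carrier W"
 by (simp add: tensor_module_simps)

lemma tactW_closed [simp]: "[|t \<in> carrier QQ; x \<in> carrier W|] ==> tact t x \<in> carrier W"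
 by (simp add: tensor_module_simps tensor_algebra_simps)

lemma tactW_add: "[|t \<in> carrier QQ; x \<in> carrier W; y \<in> carrier W|] ==> tact t (x \<oplus>\<^bsub>W\<^esub> y) = tact t x \<oplus>\<^bsub>W\<^esub> tact t y"
 by (simp add: tensor_module_simps tensor_algebra_simps tact_add_right)

lemma tactW_sum: "[|t \<in> carrier QQ; t' \<in> carrier QQ; x \<in> carrier W|] ==> tact (t \<oplus>\<^bsub>QQ\<^esub> t') x = tact t x \<oplus>\<^bsub>W\<^esub> tact t' x"
 by (simp add: tensor_module_simps tensor_algebra_simps tact_add_left)

lemma tactW_mult: "[|t \<in> carrier QQ; t' \<in> carrier QQ; x \<in> carrier W|] ==> tact (t \<otimes>\<^bsub>QQ\<^esub> t') x = tact t (tact t' x)"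
 by (simp add: tensor_module_simps tensor_algebra_simps tact_assoc)

lemma scW_tact: "scW c x = tact (reg_tensor \<eta> A (\<eta> c) \<one>\<^bsub>A\<^esub>) x"
 by (simp add: T.W.sc_def tensor_module_simps)

lemma tactW_sc: assumes "t \<in> carrier QQ" "x \<in> carrier W" shows "tact t (scW c x) = scW c (tact t x)"
 using assms QQ.unit_central[OF assms(1), of c] unfolding scW_tact by (simp flip: tactW_mult)

lemma tactW_pt: "[|a \<in> carrier A; b \<in> carrier A; x \<in> carrier M; y \<in> carrier L|] ==>
 tact (reg_tensor \<eta> A a b) (pt x y) = pt (a \<odot>\<^bsub>M\<^esub> x) (b \<odot>\<^bsub>L\<^esub> y)"
 by (rule tact_pt)

lemma pt_sc_left: "[|x \<in> carrier M; y \<in> carrier L|] ==> pt (M.sc c x) y = scW c (pt x y)"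
 by (simp add: T.sc_pt)

lemma pt_sc_right: "[|x \<in> carrier M; y \<in> carrier L|] ==> pt x (L.sc c y) = scW c (pt x y)"
 by (simp add: pt_balanced T.sc_pt)

text \<open>For \<open>u\<close> and \<open>v\<close> with \<open>\<kappa>\<close>-eigenvalues \<open>q\<close> to the \<open>n * a\<close> and \<open>n * d\<close>, this rescaling of the pure
 tensor absorbs the carries of the exponents of the second factor modulo \<open>n\<close>.\<close>

definition tw :: "int => int => 'm => 'l => ('m \<times> 'l \<Rightarrow>\<^sub>0 'k) set" where
 "tw a d u v = scW (q powi (- (int n * a * (d div int n)))) (pt u v)"

lemma tw_closed [simp]: "[|u \<in> carrier M; v \<in> carrier L|] ==> tw a d u v \<in> carrier W"
 by (simp add: tw_def)

lemma tw_sc_left: "[|u \<in> carrier M; v \<in> carrier L|] ==> tw a d (M.sc c u) v = scW c (tw a d u v)"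
 by (simp add: tw_def pt_sc_left mult.commute)

lemma tw_sc_right: "[|u \<in> carrier M; v \<in> carrier L|] ==> tw a d u (L.sc c v) = scW c (tw a d u v)"
 by (simp add: tw_def pt_sc_right mult.commute)

lemma tw_add_left: "[|u \<in> carrier M; u' \<in> carrier M; v \<in> carrier L|] ==>
  tw a d (u \<oplus>\<^bsub>M\<^esub> u') v = tw a d u v \<oplus>\<^bsub>W\<^esub> tw a d u' v"
 by (simp add: tw_def T.pt_sum_left T.W.sc_add_right)

lemma tw_add_right: "[|u \<in> carrier M; v \<in> carrier L; v' \<in> carrier L|] ==>
  tw a d u (v \<oplus>\<^bsub>L\<^esub> v') = tw a d u v \<oplus>\<^bsub>W\<^esub> tw a d u v'"
 by (simp add: tw_def T.pt_sum_right T.W.sc_add_right)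

lemma tw_zero_left [simp]: "v \<in> carrier L ==> tw a d \<zero>\<^bsub>M\<^esub> v = \<zero>\<^bsub>W\<^esub>"
 by (simp add: tw_def T.pt_zero_left)

lemma tw_zero_right [simp]: "u \<in> carrier M ==> tw a d u \<zero>\<^bsub>L\<^esub> = \<zero>\<^bsub>W\<^esub>"
 by (simp add: tw_def T.pt_zero_right)

lemma dK_tw:
 assumes "u \<in> carrier M" "v \<in> carrier L"
 shows "tact dK (tw a d u v) = tw a d (M.opk u) (L.opk v)" "tact dKh (tw a d u v) = tw a d (M.opkh u) (L.opkh v)"
 using assms tactW_sc[OF d_closed(1)] tactW_sc[OF d_closed(2)]
 by (simp_all add: tw_def) (simp_all add: dK_def dKh_def tactW_pt M.opk_def L.opk_def M.opkh_def L.opkh_def)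

text \<open>The quotient by n changes exactly where \<open>1_0\<close> replaces the other
  idempotents in \<Delta>(E).\<close>

lemma carry_div:
 fixes d :: int shows "(d + 1) div int n = (if (d + 1) mod int n = 0 then d div int n + 1 else d div int n)"
proof -
 let ?k = "(d + 1) div int n" and ?r = "(d + 1) mod int n"
 have eq: "d + 1 = int n * ?k + ?r" and r: "0 \<le> ?r" "?r < int n" using n_pos by auto
 have "d div int n = ?k - 1" if "?r = 0"
  by (rule int_div_pos_eq[of _ _ _ "int n - 1"]) (use eq that n_pos in \<open>auto simp: algebra_simps\<close>)
 moreover have "d div int n = ?k" if "?r \<noteq> 0"
  by (rule int_div_pos_eq[of _ _ _ "?r - 1"]) (use eq that r in \<open>auto simp: algebra_simps\<close>)
 ultimately show ?thesis by auto
qed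

text \<open>The purpose of the rescaling: the distinction between \<open>1_0\<close> and the other
  idempotents disappears together with the factor \<open>\<kappa>^(-1)\<close>, and the residue of d
  that comes from the inverse of \<open>\<flat>\<close> is replaced by the integer d.\<close>

lemma dE_tw:
 assumes u: "M.kev a u" and v: "L.kev d v"
 shows "tact dE (tw a d u v) = scW (q powi d) (tw (a + 1) d (M.opE u) v) \<oplus>\<^bsub>W\<^esub> tw a (d + 1) u (L.opE v)"
proof -
 have uv: "u \<in> carrier M" "v \<in> carrier L" using u v by auto
 let ?s = "q powi (- (int n * a * (d div int n)))"
 have m: "d mod int n = d - int n * (d div int n)" by (simp add: minus_mult_div_eq_mod)
 have 1: "scW ?s (pt (M.opE u) (L.sc (q powi (d mod int n)) v)) = scW (q powi d) (tw (a + 1) d (M.opE u) v)"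
 proof -
  have "?s * q powi (d mod int n) = q powi d * q powi (- (int n * (a + 1) * (d div int n)))"
   unfolding m by (simp add: power_int_add[symmetric] algebra_simps)
  then show ?thesis using uv by (simp add: tw_def pt_sc_right)
 qed
 \<comment> \<open>The last two summands of \<open>dE\<close> exclude each other:
   \<open>1_0 E v\<close> survives exactly if n divides d + 1.\<close>
 have 2: "tact dE (pt u v) = pt (M.opE u) (L.sc (q powi (d mod int n)) v)
   \<oplus>\<^bsub>W\<^esub> (if (d + 1) mod int n = 0 then pt (M.opki u) (L.opE v) else pt u (L.opE v))"
  using uv n_pos L.kev_opE[OF v]
  by (simp add: dE_def tactW_sum QQ.a_closed tactW_pt L.flat_inv_act[OF v] L.idem_tail_E_act[OF v]
    L.act_assoc L.idem_act[OF L.kev_opE[OF v]] M.opE_def[symmetric] L.opE_def[symmetric] M.opki_def[symmetric]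
    del: One_nat_def)
 \<comment> \<open>At a carry the factor \<open>\<kappa>^(-1)\<close> contributes
   \<open>q^(-na)\<close>, which is precisely the change of the rescaling factor from d to d +
   1.\<close>
 have 3: "scW ?s (if (d + 1) mod int n = 0 then pt (M.opki u) (L.opE v) else pt u (L.opE v)) = tw a (d + 1) u (L.opE v)"
 proof (cases "(d + 1) mod int n = 0")
  case True
  have "?s * q powi (- int n * a) = q powi (- (int n * a * (d div int n + 1)))"
   by (simp add: power_int_add[symmetric] algebra_simps)
  then show ?thesis using True uv by (simp add: tw_def carry_div M.kev_opki[OF u] pt_sc_left)
 next
  case False
  then show ?thesis by (simp add: tw_def carry_div)
 qed
 show ?thesis unfolding tw_def[of a d u v] 1[symmetric] 3[symmetric]
  using uv by (subst tactW_sc) (auto simp: 2 T.W.sc_add_right)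
qed

lemma dF_tw:
 assumes u: "M.kev a u" and v: "L.kev d v"
 shows "tact dF (tw a d u v) = scW (q powi (- d)) (tw (a - 1) d (M.opF u) v) \<oplus>\<^bsub>W\<^esub> tw a (d - 1) (M.opK u) (L.opF v)"
proof -
 have uv: "u \<in> carrier M" "v \<in> carrier L" using u v by auto
 let ?s = "q powi (- (int n * a * (d div int n)))"
 have m: "d mod int n = d - int n * (d div int n)" by (simp add: minus_mult_div_eq_mod)
 have 1: "scW ?s (pt (M.opF u) (L.sc (q powi (- (d mod int n))) v)) = scW (q powi (- d)) (tw (a - 1) d (M.opF u) v)"
 proof -
  have "?s * q powi (- (d mod int n)) = q powi (- d) * q powi (- (int n * (a - 1) * (d div int n)))"
   unfolding m by (simp add: power_int_add[symmetric] algebra_simps)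
  then show ?thesis using uv by (simp add: tw_def pt_sc_right)
 qed
 have opF_if: "F \<odot>\<^bsub>L\<^esub> (if P then \<zero>\<^bsub>L\<^esub> else v) = (if P then \<zero>\<^bsub>L\<^esub> else L.opF v)"
  "F \<odot>\<^bsub>L\<^esub> (if P then v else \<zero>\<^bsub>L\<^esub>) = (if P then L.opF v else \<zero>\<^bsub>L\<^esub>)" for P
  by (auto simp: L.opF_def)
 have 2: "tact dF (pt u v) = pt (M.opF u) (L.sc (q powi (- (d mod int n))) v)
   \<oplus>\<^bsub>W\<^esub> (if d mod int n = 0 then pt (M.opkh u) (L.opF v) else pt (M.opK u) (L.opF v))"
  using uv n_pos by (simp add: dF_def tactW_sum QQ.a_closed tactW_pt L.flat_act[OF v] L.idem_tail_act[OF v]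
    L.act_assoc L.idem_act[OF v] opF_if M.opF_def[symmetric] M.opK_def[symmetric] M.opkh_def[symmetric]
    del: One_nat_def)
 \<comment> \<open>For F the jump occurs between d - 1 and d. There the summand with \<kappa>-hat
   instead of K applies, and as \<open>\<kappa>-hat = \<kappa> K\<close> it differs by the
   eigenvalue \<open>q^(na)\<close>.\<close>
 have carry: "d div int n = (if d mod int n = 0 then (d - 1) div int n + 1 else (d - 1) div int n)"
  using carry_div[of "d - 1"] by simp
 have kh: "M.opkh u = M.sc (q powi (int n * a)) (M.opK u)" using M.kev_opK[OF u] uv by (simp add: M.kev_def flip: M.opk_opK)
 have 3: "scW ?s (if d mod int n = 0 then pt (M.opkh u) (L.opF v) else pt (M.opK u) (L.opF v)) = tw a (d - 1) (M.opK u) (L.opF v)"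
 proof (cases "d mod int n = 0")
  case True
  have "q powi (- (int n * a * ((d - 1) div int n + 1))) * q powi (int n * a) = q powi (- (int n * a * ((d - 1) div int n)))"
   by (simp add: power_int_add[symmetric] algebra_simps)
  then show ?thesis using True uv by (simp add: tw_def carry kh pt_sc_left)
 next
  case False
  then show ?thesis by (simp add: tw_def carry)
 qed
 show ?thesis unfolding tw_def[of a d u v] 1[symmetric] 3[symmetric]
  using uv by (subst tactW_sc) (auto simp: 2 T.W.sc_add_right)
qed

definition "tactE = tact dE"
definition "tactF = tact dF"

lemma tactEF_props:
 "x \<in> carrier W ==> tactE x \<in> carrier W" "x \<in> carrier W ==> tactF x \<in> carrier W"
 "[|x \<in> carrier W; y \<in> carrier W|] ==> tactE (x \<oplus>\<^bsub>W\<^esub> y) = tactE x \<oplus>\<^bsub>W\<^esub> tactE y"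
 "[|x \<in> carrier W; y \<in> carrier W|] ==> tactF (x \<oplus>\<^bsub>W\<^esub> y) = tactF x \<oplus>\<^bsub>W\<^esub> tactF y"
 "x \<in> carrier W ==> tactE (scW c x) = scW c (tactE x)"
 "x \<in> carrier W ==> tactF (scW c x) = scW c (tactF x)"
 by (simp_all add: tactE_def tactF_def tactW_add tactW_sc)

lemma kev_funpow:
 "M.kev a u ==> M.kev (a + int i) ((M.opE ^^ i) u)" "L.kev a v ==> L.kev (a + int i) ((L.opE ^^ i) v)"
 "M.kev a u ==> M.kev (a - int i) ((M.opF ^^ i) u)" "L.kev a v ==> L.kev (a - int i) ((L.opF ^^ i) v)"
 "M.kev a u ==> M.kev a ((M.opK ^^ i) u)"
proof -
 show "M.kev a u ==> M.kev (a + int i) ((M.opE ^^ i) u)" by (induction i) (auto dest: M.kev_opE simp: add_ac)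
 show "L.kev a v ==> L.kev (a + int i) ((L.opE ^^ i) v)" by (induction i) (auto dest: L.kev_opE simp: add_ac)
 show "M.kev a u ==> M.kev (a - int i) ((M.opF ^^ i) u)"
  by (induction i) (auto dest: M.kev_opF simp: algebra_simps)
 show "L.kev a v ==> L.kev (a - int i) ((L.opF ^^ i) v)"
  by (induction i) (auto dest: L.kev_opF simp: algebra_simps)
 show "M.kev a u ==> M.kev a ((M.opK ^^ i) u)" by (induction i) (auto dest: M.kev_opK)
qed

lemma opF_opK_pow: "u \<in> carrier M ==> M.opF ((M.opK ^^ s) u) = M.sc (q powi (- (2 * int s))) ((M.opK ^^ s) (M.opF u))"
proof (induction s)
 case (Suc s)
 let ?w = "(M.opK ^^ s) u"
 have "M.opF (M.opK ?w) = M.sc (inverse (q ^ 2)) (M.opK (M.opF ?w))" using Suc M.opK_opF[of ?w] by (simp add: field_simps)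
 then show ?case using Suc by (simp add: M.op_sc power_int_diff power_int_minus field_simps power2_eq_square)
qed simp

text \<open>On twisted tensors E behaves like a sum of two q-commuting parts. Only the outer terms
  of its N-th power remain, and they contain \<open>E^N\<close> on one of the factors.\<close>

lemma tactE_pow_N:
 assumes u: "M.kev a u" and v: "L.kev d v"
 shows "(tactE ^^ N) (tw a d u v) = \<zero>\<^bsub>W\<^esub>"
proof -
 have uv: "u \<in> carrier M" "v \<in> carrier L" using u v by auto
 define V where "V r i = tw (a + int i) (d + int (r - i)) ((M.opE ^^ i) u) ((L.opE ^^ (r - i)) v)" for r i
 have "(tactE ^^ N) (V 0 0) = \<zero>\<^bsub>W\<^esub>"
 proof (rule T.W.q_binomial_root[where V = V and T = tactE and m = N and x = "q powi d" and c = q])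
  show "tactE (V r i) = scW (q powi d * q ^ (r - i)) (V (Suc r) (Suc i)) \<oplus>\<^bsub>W\<^esub> V (Suc r) i" if "i \<le> r" for r i
   unfolding V_def tactE_def using dE_tw[OF kev_funpow(1)[OF u] kev_funpow(2)[OF v], of i "r - i"] that
   by (simp add: power_int_add Suc_diff_le add_ac del: of_nat_diff)
  show "q ^ i \<noteq> 1" if "0 < i" "i < N" for i using q_pow_eq_1_iff[of i] that by (auto dest: dvd_imp_le)
  show "V N 0 = \<zero>\<^bsub>W\<^esub>" "V N N = \<zero>\<^bsub>W\<^esub>"
   using uv M.opE_pow_N L.opE_pow_N by (simp_all add: V_def)
 qed (use uv q_pow_N in \<open>auto simp: V_def tactEF_props\<close>)
 then show ?thesis by (simp add: V_def)
qed

lemma tactF_pow_N: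
 assumes u: "M.kev a u" and v: "L.kev d v"
 shows "(tactF ^^ N) (tw a d u v) = \<zero>\<^bsub>W\<^esub>"
proof -
 have uv: "u \<in> carrier M" "v \<in> carrier L" using u v by auto
 \<comment> \<open>Every F on the second factor leaves a K on the first. Moving F past
   \<open>K^s\<close> costs \<open>q^(-2s)\<close> and the lowered exponent d - s gives back
   \<open>q^s\<close>, so the binomial parameter is the inverse of q.\<close>
 define V where "V r i = tw (a - int i) (d - int (r - i)) ((M.opK ^^ (r - i)) ((M.opF ^^ i) u)) ((L.opF ^^ (r - i)) v)" for r i
 have "(tactF ^^ N) (V 0 0) = \<zero>\<^bsub>W\<^esub>"
 proof (rule T.W.q_binomial_root[where V = V and T = tactF and m = N and x = "q powi (- d)" and c = "inverse q"])
  show "tactF (V r i) = scW (q powi (- d) * inverse q ^ (r - i)) (V (Suc r) (Suc i)) \<oplus>\<^bsub>W\<^esub> V (Suc r) i" if "i \<le> r" for r i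
  proof -
   let ?s = "r - i"
   have "inverse q ^ ?s = q powi (- int ?s)" by (simp add: power_int_minus power_inverse del: of_nat_diff)
   then have "q powi (- (d - int ?s)) * q powi (- (2 * int ?s)) = q powi (- d) * inverse q ^ ?s"
    by (simp only: power_int_add[symmetric] q_nonzero simp_thms) (simp add: algebra_simps del: of_nat_diff)
   then have sc: "scW (q powi (- (d - int ?s))) (scW (q powi (- (2 * int ?s))) x) = scW (q powi (- d) * inverse q ^ ?s) x"
    if "x \<in> carrier W" for x using that by simp
   have V1: "V (Suc r) (Suc i) = tw (a - int i - 1) (d - int ?s) ((M.opK ^^ ?s) (M.opF ((M.opF ^^ i) u))) ((L.opF ^^ ?s) v)"
    by (simp add: V_def algebra_simps del: of_nat_diff)
   have "Suc r - i = Suc ?s" using that by simp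
   then have V2: "V (Suc r) i = tw (a - int i) (d - int ?s - 1) (M.opK ((M.opK ^^ ?s) ((M.opF ^^ i) u))) (L.opF ((L.opF ^^ ?s) v))"
    by (simp add: V_def algebra_simps del: of_nat_diff)
   have cl: "(M.opF ^^ i) u \<in> carrier M" "(L.opF ^^ ?s) v \<in> carrier L"
    "(M.opK ^^ ?s) (M.opF ((M.opF ^^ i) u)) \<in> carrier M" using uv by auto
   have step: "scW (q powi (- (d - int ?s))) (tw (a - int i - 1) (d - int ?s) (M.opF ((M.opK ^^ ?s) ((M.opF ^^ i) u))) ((L.opF ^^ ?s) v))
    = scW (q powi (- d) * inverse q ^ ?s) (tw (a - int i - 1) (d - int ?s) ((M.opK ^^ ?s) (M.opF ((M.opF ^^ i) u))) ((L.opF ^^ ?s) v))"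
    unfolding opF_opK_pow[OF cl(1)] tw_sc_left[OF cl(3,2)] by (rule sc[OF tw_closed[OF cl(3,2)]])
   show ?thesis unfolding V1 V2 step[symmetric]
    using dF_tw[OF kev_funpow(5)[OF kev_funpow(3)[OF u, of i], of ?s] kev_funpow(4)[OF v, of ?s]]
    unfolding V_def tactF_def .
  qed
  show "inverse q ^ N = 1" using q_pow_N by (simp add: power_inverse)
  show "inverse q ^ i \<noteq> 1" if "0 < i" "i < N" for i
   using q_pow_eq_1_iff[of i] that by (auto dest: dvd_imp_le simp: power_inverse)
  have "(M.opK ^^ r) \<zero>\<^bsub>M\<^esub> = \<zero>\<^bsub>M\<^esub>" for r by (induction r) auto
  then show "V N 0 = \<zero>\<^bsub>W\<^esub>" "V N N = \<zero>\<^bsub>W\<^esub>"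
   using uv M.opF_pow_N L.opF_pow_N by (simp_all add: V_def)
 qed (use uv in \<open>auto simp: V_def tactEF_props\<close>)
 then show ?thesis by (simp add: V_def)
qed

text \<open>The mixed terms \<open>E \<otimes> F\<close> and \<open>F \<otimes> E\<close> cancel.
  The relation on the first factor contributes u \<otimes> v minus Ku \<otimes> v, that on the
  second Ku \<otimes> v minus Ku \<otimes> Kv, and the sum telescopes.\<close>

lemma tact_FE:
 assumes u: "M.kev a u" and v: "L.kev d v"
 shows "tactF (tactE (tw a d u v)) = scW (inverse q) (tactE (tactF (tw a d u v)))
  \<oplus>\<^bsub>W\<^esub> (tw a d u v \<oplus>\<^bsub>W\<^esub> scW (-1) (tw a d (M.opK u) (L.opK v)))"
proof -
 have uv: "u \<in> carrier M" "v \<in> carrier L" using u v by auto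
 note kM = M.kev_opE M.kev_opF M.kev_opK u and kL = L.kev_opE L.kev_opF v
 let ?EF = "tw a d (M.opE (M.opF u)) v" and ?EK = "tw (a + 1) (d - 1) (M.opE (M.opK u)) (L.opF v)"
  and ?F = "tw (a - 1) (d + 1) (M.opF u) (L.opE v)" and ?K = "tw a d (M.opK u) (L.opE (L.opF v))"
  and ?uv = "tw a d u v" and ?Kv = "tw a d (M.opK u) v" and ?KK = "tw a d (M.opK u) (L.opK v)"
 have carr: "?EF \<in> carrier W" "?EK \<in> carrier W" "?F \<in> carrier W" "?K \<in> carrier W" "?uv \<in> carrier W"
  "?Kv \<in> carrier W" "?KK \<in> carrier W" using uv by auto
 have "tactF (tactE (tw a d u v)) =
  scW (q powi d) (scW (q powi (- d)) (tw a d (M.opF (M.opE u)) v) \<oplus>\<^bsub>W\<^esub> tw (a + 1) (d - 1) (M.opK (M.opE u)) (L.opF v))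
  \<oplus>\<^bsub>W\<^esub> (scW (q powi (- (d + 1))) ?F \<oplus>\<^bsub>W\<^esub> tw a d (M.opK u) (L.opF (L.opE v)))"
  unfolding tactE_def tactF_def using uv dF_tw[OF kM(1)[OF u] v] dF_tw[OF u kL(1)[OF v]]
  by (simp add: dE_tw[OF u v] tactW_add tactW_sc)
 also have "tw a d (M.opF (M.opE u)) v = scW (inverse q) ?EF \<oplus>\<^bsub>W\<^esub> (?uv \<oplus>\<^bsub>W\<^esub> scW (-1) ?Kv)"
  using uv by (simp add: M.opF_opE tw_add_left tw_sc_left)
 also have "tw (a + 1) (d - 1) (M.opK (M.opE u)) (L.opF v) = scW (inverse (q ^ 2)) ?EK"
  using uv by (simp add: M.opK_opE tw_sc_left)
 also have "tw a d (M.opK u) (L.opF (L.opE v)) = scW (inverse q) ?K \<oplus>\<^bsub>W\<^esub> (?Kv \<oplus>\<^bsub>W\<^esub> scW (-1) ?KK)"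
  using uv by (simp add: L.opF_opE tw_add_right tw_sc_right)
 finally have L: "tactF (tactE (tw a d u v)) =
  scW (q powi d) (scW (q powi (- d)) (scW (inverse q) ?EF \<oplus>\<^bsub>W\<^esub> (?uv \<oplus>\<^bsub>W\<^esub> scW (-1) ?Kv)) \<oplus>\<^bsub>W\<^esub> scW (inverse (q ^ 2)) ?EK)
  \<oplus>\<^bsub>W\<^esub> (scW (q powi (- (d + 1))) ?F \<oplus>\<^bsub>W\<^esub> (scW (inverse q) ?K \<oplus>\<^bsub>W\<^esub> (?Kv \<oplus>\<^bsub>W\<^esub> scW (-1) ?KK)))" .
 have R: "tactE (tactF (tw a d u v)) =
  scW (q powi (- d)) (scW (q powi d) ?EF \<oplus>\<^bsub>W\<^esub> ?F) \<oplus>\<^bsub>W\<^esub> (scW (q powi (d - 1)) ?EK \<oplus>\<^bsub>W\<^esub> ?K)"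
  unfolding tactE_def tactF_def using uv dE_tw[OF kM(2)[OF u] v] dE_tw[OF kM(3)[OF u] kL(2)[OF v]]
  by (simp add: dF_tw[OF u v] tactW_add tactW_sc)
 have c: "?Kv \<oplus>\<^bsub>W\<^esub> scW (-1) ?Kv = \<zero>\<^bsub>W\<^esub>" using carr by (simp add: T.W.sc_minus_one T.W.M.r_neg)
 define x1 x2 x3 x4 x5 x6 x7 where x: "x1 = scW (inverse q) ?EF" "x2 = scW (inverse q * q powi (d - 1)) ?EK"
  "x3 = scW (q powi (- (d + 1))) ?F" "x4 = scW (inverse q) ?K" "x5 = ?Kv" "x6 = scW (-1) ?Kv" "x7 = scW (-1) ?KK"
 have xc: "x1 \<in> carrier W" "x2 \<in> carrier W" "x3 \<in> carrier W" "x4 \<in> carrier W" "x5 \<in> carrier W" "x6 \<in> carrier W" "x7 \<in> carrier W"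
  using carr by (auto simp: x)
 have L': "tactF (tactE (tw a d u v)) = (x1 \<oplus>\<^bsub>W\<^esub> (?uv \<oplus>\<^bsub>W\<^esub> x6) \<oplus>\<^bsub>W\<^esub> x2) \<oplus>\<^bsub>W\<^esub> (x3 \<oplus>\<^bsub>W\<^esub> (x4 \<oplus>\<^bsub>W\<^esub> (x5 \<oplus>\<^bsub>W\<^esub> x7)))"
  unfolding L x using carr by (simp add: T.W.sc_add_right power_int_minus power_int_diff power_int_add field_simps power2_eq_square)
 have R': "scW (inverse q) (tactE (tactF (tw a d u v))) = x1 \<oplus>\<^bsub>W\<^esub> x3 \<oplus>\<^bsub>W\<^esub> (x2 \<oplus>\<^bsub>W\<^esub> x4)"
  unfolding R x using carr by (simp add: T.W.sc_add_right power_int_minus power_int_diff power_int_add field_simps power2_eq_square)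
 have "(x1 \<oplus>\<^bsub>W\<^esub> (?uv \<oplus>\<^bsub>W\<^esub> x6) \<oplus>\<^bsub>W\<^esub> x2) \<oplus>\<^bsub>W\<^esub> (x3 \<oplus>\<^bsub>W\<^esub> (x4 \<oplus>\<^bsub>W\<^esub> (x5 \<oplus>\<^bsub>W\<^esub> x7)))
  = (x1 \<oplus>\<^bsub>W\<^esub> x3 \<oplus>\<^bsub>W\<^esub> (x2 \<oplus>\<^bsub>W\<^esub> x4)) \<oplus>\<^bsub>W\<^esub> (?uv \<oplus>\<^bsub>W\<^esub> x7) \<oplus>\<^bsub>W\<^esub> (x5 \<oplus>\<^bsub>W\<^esub> x6)"
  using xc carr(5) by (simp add: T.W.M.a_ac)
 also have "x5 \<oplus>\<^bsub>W\<^esub> x6 = \<zero>\<^bsub>W\<^esub>" using c by (simp add: x)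
 finally show ?thesis unfolding L' R' using xc carr by (simp add: x T.W.M.a_assoc)
qed

end

section \<open>Existence and uniqueness of the comultiplication\<close>

lemma (in kalg) minus_unit: assumes "x \<in> carrier A" shows "\<ominus> x = \<eta> (-1) \<otimes> x"
proof -
 have "\<eta> (-1) \<oplus> \<eta> 1 = \<eta> (- 1 + 1)" by (simp only: unit_add)
 also have "... = \<zero>" using kmod.unit_zero[OF regular_kmod] by simp
 finally have "\<eta> (-1) \<otimes> x \<oplus> x = \<zero>"
  using assms by (metis l_distr l_null l_one unit_closed unit_one)
 then show ?thesis using assms by (simp add: minus_equality)
qed

context qtens
begin

lemma tactW_zero: "x \<in> carrier W ==> tact \<zero>\<^bsub>QQ\<^esub> x = \<zero>\<^bsub>W\<^esub>"
proof -
 assume x: "x \<in> carrier W"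
 have "\<zero>\<^bsub>QQ\<^esub> = reg_tensor \<eta> A (\<eta> 0) \<one>\<^bsub>A\<^esub>"
  using kmod.unit_zero[OF QQ.regular_kmod] by simp
 then show ?thesis using x by (simp flip: scW_tact)
qed

lemma tactW_one: "x \<in> carrier W ==> tact \<one>\<^bsub>QQ\<^esub> x = x"
 by (simp add: tensor_algebra_simps tensor_module_simps tact_one)

lemma tactW_pow: "[|t \<in> carrier QQ; x \<in> carrier W|] ==> tact (t [^]\<^bsub>QQ\<^esub> (r::nat)) x = (tact t ^^ r) x"
proof (induction r arbitrary: x)
 case (Suc r)
 then show ?case by (simp add: tactW_mult funpow_swap1)
qed (simp add: tactW_one)

lemma pt_tw: "[|u \<in> carrier M; v \<in> carrier L|] ==> pt u v = scW (q powi (int n * a * (d div int n))) (tw a d u v)"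
 by (simp add: tw_def power_int_minus)

lemma tactW_minus: "[|t \<in> carrier QQ; x \<in> carrier W|] ==> tact (\<ominus>\<^bsub>QQ\<^esub> t) x = scW (-1) (tact t x)"
 unfolding QQ.minus_unit scW_tact by (rule tactW_mult) auto

lemma tact_KK:
 assumes "u \<in> carrier M" "v \<in> carrier L"
 shows "tact (reg_tensor \<eta> A K K) (tw a d u v) = tw a d (M.opK u) (L.opK v)"
 using assms by (simp add: tw_def tactW_sc tactW_pt M.opK_def L.opK_def)

end

context qparam
begin

sublocale RR: qtens n q "regular_module A" "regular_module A"
 by (intro qtens.intro tens.intro qparam_axioms R.qmod_axioms qu.regular_kmod)

lemma QQ_mult: "t \<otimes>\<^bsub>RR.QQ\<^esub> t' = RR.tact t t'" by (simp add: tensor_algebra_simps)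

lemma reg_tensor_mult: "[|a \<in> carrier A; b \<in> carrier A; a' \<in> carrier A; b' \<in> carrier A|] ==>
 reg_tensor \<eta> A a b \<otimes>\<^bsub>RR.QQ\<^esub> reg_tensor \<eta> A a' b' = reg_tensor \<eta> A (a \<cdot> a') (b \<cdot> b')"
 unfolding QQ_mult using RR.tactW_pt by simp

lemma reg_tensor_one: "\<one>\<^bsub>RR.QQ\<^esub> = reg_tensor \<eta> A \<one>\<^bsub>A\<^esub> \<one>\<^bsub>A\<^esub>"
 by (simp add: tensor_algebra_simps)

lemma reg_tensor_pow: "[|a \<in> carrier A; b \<in> carrier A|] ==>
 reg_tensor \<eta> A a b [^]\<^bsub>RR.QQ\<^esub> (r::nat) = reg_tensor \<eta> A (a \<up> r) (b \<up> r)"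
 by (induction r) (simp_all add: reg_tensor_one reg_tensor_mult)

text \<open>An element t equals t times \<open>1 \<otimes> 1\<close>, and
  \<open>1 \<otimes> 1\<close> is the sum of the \<open>1_i \<otimes> 1_j\<close>, each of which is
  a twisted tensor up to a scalar. So identities in \<open>A \<otimes> A\<close> may be verified on
  twisted tensors.\<close>

lemma QQ_eqI:
 assumes t: "t \<in> carrier RR.QQ" "t' \<in> carrier RR.QQ"
  and eq: "\<And>a d u v. [|R.kev a u; R.kev d v|] ==> RR.tact t (RR.tw a d u v) = RR.tact t' (RR.tw a d u v)"
 shows "t = t'"
proof -
 have step0: "RR.tact t (RR.pt u v) = RR.tact t' (RR.pt u v)" if "R.kev a u" "R.kev d v" for a d u v
 proof -
  have "u \<in> carrier (regular_module A)" "v \<in> carrier (regular_module A)" using that R.kev_closed by blast+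
  then show ?thesis using eq[OF that] t by (simp only: RR.pt_tw[of u v a d] RR.tactW_sc RR.tw_closed)
 qed
 have fin_left: "RR.tact t (RR.pt (finsum A f I) v) = RR.tact t' (RR.pt (finsum A f I) v)"
  if "finite I" "\<And>i. i \<in> I ==> f i \<in> carrier A" "v \<in> carrier A"
   "\<And>i. i \<in> I ==> RR.tact t (RR.pt (f i) v) = RR.tact t' (RR.pt (f i) v)" for f and v and I :: "nat set"
  using that
 proof (induction I rule: finite_induct)
  case empty
  then show ?case using t RR.T.pt_zero_left[of v] RR.tactW_sc[of _ "\<zero>\<^bsub>RR.W\<^esub>" 0] by simp
 next
  case (insert i I)
  have "finsum A f (insert i I) = f i \<oplus>\<^bsub>A\<^esub> finsum A f I" using insert by (intro qu.finsum_insert) auto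
  moreover have "finsum A f I \<in> carrier A" using insert by (intro qu.finsum_closed) auto
  ultimately show ?case using insert t RR.T.pt_sum_left[of "f i" "finsum A f I" v] by (simp add: RR.tactW_add)
 qed
 have fin_right: "RR.tact t (RR.pt u (finsum A f I)) = RR.tact t' (RR.pt u (finsum A f I))"
  if "finite I" "\<And>i. i \<in> I ==> f i \<in> carrier A" "u \<in> carrier A"
   "\<And>i. i \<in> I ==> RR.tact t (RR.pt u (f i)) = RR.tact t' (RR.pt u (f i))" for f and u and I :: "nat set"
  using that
 proof (induction I rule: finite_induct)
  case empty
  then show ?case using t RR.T.pt_zero_right[of u] RR.tactW_sc[of _ "\<zero>\<^bsub>RR.W\<^esub>" 0] by simp
 next
  case (insert i I)
  have "finsum A f (insert i I) = f i \<oplus>\<^bsub>A\<^esub> finsum A f I" using insert by (intro qu.finsum_insert) auto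
  moreover have "finsum A f I \<in> carrier A" using insert by (intro qu.finsum_closed) auto
  ultimately show ?case using insert t RR.T.pt_sum_right[of u "f i" "finsum A f I"] by (simp add: RR.tactW_add)
 qed
 have "RR.tact t (RR.pt \<one>\<^bsub>A\<^esub> v) = RR.tact t' (RR.pt \<one>\<^bsub>A\<^esub> v)" if "R.kev d v" for d v
  using fin_left[of "{..<n}" "qu_idem n q" v] step0[OF kev_idem that] R.kev_closed[OF that] by (simp add: sum_idem)
 then have "RR.tact t (RR.pt \<one>\<^bsub>A\<^esub> (qu_idem n q i)) = RR.tact t' (RR.pt \<one>\<^bsub>A\<^esub> (qu_idem n q i))" if "i \<in> {..<n}" for i
  using kev_idem[of i] that by blast
 from fin_right[of "{..<n}" "qu_idem n q" "\<one>\<^bsub>A\<^esub>", OF _ _ _ this]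
 have "RR.tact t (RR.pt \<one>\<^bsub>A\<^esub> \<one>\<^bsub>A\<^esub>) = RR.tact t' (RR.pt \<one>\<^bsub>A\<^esub> \<one>\<^bsub>A\<^esub>)"
  by (simp add: sum_idem)
 then show ?thesis using t by (simp flip: QQ_mult reg_tensor_one)
qed

fun dgen :: "qu_gen => ('k free_qu set \<times> 'k free_qu set \<Rightarrow>\<^sub>0 'k) set" where
 "dgen Kappa = dK" | "dgen Kappa_hat = dKh" | "dgen Gen_E = dE" | "dgen Gen_F = dF"

text \<open>The relations of the torus follow by multiplying pure tensors; those that involve E or F
  are compared on twisted tensors.\<close>

lemma comult_relations: "qu_relations RR.QQ (\<lambda>c. reg_tensor \<eta> A (\<eta> c) \<one>\<^bsub>A\<^esub>) n q dgen"
proof (intro qu_relations.intro QQ.kalg_axioms qu_relations_axioms.intro; (unfold dgen.simps)?)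
 note acts = RR.tactW_mult RR.tactW_sum RR.tactW_add RR.tactW_sc RR.scW_tact[symmetric] RR.tactW_zero
  RR.tactW_one RR.tactW_pow RR.tactW_minus RR.dK_tw RR.dE_tw RR.dF_tw
 note kev = R.kev_opE R.kev_opF R.kev_opK R.kev_opk R.kev_opkh
 show "dgen x \<in> carrier RR.QQ" for x by (cases x) auto
 show "dK [^]\<^bsub>RR.QQ\<^esub> n = \<one>\<^bsub>RR.QQ\<^esub>"
  using qu.kappa_pow by (simp add: dK_def reg_tensor_pow reg_tensor_one)
 show "dKh [^]\<^bsub>RR.QQ\<^esub> n \<otimes>\<^bsub>RR.QQ\<^esub> dK [^]\<^bsub>RR.QQ\<^esub> (2::nat) = \<one>\<^bsub>RR.QQ\<^esub>"
  using qu.kappa_hat_pow by (simp add: dK_def dKh_def reg_tensor_pow reg_tensor_one reg_tensor_mult)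
 show "dK \<otimes>\<^bsub>RR.QQ\<^esub> dKh = dKh \<otimes>\<^bsub>RR.QQ\<^esub> dK"
  using qu.kappa_comm by (simp add: dK_def dKh_def reg_tensor_mult)
 show "dK \<otimes>\<^bsub>RR.QQ\<^esub> dE = reg_tensor \<eta> A (\<eta> (q ^ n)) \<one>\<^bsub>A\<^esub> \<otimes>\<^bsub>RR.QQ\<^esub> dE \<otimes>\<^bsub>RR.QQ\<^esub> dK"
 proof (rule QQ_eqI)
  fix a d u v assume u: "R.kev a u" and v: "R.kev d v"
  then have uv: "u \<in> carrier (regular_module A)" "v \<in> carrier (regular_module A)" using R.kev_closed by blast+
  show "RR.tact (dK \<otimes>\<^bsub>RR.QQ\<^esub> dE) (RR.tw a d u v)
    = RR.tact (reg_tensor \<eta> A (\<eta> (q ^ n)) \<one>\<^bsub>A\<^esub> \<otimes>\<^bsub>RR.QQ\<^esub> dE \<otimes>\<^bsub>RR.QQ\<^esub> dK) (RR.tw a d u v)"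
   using uv u v RR.dE_tw[OF kev(4)[OF u] kev(4)[OF v]] by (simp add: acts del: regular_module_simps)
    (simp add: R.opk_opE RR.tw_sc_left RR.tw_sc_right RR.T.W.sc_add_right mult.commute del: regular_module_simps)
 qed auto
 show "dK \<otimes>\<^bsub>RR.QQ\<^esub> dF = reg_tensor \<eta> A (\<eta> (inverse (q ^ n))) \<one>\<^bsub>A\<^esub> \<otimes>\<^bsub>RR.QQ\<^esub> dF \<otimes>\<^bsub>RR.QQ\<^esub> dK"
 proof (rule QQ_eqI)
  fix a d u v assume u: "R.kev a u" and v: "R.kev d v"
  then have uv: "u \<in> carrier (regular_module A)" "v \<in> carrier (regular_module A)" using R.kev_closed by blast+
  have Kk: "R.opk (R.opK u) = R.opK (R.opk u)" using uv by (simp only: R.opk_opK R.opK_altdef R.opk_opkh[symmetric] R.op_closed R.opki_cancel)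
  show "RR.tact (dK \<otimes>\<^bsub>RR.QQ\<^esub> dF) (RR.tw a d u v)
    = RR.tact (reg_tensor \<eta> A (\<eta> (inverse (q ^ n))) \<one>\<^bsub>A\<^esub> \<otimes>\<^bsub>RR.QQ\<^esub> dF \<otimes>\<^bsub>RR.QQ\<^esub> dK) (RR.tw a d u v)"
   using uv u v RR.dF_tw[OF kev(4)[OF u] kev(4)[OF v]] by (simp add: acts del: regular_module_simps)
    (simp add: R.opk_opF Kk RR.tw_sc_left RR.tw_sc_right RR.T.W.sc_add_right mult.commute del: regular_module_simps)
 qed auto
 show "dKh \<otimes>\<^bsub>RR.QQ\<^esub> dE = reg_tensor \<eta> A (\<eta> (q ^ n * inverse (q ^ 2))) \<one>\<^bsub>A\<^esub> \<otimes>\<^bsub>RR.QQ\<^esub> dE \<otimes>\<^bsub>RR.QQ\<^esub> dKh"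
 proof (rule QQ_eqI)
  fix a d u v assume u: "R.kev a u" and v: "R.kev d v"
  then have uv: "u \<in> carrier (regular_module A)" "v \<in> carrier (regular_module A)" using R.kev_closed by blast+
  show "RR.tact (dKh \<otimes>\<^bsub>RR.QQ\<^esub> dE) (RR.tw a d u v)
    = RR.tact (reg_tensor \<eta> A (\<eta> (q ^ n * inverse (q ^ 2))) \<one>\<^bsub>A\<^esub> \<otimes>\<^bsub>RR.QQ\<^esub> dE \<otimes>\<^bsub>RR.QQ\<^esub> dKh) (RR.tw a d u v)"
   using uv u v RR.dE_tw[OF kev(5)[OF u] kev(5)[OF v]] by (simp add: acts del: regular_module_simps)
    (simp add: R.opkh_opE RR.tw_sc_left RR.tw_sc_right RR.T.W.sc_add_right mult.commute del: regular_module_simps)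
 qed auto
 show "dKh \<otimes>\<^bsub>RR.QQ\<^esub> dF = reg_tensor \<eta> A (\<eta> (inverse (q ^ n) * q ^ 2)) \<one>\<^bsub>A\<^esub> \<otimes>\<^bsub>RR.QQ\<^esub> dF \<otimes>\<^bsub>RR.QQ\<^esub> dKh"
 proof (rule QQ_eqI)
  fix a d u v assume u: "R.kev a u" and v: "R.kev d v"
  then have uv: "u \<in> carrier (regular_module A)" "v \<in> carrier (regular_module A)" using R.kev_closed by blast+
  have "R.opkh (R.opki (R.opkh u)) = R.opki (R.opkh (R.opkh u))"
   by (rule R.opk_inj) (use uv in \<open>simp_all only: R.opk_opkh R.op_closed R.opki_cancel\<close>)
  then have Kk: "R.opkh (R.opK u) = R.opK (R.opkh u)" using uv by (simp only: R.opK_altdef R.op_closed)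
  show "RR.tact (dKh \<otimes>\<^bsub>RR.QQ\<^esub> dF) (RR.tw a d u v)
    = RR.tact (reg_tensor \<eta> A (\<eta> (inverse (q ^ n) * q ^ 2)) \<one>\<^bsub>A\<^esub> \<otimes>\<^bsub>RR.QQ\<^esub> dF \<otimes>\<^bsub>RR.QQ\<^esub> dKh) (RR.tw a d u v)"
   using uv u v RR.dF_tw[OF kev(5)[OF u] kev(5)[OF v]] by (simp add: acts del: regular_module_simps)
    (simp add: R.opkh_opF Kk RR.tw_sc_left RR.tw_sc_right RR.T.W.sc_add_right mult.commute del: regular_module_simps)
 qed auto
 show "dE [^]\<^bsub>RR.QQ\<^esub> N = \<zero>\<^bsub>RR.QQ\<^esub>"
 proof (rule QQ_eqI)
  fix a d u v assume u: "R.kev a u" and v: "R.kev d v"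
  then have uv: "u \<in> carrier (regular_module A)" "v \<in> carrier (regular_module A)" using R.kev_closed by blast+
  show "RR.tact (dE [^]\<^bsub>RR.QQ\<^esub> N) (RR.tw a d u v) = RR.tact \<zero>\<^bsub>RR.QQ\<^esub> (RR.tw a d u v)"
   using RR.tactE_pow_N[OF u v] uv by (simp only: RR.tactE_def RR.tactW_pow RR.tactW_zero RR.tw_closed d_closed)
 qed auto
 show "dF [^]\<^bsub>RR.QQ\<^esub> N = \<zero>\<^bsub>RR.QQ\<^esub>"
 proof (rule QQ_eqI)
  fix a d u v assume u: "R.kev a u" and v: "R.kev d v"
  then have uv: "u \<in> carrier (regular_module A)" "v \<in> carrier (regular_module A)" using R.kev_closed by blast+
  show "RR.tact (dF [^]\<^bsub>RR.QQ\<^esub> N) (RR.tw a d u v) = RR.tact \<zero>\<^bsub>RR.QQ\<^esub> (RR.tw a d u v)"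
   using RR.tactF_pow_N[OF u v] uv by (simp only: RR.tactF_def RR.tactW_pow RR.tactW_zero RR.tw_closed d_closed)
 qed auto
 have KK: "dK [^]\<^bsub>RR.QQ\<^esub> (n - 1) \<otimes>\<^bsub>RR.QQ\<^esub> dKh = reg_tensor \<eta> A K K"
  unfolding kappa_inv by (simp add: dK_def dKh_def reg_tensor_pow reg_tensor_mult)
 show "dF \<otimes>\<^bsub>RR.QQ\<^esub> dE = reg_tensor \<eta> A (\<eta> (inverse q)) \<one>\<^bsub>A\<^esub> \<otimes>\<^bsub>RR.QQ\<^esub> dE \<otimes>\<^bsub>RR.QQ\<^esub> dF
  \<oplus>\<^bsub>RR.QQ\<^esub> (\<one>\<^bsub>RR.QQ\<^esub> \<ominus>\<^bsub>RR.QQ\<^esub> dK [^]\<^bsub>RR.QQ\<^esub> (n - 1) \<otimes>\<^bsub>RR.QQ\<^esub> dKh)"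
  unfolding KK a_minus_def
 proof (rule QQ_eqI)
  fix a d u v assume u: "R.kev a u" and v: "R.kev d v"
  then have uv: "u \<in> carrier (regular_module A)" "v \<in> carrier (regular_module A)" using R.kev_closed by blast+
  show "RR.tact (dF \<otimes>\<^bsub>RR.QQ\<^esub> dE) (RR.tw a d u v) = RR.tact (reg_tensor \<eta> A (\<eta> (inverse q)) \<one>\<^bsub>A\<^esub> \<otimes>\<^bsub>RR.QQ\<^esub> dE \<otimes>\<^bsub>RR.QQ\<^esub> dF
   \<oplus>\<^bsub>RR.QQ\<^esub> (\<one>\<^bsub>RR.QQ\<^esub> \<oplus>\<^bsub>RR.QQ\<^esub> \<ominus>\<^bsub>RR.QQ\<^esub> reg_tensor \<eta> A K K)) (RR.tw a d u v)"
   using RR.tact_FE[OF u v] uv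
   by (simp add: RR.tactE_def RR.tactF_def RR.tactW_mult RR.tactW_sum RR.tactW_minus RR.tactW_one RR.tact_KK
     RR.scW_tact[symmetric] del: regular_module_simps)
 qed auto
qed

text \<open>Existence is the universal property of the presentation, uniqueness is induction over
  the generators; values outside the carrier are fixed by extensionality.\<close>

lemma qu_comult_unique:
 "\<exists>!D. D \<in> extensional (carrier A) \<and> D \<in> ring_hom A RR.QQ \<and> (\<forall>c. D (\<eta> c) = reg_tensor \<eta> A (\<eta> c) \<one>\<^bsub>A\<^esub>) \<and>
  D \<kappa> = dK \<and> D \<kappa>h = dKh \<and> D E = dE \<and> D F = dF"
proof -
 interpret D: qu_relations RR.QQ "\<lambda>c. reg_tensor \<eta> A (\<eta> c) \<one>\<^bsub>A\<^esub>" n q dgen by (rule comult_relations)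
 obtain \<phi> where \<phi>: "\<phi> \<in> ring_hom A RR.QQ" "\<And>c. \<phi> (\<eta> c) = reg_tensor \<eta> A (\<eta> c) \<one>\<^bsub>A\<^esub>"
  "\<phi> \<kappa> = dgen Kappa" "\<phi> \<kappa>h = dgen Kappa_hat" "\<phi> E = dgen Gen_E" "\<phi> F = dgen Gen_F"
  using D.qu_hom_exists by blast
 show ?thesis
 proof (rule ex1I[of _ "restrict \<phi> (carrier A)"])
  have "restrict \<phi> (carrier A) \<in> ring_hom A RR.QQ" by (rule ring_hom_memI)
    (use ring_hom_closed[OF \<phi>(1)] ring_hom_add[OF \<phi>(1)] ring_hom_mult[OF \<phi>(1)] ring_hom_one[OF \<phi>(1)] in auto)
  with \<phi> show "restrict \<phi> (carrier A) \<in> extensional (carrier A) \<and> restrict \<phi> (carrier A) \<in> ring_hom A RR.QQ \<and>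
   (\<forall>c. restrict \<phi> (carrier A) (\<eta> c) = reg_tensor \<eta> A (\<eta> c) \<one>\<^bsub>A\<^esub>) \<and>
   restrict \<phi> (carrier A) \<kappa> = dK \<and> restrict \<phi> (carrier A) \<kappa>h = dKh \<and> restrict \<phi> (carrier A) E = dE \<and> restrict \<phi> (carrier A) F = dF"
   by simp
 next
  fix D assume D: "D \<in> extensional (carrier A) \<and> D \<in> ring_hom A RR.QQ \<and> (\<forall>c. D (\<eta> c) = reg_tensor \<eta> A (\<eta> c) \<one>\<^bsub>A\<^esub>) \<and>
  D \<kappa> = dK \<and> D \<kappa>h = dKh \<and> D E = dE \<and> D F = dF"
  then have hom: "D \<in> ring_hom A RR.QQ" by blast
  have "D x = \<phi> x" if "x \<in> carrier A" for x using that by (induction rule: qu_induct)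
    (use D \<phi> ring_hom_add[OF hom] ring_hom_mult[OF hom] ring_hom_add[OF \<phi>(1)] ring_hom_mult[OF \<phi>(1)] in auto)
  then show "D = restrict \<phi> (carrier A)" using D by (intro extensionalityI[of _ "carrier A"]) auto
 qed
qed

lemma
 shows comult_hom: "qu_comult n q \<in> ring_hom A RR.QQ"
  and comult_unit: "qu_comult n q (\<eta> c) = reg_tensor \<eta> A (\<eta> c) \<one>\<^bsub>A\<^esub>"
  and comult_gens: "qu_comult n q \<kappa> = dK" "qu_comult n q \<kappa>h = dKh" "qu_comult n q E = dE" "qu_comult n q F = dF"
proof -
 have def: "qu_comult n q = (THE D. D \<in> extensional (carrier A) \<and> D \<in> ring_hom A RR.QQ \<and> (\<forall>c. D (\<eta> c) = reg_tensor \<eta> A (\<eta> c) \<one>\<^bsub>A\<^esub>) \<and>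
  D \<kappa> = dK \<and> D \<kappa>h = dKh \<and> D E = dE \<and> D F = dF)"
  unfolding qu_comult_def dK_def dKh_def dE_def dF_def ..
 note t = theI'[OF qu_comult_unique, folded def]
 show "qu_comult n q \<in> ring_hom A RR.QQ" "qu_comult n q (\<eta> c) = reg_tensor \<eta> A (\<eta> c) \<one>\<^bsub>A\<^esub>"
  "qu_comult n q \<kappa> = dK" "qu_comult n q \<kappa>h = dKh" "qu_comult n q E = dE" "qu_comult n q F = dF"
  using t by blast+
qed

end

context qtens
begin

text \<open>The tensor product module differs from the auxiliary module \<open>W\<close> only in its scalar multiplication.\<close>

sublocale Q: tensmod A \<eta> M L "qu_comult n q"
 by (intro tensmod.intro tens_axioms tensmod_axioms.intro comult_hom comult_unit)

abbreviation "V \<equiv> Q.W"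

lemma qu_tensor_eq: "qu_tensor n q M L = V" by (simp add: qu_tensor_def)

lemma V_W: "carrier V = carrier W" "x \<oplus>\<^bsub>V\<^esub> y = x \<oplus>\<^bsub>W\<^esub> y" "\<zero>\<^bsub>V\<^esub> = \<zero>\<^bsub>W\<^esub>" "Q.W.sc c x = scW c x"
proof -
 show "Q.W.sc c x = scW c x" unfolding Q.W.sc_def T.W.sc_def by (simp add: tensor_module_simps comult_unit)
qed (simp_all add: tensor_module_simps)

sublocale V: qmod n q V
 by (intro qmod.intro qparam_axioms Q.kmod_W)

lemma V_ops:
 "V.opk x = tact dK x" "V.opkh x = tact dKh x" "V.opE x = tactE x" "V.opF x = tactF x"
 unfolding V.op_defs by (simp_all add: tensor_module_simps comult_gens tactE_def tactF_def)

end

section \<open>Weight vectors and the structure of the modules \<open>P\<close>\<close>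

context qparam
begin

lemma N_ge: "N \<ge> 16" and n_even: "even n" and n_half_even: "even (n div 2)"
proof -
 obtain m where m: "n = 4 * m" "m > 0" using four_dvd n_pos by (auto simp: dvd_def)
 have "m * m \<ge> 1" using m by (simp add: Suc_le_eq)
 then show "N \<ge> 16" using m by (simp add: power2_eq_square)
 show "even n" "even (n div 2)" using m by auto
qed

lemma q_neq_1: "inverse q \<noteq> 1" "q \<noteq> 1" using q_pow_eq_1_iff[of 1] N_ge by (auto simp: field_simps)

lemma q_add: "q powi (a + b) = q powi a * q powi b" by (simp add: power_int_add)

lemma q_minus_Suc: "q powi (- int (Suc l)) = inverse q * q powi (- int l)" using q_add[of "- 1" "- int l"] by simp

text \<open>The structure constant of a string: for v of weight x,
  \<open>F E^l v = q^(-l) E^l F v + cc x l E^(l-1) v\<close>. Up to normalisation it is the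
  q-analogue of l (2x - l + 1); the factored form exhibits its zeros.\<close>

definition cc :: "int => nat => 'k" where
 "cc x l = (1 - q powi (- int l)) * (1 - q powi (2 * x - int l + 1)) / (1 - inverse q)"

lemma cc_0 [simp]: "cc x 0 = 0" by (simp add: cc_def)

lemma cc_Suc: "cc x (Suc l) = inverse q * cc x l + (1 - q powi (2 * (x - int l)))"
proof -
 define p a b where "p = inverse q" "a = q powi (- int l)" "b = q powi (2 * x - int l)"
 have pq: "p * q = 1" "1 - p \<noteq> 0" using q_neq_1 by (auto simp: p_a_b_def)
 have 1: "q powi (- int (Suc l)) = a * p" unfolding q_minus_Suc p_a_b_def by simp
 have 2: "q powi (2 * x - int (Suc l) + 1) = b" by (simp add: p_a_b_def algebra_simps)
 have 3: "q powi (2 * x - int l + 1) = b * q" by (simp add: p_a_b_def power_int_add_1)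
 have 4: "q powi (2 * (x - int l)) = a * b" by (simp add: p_a_b_def flip: power_int_add)
 have "(1 - a * p) * (1 - b) = p * ((1 - a) * (1 - b * q)) + (1 - a * b) * (1 - p)"
 proof -
  have "p * ((1 - a) * (1 - b * q)) = (1 - a) * (p - b * (p * q))" by (simp add: algebra_simps)
  then show ?thesis unfolding pq(1) by (simp add: algebra_simps)
 qed
 then show ?thesis unfolding cc_def 1 2 3 4 p_a_b_def(1)[symmetric] p_a_b_def(2)[symmetric] using pq(2)
  by (simp add: field_simps)
qed

lemma cc_eq_0_iff: "cc x l = 0 \<longleftrightarrow> int N dvd int l \<or> int N dvd 2 * x - int l + 1"
proof -
 have 1: "1 - q powi (- int l) = 0 \<longleftrightarrow> int N dvd int l"
  using q_powi_eq_1_iff[of "- int l"] by (metis dvd_minus_iff eq_iff_diff_eq_0)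
 have 2: "1 - q powi (2 * x - int l + 1) = 0 \<longleftrightarrow> int N dvd 2 * x - int l + 1"
  using q_powi_eq_1_iff by (metis eq_iff_diff_eq_0)
 show ?thesis unfolding cc_def divide_eq_0_iff mult_eq_0_iff 1 2 using q_neq_1 by simp
qed

lemma zdvd_bounded: assumes "int m dvd y" "- int m < y" "y < int m" shows "y = 0"
 using assms by (metis abs_less_iff dvd_imp_le_int minus_less_iff not_less abs_of_nat)

text \<open>For the weight i - 1 of \<alpha> the exponent 2i - 1 - l lies strictly between -N and N,
  so it is divisible by N only if it is 0. The string of \<alpha> thus breaks at a single
  place.\<close>

lemma cc_alpha_0_iff:
 assumes "1 \<le> i" "2 * i \<le> N" "0 < l" "l < N"
 shows "cc (int i - 1) l = 0 \<longleftrightarrow> l = 2 * i - 1"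
proof -
 have "\<not> int N dvd int l" using assms by (auto dest: zdvd_imp_le simp del: of_nat_power)
 moreover have "int N dvd 2 * (int i - 1) - int l + 1 \<longleftrightarrow> l = 2 * i - 1"
 proof
  assume "int N dvd 2 * (int i - 1) - int l + 1"
  then have "2 * (int i - 1) - int l + 1 = 0"
   by (rule zdvd_bounded) (use assms in \<open>auto simp del: of_nat_power\<close>)
  then show "l = 2 * i - 1" by arith
 next
  assume "l = 2 * i - 1"
  then have "2 * (int i - 1) - int l + 1 = 0" using assms by (simp add: of_nat_diff)
  then show "int N dvd 2 * (int i - 1) - int l + 1" by simp
 qed
 ultimately show ?thesis unfolding cc_eq_0_iff by blast
qed

lemma cc_gamma_0_iff:
 assumes "1 \<le> i" "2 * i \<le> N" "0 < l" "l < N"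
 shows "cc (- int i) l = 0 \<longleftrightarrow> l = N - 2 * i + 1"
proof -
 have "\<not> int N dvd int l" using assms by (auto dest: zdvd_imp_le simp del: of_nat_power)
 moreover have "int N dvd 2 * (- int i) - int l + 1 \<longleftrightarrow> l = N - 2 * i + 1"
 proof
  assume "int N dvd 2 * (- int i) - int l + 1"
  \<comment> \<open>For the weight -i of \<gamma> the exponent has to be shifted by N to lie between
    -N and N.\<close>
  then have "int N dvd (2 * (- int i) - int l + 1) + int N" by (rule dvd_add) simp
  then have "(2 * (- int i) - int l + 1) + int N = 0"
   by (rule zdvd_bounded) (use assms in \<open>auto simp del: of_nat_power\<close>)
  then show "l = N - 2 * i + 1" using assms(2) by linarith
 next
  assume "l = N - 2 * i + 1"
  then have "2 * (- int i) - int l + 1 = - int N" using assms by (simp add: of_nat_diff)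
  then show "int N dvd 2 * (- int i) - int l + 1" by simp
 qed
 ultimately show ?thesis unfolding cc_eq_0_iff by blast
qed

end

context qmod
begin

text \<open>For s equal to 1 or -1 these are characters of the torus. K acts by
  \<open>q^(2x)\<close>, E lowers x by one and F raises it by one. The sign separates the two
  characters with the same value of K, and x matters only modulo N/2
  (\<open>wt_cong\<close>).\<close>

definition wt :: "'k => int => 'm => bool" where
 "wt s x v \<longleftrightarrow> v \<in> carrier M \<and> opk v = sc (s * q powi (- int n * x)) v \<and>
  opkh v = sc (s * q powi ((2 - int n) * x)) v"

lemma wt_closed [dest]: "wt s x v ==> v \<in> carrier M" by (simp add: wt_def)

lemma wt_opE: assumes "wt s x v" shows "wt s (x - 1) (opE v)"
proof -
 have v: "v \<in> carrier M" using assms by auto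
 have 1: "q ^ n * (s * q powi (- int n * x)) = s * q powi (- int n * (x - 1))"
  by (simp add: power_int_add[symmetric] algebra_simps flip: power_int_of_nat)
 have "q ^ n * inverse (q ^ 2) = q powi (int n - 2)" by (simp add: power_int_diff field_simps)
 then have 2: "q ^ n * inverse (q ^ 2) * (s * q powi ((2 - int n) * x)) = s * q powi ((2 - int n) * (x - 1))"
  by (simp add: power_int_add[symmetric] algebra_simps)
 show ?thesis unfolding wt_def 1[symmetric] 2[symmetric] using assms v unfolding wt_def
  by (simp add: opk_opE opkh_opE op_sc)
qed

lemma wt_opF: assumes "wt s x v" shows "wt s (x + 1) (opF v)"
proof -
 have v: "v \<in> carrier M" using assms by auto
 have "inverse (q ^ n) = q powi (- int n)" by (simp add: power_int_minus)
 then have 1: "inverse (q ^ n) * (s * q powi (- int n * x)) = s * q powi (- int n * (x + 1))"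
  by (simp add: power_int_add[symmetric] algebra_simps)
 have "inverse (q ^ n) * q ^ 2 = q powi (2 - int n)" by (simp add: power_int_diff field_simps)
 then have 2: "inverse (q ^ n) * q ^ 2 * (s * q powi ((2 - int n) * x)) = s * q powi ((2 - int n) * (x + 1))"
  by (simp add: power_int_add[symmetric] algebra_simps)
 show ?thesis unfolding wt_def 1[symmetric] 2[symmetric] using assms v unfolding wt_def
  by (simp add: opk_opF opkh_opF op_sc)
qed

lemma wt_opE_pow: "wt s x v ==> wt s (x - int l) ((opE ^^ l) v)"
 by (induction l) (auto dest: wt_opE simp: algebra_simps)

lemma wt_opF_pow: "wt s x v ==> wt s (x + int l) ((opF ^^ l) v)"
 by (induction l) (auto dest: wt_opF simp: algebra_simps)

lemma wt_sc: "wt s x v ==> wt s x (sc c v)" by (auto simp: wt_def op_sc mult.commute)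

lemma wt_add: "[|wt s x v; wt s x w|] ==> wt s x (v \<oplus> w)"
 by (auto simp: wt_def op_add sc_add_right)

lemma wt_opK: assumes "wt s x v" "s \<noteq> 0" shows "opK v = sc (q powi (2 * x)) v"
proof -
 have v: "v \<in> carrier M" using assms by auto
 have eq: "q powi (2 * x) * (s * q powi (- int n * x)) = s * q powi ((2 - int n) * x)"
  by (simp add: power_int_add[symmetric] algebra_simps)
 have k: "opk v = sc (s * q powi (- int n * x)) v" "opkh v = sc (s * q powi ((2 - int n) * x)) v"
  using assms(1) unfolding wt_def by blast+
 have "opk (opK v) = opk (sc (q powi (2 * x)) v)" unfolding opk_opK[OF v] op_sc(1)[OF v] k sc_sc[OF v] eq ..
 then show ?thesis by (rule opk_inj) (use v in auto)
qed

lemma opF_opE_pow: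
 assumes v: "wt s x v" and s: "s \<noteq> 0"
 shows "opF ((opE ^^ l) v) = sc (q powi (- int l)) ((opE ^^ l) (opF v)) \<oplus> sc (cc x l) ((opE ^^ (l - 1)) v)"
proof (induction l)
 case 0
 then show ?case using v by auto
next
 case (Suc l)
 have vc: "v \<in> carrier M" using v by auto
 let ?w = "(opE ^^ l) v"
 have w: "?w \<in> carrier M" using vc by simp
 have K: "opK ?w = sc (q powi (2 * (x - int l))) ?w" using wt_opK[OF wt_opE_pow[OF v] s] .
 have E: "sc (cc x l) (opE ((opE ^^ (l - 1)) v)) = sc (cc x l) ?w" using vc by (cases l) auto
 let ?u = "opE ((opE ^^ l) (opF v))"
 have uc: "?u \<in> carrier M" using vc by simp
 have "opF ((opE ^^ Suc l) v) = sc (inverse q) (opE (opF ?w)) \<oplus> (?w \<oplus> sc (-1) (opK ?w))"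
  using w by (simp add: opF_opE)
 also have "opE (opF ?w) = sc (q powi (- int l)) ?u \<oplus> sc (cc x l) ?w"
  unfolding Suc using vc E by (simp add: op_add op_sc)
 also have "sc (inverse q) (sc (q powi (- int l)) ?u \<oplus> sc (cc x l) ?w) \<oplus> (?w \<oplus> sc (-1) (opK ?w))
   = sc (inverse q * q powi (- int l)) ?u \<oplus> (sc (inverse q * cc x l) ?w \<oplus> (sc 1 ?w \<oplus> sc (- (q powi (2 * (x - int l)))) ?w))"
  unfolding K using uc w by (simp add: sc_add_right M.a_assoc)
 also have "sc (inverse q * cc x l) ?w \<oplus> (sc 1 ?w \<oplus> sc (- (q powi (2 * (x - int l)))) ?w)
   = sc (inverse q * cc x l + (1 + - (q powi (2 * (x - int l))))) ?w"
  using w by (simp only: sc_add)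
 also have "inverse q * cc x l + (1 + - (q powi (2 * (x - int l)))) = cc x (Suc l)" unfolding cc_Suc by simp
 also have "inverse q * q powi (- int l) = q powi (- int (Suc l))" unfolding q_minus_Suc ..
 finally show ?case by simp
qed

lemma opE_pow_zero: "[|v \<in> carrier M; N \<le> l|] ==> (opE ^^ l) v = \<zero>"
 using opE_pow_N[of v] Nat.funpow_add[of "l - N" N opE] by (simp add: fun_eq_iff)

lemma opF_pow_split:
 assumes "m = k + (b + a)" "(opF ^^ b) ((opF ^^ a) v) = \<zero>" shows "(opF ^^ m) v = \<zero>"
 using assms by (simp add: Nat.funpow_add)

text \<open>The relations that hold between \<open>\<alpha>_(2i,j)\<close> and
  \<open>\<gamma>_(2i,j)\<close> in A, abstracted to an arbitrary module; see
  \<open>alpha_gamma_pair\<close>.\<close>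

definition ppair :: "nat => 'k => 'm => 'm => bool" where
 "ppair i s al ga \<longleftrightarrow> 1 \<le> i \<and> 2 * i \<le> N \<and> s \<noteq> 0 \<and> wt s (int i - 1) al \<and> wt s (- int i) ga \<and>
  opF al = \<zero> \<and> opF ga = (opE ^^ (2 * i - 2)) al"

lemma ppair_closed: "ppair i s al ga ==> al \<in> carrier M" "ppair i s al ga ==> ga \<in> carrier M"
 by (auto simp: ppair_def)

lemma opF_alpha: assumes "ppair i s al ga"
 shows "opF ((opE ^^ l) al) = sc (cc (int i - 1) l) ((opE ^^ (l - 1)) al)"
 using assms opF_opE_pow[of s "int i - 1" al l] by (auto simp: ppair_def)

lemma opF_gamma: assumes "ppair i s al ga"
 shows "opF ((opE ^^ l) ga) = sc (q powi (- int l)) ((opE ^^ (l + 2 * i - 2)) al) \<oplus> sc (cc (- int i) l) ((opE ^^ (l - 1)) ga)"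
proof -
 have e: "l + 2 * i - 2 = l + (2 * i - 2)" using assms by (auto simp: ppair_def)
 show ?thesis using assms opF_opE_pow[of s "- int i" ga l] unfolding e Nat.funpow_add o_apply by (simp add: ppair_def)
qed

lemma opF_pow_alpha: assumes p: "ppair i s al ga" and m: "m \<le> l"
 shows "(opF ^^ m) ((opE ^^ l) al) = sc (\<Prod>r<m. cc (int i - 1) (l - r)) ((opE ^^ (l - m)) al)" using m
proof (induction m)
 case (Suc m)
 then show ?case using ppair_closed[OF p] opF_alpha[OF p, of "l - m"] by (simp add: op_sc mult.commute)
qed (use ppair_closed[OF p] in simp)

lemma opF_pow_alpha_zero: assumes p: "ppair i s al ga" and m: "l < m"
 shows "(opF ^^ m) ((opE ^^ l) al) = \<zero>"
proof -
 have "(opF ^^ Suc l) ((opE ^^ l) al) = \<zero>"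
  using opF_pow_alpha[OF p, of l l] p ppair_closed[OF p] by (simp add: ppair_def op_sc)
 then show ?thesis by (intro opF_pow_split[of m "m - Suc l" 0 "Suc l"]) (use m in auto)
qed

text \<open>On its way down from \<open>E^l \<alpha>\<close> with l at least 2i - 1, F meets the
  zero of the structure constant at 2i - 1 and does not reach the part of the string below.\<close>

lemma opF_pow_alpha_zero': assumes p: "ppair i s al ga" and m: "l < m + (2 * i - 1)" "2 * i - 1 \<le> l" "l < N"
 shows "(opF ^^ m) ((opE ^^ l) al) = \<zero>"
proof (cases "m \<le> l")
 case True
 let ?r = "l - (2 * i - 1)"
 have i: "1 \<le> i" "2 * i \<le> N" using p by (auto simp: ppair_def)
 have "cc (int i - 1) (l - ?r) = 0" using cc_alpha_0_iff[of i "l - ?r"] i m by simp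
 moreover have "?r < m" using m by simp
 ultimately have pz: "(\<Prod>r<m. cc (int i - 1) (l - r)) = 0" by (intro prod_zero) auto
 show ?thesis unfolding opF_pow_alpha[OF p True] pz using ppair_closed[OF p] by simp
qed (use opF_pow_alpha_zero[OF p] in auto)

text \<open>The part along the string of \<gamma> is explicit, while the remainder c is left open:
  all that matters is that it stays at the position 2i - 1 above the current one on the string of
  \<alpha>.\<close>

lemma opF_pow_gamma: assumes p: "ppair i s al ga" and m: "m \<le> l"
 shows "\<exists>c. (opF ^^ m) ((opE ^^ l) ga) = sc (\<Prod>r<m. cc (- int i) (l - r)) ((opE ^^ (l - m)) ga)
  \<oplus> sc c ((opE ^^ (l - m + 2 * i - 1)) al)"
 using m
proof (induction m)
 case 0
 then show ?case using ppair_closed[OF p] by (intro exI[of _ 0]) simp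
next
 case (Suc m)
 note cl = ppair_closed[OF p]
 have i: "1 \<le> i" using p by (auto simp: ppair_def)
 let ?P = "\<lambda>m. \<Prod>r<m. cc (- int i) (l - r)"
 let ?k = "l - m + 2 * i - 2"
 obtain c where c: "(opF ^^ m) ((opE ^^ l) ga) = sc (?P m) ((opE ^^ (l - m)) ga) \<oplus> sc c ((opE ^^ (l - m + 2 * i - 1)) al)"
  using Suc by auto
 have k: "l - m + 2 * i - 1 - 1 = ?k" "l - Suc m + 2 * i - 1 = ?k" using i Suc.prems by auto
 have "(opF ^^ Suc m) ((opE ^^ l) ga) = sc (?P m) (opF ((opE ^^ (l - m)) ga)) \<oplus> sc c (opF ((opE ^^ (l - m + 2 * i - 1)) al))"
  using cl by (simp add: c op_add op_sc)
 also have "... = sc (?P m * q powi (- int (l - m))) ((opE ^^ ?k) al)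
  \<oplus> sc (?P (Suc m)) ((opE ^^ (l - Suc m)) ga) \<oplus> sc (c * cc (int i - 1) (l - m + 2 * i - 1)) ((opE ^^ ?k) al)"
  unfolding opF_gamma[OF p] opF_alpha[OF p] k using cl by (simp add: sc_add_right)
 also have "... = sc (?P (Suc m)) ((opE ^^ (l - Suc m)) ga) \<oplus>
  sc (?P m * q powi (- int (l - m)) + c * cc (int i - 1) (l - m + 2 * i - 1)) ((opE ^^ ?k) al)"
  using cl by (simp add: sc_add M.a_ac)
 finally show ?case unfolding k(2) by blast
qed

text \<open>The path of F: l steps down to \<gamma>, one to \<open>E^(2i-2) \<alpha>\<close>, then
  2i - 2 down to \<alpha>, and one to zero. The stray term at \<open>E^(2i-1) \<alpha>\<close> is
  killed at once.\<close>

lemma opF_pow_gamma_zero: assumes p: "ppair i s al ga" and m: "l + 2 * i \<le> m"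
 shows "(opF ^^ m) ((opE ^^ l) ga) = \<zero>"
proof -
 note cl = ppair_closed[OF p]
 have i: "1 \<le> i" "2 * i \<le> N" using p by (auto simp: ppair_def)
 obtain c where c: "(opF ^^ l) ((opE ^^ l) ga) = sc (\<Prod>r<l. cc (- int i) (l - r)) ga
  \<oplus> sc c ((opE ^^ (2 * i - 1)) al)"
  using opF_pow_gamma[OF p, of l l] by auto
 let ?a = "\<Prod>r<l. cc (- int i) (l - r)"
 have "cc (int i - 1) (2 * i - 1) = 0" using cc_alpha_0_iff[of i "2 * i - 1"] i by simp
 then have "(opF ^^ Suc l) ((opE ^^ l) ga) = sc ?a ((opE ^^ (2 * i - 2)) al)"
  using cl p opF_alpha[OF p, of "2 * i - 1"] by (simp add: c op_add op_sc ppair_def)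
 then have "(opF ^^ (2 * i - 1)) ((opF ^^ Suc l) ((opE ^^ l) ga)) = sc ?a \<zero>"
  using opF_pow_alpha_zero[OF p, of "2 * i - 2" "2 * i - 1"] i cl by (simp add: funpow_sc)
 then show ?thesis by (intro opF_pow_split[of m "m - (l + 2 * i)" "2 * i - 1" "Suc l"]) (use m i in auto)
qed

text \<open>Above its break at N - 2i + 1 the string of \<gamma> does not continue downwards but
  falls onto \<open>E^(N-1) \<alpha>\<close>, from where F stops at
  \<open>E^(2i-1) \<alpha>\<close>. For l = N - 2i + 1 + k this needs only l + 1 steps instead of l
  + 2i.\<close>

lemma opF_pow_gamma_zero': assumes p: "ppair i s al ga" and m: "k + N - 2 * i + 2 \<le> m" "N - 2 * i + 1 + k < N"
 shows "(opF ^^ m) ((opE ^^ (N - 2 * i + 1 + k)) ga) = \<zero>"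
proof -
 note cl = ppair_closed[OF p]
 have i: "1 \<le> i" "2 * i \<le> N" using p by (auto simp: ppair_def)
 let ?l = "N - 2 * i + 1 + k"
 have l: "?l - Suc k = N - 2 * i" "?l - k = N - 2 * i + 1" "N - 2 * i + 2 * i - 1 = N - 1" using i by auto
 obtain c where c: "(opF ^^ Suc k) ((opE ^^ ?l) ga) = sc (\<Prod>r<Suc k. cc (- int i) (?l - r)) ((opE ^^ (N - 2 * i)) ga)
  \<oplus> sc c ((opE ^^ (N - 1)) al)"
  using opF_pow_gamma[OF p, of "Suc k" ?l] l by auto
 have z: "cc (- int i) (?l - k) = 0" using cc_gamma_0_iff[of i "?l - k"] i m unfolding l by simp
 have "(\<Prod>r<Suc k. cc (- int i) (?l - r)) = 0" by (rule prod_zero, simp, rule bexI[of _ k], fact z, simp)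
 then have eq: "(opF ^^ Suc k) ((opE ^^ ?l) ga) = sc c ((opE ^^ (N - 1)) al)" using cl by (simp only: c) simp
 have z: "(opF ^^ (N - 2 * i + 1)) ((opE ^^ (N - 1)) al) = \<zero>"
  by (rule opF_pow_alpha_zero'[OF p]) (use i N_pos in auto)
 have "(opF ^^ (N - 2 * i + 1)) ((opF ^^ Suc k) ((opE ^^ ?l) ga)) = sc c \<zero>"
  unfolding eq funpow_sc(2)[OF funpow_closed(1)[OF cl(1)]] z ..
 moreover have "m = (m - (k + N - 2 * i + 2)) + ((N - 2 * i + 1) + Suc k)" using m i by simp
 ultimately show ?thesis by (intro opF_pow_split[of m _ "N - 2 * i + 1" "Suc k"]) (simp_all del: funpow.simps)
qed

end

lemma (in kmod) lc_reindex:
 assumes "inj_on h J" "b \<in> h ` J \<rightarrow> carrier M"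
 shows "lc (h ` J) b c = lc J (\<lambda>j. b (h j)) (\<lambda>j. c (h j))"
 unfolding lc_def using assms by (intro M.add.finprod_reindex) auto

lemma (in kmod) lc_cong2:
 assumes "b' \<in> I \<rightarrow> carrier M" "\<And>i. i \<in> I ==> b i = b' i" "\<And>i. i \<in> I ==> c i = c' i"
 shows "lc I b c = lc I b' c'" unfolding lc_def using assms by (intro M.finsum_cong') auto

section \<open>Families of pairs, the kernel and the image of F on their span\<close>

context qmod
begin

definition pfam :: "('t => 'm) => ('t => 'm) => 't \<times> bool \<times> nat => 'm" where
 "pfam al ga = (\<lambda>(t, g, l). (opE ^^ l) (if g then ga t else al t))"

definition pidx :: "'t set => ('t \<times> bool \<times> nat) set" where
 "pidx T = T \<times> UNIV \<times> {..<N}"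

definition pfamily :: "'t set => ('t => nat) => ('t => 'k) => ('t => 'm) => ('t => 'm) => bool" where
 "pfamily T i s al ga \<longleftrightarrow> finite T \<and> (\<forall>t\<in>T. ppair (i t) (s t) (al t) (ga t))"

text \<open>The matrix of \<open>F\<close> with respect to such a family.\<close>

definition Fcoeff :: "('t => nat) => ('t \<times> bool \<times> nat => 'k) => 't \<times> bool \<times> nat => 'k" where
 "Fcoeff i c = (\<lambda>(t, g, l).
  (if Suc l < N then cc (if g then - int (i t) else int (i t) - 1) (Suc l) * c (t, g, Suc l) else 0)
  + (if \<not> g \<and> 2 * i t - 2 \<le> l then q powi (- int (l - (2 * i t - 2))) * c (t, True, l - (2 * i t - 2)) else 0))"

lemma finite_pidx [simp]: "finite T ==> finite (pidx T)" by (simp add: pidx_def)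

lemma card_pidx: "finite T ==> card (pidx T) = 2 * N * card T" by (simp add: pidx_def card_cartesian_product)

lemma pfam_closed: assumes "pfamily T i s al ga" shows "pfam al ga \<in> pidx T \<rightarrow> carrier M"
 using assms ppair_closed unfolding pfamily_def pfam_def pidx_def by fastforce

lemma opF_pfam:
 assumes p: "pfamily T i s al ga"
 shows "opF (lc (pidx T) (pfam al ga) c) = lc (pidx T) (pfam al ga) (Fcoeff i c)"
proof -
 let ?I = "pidx T" and ?b = "pfam al ga"
 note b = pfam_closed[OF p]
 have fin: "finite ?I" using p by (simp add: pfamily_def)
 \<comment> \<open>The entry of F in row y and column x: a step down inside one string, or the fall
   from \<open>E^l \<gamma>\<close> to \<open>E^(l+2i-2) \<alpha>\<close>.\<close>
 define a :: "('a \<times> bool \<times> nat) => ('a \<times> bool \<times> nat) => 'k" where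
  "a y x = (case y of (t, g, l) =>
   (if x = (t, g, Suc l) then (if Suc l < N then cc (if g then - int (i t) else int (i t) - 1) (Suc l) else 0) else 0)
  + (if x = (t, True, l - (2 * i t - 2)) then (if \<not> g \<and> 2 * i t - 2 \<le> l then q powi (- int (l - (2 * i t - 2))) else 0) else 0))" for x y
 have "F \<odot> ?b x = lc ?I ?b (\<lambda>y. a y x)" if x: "x \<in> ?I" for x
 proof -
  obtain t g l where x_eq: "x = (t, g, l)" "t \<in> T" "l < N" using x by (auto simp: pidx_def)
  have pt: "ppair (i t) (s t) (al t) (ga t)" using p x_eq by (simp add: pfamily_def)
  note cl = ppair_closed[OF pt]
  have i: "1 \<le> i t" using pt by (simp add: ppair_def)
  let ?x = "if g then - int (i t) else int (i t) - 1"
  have mem: "(t, g, l - 1) \<in> ?I" using x_eq by (auto simp: pidx_def)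
  have first: "lc ?I ?b (\<lambda>y. if y = (t, g, l - 1) then cc ?x l else 0) = sc (cc ?x l) ((opE ^^ (l - 1)) (if g then ga t else al t))"
   by (subst lc_single[OF fin b mem]) (simp add: pfam_def)
  show ?thesis
  proof (cases g)
   case False
   have "lc ?I ?b (\<lambda>y. a y x) = lc ?I ?b (\<lambda>y. if y = (t, g, l - 1) then cc ?x l else 0)"
   proof (rule lc_cong[OF b])
    fix y assume "y \<in> ?I"
    then obtain t' g' l' where y: "y = (t', g', l')" "l' < N" by (auto simp: pidx_def)
    show "a y x = (if y = (t, g, l - 1) then cc ?x l else 0)" using False x_eq y by (cases l) (auto simp: a_def)
   qed
   then show ?thesis using first False opF_alpha[OF pt, of l] x_eq by (simp add: pfam_def opF_def)
  next
   case True
   let ?second = "\<lambda>y. if y = (t, False, l + 2 * i t - 2) then (if l + 2 * i t - 2 < N then q powi (- int l) else 0) else 0"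
   have "lc ?I ?b (\<lambda>y. a y x) = lc ?I ?b (\<lambda>y. (if y = (t, g, l - 1) then cc ?x l else 0) + ?second y)"
   proof (rule lc_cong[OF b])
    fix y assume "y \<in> ?I"
    then obtain t' g' l' where y: "y = (t', g', l')" "l' < N" by (auto simp: pidx_def)
    have 1: "(if x = (t', g', Suc l') then (if Suc l' < N then cc (if g' then - int (i t') else int (i t') - 1) (Suc l') else 0) else 0)
      = (if y = (t, g, l - 1) then cc ?x l else 0)"
     using x_eq y by (cases l) auto
    have 2: "(if x = (t', True, l' - (2 * i t' - 2)) then (if \<not> g' \<and> 2 * i t' - 2 \<le> l' then q powi (- int (l' - (2 * i t' - 2))) else 0) else 0)
      = ?second y"
    proof (cases "y = (t, False, l + 2 * i t - 2)")
     case True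
     then have "l' - (2 * i t - 2) = l" "2 * i t - 2 \<le> l'" "t' = t" "\<not> g'" using y i by auto
     then show ?thesis using True x_eq y \<open>g\<close> by simp
    next
     case False
     then show ?thesis using x_eq y \<open>g\<close> i by auto
    qed
    show "a y x = (if y = (t, g, l - 1) then cc ?x l else 0) + ?second y"
     unfolding 1[symmetric] 2[symmetric] by (simp add: a_def y)
   qed
   also have "... = sc (cc ?x l) ((opE ^^ (l - 1)) (ga t)) \<oplus> lc ?I ?b ?second"
    using first True by (subst lc_add[OF fin b]) simp
   also have "lc ?I ?b ?second = sc (q powi (- int l)) ((opE ^^ (l + 2 * i t - 2)) (al t))"
   proof (cases "l + 2 * i t - 2 < N")
    case True
    then have "(t, False, l + 2 * i t - 2) \<in> ?I" using x_eq by (auto simp: pidx_def)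
    then show ?thesis using True lc_single[OF fin b] by (simp add: pfam_def)
   next
    \<comment> \<open>Beyond N - 1 the target of the fall is zero in the module, which agrees with
      its absence from the index set.\<close>
    case False
    then show ?thesis using b cl opE_pow_zero[of "al t" "l + 2 * i t - 2"] by (simp add: if_distrib cong: if_cong)
   qed
   finally show ?thesis using True opF_gamma[OF pt, of l] x_eq cl by (simp add: pfam_def opF_def[symmetric] M.a_comm)
  qed
 qed
 then have "lc ?I (\<lambda>x. F \<odot> ?b x) c = lc ?I ?b (\<lambda>y. \<Sum>x\<in>?I. a y x * c x)"
  by (intro lc_matrix fin b) auto
 also have "... = lc ?I ?b (Fcoeff i c)"
 proof (rule lc_cong[OF b])
  fix y assume y: "y \<in> ?I"
  then obtain t g l where y_eq: "y = (t, g, l)" "t \<in> T" "l < N" by (auto simp: pidx_def)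
  have delta: "(\<Sum>x\<in>?I. (if x = z then k else 0) * c x) = (if z \<in> ?I then k * c z else 0)" for z k
  proof -
   have "(\<Sum>x\<in>?I. (if x = z then k else 0) * c x) = (\<Sum>x\<in>?I. (if x = z then k * c x else 0))"
    by (rule sum.cong) auto
   then show ?thesis using fin by (simp add: sum.delta)
  qed
  show "(\<Sum>x\<in>?I. a y x * c x) = Fcoeff i c y"
   unfolding y_eq a_def prod.case distrib_right sum.distrib delta Fcoeff_def using y_eq by (auto simp: pidx_def)
 qed
 finally show ?thesis unfolding opF_def by (subst lc_act[OF fin b]) auto
qed

text \<open>A coefficient on the string of \<gamma> is forced to vanish by the row just below it,
  except at 0 and at the break N - 2i + 1. These two are caught by the rows 2i - 2 and N - 1 of the
  string of \<alpha>, where the term from the string of \<alpha> itself is zero or absent.\<close>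

lemma Fcoeff_ker:
 assumes p: "pfamily T i s al ga" and c: "\<And>x. x \<in> pidx T ==> Fcoeff i c x = 0" and t: "t \<in> T" and l: "l < N"
 shows "c (t, True, l) = 0" "l \<noteq> 0 ==> l \<noteq> 2 * i t - 1 ==> c (t, False, l) = 0"
proof -
 have i: "1 \<le> i t" "2 * i t \<le> N" using p t by (auto simp: pfamily_def ppair_def)
 have G: "c (t, True, l) = 0" if "l < N" for l
 proof -
  consider "l = 0" | "l = N - 2 * i t + 1" | l' where "l = Suc l'" "l \<noteq> N - 2 * i t + 1" by (cases l) auto
  then show ?thesis
  proof cases
   case 1
   have "cc (int (i t) - 1) (Suc (2 * i t - 2)) = 0" if "Suc (2 * i t - 2) < N"
    using cc_alpha_0_iff[of "i t" "Suc (2 * i t - 2)"] i that by auto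
   moreover have "2 * i t - 2 < N" using i N_pos by linarith
   ultimately show ?thesis using c[of "(t, False, 2 * i t - 2)"] t 1 by (auto simp: pidx_def Fcoeff_def split: if_splits)
  next
   case 2
   have "N - 1 - (2 * i t - 2) = l" "2 * i t - 2 \<le> N - 1" "\<not> Suc (N - 1) < N" using 2 i N_pos by auto
   then show ?thesis using c[of "(t, False, N - 1)"] t N_pos by (auto simp: pidx_def Fcoeff_def)
  next
   case 3
   then have "cc (- int (i t)) l \<noteq> 0" using cc_gamma_0_iff[of "i t" l] i that by auto
   then show ?thesis using c[of "(t, True, l')"] t 3 that by (auto simp: pidx_def Fcoeff_def)
  qed
 qed
 show "c (t, True, l) = 0" by (rule G[OF l])
 assume l': "l \<noteq> 0" "l \<noteq> 2 * i t - 1"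
 then obtain m where m: "l = Suc m" by (cases l) auto
 have "cc (int (i t) - 1) l \<noteq> 0" using cc_alpha_0_iff[of "i t" l] i l' l by auto
 moreover have "c (t, True, m - (2 * i t - 2)) = 0" by (rule G) (use l m in linarith)
 ultimately show "c (t, False, l) = 0" using c[of "(t, False, m)"] t l m
  by (auto simp: pidx_def Fcoeff_def split: if_splits)
qed

text \<open>The spanning vectors of ker F found in \<open>Fcoeff_ker_lc\<close>. Here the flag does
  not refer to \<gamma>: it distinguishes \<open>E^(2i-1) \<alpha>\<close> from \<alpha>.\<close>

definition kfam :: "('t => nat) => ('t => 'm) => 't \<times> bool => 'm" where
 "kfam i al = (\<lambda>(t, g). (opE ^^ (if g then 2 * i t - 1 else 0)) (al t))"

lemma Fcoeff_ker_lc: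
 assumes p: "pfamily T i s al ga" and c: "\<And>x. x \<in> pidx T ==> Fcoeff i c x = 0"
 shows "lc (pidx T) (pfam al ga) c
  = lc (T \<times> UNIV) (kfam i al) (\<lambda>(t, g). c (t, False, if g then 2 * i t - 1 else 0))"
proof -
 let ?h = "\<lambda>(t, g). (t, False, if g then 2 * i t - 1 else (0::nat))"
 have i: "1 \<le> i t" "2 * i t \<le> N" if "t \<in> T" for t using p that by (auto simp: pfamily_def ppair_def)
 have inj: "inj_on ?h (T \<times> UNIV)" using i by (fastforce simp: inj_on_def split: if_splits)
 have sub: "?h ` (T \<times> UNIV) \<subseteq> pidx T" using i N_pos by (fastforce simp: pidx_def split: if_splits)
 have fin: "finite T" using p by (simp add: pfamily_def)
 have "lc (pidx T) (pfam al ga) c = lc (?h ` (T \<times> UNIV)) (pfam al ga) c"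
 proof (rule lc_mono_neutral[OF _ sub pfam_closed[OF p]])
  fix x assume x: "x \<in> pidx T - ?h ` (T \<times> UNIV)"
  then obtain t g l where x_eq: "x = (t, g, l)" "t \<in> T" "l < N" by (auto simp: pidx_def)
  have m: "(t, False, 0) \<in> ?h ` (T \<times> UNIV)" "(t, False, 2 * i t - 1) \<in> ?h ` (T \<times> UNIV)"
   by (rule image_eqI[of _ _ "(t, False)"], use x_eq in simp_all)
    (rule image_eqI[of _ _ "(t, True)"], use x_eq in simp_all)
  show "c x = 0"
  proof (cases g)
   case True
   then show ?thesis using Fcoeff_ker[OF p c x_eq(2,3)] x_eq by simp
  next
   case False
   then have nx: "(t, False, l) \<notin> ?h ` (T \<times> UNIV)" using x unfolding x_eq by (simp only: Diff_iff simp_thms)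
   have "l \<noteq> 0" using nx m(1) by (rule_tac notI) (simp only: simp_thms)
   moreover have "l \<noteq> 2 * i t - 1" using nx m(2) by (rule_tac notI) (simp only: simp_thms)
   ultimately have "l \<noteq> 0" "l \<noteq> 2 * i t - 1" by blast+
   then show ?thesis using Fcoeff_ker(2)[OF p c x_eq(2,3)] x_eq False by simp
  qed
 qed (use fin in simp)
 also have "... = lc (T \<times> UNIV) (\<lambda>x. pfam al ga (?h x)) (\<lambda>x. c (?h x))"
  by (rule lc_reindex[OF inj]) (use sub pfam_closed[OF p] in auto)
 also have "... = lc (T \<times> UNIV) (kfam i al) (\<lambda>(t, g). c (t, False, if g then 2 * i t - 1 else 0))"
 proof (rule lc_cong2)
  have "al t \<in> carrier M" if "t \<in> T" for t
   using p that ppair_closed(1)[of "i t" "s t" "al t" "ga t"] by (auto simp: pfamily_def)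
  then show "kfam i al \<in> T \<times> UNIV \<rightarrow> carrier M" by (auto simp: kfam_def)
 qed (auto simp: kfam_def pfam_def)
 finally show ?thesis .
qed

text \<open>F maps a relation to a relation of smaller height. If the latter is trivial, the former
  only involves vectors of ker F; so independence has to be known there alone.\<close>

lemma pfam_independent:
 assumes p: "pfamily T i s al ga"
  and ind: "\<And>c x. [|lc (T \<times> UNIV) (kfam i al) c = \<zero>; x \<in> T \<times> UNIV|] ==> c x = 0"
  and c: "lc (pidx T) (pfam al ga) c = \<zero>" and x: "x \<in> pidx T"
 shows "c x = 0"
proof -
 \<comment> \<open>Every vector on a string of \<gamma> is placed above all vectors on strings of
   \<alpha>, so that F lowers the height even when it crosses from one string to the other. All
   heights are below 3N.\<close>
 define ht :: "'a \<times> bool \<times> nat => nat" where "ht = (\<lambda>(t, g, l). l + (if g then 2 * N else 0))"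
 have main: "\<forall>x\<in>pidx T. c x = 0"
  if "lc (pidx T) (pfam al ga) c = \<zero>" "\<forall>x\<in>pidx T. h \<le> ht x \<longrightarrow> c x = 0" for h c
  using that
 proof (induction h arbitrary: c)
  case (Suc h)
  have F0: "\<forall>x\<in>pidx T. Fcoeff i c x = 0"
  proof (rule Suc.IH)
   show "lc (pidx T) (pfam al ga) (Fcoeff i c) = \<zero>" using opF_pfam[OF p, of c] Suc.prems(1) by simp
   show "\<forall>x\<in>pidx T. h \<le> ht x \<longrightarrow> Fcoeff i c x = 0"
   proof (intro ballI impI)
    fix x assume x: "x \<in> pidx T" "h \<le> ht x"
    then obtain t g l where x_eq: "x = (t, g, l)" "t \<in> T" "l < N" by (auto simp: pidx_def)
    have i: "1 \<le> i t" "2 * i t \<le> N" using p x_eq by (auto simp: pfamily_def ppair_def)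
    have 1: "c (t, g, Suc l) = 0" if "Suc l < N" using Suc.prems(2) x x_eq that by (auto simp: pidx_def ht_def)
    have 2: "c (t, True, l - (2 * i t - 2)) = 0" if "\<not> g"
    proof -
     have "Suc h \<le> ht (t, True, l - (2 * i t - 2))" using x x_eq that i by (simp add: ht_def)
     moreover have "(t, True, l - (2 * i t - 2)) \<in> pidx T" using x_eq by (auto simp: pidx_def)
     ultimately show ?thesis using Suc.prems(2) by blast
    qed
    show "Fcoeff i c x = 0" using 1 2 by (cases g) (auto simp: Fcoeff_def x_eq)
   qed
  qed
  show ?case
  proof
   fix x assume x: "x \<in> pidx T"
   then obtain t g l where x_eq: "x = (t, g, l)" "t \<in> T" "l < N" by (auto simp: pidx_def)
   have F0': "\<And>x. x \<in> pidx T ==> Fcoeff i c x = 0" using F0 by blast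
   have k: "c (t, False, if g then 2 * i t - 1 else 0) = 0" for g
    using ind[OF Fcoeff_ker_lc[OF p F0', symmetric, unfolded Suc.prems(1)], of "(t, g)"] x_eq by simp
   show "c x = 0" using Fcoeff_ker[OF p F0' x_eq(2,3)] k[of True] k[of False] x_eq by (cases g) auto
  qed
 qed auto
 have "\<forall>x\<in>pidx T. 3 * N \<le> ht x \<longrightarrow> c x = 0" by (auto simp: pidx_def ht_def)
 from main[OF c this] x show ?thesis by blast
qed

text \<open>Any nonzero submodule contains a nonzero vector killed by \<open>F\<close>, hence \<open>E\<^bsup>2i-1\<^esup> \<alpha>\<close>.\<close>

lemma submodule_contains_socle_vector:
 assumes p: "pfamily {t} i s al ga" and B: "kbasis (pidx {t}) (pfam al ga)"
  and H: "H \<subseteq> carrier M" "\<And>a x. [|a \<in> carrier A; x \<in> H|] ==> a \<odot> x \<in> H"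
  and x: "x \<in> H" "x \<noteq> \<zero>"
 shows "(opE ^^ (2 * i t - 1)) (al t) \<in> H"
proof -
 have pt: "ppair (i t) (s t) (al t) (ga t)" using p by (simp add: pfamily_def)
 note cl = ppair_closed[OF pt]
 have i: "1 \<le> i t" "2 * i t \<le> N" using pt by (auto simp: ppair_def)
 have powH: "(opF ^^ r) y \<in> H" "(opE ^^ r) y \<in> H" "sc c y \<in> H" if "y \<in> H" for r y c
  using that H(2) by (induction r) (auto simp: op_defs sc_def)
 have "\<exists>r. (opF ^^ r) x \<noteq> \<zero> \<and> (opF ^^ Suc r) x = \<zero>"
 proof (rule ccontr)
  assume "\<not> ?thesis"
  then have "(opF ^^ r) x \<noteq> \<zero>" for r by (induction r) (use x in auto)
  then show False using opF_pow_N x H by blast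
 qed
 then obtain r where r: "(opF ^^ r) x \<noteq> \<zero>" "opF ((opF ^^ r) x) = \<zero>" by auto
 define y where "y = (opF ^^ r) x"
 have y: "y \<in> H" "y \<in> carrier M" "y \<noteq> \<zero>" "opF y = \<zero>" using r powH x H by (auto simp: y_def)
 obtain c where c: "y = lc (pidx {t}) (pfam al ga) c" using kbasisD(3)[OF B y(2)] by blast
 have "lc (pidx {t}) (pfam al ga) (Fcoeff i c) = \<zero>" using y opF_pfam[OF p, of c] c by simp
 then have Fc: "\<And>x. x \<in> pidx {t} ==> Fcoeff i c x = 0" using kbasisD(4)[OF B] by blast
 define a b where "a = c (t, False, 0)" "b = c (t, False, 2 * i t - 1)"
 let ?w = "(opE ^^ (2 * i t - 1)) (al t)"
 have kcl: "kfam i al \<in> I \<rightarrow> carrier M" if "I \<subseteq> {t} \<times> UNIV" for I using that cl by (auto simp: kfam_def)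
 have set: "{t} \<times> UNIV = {(t, False), (t, True)}" by (auto simp: UNIV_bool)
 have "y = lc {(t, False), (t, True)} (kfam i al) (\<lambda>(t, g). c (t, False, if g then 2 * i t - 1 else 0))"
  using Fcoeff_ker_lc[OF p Fc] c unfolding set by simp
 also have "... = sc a (al t) \<oplus> sc b ?w" using cl by (simp add: lc_insert kfam_def a_b_def)
 finally have ya: "y = sc a (al t) \<oplus> sc b ?w" .
 show ?thesis
 proof (cases "a = 0")
  case True
  then have "y = sc b ?w" "b \<noteq> 0" using ya y cl by auto
  then have "?w = sc (inverse b) y" using cl by simp
  then show ?thesis using powH(3) y by simp
 next
  \<comment> \<open>\<open>E^(N-1)\<close> removes the second term of y. From
    \<open>E^(N-1) \<alpha>\<close> the N - 2i steps down to \<open>E^(2i-1) \<alpha>\<close> meet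
    no zero of the structure constant.\<close>
  case False
  let ?z = "(opE ^^ (N - 1)) (al t)"
  have "(opE ^^ (N - 1)) ?w = (opE ^^ (N - 1 + (2 * i t - 1))) (al t)" by (simp add: Nat.funpow_add)
  also have "... = \<zero>" by (rule opE_pow_zero) (use cl i N_pos in auto)
  finally have "(opE ^^ (N - 1)) y = sc a ?z" using cl unfolding ya by (simp add: funpow_add funpow_sc)
  then have "?z = sc (inverse a) ((opE ^^ (N - 1)) y)" using cl False by simp
  then have z: "?z \<in> H" using powH y by simp
  define P where "P = (\<Prod>r<N - 2 * i t. cc (int (i t) - 1) (N - 1 - r))"
  have "N - 1 - (N - 2 * i t) = 2 * i t - 1" using i N_pos by simp
  then have F: "(opF ^^ (N - 2 * i t)) ?z = sc P ?w"
   using opF_pow_alpha[OF pt, of "N - 2 * i t" "N - 1"] i by (simp add: P_def)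
  have "P \<noteq> 0" unfolding P_def using i cc_alpha_0_iff[of "i t"] by auto
  then have "?w = sc (inverse P) ((opF ^^ (N - 2 * i t)) ?z)" using F cl by simp
  then show ?thesis using powH z by simp
 qed
qed

text \<open>Modulo the image of F only the two vectors \<open>E^(N-1) \<gamma>\<close> and
  \<open>E^(N-2i) \<gamma>\<close> remain, and \<open>F^(N-1)\<close> sends them to nonzero
  multiples of the independent vectors \<open>E^(2i-1) \<alpha>\<close> and \<alpha>. So
  \<open>F^(N-1) x = 0\<close> removes both.\<close>

lemma F_exact:
 assumes p: "pfamily {t} i s al ga" and B: "kbasis (pidx {t}) (pfam al ga)"
  and x: "x \<in> carrier M" "(opF ^^ (N - 1)) x = \<zero>"
 shows "\<exists>y\<in>carrier M. opF y = x"
proof -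
 have pt: "ppair (i t) (s t) (al t) (ga t)" using p by (simp add: pfamily_def)
 note cl = ppair_closed[OF pt]
 define m where "m = i t"
 have i: "1 \<le> m" "2 * m \<le> N" using pt by (auto simp: ppair_def m_def)
 note b = pfam_closed[OF p]
 have fin: "finite (pidx {t})" by simp
 obtain c where c: "x = lc (pidx {t}) (pfam al ga) c" using kbasisD(3)[OF B x(1)] by blast
 \<comment> \<open>The preimage is solved for row by row. The coefficients of \<gamma> at 0 and N -
   2m + 1 do not occur in rows of their own string; they are used for the rows 2m - 2 and N - 1 of
   the string of \<alpha>, which have no other unknown.\<close>
 define dG where "dG l = (if l = 0 then c (t, False, 2 * m - 2) else if l = N - 2 * m + 1
  then q powi (int (N - 2 * m + 1)) * c (t, False, N - 1) else c (t, True, l - 1) / cc (- int m) l)" for l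
 define dA where "dA l = (c (t, False, l - 1) - (if 2 * m - 2 \<le> l - 1 then q powi (- int (l - 1 - (2 * m - 2))) * dG (l - 1 - (2 * m - 2)) else 0)) / cc (int m - 1) l" for l
 define d :: "'a \<times> bool \<times> nat => 'k" where "d = (\<lambda>(t, g, l). if g then dG l else dA l)"
 \<comment> \<open>The two rows that F does not reach.\<close>
 define e where "e y = (if y = (t, True, N - 1) then c y else 0) + (if y = (t, True, N - 2 * m) then c y else 0)" for y
 have "c y = Fcoeff i d y + e y" if mem: "y \<in> pidx {t}" for y
 proof -
  obtain g l where y: "y = (t, g, l)" "l < N" using mem by (auto simp: pidx_def)
  show ?thesis
  proof (cases g)
   case True
   consider "l = N - 1" | "l = N - 2 * m" "Suc l < N" | "Suc l < N" "l \<noteq> N - 2 * m" using y by linarith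
   then show ?thesis
   proof cases
    case 1
    then show ?thesis using True y i N_pos by (simp add: Fcoeff_def e_def)
   next
    case 2
    have "cc (- int m) (Suc l) = 0" using cc_gamma_0_iff[of m "Suc l"] i 2 by auto
    then show ?thesis using True y i 2 by (auto simp: Fcoeff_def e_def m_def[symmetric])
   next
    case 3
    then have "cc (- int m) (Suc l) \<noteq> 0" using cc_gamma_0_iff[of m "Suc l"] i by auto
    then show ?thesis using True y i 3 by (auto simp: Fcoeff_def e_def d_def dG_def m_def[symmetric])
   qed
  next
   case False
   consider "l = N - 1" | "l = 2 * m - 2" "Suc l < N" | "Suc l < N" "l \<noteq> 2 * m - 2" using y by linarith
   then show ?thesis
   proof cases
    case 1
    have e: "N - 1 - (2 * m - 2) = N - 2 * m + 1" "2 * m - 2 \<le> N - 1" "\<not> Suc (N - 1) < N" using i N_pos by auto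
    have "Fcoeff i d (t, False, N - 1) = q powi (- int (N - 2 * m + 1)) * dG (N - 2 * m + 1)"
     unfolding Fcoeff_def d_def prod.case unfolding m_def[symmetric] e(1) using e(2,3) by simp
    moreover have "dG (N - 2 * m + 1) = q powi int (N - 2 * m + 1) * c (t, False, N - 1)" by (simp add: dG_def)
    moreover have "q powi (- int (N - 2 * m + 1)) * q powi int (N - 2 * m + 1) = 1" by (simp only: q_add[symmetric]) simp
    ultimately have "Fcoeff i d (t, False, N - 1) = c (t, False, N - 1)"
     by (simp only: mult.assoc[symmetric] mult_1_left)
    then show ?thesis using False y 1 by (simp add: e_def)
   next
    case 2
    have "cc (int m - 1) (Suc l) = 0" using cc_alpha_0_iff[of m "Suc l"] i 2 by auto
    then show ?thesis using False y 2 by (simp add: Fcoeff_def e_def d_def dG_def m_def[symmetric])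
   next
    case 3
    then have "cc (int m - 1) (Suc l) \<noteq> 0" using cc_alpha_0_iff[of m "Suc l"] i by auto
    then show ?thesis using False y 3 by (simp add: Fcoeff_def e_def d_def dA_def m_def[symmetric])
   qed
  qed
 qed
 then have "x = lc (pidx {t}) (pfam al ga) (\<lambda>y. Fcoeff i d y + e y)" unfolding c by (intro lc_cong[OF b]) auto
 also have "... = opF (lc (pidx {t}) (pfam al ga) d) \<oplus> lc (pidx {t}) (pfam al ga) e"
  by (simp add: lc_add[OF fin b] opF_pfam[OF p])
 finally have x1: "x = opF (lc (pidx {t}) (pfam al ga) d) \<oplus> lc (pidx {t}) (pfam al ga) e" .
 define c1 c2 where "c1 = c (t, True, N - 1)" "c2 = c (t, True, N - 2 * m)"
 let ?G1 = "(opE ^^ (N - 1)) (ga t)" and ?G2 = "(opE ^^ (N - 2 * m)) (ga t)"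
 have ee: "lc (pidx {t}) (pfam al ga) e = sc c1 ?G1 \<oplus> sc c2 ?G2"
 proof -
  have "lc (pidx {t}) (pfam al ga) e = lc (pidx {t}) (pfam al ga)
   (\<lambda>y. (if y = (t, True, N - 1) then c1 else 0) + (if y = (t, True, N - 2 * m) then c2 else 0))"
   by (rule lc_cong[OF b]) (auto simp: e_def c1_c2_def)
  then show ?thesis using i N_pos
   by (simp only: lc_add[OF fin b], subst (1 2) lc_single[OF fin b]) (auto simp: pidx_def pfam_def)
 qed
 have y: "lc (pidx {t}) (pfam al ga) d \<in> carrier M" using b by auto
 have top: "(opF ^^ (N - 1)) (opF (lc (pidx {t}) (pfam al ga) d)) = \<zero>"
  using opF_pow_N[OF y] N_pos by (metis Suc_diff_1 funpow_Suc_right comp_apply)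
 have F0: "sc c1 ((opF ^^ (N - 1)) ?G1) \<oplus> sc c2 ((opF ^^ (N - 1)) ?G2) = \<zero>"
  using x(2) top cl y unfolding x1 ee by (simp add: funpow_add funpow_sc)
 let ?A1 = "(opE ^^ (2 * m - 1)) (al t)"
 \<comment> \<open>Down the string of \<gamma> to its break, across to
   \<open>E^(N-1) \<alpha>\<close>, down to \<open>E^(2m-1) \<alpha>\<close>: (2m - 2) + 1 + (N -
   2m) = N - 1 steps, all with nonzero factors.\<close>
 have G1: "\<exists>k. k \<noteq> 0 \<and> (opF ^^ (N - 1)) ?G1 = sc k ?A1"
 proof -
  define P where "P = (\<Prod>r<2 * m - 2. cc (- int m) (N - 1 - r))"
  define P' where "P' = (\<Prod>r<N - 2 * m. cc (int m - 1) (N - 1 - r))"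
  have e: "N - 1 - (2 * m - 2) = N - 2 * m + 1" "N - 2 * m + 1 + 2 * m - 1 = N" "N - 2 * m + 1 + 2 * m - 2 = N - 1"
   "N - 1 - (N - 2 * m) = 2 * m - 1" "2 * m - 2 \<le> N - 1" "N - 2 * m \<le> N - 1" using i N_pos by auto
  obtain k where k: "(opF ^^ (2 * m - 2)) ?G1 = sc P ((opE ^^ (N - 2 * m + 1)) (ga t)) \<oplus> sc k ((opE ^^ N) (al t))"
   using opF_pow_gamma[OF pt, of "2 * m - 2" "N - 1"] e unfolding m_def[symmetric] P_def by auto
  have "cc (- int m) (N - 2 * m + 1) = 0" if "N - 2 * m + 1 < N" using cc_gamma_0_iff[of m "N - 2 * m + 1"] i that by simp
  then have cz: "cc (- int m) (N - 2 * m + 1) = 0" using i by simp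
  have "(opF ^^ (2 * m - 2)) ?G1 = sc P ((opE ^^ (N - 2 * m + 1)) (ga t))" unfolding k opE_pow_N[OF cl(1)] using cl by simp
  then have "opF ((opF ^^ (2 * m - 2)) ?G1) = sc P (opF ((opE ^^ (N - 2 * m + 1)) (ga t)))"
   using op_sc(5)[of "(opE ^^ (N - 2 * m + 1)) (ga t)" P] cl by (simp del: funpow.simps)
  also have "opF ((opE ^^ (N - 2 * m + 1)) (ga t)) = sc (q powi (- int (N - 2 * m + 1))) ((opE ^^ (N - 1)) (al t))"
   using opF_gamma[OF pt, of "N - 2 * m + 1"] cl unfolding m_def[symmetric] e cz by (simp del: funpow.simps)
  finally have 1: "(opF ^^ Suc (2 * m - 2)) ?G1 = sc (P * q powi (- int (N - 2 * m + 1))) ((opE ^^ (N - 1)) (al t))"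
   using cl by simp
  have 2: "(opF ^^ (N - 2 * m)) ((opE ^^ (N - 1)) (al t)) = sc P' ?A1"
   using opF_pow_alpha[OF pt e(6)] unfolding m_def[symmetric] e P'_def .
  have "N - 1 = (N - 2 * m) + Suc (2 * m - 2)" using i by simp
  then have "(opF ^^ (N - 1)) ?G1 = (opF ^^ (N - 2 * m)) ((opF ^^ Suc (2 * m - 2)) ?G1)"
   by (metis Nat.funpow_add comp_apply)
  also have "... = sc (P * q powi (- int (N - 2 * m + 1)) * P') ?A1"
   unfolding 1 funpow_sc(2)[OF funpow_closed(1)[OF cl(1)]] 2 using cl by simp
  finally have "(opF ^^ (N - 1)) ?G1 = sc (P * q powi (- int (N - 2 * m + 1)) * P') ?A1" .
  moreover have "P \<noteq> 0" unfolding P_def using i cc_gamma_0_iff[of m] by auto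
  moreover have "P' \<noteq> 0" unfolding P'_def using i cc_alpha_0_iff[of m] by auto
  ultimately show ?thesis by (intro exI[of _ "P * q powi (- int (N - 2 * m + 1)) * P'"]) simp
 qed
 \<comment> \<open>N - 2m steps down to \<gamma>, one across to \<open>E^(2m-2) \<alpha>\<close> and
   2m - 2 down to \<alpha>, again N - 1 in all.\<close>
 have G2: "\<exists>k. k \<noteq> 0 \<and> (opF ^^ (N - 1)) ?G2 = sc k (al t)"
 proof -
  define P where "P = (\<Prod>r<N - 2 * m. cc (- int m) (N - 2 * m - r))"
  define P' where "P' = (\<Prod>r<2 * m - 2. cc (int m - 1) (2 * m - 2 - r))"
  have e: "0 + 2 * m - 1 = 2 * m - 1" "2 * m - 1 - 1 = 2 * m - 2" using i by auto
  obtain k where k: "(opF ^^ (N - 2 * m)) ?G2 = sc P (ga t) \<oplus> sc k ?A1"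
   using opF_pow_gamma[OF pt, of "N - 2 * m" "N - 2 * m"] unfolding m_def[symmetric] P_def by auto
  have "cc (int m - 1) (2 * m - 1) = 0" using cc_alpha_0_iff[of m "2 * m - 1"] i by simp
  then have z: "opF ?A1 = \<zero>" using opF_alpha[OF pt, of "2 * m - 1"] cl unfolding m_def[symmetric] by simp
  have ga: "opF (ga t) = (opE ^^ (2 * m - 2)) (al t)" using pt by (simp add: ppair_def m_def)
  have 1: "(opF ^^ Suc (N - 2 * m)) ?G2 = sc P ((opE ^^ (2 * m - 2)) (al t))"
   unfolding funpow.simps o_apply k using cl z ga by (simp add: op_add op_sc)
  have 2: "(opF ^^ (2 * m - 2)) ((opE ^^ (2 * m - 2)) (al t)) = sc P' (al t)"
   using opF_pow_alpha[OF pt, of "2 * m - 2" "2 * m - 2"] unfolding m_def[symmetric] P'_def by simp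
  have "N - 1 = (2 * m - 2) + Suc (N - 2 * m)" using i by simp
  then have "(opF ^^ (N - 1)) ?G2 = (opF ^^ (2 * m - 2)) ((opF ^^ Suc (N - 2 * m)) ?G2)"
   by (metis Nat.funpow_add comp_apply)
  also have "... = sc (P * P') (al t)" unfolding 1 funpow_sc(2)[OF funpow_closed(1)[OF cl(1)]] 2 using cl by simp
  finally have "(opF ^^ (N - 1)) ?G2 = sc (P * P') (al t)" .
  moreover have "P \<noteq> 0" unfolding P_def using i cc_gamma_0_iff[of m] by auto
  moreover have "P' \<noteq> 0" unfolding P'_def using i cc_alpha_0_iff[of m] by auto
  ultimately show ?thesis by (intro exI[of _ "P * P'"]) simp
 qed
 obtain k1 k2 where k: "k1 \<noteq> 0" "(opF ^^ (N - 1)) ?G1 = sc k1 ?A1" "k2 \<noteq> 0" "(opF ^^ (N - 1)) ?G2 = sc k2 (al t)"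
  using G1 G2 by blast
 define f where "f y = (if y = (t, False, 2 * m - 1) then c1 * k1 else 0) + (if y = (t, False, 0) then c2 * k2 else 0)" for y
 have "lc (pidx {t}) (pfam al ga) f = sc (c1 * k1) ?A1 \<oplus> sc (c2 * k2) (al t)"
  unfolding f_def using i N_pos by (simp only: lc_add[OF fin b], subst (1 2) lc_single[OF fin b]) (auto simp: pidx_def pfam_def)
 also have "... = \<zero>" using F0 k cl by simp
 finally have "f y = 0" if "y \<in> pidx {t}" for y using kbasisD(4)[OF B _ that] by blast
 from this[of "(t, False, 2 * m - 1)"] this[of "(t, False, 0)"] have "c1 = 0" "c2 = 0"
  using k i N_pos by (auto simp: pidx_def f_def)
 then have "x = opF (lc (pidx {t}) (pfam al ga) d)" using x1 ee cl y by simp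
 then show ?thesis using y by blast
qed

end

section \<open>A faithful family of representations\<close>

context qparam
begin

text \<open>For w of weight y, \<open>E F^a w = q^a F^a E w + ecoeff y a F^(a-1) w\<close>; the
  recursion is the relation \<open>E F = q F E - q (1 - K)\<close>.\<close>

fun ecoeff :: "int => nat => 'k" where
 "ecoeff y 0 = 0"
| "ecoeff y (Suc a) = q * ecoeff y a + q * (q powi (2 * (y + int a)) - 1)"

lemma ecoeff_closed_form: "ecoeff y a * (q - 1) = (q ^ a - 1) * (q powi (2 * y + int a) - q)"
proof (induction a)
 case (Suc a)
 define u w where "u = q ^ a" "w = q powi (2 * y)"
 have 1: "q powi (2 * y + int a) = w * u" by (simp add: u_w_def power_int_add)
 have 2: "q powi (2 * y + int (Suc a)) = w * u * q" by (simp add: u_w_def power_int_add)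
 have "q powi (2 * (y + int a)) = q powi (2 * y + (int a + int a))" by (simp add: algebra_simps)
 also have "... = w * u * u" unfolding q_add u_w_def by simp
 finally have 3: "q powi (2 * (y + int a)) = w * u * u" .
 have IH: "ecoeff y a * (q - 1) = (u - 1) * (w * u - q)" using Suc unfolding 1 u_w_def .
 have "ecoeff y (Suc a) * (q - 1) = q * (ecoeff y a * (q - 1)) + q * (w * u * u - 1) * (q - 1)"
  unfolding ecoeff.simps 3 by (simp add: algebra_simps)
 also have "... = (u * q - 1) * (w * u * q - q)" unfolding IH by (simp add: algebra_simps)
 finally show ?case unfolding 2 by (simp add: u_w_def mult.commute)
qed simp

text \<open>Makes the relation between E and F compatible with cutting off at
  \<open>F^N = 0\<close>.\<close>

lemma ecoeff_N: "ecoeff y N = 0" using ecoeff_closed_form[of y N] q_pow_N q_neq_1 by simp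

text \<open>The module induced from the character of weight \<open>x\<close> and sign \<open>s\<close> of the torus: the indicator
 function of \<open>(a, b)\<close> is \<open>F\<^sup>a E\<^sup>b z\<close>. Outside the square of side \<open>N\<close>, it is trivial.\<close>

type_synonym 'l vec = "nat \<times> nat => 'l"

definition vF :: "'k vec => 'k vec" where
 "vF v = (\<lambda>(a, b). if 0 < a \<and> a < N \<and> b < N then v (a - 1, b) else 0)"

text \<open>Both ways to reach \<open>F^a E^b z\<close>: E passes \<open>F^a\<close> and raises the
  power of E, or it is absorbed by one factor of \<open>F^(a+1)\<close>. The weight of
  \<open>E^b z\<close> is x - b.\<close>

definition vE :: "int => 'k vec => 'k vec" where
 "vE x v = (\<lambda>(a, b). if a < N \<and> b < N then (if 0 < b then q ^ a * v (a, b - 1) else 0)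
  + (if Suc a < N then ecoeff (x - int b) (Suc a) * v (Suc a, b) else 0) else 0)"

lemma vE_eval: "vE x w (a, b) = (if a < N \<and> b < N then (if 0 < b then q ^ a * w (a, b - 1) else 0)
  + (if Suc a < N then ecoeff (x - int b) (Suc a) * w (Suc a, b) else 0) else 0)"
 by (simp add: vE_def)

text \<open>Outside the square it is the identity rather than zero, so that the relations of the
  torus hold on all functions.\<close>

definition vdiag :: "(int => 'k) => int => 'k vec => 'k vec" where
 "vdiag f x v = (\<lambda>(a, b). if a < N \<and> b < N then f (x - int b + int a) * v (a, b) else v (a, b))"

definition vk :: "'k => int => 'k" where "vk s y = s * q powi (- int n * y)"
definition vkh :: "'k => int => 'k" where "vkh s y = s * q powi ((2 - int n) * y)"

lemma vdiag_pow: "(vdiag f x ^^ r) v = vdiag (\<lambda>y. f y ^ r) x v" by (induction r) (auto simp: vdiag_def fun_eq_iff)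

lemma vdiag_vdiag: "vdiag f x (vdiag g x v) = vdiag (\<lambda>y. f y * g y) x v" by (auto simp: vdiag_def fun_eq_iff)

lemma vdiag_one: "(\<And>y. f y = 1) ==> vdiag f x v = v" by (auto simp: vdiag_def fun_eq_iff)

lemma vEF: "vF (vE x v) = (\<lambda>p. inverse q * vE x (vF v) p + (v p - vdiag (\<lambda>y. q powi (2 * y)) x v p))"
proof (rule ext, clarify)
 fix a b
 show "vF (vE x v) (a, b) = inverse q * vE x (vF v) (a, b) + (v (a, b) - vdiag (\<lambda>y. q powi (2 * y)) x v (a, b))"
 proof (cases "a < N \<and> b < N")
  case True
  let ?f = "ecoeff (x - int b)"
  have f: "?f (Suc a) = (if Suc a < N then ?f (Suc a) else 0)" using ecoeff_N True by (metis Suc_lessI)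
  have L: "vF (vE x v) (a, b) = (if 0 < a \<and> 0 < b then q ^ (a - 1) * v (a - 1, b - 1) else 0) + ?f a * v (a, b)"
   using True by (cases a) (auto simp: vF_def vE_def simp del: ecoeff.simps(2))
  have "vE x (vF v) (a, b) = (if 0 < a \<and> 0 < b then q ^ a * v (a - 1, b - 1) else 0) + (if Suc a < N then ?f (Suc a) else 0) * v (a, b)"
   using True by (auto simp: vF_def vE_def simp del: ecoeff.simps(2))
  then have R: "vE x (vF v) (a, b) = (if 0 < a \<and> 0 < b then q ^ a * v (a - 1, b - 1) else 0) + ?f (Suc a) * v (a, b)"
   unfolding f[symmetric] .
  have D: "vdiag (\<lambda>y. q powi (2 * y)) x v (a, b) = q powi (2 * (x - int b + int a)) * v (a, b)"
   using True by (simp add: vdiag_def)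
  have q: "inverse q * (if 0 < a \<and> 0 < b then q ^ a * v (a - 1, b - 1) else 0) = (if 0 < a \<and> 0 < b then q ^ (a - 1) * v (a - 1, b - 1) else 0)"
   by (cases a) auto
  have fS: "inverse q * (?f (Suc a) * c) = ?f a * c + (q powi (2 * (x - int b + int a)) - 1) * c" for c
  proof -
   have "inverse q * ?f (Suc a) = ?f a + (q powi (2 * (x - int b + int a)) - 1)"
    by (simp only: ecoeff.simps distrib_left mult.assoc[symmetric] left_inverse[OF q_nonzero] mult_1_left)
   then show ?thesis by (simp only: mult.assoc[symmetric] distrib_right)
  qed
  show ?thesis unfolding L R D distrib_left q fS by (simp add: algebra_simps)
 qed (auto simp: vF_def vE_def vdiag_def)
qed

lemma v_lin:
 "vF (\<lambda>p. v p + w p) = (\<lambda>p. vF v p + vF w p)" "vF (\<lambda>p. c * v p) = (\<lambda>p. c * vF v p)"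
 "vE x (\<lambda>p. v p + w p) = (\<lambda>p. vE x v p + vE x w p)" "vE x (\<lambda>p. c * v p) = (\<lambda>p. c * vE x v p)"
 "vdiag f x (\<lambda>p. v p + w p) = (\<lambda>p. vdiag f x v p + vdiag f x w p)"
 "vdiag f x (\<lambda>p. c * v p) = (\<lambda>p. c * vdiag f x v p)"
 by (auto simp: vF_def vE_def vdiag_def fun_eq_iff algebra_simps)

lemma vE_pow_lin: "(vE x ^^ r) (\<lambda>p. v p + w p) = (\<lambda>p. (vE x ^^ r) v p + (vE x ^^ r) w p)"
 "(vE x ^^ r) (\<lambda>p. c * v p) = (\<lambda>p. c * (vE x ^^ r) v p)" by (induction r) (auto simp: v_lin)

abbreviation "vK x \<equiv> vdiag (\<lambda>y. q powi (2 * y)) x"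

lemma vE_vK: "vE x (vK x v) = (\<lambda>p. q ^ 2 * vK x (vE x v) p)"
proof (rule ext, clarify)
 fix a b
 have 1: "q powi (2 * (x - int (b - 1) + int a)) = q ^ 2 * q powi (2 * (x - int b + int a))" if "0 < b"
 proof -
  have "2 * (x - int (b - 1) + int a) = 2 + 2 * (x - int b + int a)" using that by (simp add: of_nat_diff)
  then show ?thesis by (simp only: q_add) simp
 qed
 have 2: "q powi (2 * (x - int b + int (Suc a))) = q ^ 2 * q powi (2 * (x - int b + int a))"
 proof -
  have "2 * (x - int b + int (Suc a)) = 2 + 2 * (x - int b + int a)" by simp
  then show ?thesis by (simp only: q_add) simp
 qed
 show "vE x (vK x v) (a, b) = q ^ 2 * vK x (vE x v) (a, b)"
 proof (cases "a < N \<and> b < N")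
  case True
  have b1: "b - 1 < N" using True by linarith
  let ?k = "q powi (2 * (x - int b + int a))"
  have "vE x (vK x v) (a, b) = (if 0 < b then q ^ a * (q powi (2 * (x - int (b - 1) + int a)) * v (a, b - 1)) else 0)
   + (if Suc a < N then ecoeff (x - int b) (Suc a) * (q powi (2 * (x - int b + int (Suc a))) * v (Suc a, b)) else 0)"
   using True b1 unfolding vE_def vdiag_def by (simp del: ecoeff.simps(2) of_nat_Suc of_nat_diff)
  also have "... = q ^ 2 * (?k * ((if 0 < b then q ^ a * v (a, b - 1) else 0) + (if Suc a < N then ecoeff (x - int b) (Suc a) * v (Suc a, b) else 0)))"
   by (cases "0 < b"; cases "Suc a < N"; simp only: 1 2 if_True if_False; simp add: algebra_simps del: ecoeff.simps(2))
  also have "... = q ^ 2 * vK x (vE x v) (a, b)" using True unfolding vE_def vdiag_def by (simp del: ecoeff.simps(2))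
  finally show ?thesis .
 qed (auto simp: vE_def vdiag_def)
qed

text \<open>Coefficients in \<open>E^l F = q^l F E^l + (cA l + cB l K) E^(l-1)\<close>. Both vanish
  at l = N, so \<open>E^N\<close> commutes with F.\<close>

fun cA :: "nat => 'k" and cB :: "nat => 'k" where
 "cA 0 = 0" | "cA (Suc l) = cA l - q ^ Suc l"
| "cB 0 = 0" | "cB (Suc l) = q ^ 2 * cB l + q ^ Suc l"

lemma cA_cB_N: "cA N = 0" "cB N = 0"
proof -
 have "cA l * (q - 1) = q * (1 - q ^ l)" for l by (induction l) (auto simp: algebra_simps)
 then show "cA N = 0" using q_pow_N q_neq_1 by (metis mult_eq_0_iff right_minus_eq diff_self mult_zero_right)
 have "cB l * (q - 1) = q ^ l * q ^ l - q ^ l" for l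
 proof (induction l)
  case (Suc l)
  have "cB (Suc l) * (q - 1) = q ^ 2 * (cB l * (q - 1)) + q ^ Suc l * (q - 1)" by (simp add: algebra_simps)
  then show ?case unfolding Suc by (simp add: algebra_simps power2_eq_square)
 qed simp
 then have "cB N * (q - 1) = 0" using q_pow_N by simp
 then show "cB N = 0" using q_neq_1 by simp
qed

lemma vE_pow_vF: "(vE x ^^ l) (vF v) = (\<lambda>p. q ^ l * vF ((vE x ^^ l) v) p + (cA l * (vE x ^^ (l - 1)) v p + cB l * vK x ((vE x ^^ (l - 1)) v) p))"
proof (induction l)
 case (Suc l)
 let ?w = "(vE x ^^ l) v" and ?w' = "(vE x ^^ (l - 1)) v"
 have EF: "vE x (vF ?w) = (\<lambda>p. q * vF (vE x ?w) p + (q * vK x ?w p - q * ?w p))"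
  by (rule ext) (simp add: vEF algebra_simps flip: mult.assoc)
 have "(vE x ^^ Suc l) (vF v) = vE x (\<lambda>p. q ^ l * vF ?w p + (cA l * ?w' p + cB l * vK x ?w' p))" by (simp add: Suc)
 also have "... = (\<lambda>p. q ^ l * vE x (vF ?w) p + (cA l * vE x ?w' p + cB l * (q ^ 2 * vK x (vE x ?w') p)))"
  by (simp add: v_lin vE_vK)
 also have "... = (\<lambda>p. q ^ l * (q * vF (vE x ?w) p + (q * vK x ?w p - q * ?w p)) + (cA l * ?w p + q ^ 2 * (cB l * vK x ?w p)))"
  unfolding EF by (cases l) (simp_all add: mult.left_commute)
 finally show ?case by (simp add: algebra_simps)
qed simp

text \<open>On functions supported at a = 0 each E raises b, so \<open>E^N\<close> vanishes there.
  Since \<open>E^N\<close> commutes with F, induction on the largest power of F in the support does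
  the rest.\<close>

lemma vE_pow_N: "(vE x ^^ N) v = (\<lambda>p. 0)"
proof -
 have comm: "(vE x ^^ N) (vF v) = vF ((vE x ^^ N) v)" for v unfolding vE_pow_vF cA_cB_N using q_pow_N by simp
 have vF0: "vF (\<lambda>p. 0) = (\<lambda>p. 0)" by (auto simp: vF_def fun_eq_iff)
 have base: "(vE x ^^ m) v (a, b) = 0"
  if "\<And>a b. 0 < a ==> v (a, b) = 0" "0 < a \<or> b < m \<or> (0 < m \<and> N \<le> b)" for m v a b
  using that(2)
 proof (induction m arbitrary: a b)
  case 0 then show ?case using that(1) by simp
 next
  case (Suc m)
  have "(vE x ^^ Suc m) v (a, b) = vE x ((vE x ^^ m) v) (a, b)" by simp
  also have "... = 0"
  proof (cases "a < N \<and> b < N")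
   case True
   have "(vE x ^^ m) v (a, b - 1) = 0" if "0 < b" by (rule Suc.IH) (use Suc.prems True that in linarith)
   moreover have "(vE x ^^ m) v (Suc a, b) = 0" by (rule Suc.IH) simp
   ultimately show ?thesis unfolding vE_eval by simp
  qed (auto simp: vE_eval)
  finally show ?case .
 qed
 have main: "(vE x ^^ N) v = (\<lambda>p. 0)" if "\<And>a' b. a < a' ==> v (a', b) = 0" "\<And>a b. N \<le> a \<or> N \<le> b ==> v (a, b) = 0" for a v
  using that
 proof (induction a arbitrary: v)
  case 0
  show ?case
  proof (rule ext, clarify)
   fix a b show "(vE x ^^ N) v (a, b) = 0" by (rule base) (use 0 N_pos in auto)
  qed
 next
  case (Suc a)
  \<comment> \<open>The part with a = 0 is split off; what remains is F applied to a function with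
    smaller powers of F.\<close>
  define v0 where "v0 = (\<lambda>(a', b). if a' = 0 then v (a', b) else (0::'k))"
  define v1 where "v1 = (\<lambda>(a', b). v (Suc a', b))"
  have v: "v = (\<lambda>p. v0 p + vF v1 p)" using Suc.prems(2) by (auto simp: v0_def v1_def vF_def fun_eq_iff not_less)
  have "(vE x ^^ N) v0 = (\<lambda>p. 0)"
  proof (rule ext, clarify)
   fix a b show "(vE x ^^ N) v0 (a, b) = 0" by (rule base) (use N_pos in \<open>auto simp: v0_def\<close>)
  qed
  moreover have "(vE x ^^ N) v1 = (\<lambda>p. 0)" by (rule Suc.IH) (use Suc.prems in \<open>auto simp: v1_def\<close>)
  ultimately show ?case by (subst v) (simp add: vE_pow_lin comm vF0)
 qed
 \<comment> \<open>Values outside the square do not influence \<open>vE\<close>, and without them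
   the support is bounded.\<close>
 define v' where "v' = (\<lambda>(a, b). if a < N \<and> b < N then v (a, b) else 0)"
 have "vE x v = vE x v'" by (auto simp: vE_def v'_def fun_eq_iff)
 moreover obtain N' where "N = Suc N'" using N_pos by (metis Suc_diff_1)
 ultimately have "(vE x ^^ N) v = (vE x ^^ N) v'" by (simp add: funpow_swap1)
 also have "... = (\<lambda>p. 0)" by (rule main[of N]) (auto simp: v'_def)
 finally show ?thesis .
qed

lemma vF_pow: "0 < a \<or> True ==> a < m ==> (vF ^^ m) v (a, b) = 0"
 by (induction m arbitrary: a) (auto simp: vF_def)

lemma vF_pow_N: "(vF ^^ N) v = (\<lambda>p. 0)"
proof (rule ext, clarify)
 fix a b
 obtain N' where N': "N = Suc N'" using N_pos by (metis Suc_diff_1)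
 show "(vF ^^ N) v (a, b) = 0"
 proof (cases "a < N")
  case False
  then have "vF ((vF ^^ N') v) (a, b) = 0" by (simp add: vF_def)
  then show ?thesis by (simp add: N')
 qed (simp add: vF_pow)
qed

definition vEnd :: "('k vec => 'k vec) ring" where
 "vEnd = \<lparr>carrier = {f. (\<forall>v w. f (\<lambda>p. v p + w p) = (\<lambda>p. f v p + f w p)) \<and> (\<forall>c v. f (\<lambda>p. c * v p) = (\<lambda>p. c * f v p))},
  monoid.mult = (\<circ>), one = id, zero = (\<lambda>v p. 0), add = (\<lambda>f g v p. f v p + g v p)\<rparr>"

lemma vEnd_simps [simp]: "f \<otimes>\<^bsub>vEnd\<^esub> g = f \<circ> g" "\<one>\<^bsub>vEnd\<^esub> = id" "\<zero>\<^bsub>vEnd\<^esub> = (\<lambda>v p. 0)"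
 "f \<oplus>\<^bsub>vEnd\<^esub> g = (\<lambda>v p. f v p + g v p)" by (simp_all add: vEnd_def)

lemma vEnd_carrier: "f \<in> carrier vEnd \<longleftrightarrow> (\<forall>v w. f (\<lambda>p. v p + w p) = (\<lambda>p. f v p + f w p)) \<and> (\<forall>c v. f (\<lambda>p. c * v p) = (\<lambda>p. c * f v p))"
 by (simp add: vEnd_def)

definition vscal :: "'k => 'k vec => 'k vec" where "vscal c v = (\<lambda>p. c * v p)"

lemma vEnd_kalg: "kalg vEnd vscal"
proof (intro kalg.intro ringI abelian_groupI monoidI kalg_axioms.intro)
 fix f assume f: "f \<in> carrier vEnd"
 show "\<exists>g\<in>carrier vEnd. g \<oplus>\<^bsub>vEnd\<^esub> f = \<zero>\<^bsub>vEnd\<^esub>"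
  by (rule bexI[of _ "\<lambda>v p. - f v p"]) (use f in \<open>auto simp: vEnd_carrier\<close>)
 show "f \<otimes>\<^bsub>vEnd\<^esub> vscal c = vscal c \<otimes>\<^bsub>vEnd\<^esub> f" for c
  using f by (auto simp: vEnd_carrier vscal_def fun_eq_iff)
 show "g \<otimes>\<^bsub>vEnd\<^esub> (f \<oplus>\<^bsub>vEnd\<^esub> h) = g \<otimes>\<^bsub>vEnd\<^esub> f \<oplus>\<^bsub>vEnd\<^esub> g \<otimes>\<^bsub>vEnd\<^esub> h" if "g \<in> carrier vEnd" for g h
  using that by (simp add: vEnd_carrier o_def)
next
 fix f g assume "f \<in> carrier vEnd" "g \<in> carrier vEnd"
 then show "f \<otimes>\<^bsub>vEnd\<^esub> g \<in> carrier vEnd" by (simp add: vEnd_carrier)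
qed (auto simp: vEnd_carrier vscal_def fun_eq_iff algebra_simps)

lemma vEnd_pow: "(f [^]\<^bsub>vEnd\<^esub> (r::nat)) = f ^^ r"
proof (induction r)
 case (Suc r)
 have "f [^]\<^bsub>vEnd\<^esub> Suc r = f [^]\<^bsub>vEnd\<^esub> r \<circ> f" by (simp add: nat_pow_def)
 then show ?case using Suc by (simp add: funpow_Suc_right del: funpow.simps)
qed (simp add: nat_pow_def)

lemma vEnd_minus: assumes "f \<in> carrier vEnd" "g \<in> carrier vEnd" shows "f \<ominus>\<^bsub>vEnd\<^esub> g = (\<lambda>v p. f v p - g v p)"
proof -
 interpret V: kalg vEnd vscal by (rule vEnd_kalg)
 have "\<ominus>\<^bsub>vEnd\<^esub> g = (\<lambda>v p. - g v p)" using assms V.minus_unit[of g] by (simp add: vscal_def fun_eq_iff)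
 then show ?thesis by (simp add: a_minus_def)
qed

fun vgen :: "'k => int => qu_gen => 'k vec => 'k vec" where
 "vgen s x Kappa = vdiag (vk s) x" | "vgen s x Kappa_hat = vdiag (vkh s) x"
| "vgen s x Gen_E = vE x" | "vgen s x Gen_F = vF"

lemma q_half: "q powi (int N div 2) = - 1"
proof -
 have half: "int N = 2 * (int N div 2)" using n_even by (auto simp: power2_eq_square)
 have "(q powi (int N div 2)) ^ 2 = q powi (2 * (int N div 2))" by (simp add: power2_eq_square power_int_add[symmetric])
 also have "... = 1" using half q_powi_eq_1_iff[of "int N"] by simp
 finally have "q powi (int N div 2) = 1 \<or> q powi (int N div 2) = - 1" by (simp add: power2_eq_1_iff)
 moreover have "q powi (int N div 2) \<noteq> 1"
 proof
  assume "q powi (int N div 2) = 1"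
  then have "int N dvd int N div 2" unfolding q_powi_eq_1_iff .
  then show False using half N_ge by (auto dest!: zdvd_imp_le simp del: of_nat_power)
 qed
 ultimately show ?thesis by blast
qed

lemma q_pow: "(q powi k) ^ r = q powi (k * int r)" by (metis power_int_mult power_int_of_nat)

lemma qn_powi_pow: "(q powi (int n * y)) ^ n = 1"
proof -
 have "(q powi (int n * y)) ^ n = q powi (int n * y * int n)" by (rule q_pow)
 also have "int n * y * int n = int N * y" by (simp add: power2_eq_square)
 finally show ?thesis using q_powi_eq_1_iff by simp
qed

lemma
 assumes s: "s = 1 \<or> s = - 1"
 shows vk_pow: "vk s y ^ n = 1" and vkh_vk: "vkh s y ^ n * vk s y ^ 2 = 1"
  and vK_vk: "vk s y ^ (n - 1) * vkh s y = q powi (2 * y)"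
proof -
 have s: "s ^ n = 1" "s * s = 1" using s n_even by auto
 show *: "vk s y ^ n = 1" using qn_powi_pow[of "- y"] s by (simp add: vk_def power_mult_distrib)
 have "vkh s y = vk s y * q powi (2 * y)" by (simp add: vk_def vkh_def left_diff_distrib power_int_diff power_int_minus field_simps)
 moreover have "vk s y ^ (n - 1) * vk s y = 1" using * n_pos by (metis Suc_diff_1 power_Suc2)
 ultimately show "vk s y ^ (n - 1) * vkh s y = q powi (2 * y)" by (simp flip: mult.assoc)
 have "vkh s y ^ n * vk s y ^ 2 = vk s y ^ n * (vk s y ^ 2 * (q powi (2 * y)) ^ n)"
  unfolding \<open>vkh s y = vk s y * q powi (2 * y)\<close> by (simp add: power_mult_distrib)
 also have "vk s y ^ 2 * (q powi (2 * y)) ^ n = q powi (- int n * y + - int n * y + 2 * y * int n)"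
  using s unfolding vk_def q_add q_pow by (simp add: power2_eq_square mult_ac)
 finally show "vkh s y ^ n * vk s y ^ 2 = 1" using * by (simp add: algebra_simps)
qed

lemma vk_step: "vk s (y - 1) = q ^ n * vk s y" "vk s (y + 1) = inverse (q ^ n) * vk s y"
 "vkh s (y - 1) = q ^ n * inverse (q ^ 2) * vkh s y" "vkh s (y + 1) = inverse (q ^ n) * q ^ 2 * vkh s y"
proof -
 have e: "- int n * (y - 1) = int n + - int n * y" "- int n * (y + 1) = - int n + - int n * y"
  "(2 - int n) * (y - 1) = int n + (- 2 + (2 - int n) * y)" "(2 - int n) * (y + 1) = - int n + (2 + (2 - int n) * y)"
  by (simp_all add: algebra_simps)
 have p: "q powi (- int n) = inverse (q ^ n)" "q powi (- 2) = inverse (q ^ 2)" "q powi 2 = q ^ 2" "q powi int n = q ^ n"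
  by (simp_all add: power_int_minus)
 show "vk s (y - 1) = q ^ n * vk s y" "vk s (y + 1) = inverse (q ^ n) * vk s y"
  "vkh s (y - 1) = q ^ n * inverse (q ^ 2) * vkh s y" "vkh s (y + 1) = inverse (q ^ n) * q ^ 2 * vkh s y"
  unfolding vk_def vkh_def e q_add p by (simp_all add: mult_ac)
qed

lemma vdiag_vE:
 assumes "\<And>y. f (y - 1) = c * f y"
 shows "vdiag f x (vE x v) = (\<lambda>p. c * vE x (vdiag f x v) p)"
proof (rule ext, clarify)
 fix a b
 have 1: "f (x - int b + int a) = c * f (x - int (b - 1) + int a)" if "0 < b"
 proof -
  have "x - int b + int a = x - int (b - 1) + int a - 1" using that by (simp add: of_nat_diff)
  then show ?thesis by (simp only: assms)
 qed
 have 2: "f (x - int b + int a) = c * f (x - int b + int (Suc a))"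
 proof -
  have "x - int b + int (Suc a) - 1 = x - int b + int a" by simp
  then show ?thesis using assms[of "x - int b + int (Suc a)"] by (simp only:)
 qed
 show "vdiag f x (vE x v) (a, b) = c * vE x (vdiag f x v) (a, b)"
 proof (cases "a < N \<and> b < N")
  case True
  have b1: "b - 1 < N" using True by linarith
  have "c * vE x (vdiag f x v) (a, b) = (if 0 < b then q ^ a * ((c * f (x - int (b - 1) + int a)) * v (a, b - 1)) else 0)
   + (if Suc a < N then ecoeff (x - int b) (Suc a) * ((c * f (x - int b + int (Suc a))) * v (Suc a, b)) else 0)"
   using True b1 unfolding vE_eval vdiag_def
   by (simp add: distrib_left mult_ac del: ecoeff.simps(2) of_nat_Suc of_nat_diff)
  also have "... = f (x - int b + int a) * ((if 0 < b then q ^ a * v (a, b - 1) else 0)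
   + (if Suc a < N then ecoeff (x - int b) (Suc a) * v (Suc a, b) else 0))"
   unfolding 2[symmetric] using 1 by (cases "0 < b") (simp_all add: distrib_left mult_ac del: ecoeff.simps(2) of_nat_Suc of_nat_diff)
  finally show ?thesis using True unfolding vE_eval vdiag_def by (simp del: ecoeff.simps(2))
 qed (auto simp: vE_def vdiag_def)
qed

lemma vdiag_vF:
 assumes "\<And>y. f (y + 1) = c * f y"
 shows "vdiag f x (vF v) = (\<lambda>p. c * vF (vdiag f x v) p)"
proof (rule ext, clarify)
 fix a b
 have "f (x - int b + int a) = c * f (x - int b + int (a - 1))" if "0 < a"
 proof -
  have "x - int b + int (a - 1) + 1 = x - int b + int a" using that by (simp add: of_nat_diff)
  then show ?thesis using assms[of "x - int b + int (a - 1)"] by (simp only:)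
 qed
 then show "vdiag f x (vF v) (a, b) = c * vF (vdiag f x v) (a, b)" by (auto simp: vF_def vdiag_def)
qed

lemma v_relations:
 assumes s: "s = 1 \<or> s = - 1"
 shows "qu_relations vEnd vscal n q (vgen s x)"
proof (intro qu_relations.intro vEnd_kalg qu_relations_axioms.intro; (unfold vgen.simps vEnd_pow)?)
 note sm = vdiag_vdiag vdiag_pow fun_eq_iff o_def
 have vd: "vdiag f x \<in> carrier vEnd" for f by (auto simp: vEnd_carrier v_lin)
 show "vgen s x g \<in> carrier vEnd" for g by (cases g) (auto simp: vEnd_carrier v_lin)
 show "vdiag (vk s) x ^^ n = \<one>\<^bsub>vEnd\<^esub>" by (rule ext) (simp add: vdiag_pow vdiag_one vk_pow[OF s])
 show "vdiag (vkh s) x ^^ n \<otimes>\<^bsub>vEnd\<^esub> vdiag (vk s) x ^^ 2 = \<one>\<^bsub>vEnd\<^esub>"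
  by (rule ext) (simp add: vdiag_pow vdiag_vdiag vdiag_one vkh_vk[OF s] del: funpow.simps)
 show "vdiag (vk s) x \<otimes>\<^bsub>vEnd\<^esub> vdiag (vkh s) x = vdiag (vkh s) x \<otimes>\<^bsub>vEnd\<^esub> vdiag (vk s) x"
  by (rule ext) (simp add: vdiag_vdiag mult.commute)
 show "vdiag (vk s) x \<otimes>\<^bsub>vEnd\<^esub> vE x = vscal (q ^ n) \<otimes>\<^bsub>vEnd\<^esub> vE x \<otimes>\<^bsub>vEnd\<^esub> vdiag (vk s) x"
  by (rule ext) (simp add: vdiag_vE[where f = "vk s" and c = "q ^ n", OF vk_step(1)] vscal_def)
 show "vdiag (vk s) x \<otimes>\<^bsub>vEnd\<^esub> vF = vscal (inverse (q ^ n)) \<otimes>\<^bsub>vEnd\<^esub> vF \<otimes>\<^bsub>vEnd\<^esub> vdiag (vk s) x"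
  by (rule ext) (simp add: vdiag_vF[where f = "vk s" and c = "inverse (q ^ n)", OF vk_step(2)] vscal_def)
 show "vdiag (vkh s) x \<otimes>\<^bsub>vEnd\<^esub> vE x = vscal (q ^ n * inverse (q ^ 2)) \<otimes>\<^bsub>vEnd\<^esub> vE x \<otimes>\<^bsub>vEnd\<^esub> vdiag (vkh s) x"
  by (rule ext) (simp add: vdiag_vE[where f = "vkh s" and c = "q ^ n * inverse (q ^ 2)", OF vk_step(3)] vscal_def)
 show "vdiag (vkh s) x \<otimes>\<^bsub>vEnd\<^esub> vF = vscal (inverse (q ^ n) * q ^ 2) \<otimes>\<^bsub>vEnd\<^esub> vF \<otimes>\<^bsub>vEnd\<^esub> vdiag (vkh s) x"
  by (rule ext) (simp add: vdiag_vF[where f = "vkh s" and c = "inverse (q ^ n) * q ^ 2", OF vk_step(4)] vscal_def)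
 show "vE x ^^ N = \<zero>\<^bsub>vEnd\<^esub>" by (rule ext) (simp add: vE_pow_N)
 show "vF ^^ N = \<zero>\<^bsub>vEnd\<^esub>" by (rule ext) (simp add: vF_pow_N)
 have K: "vdiag (vk s) x ^^ (n - 1) \<otimes>\<^bsub>vEnd\<^esub> vdiag (vkh s) x = vK x"
  by (rule ext) (simp add: vdiag_pow vdiag_vdiag vK_vk[OF s, simplified])
 have one: "\<one>\<^bsub>vEnd\<^esub> \<in> carrier vEnd" by (auto simp: vEnd_carrier)
 show "vF \<otimes>\<^bsub>vEnd\<^esub> vE x = vscal (inverse q) \<otimes>\<^bsub>vEnd\<^esub> vE x \<otimes>\<^bsub>vEnd\<^esub> vF
   \<oplus>\<^bsub>vEnd\<^esub> (\<one>\<^bsub>vEnd\<^esub> \<ominus>\<^bsub>vEnd\<^esub> vdiag (vk s) x ^^ (n - 1) \<otimes>\<^bsub>vEnd\<^esub> vdiag (vkh s) x)"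
  unfolding K vEnd_minus[OF one vd] by (rule ext) (simp add: vEF vscal_def)
qed

text \<open>Serves two purposes: these modules detect the coefficients of a sum of
  \<open>F^a u E^b\<close>, and they show that \<open>E^(N-1) \<alpha>\<close> is nonzero.\<close>

lemma v_module:
 assumes s: "s = 1 \<or> s = - 1"
 obtains M :: "('k free_qu set, 'k vec) module" where "qmod n q M" "carrier M = UNIV"
  "\<And>v w. v \<oplus>\<^bsub>M\<^esub> w = (\<lambda>p. v p + w p)" "\<zero>\<^bsub>M\<^esub> = (\<lambda>p. 0)" "\<And>c v. \<eta> c \<odot>\<^bsub>M\<^esub> v = (\<lambda>p. c * v p)"
  "\<And>v. \<kappa> \<odot>\<^bsub>M\<^esub> v = vdiag (vk s) x v" "\<And>v. \<kappa>h \<odot>\<^bsub>M\<^esub> v = vdiag (vkh s) x v"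
  "\<And>v. E \<odot>\<^bsub>M\<^esub> v = vE x v" "\<And>v. F \<odot>\<^bsub>M\<^esub> v = vF v"
proof -
 interpret V: qu_relations vEnd vscal n q "vgen s x" by (rule v_relations[OF s])
 obtain \<phi> where \<phi>: "\<phi> \<in> ring_hom A vEnd" "\<And>c. \<phi> (\<eta> c) = vscal c" "\<phi> \<kappa> = vgen s x Kappa"
  "\<phi> \<kappa>h = vgen s x Kappa_hat" "\<phi> E = vgen s x Gen_E" "\<phi> F = vgen s x Gen_F"
  using V.qu_hom_exists by blast
 define M :: "('k free_qu set, 'k vec) module" where
  "M = \<lparr>carrier = UNIV, monoid.mult = undefined, one = undefined, zero = (\<lambda>p. 0), add = (\<lambda>v w p. v p + w p), module.smult = \<phi>\<rparr>"
 have \<phi>c: "\<phi> a (\<lambda>p. v p + w p) = (\<lambda>p. \<phi> a v p + \<phi> a w p)" if "a \<in> carrier A" for a v w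
  using ring_hom_closed[OF \<phi>(1) that] by (simp add: vEnd_carrier)
 have "kmod A \<eta> M"
 proof (intro kmod.intro qu.kalg_axioms abelian_groupI kmod_axioms.intro)
  show "\<exists>y\<in>carrier M. y \<oplus>\<^bsub>M\<^esub> v = \<zero>\<^bsub>M\<^esub>" for v
   by (rule bexI[of _ "\<lambda>p. - v p"]) (simp_all add: M_def)
 qed (use ring_hom_add[OF \<phi>(1)] ring_hom_mult[OF \<phi>(1)] ring_hom_one[OF \<phi>(1)] \<phi>c in
   \<open>simp_all add: M_def fun_eq_iff algebra_simps\<close>)
 then have "qmod n q M" by (intro qmod.intro qparam_axioms)
 then show ?thesis by (rule that) (simp_all add: M_def \<phi> vscal_def)
qed

end

section \<open>The elements \<open>\<alpha>\<close> and \<open>\<gamma>\<close>\<close>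

text \<open>Moving x past y multiplies y by b, so x carries one spectral projection of y to another.
  This is how F is moved past projections onto weights.\<close>

lemma (in kalg) proj_twist:
 assumes x: "x \<in> carrier A" and y: "y \<in> carrier A" and xy: "x \<otimes> y = \<eta> b \<otimes> (y \<otimes> x)"
 shows "x \<otimes> proj m y c = proj m y (c * b) \<otimes> x"
proof -
 have pw: "x \<otimes> y [^] r = \<eta> (b ^ r) \<otimes> (y [^] r \<otimes> x)" for r :: nat
 proof (induction r)
  case (Suc r)
  have "x \<otimes> y [^] Suc r = (x \<otimes> y [^] r) \<otimes> y" using x y by (simp add: m_assoc)
  also have "... = \<eta> (b ^ r) \<otimes> (y [^] r \<otimes> (x \<otimes> y))" unfolding Suc using x y by (simp add: m_assoc)
  also have "... = \<eta> (b ^ r) \<otimes> (\<eta> b \<otimes> (y [^] r \<otimes> (y \<otimes> x)))"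
   unfolding xy using x y by (simp only: unit_left_comm[of "y [^] r" "y \<otimes> x"] nat_pow_closed m_closed)
  finally show ?case using x y by (simp add: m_assoc unit_mult_left mult.commute)
 qed (use x in \<open>simp add: unit_one\<close>)
 have t: "x \<otimes> (\<eta> (c ^ r) \<otimes> y [^] r) = (\<eta> ((c * b) ^ r) \<otimes> y [^] r) \<otimes> x" for r :: nat
  using x y by (simp add: unit_left_comm[of x "y [^] r"] m_assoc pw unit_mult_left power_mult_distrib)
 define S where "S d = (\<Oplus>r\<in>{..<m}. \<eta> (d ^ r) \<otimes> y [^] r)" for d
 have S: "S d \<in> carrier A" for d unfolding S_def using y by (intro finsum_closed) auto
 have "x \<otimes> S c = (\<Oplus>r\<in>{..<m}. x \<otimes> (\<eta> (c ^ r) \<otimes> y [^] r))"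
  unfolding S_def using x y by (intro finsum_rdistr) auto
 also have "... = (\<Oplus>r\<in>{..<m}. (\<eta> ((c * b) ^ r) \<otimes> y [^] r) \<otimes> x)" unfolding t ..
 also have "... = S (c * b) \<otimes> x" unfolding S_def using x y by (intro finsum_ldistr[symmetric]) auto
 finally have "x \<otimes> S c = S (c * b) \<otimes> x" .
 then have "x \<otimes> (\<eta> (1 / of_nat m) \<otimes> S c) = (\<eta> (1 / of_nat m) \<otimes> S (c * b)) \<otimes> x"
  using x S by (simp add: unit_left_comm[of x "S c"] m_assoc)
 then show ?thesis unfolding proj_def S_def .
qed

lemma (in kalg) proj_comm:
 assumes "x \<in> carrier A" "y \<in> carrier A" "x \<otimes> y = y \<otimes> x"
 shows "x \<otimes> proj m y c = proj m y c \<otimes> x" using proj_twist[of x y 1 m c] assms by (simp add: unit_one)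

context qmod
begin

text \<open>As n is even, both n N/2 and (2 - n) N/2 are multiples of N, so neither eigenvalue
  changes.\<close>

lemma wt_cong:
 assumes "int (N div 2) dvd x - y" shows "wt s x v \<longleftrightarrow> wt s y v"
proof -
 have h: "int N = 2 * int (N div 2)" using n_even by (auto simp: power2_eq_square elim: evenE)
 obtain z where z: "x - y = int (N div 2) * z" using assms by (auto simp: dvd_def)
 obtain m where m: "int n = 2 * m" using n_even by (auto elim: evenE)
 have "- int n * x - - int n * y = - int n * (x - y)" by (simp add: algebra_simps)
 also have "... = int N * (- m * z)" unfolding z h m by simp
 finally have "- int n * x - - int n * y = int N * (- m * z)" .
 then have "q powi (- int n * x) = q powi (- int n * y)" unfolding q_powi_eq_iff by simp
 moreover have "(2 - int n) * x - (2 - int n) * y = int N * ((1 - m) * z)"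
 proof -
  have "(2 - int n) * x - (2 - int n) * y = (2 - int n) * (x - y)" by (simp add: algebra_simps)
  also have "... = int N * ((1 - m) * z)" unfolding z h m by (simp add: algebra_simps)
  finally show ?thesis .
 qed
 then have "q powi ((2 - int n) * x) = q powi ((2 - int n) * y)" unfolding q_powi_eq_iff by simp
 ultimately show ?thesis unfolding wt_def by simp
qed

lemma opE_opF: assumes x: "x \<in> carrier M"
 shows "opE (opF x) = sc q (opF (opE x)) \<oplus> (sc (- q) x \<oplus> sc q (opK x))"
proof -
 let ?a = "opE (opF x)"
 have c: "?a \<in> carrier M" "opK x \<in> carrier M" using x by auto
 have "sc q (opF (opE x)) = ?a \<oplus> (sc q x \<oplus> sc (- q) (opK x))" using x by (simp add: opF_opE sc_add_right)
 then have "sc q (opF (opE x)) \<oplus> (sc (- q) x \<oplus> sc q (opK x))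
  = ?a \<oplus> ((sc q x \<oplus> sc (- q) x) \<oplus> (sc (- q) (opK x) \<oplus> sc q (opK x)))"
  using x c by (simp add: M.a_ac)
 also have "... = ?a" using x c by (simp flip: sc_add)
 finally show ?thesis by simp
qed

lemma opE_opF_pow:
 assumes w: "wt s x w" and s: "s \<noteq> 0"
 shows "\<exists>d. opE ((opF ^^ m) w) = sc (q ^ m) ((opF ^^ m) (opE w)) \<oplus> sc d ((opF ^^ (m - 1)) w)"
proof (induction m)
 case 0
 then show ?case using w by (intro exI[of _ 0]) auto
next
 case (Suc m)
 have wc: "w \<in> carrier M" using w by auto
 let ?y = "(opF ^^ m) w" and ?z = "(opF ^^ Suc m) (opE w)"
 have cl: "?y \<in> carrier M" "?z \<in> carrier M" using wc by auto
 obtain d where d: "opE ?y = sc (q ^ m) ((opF ^^ m) (opE w)) \<oplus> sc d ((opF ^^ (m - 1)) w)" using Suc by blast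
 have e: "opF (opE ?y) = sc (q ^ m) ?z \<oplus> sc d (opF ((opF ^^ (m - 1)) w))"
  unfolding d using wc by (simp add: op_add op_sc)
 have "\<exists>d'. opF (opE ?y) = sc (q ^ m) ?z \<oplus> sc d' ?y"
 proof (cases "m = 0")
  case True
  then show ?thesis using wc by (intro exI[of _ 0]) simp
 next
  case False
  then have "opF ((opF ^^ (m - 1)) w) = ?y" by (cases m) auto
  then show ?thesis using e by metis
 qed
 then obtain d' where d': "opF (opE ?y) = sc (q ^ m) ?z \<oplus> sc d' ?y" by blast
 define k where "k = q powi (2 * (x + int m))"
 have K: "opK ?y = sc k ?y" unfolding k_def by (rule wt_opK[OF wt_opF_pow[OF w] s])
 have "opE ((opF ^^ Suc m) w) = sc q (opF (opE ?y)) \<oplus> (sc (- q) ?y \<oplus> sc q (opK ?y))"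
  using opE_opF[OF cl(1)] by simp
 also have "... = sc (q ^ Suc m) ?z \<oplus> (sc (q * d') ?y \<oplus> (sc (- q) ?y \<oplus> sc (q * k) ?y))"
  unfolding d' K using cl by (simp add: sc_add_right M.a_assoc del: funpow.simps)
 also have "sc (q * d') ?y \<oplus> (sc (- q) ?y \<oplus> sc (q * k) ?y) = sc (q * d' + (- q + q * k)) ?y"
  unfolding sc_add[OF cl(1)] ..
 finally show ?case unfolding diff_Suc_1 by blast
qed

text \<open>Each commutation of E with the block of F removes one E together with one F, so at least
  m - t factors F stay in front. This allows one F to be divided out of
  \<open>E^(2i-2) F^(N-1) e\<close>.\<close>

lemma opE_pow_opF_pow:
 assumes w: "wt s x w" and s: "s \<noteq> 0" and t: "t \<le> m"
 shows "\<exists>c. (opE ^^ t) ((opF ^^ m) w) = lc {..t} (\<lambda>r. (opF ^^ (m - r)) ((opE ^^ (t - r)) w)) c" using t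
proof (induction t)
 case 0
 have wc: "w \<in> carrier M" using w by auto
 have "lc {..0} (\<lambda>r. (opF ^^ (m - r)) ((opE ^^ (0 - r)) w)) (\<lambda>_. 1) = (opF ^^ m) w"
  using wc by (simp add: lc_insert)
 then show ?case by (intro exI[of _ "\<lambda>_. 1"]) simp
next
 case (Suc t)
 have wc: "w \<in> carrier M" using w by auto
 let ?b = "\<lambda>t r. (opF ^^ (m - r)) ((opE ^^ (t - r)) w)"
 obtain c where c: "(opE ^^ t) ((opF ^^ m) w) = lc {..t} (?b t) c" using Suc by auto
 have "\<exists>a. E \<odot> ?b t r = lc {..Suc t} (?b (Suc t)) a" if r: "r \<in> {..t}" for r
 proof -
  obtain d where d: "opE (?b t r) = sc (q ^ (m - r)) ((opF ^^ (m - r)) (opE ((opE ^^ (t - r)) w))) \<oplus> sc d ((opF ^^ (m - r - 1)) ((opE ^^ (t - r)) w))"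
   using opE_opF_pow[OF wt_opE_pow[OF w] s] by blast
  have e: "(opF ^^ (m - r)) (opE ((opE ^^ (t - r)) w)) = ?b (Suc t) r" "(opF ^^ (m - r - 1)) ((opE ^^ (t - r)) w) = ?b (Suc t) (Suc r)"
   using r by (simp_all add: Suc_diff_le)
  have "lc {..Suc t} (?b (Suc t)) (\<lambda>i. (if i = r then q ^ (m - r) else 0) + (if i = Suc r then d else 0))
   = sc (q ^ (m - r)) (?b (Suc t) r) \<oplus> sc d (?b (Suc t) (Suc r))"
   using r wc by (subst lc_add, simp, simp, subst (1 2) lc_single) auto
  then have "opE (?b t r) = lc {..Suc t} (?b (Suc t)) (\<lambda>i. (if i = r then q ^ (m - r) else 0) + (if i = Suc r then d else 0))"
   unfolding d e by (rule sym)
  then show ?thesis unfolding opE_def by blast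
 qed
 note ex = this
 define a where "a j r = (SOME f. E \<odot> ?b t r = lc {..Suc t} (?b (Suc t)) f) j" for j r
 have a: "E \<odot> ?b t r = lc {..Suc t} (?b (Suc t)) (\<lambda>j. a j r)" if "r \<in> {..t}" for r
  unfolding a_def using someI_ex[OF ex[OF that]] .
 have "(opE ^^ Suc t) ((opF ^^ m) w) = lc {..t} (\<lambda>r. E \<odot> ?b t r) c"
  unfolding funpow.simps o_apply c by (subst opE_def, rule lc_act) (use wc in auto)
 also have "... = lc {..Suc t} (?b (Suc t)) (\<lambda>j. \<Sum>r\<in>{..t}. a j r * c r)"
  by (rule lc_matrix) (use a wc in auto)
 finally show ?case by blast
qed

end

context qparam
begin

definition "hN = n div 2 * n"

lemma hN: "N = 2 * hN" "hN > 0" "hN = N div 2"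
proof -
 have "n = 2 * (n div 2)" using n_even by simp
 then show 1: "N = 2 * hN" unfolding hN_def power2_eq_square by (metis mult.assoc)
 then show "hN > 0" "hN = N div 2" using N_pos by simp_all
qed

lemma K_comm: "\<kappa>i \<cdot> \<kappa>h = \<kappa>h \<cdot> \<kappa>i"
proof -
 have "\<kappa>i \<cdot> \<kappa>h = \<kappa>i \<cdot> (\<kappa>h \<cdot> (\<kappa> \<cdot> \<kappa>i))" by simp
 also have "... = \<kappa>i \<cdot> (\<kappa> \<cdot> \<kappa>h) \<cdot> \<kappa>i"
  using qu.kappa_comm by (simp add: qu.m_assoc del: kappa_inv_cancel)
 also have "... = (\<kappa>i \<cdot> \<kappa>) \<cdot> \<kappa>h \<cdot> \<kappa>i" by (simp add: qu.m_assoc del: kappa_inv_cancel)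
 finally show ?thesis by simp
qed

text \<open>\<open>K^n = \<kappa>-hat^n = \<kappa>^(-2)\<close>, and the power n/2 of this is
  \<open>\<kappa>^(-n) = 1\<close>.\<close>

lemma K_pow_hN: "K \<up> hN = \<one>\<^bsub>A\<^esub>"
proof -
 have "\<kappa>i \<up> n \<cdot> \<kappa> \<up> n = (\<kappa>i \<cdot> \<kappa>) \<up> n"
  by (rule qu.pow_mult_distrib[symmetric]) auto
 then have ki: "\<kappa>i \<up> n = \<one>\<^bsub>A\<^esub>" using qu.kappa_pow by simp
 have Kn: "K \<up> n = \<kappa>h \<up> n" using qu.pow_mult_distrib[OF K_comm, of n] ki by simp
 have c: "\<kappa>h \<up> n \<cdot> \<kappa> \<up> (2::nat) = \<kappa> \<up> (2::nat) \<cdot> \<kappa>h \<up> n"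
 proof -
  have 1: "\<kappa> \<cdot> \<kappa>h \<up> r = \<kappa>h \<up> r \<cdot> \<kappa>" for r :: nat
   using qu.kappa_comm qu.group_commutes_pow[of \<kappa>h \<kappa> r] by simp
  then show ?thesis using qu.group_commutes_pow[of \<kappa> "\<kappa>h \<up> n" 2] by simp
 qed
 have "\<one>\<^bsub>A\<^esub> = (\<kappa>h \<up> n \<cdot> \<kappa> \<up> (2::nat)) \<up> (n div 2)"
  using qu.kappa_hat_pow by simp
 also have "... = (\<kappa>h \<up> n) \<up> (n div 2) \<cdot> (\<kappa> \<up> (2::nat)) \<up> (n div 2)"
  using qu.pow_mult_distrib[OF c, of "n div 2"] by simp
 also have "(\<kappa> \<up> (2::nat)) \<up> (n div 2) = \<one>\<^bsub>A\<^esub>"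
  using n_even qu.kappa_pow by (simp add: qu.nat_pow_pow)
 also have "(\<kappa>h \<up> n) \<up> (n div 2) = K \<up> hN"
  unfolding Kn[symmetric] by (simp add: qu.nat_pow_pow hN_def mult.commute)
 finally show ?thesis by simp
qed

lemma phi_proj: "qu_phi n q s = qu.proj hN K (inverse q ^ s)"
 by (simp add: qu_phi_def qu.proj_def qu_scale_def Let_def hN_def power_mult)

text \<open>The involution whose eigenspaces for 1 and -1 are cut out by the boldface
  idempotents.\<close>

definition "gsgn = \<kappa> \<cdot> \<kappa>h \<up> (n div 2)"

lemma gsgn_closed [simp]: "gsgn \<in> carrier A" by (simp add: gsgn_def)

lemma gsgn_square: "gsgn \<cdot> gsgn = \<one>\<^bsub>A\<^esub>"
proof -
 let ?h = "\<kappa>h \<up> (n div 2)"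
 have c: "?h \<cdot> \<kappa> = \<kappa> \<cdot> ?h"
  using qu.kappa_comm qu.group_commutes_pow[of \<kappa>h \<kappa> "n div 2"] by simp
 have hh: "?h \<cdot> ?h = \<kappa>h \<up> n" using n_even by (simp add: qu.nat_pow_mult flip: mult_2)
 have "gsgn \<cdot> gsgn = \<kappa> \<cdot> (?h \<cdot> \<kappa>) \<cdot> ?h" by (simp add: gsgn_def qu.m_assoc)
 also have "... = \<kappa> \<cdot> (\<kappa> \<cdot> ?h) \<cdot> ?h" unfolding c ..
 also have "... = \<kappa> \<cdot> (\<kappa> \<cdot> \<kappa>h \<up> n)" by (simp add: qu.m_assoc hh)
 also have "\<kappa> \<cdot> \<kappa>h \<up> n = \<kappa>h \<up> n \<cdot> \<kappa>"
  using qu.kappa_comm qu.group_commutes_pow[of \<kappa>h \<kappa> n] by simp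
 also have "\<kappa> \<cdot> (\<kappa>h \<up> n \<cdot> \<kappa>) = (\<kappa> \<cdot> \<kappa>h \<up> n) \<cdot> \<kappa>" by (simp add: qu.m_assoc)
 also have "\<kappa> \<cdot> \<kappa>h \<up> n = \<kappa>h \<up> n \<cdot> \<kappa>"
  using qu.kappa_comm qu.group_commutes_pow[of \<kappa>h \<kappa> n] by simp
 also have "\<kappa>h \<up> n \<cdot> \<kappa> \<cdot> \<kappa> = \<kappa>h \<up> n \<cdot> \<kappa> \<up> (2::nat)"
  by (simp add: qu.m_assoc numeral_2_eq_2)
 finally show ?thesis using qu.kappa_hat_pow by simp
qed

lemma gsgn_K: "gsgn \<cdot> K = K \<cdot> gsgn"
proof -
 have "K \<cdot> \<kappa> = \<kappa>i \<cdot> (\<kappa> \<cdot> \<kappa>h)"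
  unfolding qu.kappa_comm[unfolded qu_gen_class.simps] by (simp add: qu.m_assoc)
 then have 1: "\<kappa> \<cdot> K = K \<cdot> \<kappa>" by (simp add: qu.m_assoc[symmetric])
 have 2: "\<kappa>h \<cdot> K = K \<cdot> \<kappa>h" using K_comm by (metis qu.m_assoc kappa_inv_closed gens_closed(2))
 have 3: "\<kappa>h \<up> (n div 2) \<cdot> K = K \<cdot> \<kappa>h \<up> (n div 2)"
  using qu.group_commutes_pow[OF 2, of "n div 2"] by simp
 have "gsgn \<cdot> K = \<kappa> \<cdot> (\<kappa>h \<up> (n div 2) \<cdot> K)" by (simp add: gsgn_def qu.m_assoc)
 also have "... = (\<kappa> \<cdot> K) \<cdot> \<kappa>h \<up> (n div 2)" unfolding 3 by (simp add: qu.m_assoc)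
 also have "... = K \<cdot> gsgn" unfolding 1 by (simp add: gsgn_def qu.m_assoc)
 finally show ?thesis .
qed

lemma bold_one_alt: "qu_bold_one n q j = \<eta> (1 / 2) \<cdot> (\<one>\<^bsub>A\<^esub> \<oplus>\<^bsub>A\<^esub> \<eta> (if j = 0 then 1 else - 1) \<cdot> gsgn)"
 by (simp add: qu_bold_one_def Let_def qu_scale_def gsgn_def[symmetric] qu.unit_one a_minus_def qu.minus_unit)

lemma bold_one_closed [simp]: "qu_bold_one n q j \<in> carrier A" by (simp add: bold_one_alt)

lemma bold_one_eigen: "gsgn \<cdot> qu_bold_one n q j = \<eta> (if j = 0 then 1 else - 1) \<cdot> qu_bold_one n q j"
proof -
 let ?e = "if j = 0 then 1 else - 1 :: 'k"
 have "gsgn \<cdot> (\<one>\<^bsub>A\<^esub> \<oplus>\<^bsub>A\<^esub> \<eta> ?e \<cdot> gsgn) = gsgn \<oplus>\<^bsub>A\<^esub> \<eta> ?e \<cdot> \<one>\<^bsub>A\<^esub>"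
  by (simp add: qu.r_distr qu.unit_left_comm[OF gsgn_closed gsgn_closed] gsgn_square del: qu.r_one) simp
 also have "... = \<eta> ?e \<cdot> (\<one>\<^bsub>A\<^esub> \<oplus>\<^bsub>A\<^esub> \<eta> ?e \<cdot> gsgn)"
  by (simp add: qu.r_distr qu.unit_mult_left qu.unit_one qu.a_comm)
 finally have *: "gsgn \<cdot> (\<one>\<^bsub>A\<^esub> \<oplus>\<^bsub>A\<^esub> \<eta> ?e \<cdot> gsgn) = \<eta> ?e \<cdot> (\<one>\<^bsub>A\<^esub> \<oplus>\<^bsub>A\<^esub> \<eta> ?e \<cdot> gsgn)" .
 have cl: "\<one>\<^bsub>A\<^esub> \<oplus>\<^bsub>A\<^esub> \<eta> ?e \<cdot> gsgn \<in> carrier A" by simp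
 show ?thesis unfolding bold_one_alt qu.unit_left_comm[OF gsgn_closed cl] * qu.unit_mult_left[OF cl]
  by (simp add: mult.commute)
qed

lemma bold_one_sum: "qu_bold_one n q 0 \<oplus>\<^bsub>A\<^esub> qu_bold_one n q 1 = \<one>\<^bsub>A\<^esub>"
proof -
 have "qu_bold_one n q 0 \<oplus>\<^bsub>A\<^esub> qu_bold_one n q 1
   = (\<eta> (1/2) \<oplus>\<^bsub>A\<^esub> \<eta> (1/2)) \<oplus>\<^bsub>A\<^esub> (\<eta> (1/2) \<oplus>\<^bsub>A\<^esub> \<eta> (- 1/2)) \<cdot> gsgn"
  by (simp add: bold_one_alt qu.r_distr qu.l_distr qu.unit_mult_left qu.a_ac)
 also have "... = \<one>\<^bsub>A\<^esub>" by (simp flip: qu.unit_add add: qu.unit_one R.unit_zero)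
 finally show ?thesis .
qed

lemma phi_closed [simp]: "qu_phi n q s \<in> carrier A" by (simp add: phi_proj)

lemma q2_root: "(inverse q ^ (2 * i)) ^ hN = 1"
proof -
 have "(inverse q ^ (2 * i)) ^ hN = (inverse q ^ N) ^ i" unfolding hN(1) by (simp flip: power_mult add: mult_ac)
 then show ?thesis using q_pow_N by (simp add: power_inverse)
qed

lemma phi_eigen: "K \<cdot> qu_phi n q (2 * i) = \<eta> (q ^ (2 * i)) \<cdot> qu_phi n q (2 * i)"
 unfolding phi_proj using qu.proj_eigen[of K hN "inverse q ^ (2 * i)"] K_pow_hN q2_root[of i] by (simp add: power_inverse)

lemma phi_sum: "(\<Oplus>\<^bsub>A\<^esub> i\<in>{1..hN}. qu_phi n q (2 * i)) = \<one>\<^bsub>A\<^esub>" unfolding phi_proj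
proof (rule qu.proj_complete)
 fix r assume r: "r < hN"
 show "(\<Sum>i\<in>{1..hN}. (inverse q ^ (2 * i)) ^ r) = (if r = 0 then of_nat hN else 0)"
 proof (cases "r = 0")
  case False
  let ?c = "inverse q ^ (2 * r)"
  have "(\<Sum>i\<in>{1..hN}. (inverse q ^ (2 * i)) ^ r) = (\<Sum>i<hN. ?c * ?c ^ i)"
   unfolding One_nat_def sum.atLeast1_atMost_eq
   by (intro sum.cong refl) (simp only: power_mult[symmetric] power_add[symmetric], simp add: algebra_simps)
  also have "... = ?c * (\<Sum>i<hN. ?c ^ i)" by (simp add: sum_distrib_left)
  also have "(\<Sum>i<hN. ?c ^ i) = 0"
  proof (rule geometric_sum_root)
   show "?c ^ hN = 1" by (rule q2_root)
   have "\<not> N dvd 2 * r"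
   proof
    assume "N dvd 2 * r"
    then have "N \<le> 2 * r" using False by (intro dvd_imp_le) auto
    then show False using r hN(1) by linarith
   qed
   then show "?c \<noteq> 1" using q_pow_eq_1_iff[of "2 * r"] by (simp add: power_inverse)
  qed
  finally show ?thesis using False by simp
 qed simp
qed (use hN in auto)

lemma e_closed [simp]: "qu_e_idem n q s j \<in> carrier A" by (simp add: qu_e_idem_def)

text \<open>The sign in the weight of \<open>e_(2i,j)\<close>. The summand i in the exponent comes
  from \<open>q^(N/2) = -1\<close>.\<close>

definition sgn_ij :: "nat => nat => 'k" where "sgn_ij i j = (- 1) ^ (i + j)"

lemma sgn_ij_cases: "sgn_ij i j = 1 \<or> sgn_ij i j = - 1" and sgn_ij_nz [simp]: "sgn_ij i j \<noteq> 0"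
 by (auto simp: sgn_ij_def minus_one_power_iff)

text \<open>By construction the eigenvalues of K and of \<open>\<kappa> \<kappa>-hat^(n/2)\<close>
  on e are known. Since \<open>\<kappa>-hat = \<kappa> K\<close>, they determine the eigenvalue of
  \<open>\<kappa>^(n/2+1)\<close>. As 4 divides n, the number n/2 + 1 is its own inverse modulo n,
  and the eigenvalue of \<kappa> is recovered by one more power.\<close>

lemma e_wt:
 assumes j: "j \<le> 1"
 shows "R.wt (sgn_ij i j) (int i) (qu_e_idem n q (2 * i) j)"
proof -
 let ?e = "qu_e_idem n q (2 * i) j" and ?m = "n div 2"
 let ?sg = "(- 1) ^ j :: 'k"
 have sg: "?sg = (if j = 0 then 1 else - 1)" using j by (cases j) auto
 have Ke: "R.opK ?e = R.sc (q ^ (2 * i)) ?e" unfolding R.opK_def R.sc_def regular_module_simps qu_e_idem_def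
  by (simp only: qu.m_assoc[symmetric] phi_eigen gens_closed kappa_inv_closed qu.m_closed phi_closed bold_one_closed qu.unit_closed)
 have ge: "gsgn \<cdot> ?e = \<eta> ?sg \<cdot> ?e"
 proof -
  have "gsgn \<cdot> qu_phi n q (2 * i) = qu_phi n q (2 * i) \<cdot> gsgn"
   unfolding phi_proj by (rule qu.proj_comm[OF _ _ gsgn_K]) auto
  then have "gsgn \<cdot> ?e = qu_phi n q (2 * i) \<cdot> (gsgn \<cdot> qu_bold_one n q j)"
   unfolding qu_e_idem_def by (simp add: qu.m_assoc[symmetric])
  then show ?thesis unfolding bold_one_eigen sg qu_e_idem_def
   by (simp add: qu.unit_left_comm[OF phi_closed bold_one_closed])
 qed
 have ec: "?e \<in> carrier (regular_module A)" by simp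
 have khe: "R.opkh ((R.opk ^^ r) ?e) = R.sc (q ^ (2 * i)) ((R.opk ^^ Suc r) ?e)" "(R.opk ^^ r) ?e \<in> carrier (regular_module A)" for r
 proof -
  show c: "(R.opk ^^ r) ?e \<in> carrier (regular_module A)" for r by (induction r) (use ec R.op_closed(1) in auto)
  show "R.opkh ((R.opk ^^ r) ?e) = R.sc (q ^ (2 * i)) ((R.opk ^^ Suc r) ?e)"
  proof (induction r)
   case 0
   have "R.opkh ?e = R.opk (R.opK ?e)" using R.opk_opK[OF ec] by simp
   then show ?case using R.op_sc(1)[OF ec] by (simp add: Ke)
  next
   case (Suc r)
   have "R.opkh ((R.opk ^^ Suc r) ?e) = R.opk (R.opkh ((R.opk ^^ r) ?e))" using R.opk_opkh[OF c[of r]] by simp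
   also have "... = R.sc (q ^ (2 * i)) ((R.opk ^^ Suc (Suc r)) ?e)"
    unfolding Suc using R.op_sc(1)[OF c[of "Suc r"]] by simp
   finally show ?case .
  qed
 qed
 have kp: "(R.opkh ^^ r) ?e = R.sc (q ^ (2 * i * r)) ((R.opk ^^ r) ?e)" for r
 proof (induction r)
  case (Suc r)
  then show ?case using khe(1)[of r] R.op_sc(3)[OF khe(2)[of r]] R.sc_sc[OF khe(2)[of "Suc r"]]
   by (simp add: power_add mult.commute del: regular_module_simps)
 qed (use R.sc_one[OF ec] in simp)
 define \<mu> where "\<mu> = inverse (q ^ (2 * i * ?m)) * ?sg"
 have mu_alt: "\<mu> = ?sg * q powi (- int (2 * i * ?m))"
  by (simp only: \<mu>_def power_int_minus power_int_of_nat mult.commute)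
 have g1: "(R.opk ^^ Suc ?m) ?e = R.sc \<mu> ?e"
 proof -
  have "gsgn \<cdot> ?e = R.opk ((R.opkh ^^ ?m) ?e)"
   using R.pow_act[OF gens_closed(2) ec, of ?m] unfolding gsgn_def R.opk_def by (simp add: qu.m_assoc R.opkh_def[abs_def])
  also have "... = R.sc (q ^ (2 * i * ?m)) ((R.opk ^^ Suc ?m) ?e)"
   unfolding kp using R.op_sc(1)[OF khe(2)[of ?m]] by simp
  finally have "R.sc (q ^ (2 * i * ?m)) ((R.opk ^^ Suc ?m) ?e) = R.sc ?sg ?e" using ge by (simp add: R.sc_def)
  then have "(R.opk ^^ Suc ?m) ?e = R.sc (inverse (q ^ (2 * i * ?m))) (R.sc ?sg ?e)" by (intro R.sc_eq_imp[OF khe(2)]) auto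
  then show ?thesis unfolding R.sc_sc[OF ec] \<mu>_def .
 qed
 have pow: "(R.opk ^^ (Suc ?m * r)) ?e = R.sc (\<mu> ^ r) ?e" for r
 proof (induction r)
  case (Suc r)
  have "(R.opk ^^ (Suc ?m * Suc r)) ?e = (R.opk ^^ Suc ?m) ((R.opk ^^ (Suc ?m * r)) ?e)"
   unfolding mult_Suc_right Nat.funpow_add o_apply ..
  also have "... = (R.opk ^^ Suc ?m) (R.sc (\<mu> ^ r) ?e)" unfolding Suc ..
  also have "... = R.sc (\<mu> ^ r) ((R.opk ^^ Suc ?m) ?e)"
  proof -
   have "(R.opk ^^ l) (R.sc c ?e) = R.sc c ((R.opk ^^ l) ?e)" for l c
    by (induction l) (use R.op_sc(1)[OF khe(2)] in simp_all)
   then show ?thesis .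
  qed
  finally show ?case unfolding g1 using R.sc_sc[OF ec] by (simp add: mult.commute)
 qed (use R.sc_one[OF ec] in simp)
 have period: "(R.opk ^^ (n * r)) ?e = ?e" for r
 proof -
  have "(R.opk ^^ (n * r)) ?e = (\<kappa> \<up> (n * r)) \<odot>\<^bsub>regular_module A\<^esub> ?e"
   using R.pow_act[OF gens_closed(1) ec, of "n * r"] by (simp add: R.opk_def[abs_def])
  also have "\<kappa> \<up> (n * r) = \<one>\<^bsub>A\<^esub>" using qu.kappa_pow by (simp flip: qu.nat_pow_pow)
  finally show ?thesis by simp
 qed
 obtain m' where m': "n = 4 * m'" using four_dvd by (auto simp: dvd_def)
 have sq: "Suc ?m * Suc ?m = Suc (n * (1 + m'))" using m' by (simp add: algebra_simps)
 have "R.opk ?e = (R.opk ^^ (Suc ?m * Suc ?m)) ?e" unfolding sq using period[of "1 + m'"] by simp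
 then have ke: "R.opk ?e = R.sc (\<mu> ^ Suc ?m) ?e" unfolding pow .
 \<comment> \<open>The sign \<open>(-1)^j\<close> survives because n/2 + 1 is odd; the sign
   \<open>(-1)^i\<close> is what \<open>q^(N/2) = -1\<close> contributes.\<close>
 have mu: "\<mu> ^ Suc ?m = sgn_ij i j * q powi (- int n * int i)"
 proof -
  have "2 * ?m = n" using n_even by simp
  then have e: "- int (2 * i * ?m) = - int n * int i" by (metis mult.assoc mult.commute mult_minus_left of_nat_mult)
  have "- int n * int i * int (Suc ?m) = - int n * int i + int hN * (- int i)" by (simp add: hN_def algebra_simps)
  then have "(q powi (- int n * int i)) ^ Suc ?m = q powi (- int n * int i) * (q powi int hN) powi (- int i)"
   unfolding q_pow by (simp only: q_add power_int_mult)
  also have "q powi int hN = - 1" using q_half hN by (metis of_nat_numeral zdiv_int)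
  also have "(- 1 :: 'k) powi (- int i) = (- 1) ^ i" by (simp add: power_int_minus power_inverse[symmetric])
  finally have "(q powi (- int n * int i)) ^ Suc ?m = q powi (- int n * int i) * (- 1) ^ i" .
  moreover have "?sg ^ Suc ?m = ?sg" using n_half_even sg by (auto simp: power_Suc)
  ultimately show ?thesis unfolding mu_alt e power_mult_distrib sgn_ij_def by (simp add: power_add mult_ac)
 qed
 have "R.opkh ?e = R.sc (q ^ (2 * i)) (R.opk ?e)" using khe(1)[of 0] by simp
 also have "... = R.sc (q powi (2 * int i) * (sgn_ij i j * q powi (- int n * int i))) ?e"
  unfolding ke mu R.sc_sc[OF ec] by (simp add: power_int_def nat_mult_distrib)
 also have "q powi (2 * int i) * (sgn_ij i j * q powi (- int n * int i)) = sgn_ij i j * q powi ((2 - int n) * int i)"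
 proof -
  have "(2 - int n) * int i = 2 * int i + - int n * int i" by (simp add: algebra_simps)
  then show ?thesis by (simp only: q_add mult.left_commute)
 qed
 finally show ?thesis unfolding R.wt_def using ec ke mu by simp
qed

end

section \<open>Independence of the products of F, torus and E\<close>

context qparam
begin

text \<open>The idempotents \<open>e_(2i,j)\<close> are weight vectors of A and add up to 1.\<close>

lemma A_weight_zero:
 assumes u: "u \<in> carrier A" and 0: "\<And>s x v. [|s = 1 \<or> s = - 1; R.wt s x v|] ==> u \<cdot> v = \<zero>\<^bsub>A\<^esub>"
 shows "u = \<zero>\<^bsub>A\<^esub>"
proof -
 have e: "u \<cdot> qu_e_idem n q (2 * i) j = \<zero>\<^bsub>A\<^esub>" if "j \<le> 1" for i j
  using 0[OF sgn_ij_cases e_wt[OF that]] .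
 have "u \<cdot> qu_phi n q (2 * i) = \<zero>\<^bsub>A\<^esub>" for i
 proof -
  have "u \<cdot> qu_phi n q (2 * i) = u \<cdot> (qu_phi n q (2 * i) \<cdot> (qu_bold_one n q 0 \<oplus>\<^bsub>A\<^esub> qu_bold_one n q 1))"
   unfolding bold_one_sum by simp
  also have "... = u \<cdot> qu_e_idem n q (2 * i) 0 \<oplus>\<^bsub>A\<^esub> u \<cdot> qu_e_idem n q (2 * i) 1"
   using u by (simp add: qu_e_idem_def qu.r_distr)
  finally show ?thesis using e[of 0] e[of 1] by simp
 qed
 then have "(\<Oplus>\<^bsub>A\<^esub> i\<in>{1..hN}. u \<cdot> qu_phi n q (2 * i)) = \<zero>\<^bsub>A\<^esub>" by simp
 moreover have "(\<Oplus>\<^bsub>A\<^esub> i\<in>{1..hN}. u \<cdot> qu_phi n q (2 * i)) = u \<cdot> \<one>\<^bsub>A\<^esub>"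
  unfolding phi_sum[symmetric] using u by (intro qu.finsum_rdistr[symmetric]) auto
 ultimately show ?thesis using u by simp
qed

abbreviation "u0 \<equiv> qu_u0 n q"

lemma u0_subset: "u \<in> u0 ==> u \<in> carrier A"
 unfolding qu_u0_def by (rule qu.generate_ring_in_carrier) auto

lemma u0_closed:
 shows u0_unit: "\<eta> c \<in> u0" and u0_kappa: "\<kappa> \<in> u0" and u0_kappa_hat: "\<kappa>h \<in> u0" and u0_one: "\<one>\<^bsub>A\<^esub> \<in> u0"
  and u0_add: "[|u \<in> u0; v \<in> u0|] ==> u \<oplus>\<^bsub>A\<^esub> v \<in> u0" and u0_mult: "[|u \<in> u0; v \<in> u0|] ==> u \<cdot> v \<in> u0"
 unfolding qu_u0_def by (auto intro: generate_ring.intros)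

lemma u0_zero: "\<zero>\<^bsub>A\<^esub> \<in> u0" using u0_unit[of 0] by (simp add: R.unit_zero)

lemma u0_pow: "u \<in> u0 ==> u \<up> (r::nat) \<in> u0" by (induction r) (auto intro: u0_one u0_mult)

lemma u0_finsum: "finite I ==> (\<And>i. i \<in> I ==> f i \<in> u0) ==> finsum A f I \<in> u0"
proof (induction I rule: finite_induct)
 case (insert i I)
 then have "finsum A f (insert i I) = f i \<oplus>\<^bsub>A\<^esub> finsum A f I"
  by (intro qu.finsum_insert) (auto intro: u0_subset)
 then show ?case using insert by (simp add: u0_add)
qed (simp add: u0_zero)

lemma e_u0: "qu_e_idem n q s j \<in> u0"
proof -
 have "K \<in> u0" unfolding kappa_inv by (intro u0_mult u0_pow u0_kappa u0_kappa_hat)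
 moreover have "gsgn \<in> u0" unfolding gsgn_def by (intro u0_mult u0_pow u0_kappa u0_kappa_hat)
 ultimately show ?thesis unfolding qu_e_idem_def phi_proj qu.proj_def bold_one_alt
  by (blast intro: u0_mult u0_unit u0_add u0_one u0_pow u0_finsum[OF finite_lessThan])
qed

text \<open>Brings powers of E applied to a torus element into the form required by
  \<open>qu_lower_span\<close>, with the torus element on the left.\<close>

lemma u0_E: assumes "u \<in> u0" shows "\<exists>u'\<in>u0. E \<cdot> u = u' \<cdot> E" using assms unfolding qu_u0_def
proof (induction rule: generate_ring.induct)
 case one
 then show ?case using u0_one unfolding qu_u0_def by (intro bexI[of _ "\<one>\<^bsub>A\<^esub>"]) auto
next
 case (incl h)
 have *: "\<exists>u'\<in>u0. E \<cdot> k = u' \<cdot> E" if "k \<in> u0" "c \<noteq> 0" "k \<cdot> E = \<eta> c \<cdot> E \<cdot> k" for k c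
 proof (rule bexI)
  have k: "k \<in> carrier A" using that u0_subset by blast
  have "(\<eta> (inverse c) \<cdot> k) \<cdot> E = \<eta> (inverse c) \<cdot> (\<eta> c \<cdot> (E \<cdot> k))"
   using k that by (simp add: qu.m_assoc)
  also have "... = E \<cdot> k" using k that by (simp add: qu.unit_mult_left qu.unit_one)
  finally show "E \<cdot> k = (\<eta> (inverse c) \<cdot> k) \<cdot> E" by simp
  show "\<eta> (inverse c) \<cdot> k \<in> u0" by (intro u0_mult u0_unit that)
 qed
 from incl consider c where "h = \<eta> c" | "h = \<kappa>" | "h = \<kappa>h" by auto
 then show ?case
 proof cases
  case 1
  then show ?thesis using qu.unit_central[of E c] u0_unit[of c] unfolding qu_u0_def by (intro bexI[of _ "\<eta> c"]) auto
 next
  case 2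
  then show ?thesis using *[OF u0_kappa, of "q ^ n"] qu.kappa_E unfolding qu_u0_def by simp
 next
  case 3
  then show ?thesis using *[OF u0_kappa_hat, of "q ^ n * inverse (q ^ 2)"] qu.kappa_hat_E unfolding qu_u0_def by simp
 qed
next
 case (a_inv h)
 then have h: "h \<in> carrier A" using u0_subset unfolding qu_u0_def by blast
 from a_inv obtain u' where u': "u' \<in> u0" "E \<cdot> h = u' \<cdot> E" unfolding qu_u0_def by blast
 then have "E \<cdot> (\<ominus>\<^bsub>A\<^esub> h) = (\<ominus>\<^bsub>A\<^esub> u') \<cdot> E" using h u0_subset by (simp add: qu.r_minus qu.l_minus)
 moreover have "\<ominus>\<^bsub>A\<^esub> u' \<in> u0" using u' unfolding qu_u0_def by (rule_tac generate_ring.a_inv)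
 ultimately show ?case unfolding qu_u0_def by blast
next
 case (eng_add h1 h2)
 then have h: "h1 \<in> carrier A" "h2 \<in> carrier A" using u0_subset unfolding qu_u0_def by blast+
 from eng_add obtain u1 u2 where u: "u1 \<in> u0" "E \<cdot> h1 = u1 \<cdot> E" "u2 \<in> u0" "E \<cdot> h2 = u2 \<cdot> E"
  unfolding qu_u0_def by blast
 then have "E \<cdot> (h1 \<oplus>\<^bsub>A\<^esub> h2) = (u1 \<oplus>\<^bsub>A\<^esub> u2) \<cdot> E" using h u0_subset by (simp add: qu.r_distr qu.l_distr)
 then show ?case using u0_add[OF u(1,3)] unfolding qu_u0_def by blast
next
 case (eng_mult h1 h2)
 then have h: "h1 \<in> carrier A" "h2 \<in> carrier A" using u0_subset unfolding qu_u0_def by blast+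
 from eng_mult obtain u1 u2 where u: "u1 \<in> u0" "E \<cdot> h1 = u1 \<cdot> E" "u2 \<in> u0" "E \<cdot> h2 = u2 \<cdot> E"
  unfolding qu_u0_def by blast
 then have uc: "u1 \<in> carrier A" "u2 \<in> carrier A" using u0_subset by auto
 have "E \<cdot> (h1 \<cdot> h2) = (E \<cdot> h1) \<cdot> h2" using h by (simp add: qu.m_assoc)
 also have "... = u1 \<cdot> (E \<cdot> h2)" unfolding u(2) using h uc by (simp add: qu.m_assoc)
 also have "... = (u1 \<cdot> u2) \<cdot> E" unfolding u(4) using uc by (simp add: qu.m_assoc)
 finally show ?case using u0_mult[OF u(1,3)] unfolding qu_u0_def by blast
qed

lemma u0_E_pow: assumes "u \<in> u0" shows "\<exists>u'\<in>u0. (R.opE ^^ b) u = u' \<cdot> E \<up> b"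
proof (induction b)
 case 0
 then show ?case using assms u0_subset[OF assms] by (intro bexI[of _ u]) auto
next
 case (Suc b)
 then obtain u' where u': "u' \<in> u0" "(R.opE ^^ b) u = u' \<cdot> E \<up> b" by blast
 obtain v where v: "v \<in> u0" "E \<cdot> u' = v \<cdot> E" using u0_E[OF u'(1)] by blast
 have c: "u' \<in> carrier A" "v \<in> carrier A" using u0_subset u' v by auto
 have "(R.opE ^^ Suc b) u = (E \<cdot> u') \<cdot> E \<up> b" using u' c by (simp add: R.opE_def qu.m_assoc)
 also have "... = v \<cdot> (E \<cdot> E \<up> b)" unfolding v(2) using c by (simp add: qu.m_assoc)
 also have "E \<cdot> E \<up> b = E \<up> Suc b" by (rule qu.nat_pow_Suc2[symmetric]) simp
 finally show ?case using v by blast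
qed

text \<open>The scalar by which a torus element acts depends on the weight alone. Treating A and M
  at once allows eigenvalues found in an induced module to be transported to A.\<close>

lemma u0_val:
 fixes M :: "('k free_qu set, 'm) module"
 assumes M: "qmod n q M" and u: "u \<in> u0"
 shows "\<exists>c. (\<forall>v. R.wt s x v \<longrightarrow> u \<cdot> v = \<eta> c \<cdot> v) \<and>
  (\<forall>v. qmod.wt n q M s x v \<longrightarrow> u \<odot>\<^bsub>M\<^esub> v = \<eta> c \<odot>\<^bsub>M\<^esub> v)"
proof -
 interpret M: qmod n q M by fact
 have Rc: "v \<in> carrier A" if "R.wt s x v" for v using R.wt_closed[OF that] by simp
 have Mc: "v \<in> carrier M" if "M.wt s x v" for v using M.wt_closed[OF that] .
 show ?thesis using u unfolding qu_u0_def
 proof (induction rule: generate_ring.induct)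
  case one
  then show ?case using Rc Mc by (intro exI[of _ 1]) (auto simp: qu.unit_one)
 next
  case (incl h)
  then consider c where "h = \<eta> c" | "h = \<kappa>" | "h = \<kappa>h" by auto
  then show ?case
  proof cases
   case 1 then show ?thesis by blast
  next
   case 2 then show ?thesis by (intro exI[of _ "s * q powi (- int n * x)"])
    (auto simp: R.wt_def M.wt_def R.opk_def M.opk_def R.sc_def M.sc_def)
  next
   case 3 then show ?thesis by (intro exI[of _ "s * q powi ((2 - int n) * x)"])
    (auto simp: R.wt_def M.wt_def R.opkh_def M.opkh_def R.sc_def M.sc_def)
  qed
 next
  case (a_inv h)
  then obtain c where c: "\<forall>v. R.wt s x v \<longrightarrow> h \<cdot> v = \<eta> c \<cdot> v"
   "\<forall>v. M.wt s x v \<longrightarrow> h \<odot>\<^bsub>M\<^esub> v = \<eta> c \<odot>\<^bsub>M\<^esub> v" by blast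
  have h: "h \<in> carrier A" using a_inv u0_subset unfolding qu_u0_def by blast
  have "\<ominus>\<^bsub>A\<^esub> h \<cdot> v = \<eta> (- 1 * c) \<cdot> v" if v: "R.wt s x v" for v
   unfolding qu.minus_unit[OF h] qu.unit_mult using c(1) v h Rc[OF v] by (simp only: qu.m_assoc qu.unit_closed)
  moreover have "\<ominus>\<^bsub>A\<^esub> h \<odot>\<^bsub>M\<^esub> v = \<eta> (- 1 * c) \<odot>\<^bsub>M\<^esub> v" if v: "M.wt s x v" for v
   unfolding qu.minus_unit[OF h] qu.unit_mult using c(2) v h Mc[OF v] by (simp only: M.act_assoc qu.unit_closed)
  ultimately show ?case by blast
 next
  case (eng_add h1 h2)
  then obtain c1 c2 where c: "\<forall>v. R.wt s x v \<longrightarrow> h1 \<cdot> v = \<eta> c1 \<cdot> v"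
   "\<forall>v. M.wt s x v \<longrightarrow> h1 \<odot>\<^bsub>M\<^esub> v = \<eta> c1 \<odot>\<^bsub>M\<^esub> v" "\<forall>v. R.wt s x v \<longrightarrow> h2 \<cdot> v = \<eta> c2 \<cdot> v"
   "\<forall>v. M.wt s x v \<longrightarrow> h2 \<odot>\<^bsub>M\<^esub> v = \<eta> c2 \<odot>\<^bsub>M\<^esub> v" by blast
  have h: "h1 \<in> carrier A" "h2 \<in> carrier A" using eng_add u0_subset unfolding qu_u0_def by blast+
  show ?case using c h Rc Mc by (intro exI[of _ "c1 + c2"]) (simp add: qu.unit_add qu.l_distr M.act_l_distr)
 next
  case (eng_mult h1 h2)
  then obtain c1 c2 where c: "\<forall>v. R.wt s x v \<longrightarrow> h1 \<cdot> v = \<eta> c1 \<cdot> v"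
   "\<forall>v. M.wt s x v \<longrightarrow> h1 \<odot>\<^bsub>M\<^esub> v = \<eta> c1 \<odot>\<^bsub>M\<^esub> v" "\<forall>v. R.wt s x v \<longrightarrow> h2 \<cdot> v = \<eta> c2 \<cdot> v"
   "\<forall>v. M.wt s x v \<longrightarrow> h2 \<odot>\<^bsub>M\<^esub> v = \<eta> c2 \<odot>\<^bsub>M\<^esub> v" by blast
  have h: "h1 \<in> carrier A" "h2 \<in> carrier A" using eng_mult u0_subset unfolding qu_u0_def by blast+
  have "h1 \<cdot> h2 \<cdot> v = \<eta> (c2 * c1) \<cdot> v" if v: "R.wt s x v" for v
   using c(1,3) v h Rc[OF v] by (simp add: qu.m_assoc qu.unit_left_comm[OF h(1) Rc[OF v]] qu.unit_mult)
  moreover have "(h1 \<cdot> h2) \<odot>\<^bsub>M\<^esub> v = \<eta> (c2 * c1) \<odot>\<^bsub>M\<^esub> v" if v: "M.wt s x v" for v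
   using c(2,4) v h Mc[OF v] M.act_sc[OF h(1) Mc[OF v], of c2] M.sc_sc[OF Mc[OF v], of c2 c1]
   by (simp add: M.act_assoc M.sc_def)
  ultimately show ?case by blast
 qed
qed

definition delta :: "nat => nat => 'k vec" where "delta a b = (\<lambda>p. if p = (a, b) then 1 else 0)"

lemma vE_delta: "b < N ==> (vE x ^^ b) (delta 0 0) = delta 0 b"
proof (induction b)
 case (Suc b)
 then have "(vE x ^^ Suc b) (delta 0 0) = vE x (delta 0 b)" by simp
 also have "... = delta 0 (Suc b)"
  using Suc.prems N_pos by (auto simp: fun_eq_iff vE_eval delta_def simp del: ecoeff.simps(2))
 finally show ?case .
qed simp

lemma vF_delta: "a < N ==> b < N ==> (vF ^^ a) (delta 0 b) = delta a b"
proof (induction a)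
 case (Suc a)
 then have "(vF ^^ Suc a) (delta 0 b) = vF (delta a b)" by simp
 also have "... = delta (Suc a) b" using Suc.prems by (auto simp: fun_eq_iff vF_def delta_def)
 finally show ?case .
qed simp

lemma vE_delta_top: "m < N ==> b < N ==> (vE x ^^ m) (delta (N - 1) 0) (N - 1, b) = (if b = m then q ^ ((N - 1) * m) else 0)"
proof (induction m arbitrary: b)
 case (Suc m)
 have "N - 1 < N" "\<not> Suc (N - 1) < N" using N_pos by auto
 then have "(vE x ^^ Suc m) (delta (N - 1) 0) (N - 1, b) = (if 0 < b then q ^ (N - 1) * (vE x ^^ m) (delta (N - 1) 0) (N - 1, b - 1) else 0)"
  using Suc.prems by (simp add: vE_eval del: ecoeff.simps(2))
 moreover have "q ^ ((N - 1) * Suc m) = q ^ (N - 1) * q ^ ((N - 1) * m)" by (simp only: mult_Suc_right power_add)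
 ultimately show ?case using Suc.IH[of "b - 1"] Suc.prems by (cases b) (simp_all del: mult_Suc_right)
qed (simp add: delta_def)

lemma lower_span_mem:
 assumes "g \<in> qu_lower_span n q"
 shows "\<exists>u. (\<forall>a b. u a b \<in> u0) \<and> g = (\<Oplus>\<^bsub>A\<^esub> a\<in>{0..N - 2}. \<Oplus>\<^bsub>A\<^esub> b\<in>{0..N - 1}. F \<up> a \<cdot> u a b \<cdot> E \<up> b)"
 using assms unfolding qu_lower_span_def mem_Collect_eq by (elim exE conjE) (intro exI conjI)

text \<open>Let F g act on the generator z of the module induced from weight x + b0. Then
  \<open>E^b0 z\<close> has weight x, so \<open>u a0 b0\<close> acts on it by the same scalar as on
  v, and this scalar stands at the position (a0 + 1, b0). The bound a0 \<le> N - 2 keeps that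
  position inside the square.\<close>

lemma lower_span_coeff:
 assumes s: "s = 1 \<or> s = - 1" and a: "a0 \<le> N - 2" and b: "b0 \<le> N - 1"
  and g: "g \<in> qu_lower_span n q"
  and u: "\<And>a b. u a b \<in> u0"
  and g_eq: "g = (\<Oplus>\<^bsub>A\<^esub> a\<in>{0..N - 2}. \<Oplus>\<^bsub>A\<^esub> b\<in>{0..N - 1}. F \<up> a \<cdot> u a b \<cdot> E \<up> b)"
  and M: "qmod n q M" "carrier M = UNIV"
  "\<And>v w. v \<oplus>\<^bsub>M\<^esub> w = (\<lambda>p. v p + w p)" "\<zero>\<^bsub>M\<^esub> = (\<lambda>p. 0)" "\<And>c v. \<eta> c \<odot>\<^bsub>M\<^esub> v = (\<lambda>p. c * v p)"
  "\<And>v. \<kappa> \<odot>\<^bsub>M\<^esub> v = vdiag (vk s) (x + int b0) v" "\<And>v. \<kappa>h \<odot>\<^bsub>M\<^esub> v = vdiag (vkh s) (x + int b0) v"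
  "\<And>v. E \<odot>\<^bsub>M\<^esub> v = vE (x + int b0) v" "\<And>v. F \<odot>\<^bsub>M\<^esub> v = vF v"
  and v: "R.wt s x v"
 shows "u a0 b0 \<cdot> v = \<eta> (((F \<cdot> g) \<odot>\<^bsub>M\<^esub> delta 0 0) (Suc a0, b0)) \<cdot> v"
proof -
 interpret M: qmod n q M by fact
 have uc: "u a b \<in> carrier A" for a b using u u0_subset by blast
 \<comment> \<open>The function \<open>delta 0 b\<close> is the vector \<open>E^b z\<close>.\<close>
 have wt: "M.wt s (x + int b0 - int b) (delta 0 b)" if "b < N" for b
 proof -
  have "vdiag f (x + int b0) (delta 0 b) = (\<lambda>p. f (x + int b0 - int b) * delta 0 b p)" for f
   using that N_pos by (auto simp: vdiag_def delta_def fun_eq_iff)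
  then show ?thesis unfolding M.wt_def M.opk_def M.opkh_def M.sc_def M(2,5,6,7) vk_def vkh_def by simp
 qed
 have ex: "\<exists>c. (\<forall>v. R.wt s (x + int b0 - int b) v \<longrightarrow> u a b \<cdot> v = \<eta> c \<cdot> v) \<and>
  (\<forall>v. M.wt s (x + int b0 - int b) v \<longrightarrow> u a b \<odot>\<^bsub>M\<^esub> v = \<eta> c \<odot>\<^bsub>M\<^esub> v)" for a b
  by (rule u0_val[OF M(1) u])
 obtain c where c: "\<And>a b v. R.wt s (x + int b0 - int b) v ==> u a b \<cdot> v = \<eta> (c a b) \<cdot> v"
  "\<And>a b v. M.wt s (x + int b0 - int b) v ==> u a b \<odot>\<^bsub>M\<^esub> v = \<eta> (c a b) \<odot>\<^bsub>M\<^esub> v"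
 proof -
  define c where "c a b = (SOME c. (\<forall>v. R.wt s (x + int b0 - int b) v \<longrightarrow> u a b \<cdot> v = \<eta> c \<cdot> v) \<and>
   (\<forall>v. M.wt s (x + int b0 - int b) v \<longrightarrow> u a b \<odot>\<^bsub>M\<^esub> v = \<eta> c \<odot>\<^bsub>M\<^esub> v))" for a b
  note c = someI_ex[OF ex, folded c_def]
  show thesis using c that[of c] by blast
 qed
 have Fpow: "(F \<up> r) \<odot>\<^bsub>M\<^esub> w = (vF ^^ r) w" "(E \<up> r) \<odot>\<^bsub>M\<^esub> w = (vE (x + int b0) ^^ r) w" for r :: nat and w
  using M.pow_act[of F w r] M.pow_act[of E w r] M(2) by (simp_all add: M(8,9))
 have vFsc: "(vF ^^ r) (\<lambda>p. d * w p) = (\<lambda>p. d * (vF ^^ r) w p)" for r d w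
  by (induction r) (auto simp: v_lin)
 have trm: "(F \<cdot> (F \<up> a \<cdot> u a b \<cdot> E \<up> b)) \<odot>\<^bsub>M\<^esub> delta 0 0 = (\<lambda>p. c a b * delta (Suc a) b p)"
  if "a \<le> N - 2" "b \<le> N - 1" for a b
 proof -
  have ab: "Suc a < N" "b < N" using that N_ge by auto
  have "(F \<cdot> (F \<up> a \<cdot> u a b \<cdot> E \<up> b)) \<odot>\<^bsub>M\<^esub> delta 0 0 = vF ((vF ^^ a) (u a b \<odot>\<^bsub>M\<^esub> delta 0 b))"
   using uc M(2) by (simp add: M.act_assoc Fpow vE_delta[OF ab(2)] M(9))
  also have "... = (vF ^^ Suc a) (\<lambda>p. c a b * delta 0 b p)" unfolding c(2)[OF wt[OF ab(2)]] M(5) by simp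
  also have "... = (\<lambda>p. c a b * delta (Suc a) b p)" unfolding vFsc vF_delta[OF ab] ..
  finally show ?thesis .
 qed
 have ev: "(finsum M f I) p = (\<Sum>i\<in>I. f i p)" if "finite I" for I :: "nat set" and f p
  using that by (induction I rule: finite_induct) (auto simp: M(2,3,4))
 let ?t = "\<lambda>a b. F \<cdot> (F \<up> a \<cdot> u a b \<cdot> E \<up> b)"
 have "F \<cdot> g = (\<Oplus>\<^bsub>A\<^esub> a\<in>{0..N - 2}. \<Oplus>\<^bsub>A\<^esub> b\<in>{0..N - 1}. ?t a b)"
 proof -
  have "F \<cdot> g = (\<Oplus>\<^bsub>A\<^esub> a\<in>{0..N - 2}. F \<cdot> (\<Oplus>\<^bsub>A\<^esub> b\<in>{0..N - 1}. F \<up> a \<cdot> u a b \<cdot> E \<up> b))"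
   unfolding g_eq using uc by (intro qu.finsum_rdistr) (auto intro!: qu.finsum_closed)
  also have "... = (\<Oplus>\<^bsub>A\<^esub> a\<in>{0..N - 2}. \<Oplus>\<^bsub>A\<^esub> b\<in>{0..N - 1}. ?t a b)"
   using uc by (intro qu.finsum_cong'[OF refl] qu.finsum_rdistr) (auto intro!: qu.finsum_closed)
  finally show ?thesis .
 qed
 then have "(F \<cdot> g) \<odot>\<^bsub>M\<^esub> delta 0 0 = finsum M (\<lambda>a. (\<Oplus>\<^bsub>A\<^esub> b\<in>{0..N - 1}. ?t a b) \<odot>\<^bsub>M\<^esub> delta 0 0) {0..N - 2}"
  using uc by (simp only:, intro M.act_finsum_left) (auto intro!: qu.finsum_closed simp: M(2))
 then have "((F \<cdot> g) \<odot>\<^bsub>M\<^esub> delta 0 0) (Suc a0, b0) = (\<Sum>a\<in>{0..N - 2}. ((\<Oplus>\<^bsub>A\<^esub> b\<in>{0..N - 1}. ?t a b) \<odot>\<^bsub>M\<^esub> delta 0 0) (Suc a0, b0))"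
  by (simp add: ev)
 also have "... = (\<Sum>a\<in>{0..N - 2}. \<Sum>b\<in>{0..N - 1}. (?t a b \<odot>\<^bsub>M\<^esub> delta 0 0) (Suc a0, b0))"
 proof (rule sum.cong[OF refl])
  fix a
  have "(\<Oplus>\<^bsub>A\<^esub> b\<in>{0..N - 1}. ?t a b) \<odot>\<^bsub>M\<^esub> delta 0 0 = finsum M (\<lambda>b. ?t a b \<odot>\<^bsub>M\<^esub> delta 0 0) {0..N - 1}"
   using uc by (intro M.act_finsum_left) (auto simp: M(2))
  then show "((\<Oplus>\<^bsub>A\<^esub> b\<in>{0..N - 1}. ?t a b) \<odot>\<^bsub>M\<^esub> delta 0 0) (Suc a0, b0) = (\<Sum>b\<in>{0..N - 1}. (?t a b \<odot>\<^bsub>M\<^esub> delta 0 0) (Suc a0, b0))"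
   by (simp add: ev)
 qed
 also have "... = (\<Sum>a\<in>{0..N - 2}. \<Sum>b\<in>{0..N - 1}. if a = a0 then if b = b0 then c a b else 0 else 0)"
  by (intro sum.cong refl) (subst trm, simp, simp, auto simp: delta_def[of "Suc _"])
 also have "... = (\<Sum>a\<in>{0..N - 2}. if a = a0 then \<Sum>b\<in>{0..N - 1}. if b = b0 then c a b else 0 else 0)"
  by (intro sum.cong refl) auto
 also have "... = c a0 b0" using a b by (simp add: sum.delta)
 finally show ?thesis using c(1)[of b0 v a0] v by simp
qed

text \<open>By \<open>lower_span_coeff\<close> the action of each torus coefficient on weight
  vectors is determined by F g, and \<open>A_weight_zero\<close> then determines the coefficient
  itself. This justifies the definite description in \<open>qu_gamma\<close>.\<close>

lemma lower_span_unique: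
 assumes g: "g \<in> qu_lower_span n q" and g': "g' \<in> qu_lower_span n q" and eq: "F \<cdot> g = F \<cdot> g'"
 shows "g = g'"
proof -
 obtain u where u: "\<And>a b. u a b \<in> u0"
  "g = (\<Oplus>\<^bsub>A\<^esub> a\<in>{0..N - 2}. \<Oplus>\<^bsub>A\<^esub> b\<in>{0..N - 1}. F \<up> a \<cdot> u a b \<cdot> E \<up> b)"
  using lower_span_mem[OF g] by blast
 obtain u' where u': "\<And>a b. u' a b \<in> u0"
  "g' = (\<Oplus>\<^bsub>A\<^esub> a\<in>{0..N - 2}. \<Oplus>\<^bsub>A\<^esub> b\<in>{0..N - 1}. F \<up> a \<cdot> u' a b \<cdot> E \<up> b)"
  using lower_span_mem[OF g'] by blast
 have uc: "u a b \<in> carrier A" "u' a b \<in> carrier A" for a b using u u' u0_subset by blast+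
 have "u a b = u' a b" if ab: "a \<in> {0..N - 2}" "b \<in> {0..N - 1}" for a b
 proof -
  have "u a b \<ominus>\<^bsub>A\<^esub> u' a b = \<zero>\<^bsub>A\<^esub>"
  proof (rule A_weight_zero)
   fix s x v assume s: "s = 1 \<or> s = - 1" and v: "R.wt s x v"
   have vc: "v \<in> carrier A" using R.wt_closed[OF v] by simp
   obtain M :: "('k free_qu set, 'k vec) module" where M: "qmod n q M" "carrier M = UNIV"
    "\<And>v w. v \<oplus>\<^bsub>M\<^esub> w = (\<lambda>p. v p + w p)" "\<zero>\<^bsub>M\<^esub> = (\<lambda>p. 0)" "\<And>c v. \<eta> c \<odot>\<^bsub>M\<^esub> v = (\<lambda>p. c * v p)"
    "\<And>v. \<kappa> \<odot>\<^bsub>M\<^esub> v = vdiag (vk s) (x + int b) v" "\<And>v. \<kappa>h \<odot>\<^bsub>M\<^esub> v = vdiag (vkh s) (x + int b) v"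
    "\<And>v. E \<odot>\<^bsub>M\<^esub> v = vE (x + int b) v" "\<And>v. F \<odot>\<^bsub>M\<^esub> v = vF v"
    using v_module[OF s, of "x + int b"] by blast
   have "u a b \<cdot> v = u' a b \<cdot> v"
    using lower_span_coeff[OF s _ _ g u M v, of a] lower_span_coeff[OF s _ _ g' u' M v, of a] ab eq by simp
   then show "(u a b \<ominus>\<^bsub>A\<^esub> u' a b) \<cdot> v = \<zero>\<^bsub>A\<^esub>"
    using uc vc by (simp add: a_minus_def qu.l_distr qu.l_minus qu.r_neg)
  qed (use uc in auto)
  then show ?thesis using uc qu.minus_eq_zero_iff by blast
 qed
 then show ?thesis unfolding u(2) u'(2) using uc by (intro qu.finsum_cong' refl) (auto intro!: qu.finsum_closed)
qed

lemma lower_span_monomial: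
 assumes w: "w \<in> u0" and a: "a0 \<le> N - 2" and b: "b0 \<le> N - 1"
 shows "F \<up> a0 \<cdot> w \<cdot> E \<up> b0 \<in> qu_lower_span n q"
proof -
 define u where "u a b = (if a = a0 \<and> b = b0 then w else \<zero>\<^bsub>A\<^esub>)" for a b
 have u: "u a b \<in> u0" for a b using w u0_zero by (simp add: u_def)
 have wc: "w \<in> carrier A" by (rule u0_subset[OF w])
 let ?m = "F \<up> a0 \<cdot> w \<cdot> E \<up> b0"
 have inner: "(\<Oplus>\<^bsub>A\<^esub> b\<in>{0..N - 1}. F \<up> a \<cdot> u a b \<cdot> E \<up> b) = (if a0 = a then ?m else \<zero>\<^bsub>A\<^esub>)" for a
 proof -
  have "(\<Oplus>\<^bsub>A\<^esub> b\<in>{0..N - 1}. F \<up> a \<cdot> u a b \<cdot> E \<up> b)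
   = (\<Oplus>\<^bsub>A\<^esub> b\<in>{0..N - 1}. if b0 = b then (if a0 = a then ?m else \<zero>\<^bsub>A\<^esub>) else \<zero>\<^bsub>A\<^esub>)"
   using wc by (intro qu.finsum_cong') (auto simp: u_def)
  also have "... = (if a0 = a then ?m else \<zero>\<^bsub>A\<^esub>)" using b wc by (intro qu.finsum_singleton) auto
  finally show ?thesis .
 qed
 have "(\<Oplus>\<^bsub>A\<^esub> a\<in>{0..N - 2}. \<Oplus>\<^bsub>A\<^esub> b\<in>{0..N - 1}. F \<up> a \<cdot> u a b \<cdot> E \<up> b) = ?m"
  unfolding inner using a wc by (intro qu.finsum_singleton) auto
 then show ?thesis unfolding qu_lower_span_def using u by blast
qed

lemma lower_span_add:
 assumes "g \<in> qu_lower_span n q" "g' \<in> qu_lower_span n q" shows "g \<oplus>\<^bsub>A\<^esub> g' \<in> qu_lower_span n q"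
proof -
 obtain u where u: "\<And>a b. u a b \<in> u0"
  "g = (\<Oplus>\<^bsub>A\<^esub> a\<in>{0..N - 2}. \<Oplus>\<^bsub>A\<^esub> b\<in>{0..N - 1}. F \<up> a \<cdot> u a b \<cdot> E \<up> b)"
  using lower_span_mem[OF assms(1)] by blast
 obtain u' where u': "\<And>a b. u' a b \<in> u0"
  "g' = (\<Oplus>\<^bsub>A\<^esub> a\<in>{0..N - 2}. \<Oplus>\<^bsub>A\<^esub> b\<in>{0..N - 1}. F \<up> a \<cdot> u' a b \<cdot> E \<up> b)"
  using lower_span_mem[OF assms(2)] by blast
 have uc: "u a b \<in> carrier A" "u' a b \<in> carrier A" for a b using u u' u0_subset by blast+
 let ?t = "\<lambda>u a b. F \<up> a \<cdot> u a b \<cdot> E \<up> b"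
 have "g \<oplus>\<^bsub>A\<^esub> g' = (\<Oplus>\<^bsub>A\<^esub> a\<in>{0..N - 2}. (\<Oplus>\<^bsub>A\<^esub> b\<in>{0..N - 1}. ?t u a b) \<oplus>\<^bsub>A\<^esub> (\<Oplus>\<^bsub>A\<^esub> b\<in>{0..N - 1}. ?t u' a b))"
  unfolding u(2) u'(2) using uc by (intro qu.finsum_addf[symmetric]) (auto intro!: qu.finsum_closed)
 also have "... = (\<Oplus>\<^bsub>A\<^esub> a\<in>{0..N - 2}. \<Oplus>\<^bsub>A\<^esub> b\<in>{0..N - 1}. ?t u a b \<oplus>\<^bsub>A\<^esub> ?t u' a b)"
  using uc by (intro qu.finsum_cong' refl) (auto intro!: qu.finsum_closed qu.finsum_addf[symmetric])
 also have "... = (\<Oplus>\<^bsub>A\<^esub> a\<in>{0..N - 2}. \<Oplus>\<^bsub>A\<^esub> b\<in>{0..N - 1}. ?t (\<lambda>a b. u a b \<oplus>\<^bsub>A\<^esub> u' a b) a b)"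
  using uc by (intro qu.finsum_cong' refl) (auto intro!: qu.finsum_closed simp: qu.r_distr qu.l_distr)
 finally show ?thesis unfolding qu_lower_span_def
  by (intro CollectI exI[of _ "\<lambda>a b. u a b \<oplus>\<^bsub>A\<^esub> u' a b"] conjI allI u0_add u(1) u'(1))
qed

end

section \<open>Modules decomposed into pairs and isomorphisms between them\<close>

context qmod
begin

text \<open>A direct sum of modules P, expressed by a basis: for each t one pair with parameter
  \<open>i t\<close> and sign \<open>s t\<close>.\<close>

definition pdec :: "'t set => ('t => nat) => ('t => 'k) => bool" where
 "pdec T i s \<longleftrightarrow> (\<exists>al ga. pfamily T i s al ga \<and> kbasis (pidx T) (pfam al ga))"

lemma pfam_wt:
 assumes "pfamily T i s al ga" "(t, g, l) \<in> pidx T"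
 shows "wt (s t) ((if g then - int (i t) else int (i t) - 1) - int l) (pfam al ga (t, g, l))"
 using assms wt_opE_pow[of "s t" "int (i t) - 1" "al t" l] wt_opE_pow[of "s t" "- int (i t)" "ga t" l]
 by (cases g) (auto simp: pfamily_def ppair_def pidx_def pfam_def)

end

locale qpair = qparam n q + M: qmod n q M + V: qmod n q V
 for n :: nat and q :: "'k::field_char_0" and M :: "('k free_qu set, 'm) module" and V :: "('k free_qu set, 'v) module"
begin

definition linear :: "('m => 'v) => bool" where
 "linear f \<longleftrightarrow> f \<in> carrier M \<rightarrow> carrier V \<and>
  (\<forall>x\<in>carrier M. \<forall>y\<in>carrier M. f (x \<oplus>\<^bsub>M\<^esub> y) = f x \<oplus>\<^bsub>V\<^esub> f y) \<and> (\<forall>c. \<forall>x\<in>carrier M. f (M.sc c x) = V.sc c (f x))"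

lemma linearD:
 assumes "linear f"
 shows "x \<in> carrier M ==> f x \<in> carrier V" "[|x \<in> carrier M; y \<in> carrier M|] ==> f (x \<oplus>\<^bsub>M\<^esub> y) = f x \<oplus>\<^bsub>V\<^esub> f y"
  "x \<in> carrier M ==> f (M.sc c x) = V.sc c (f x)" using assms by (auto simp: linear_def)

lemma linear_zero: assumes "linear f" shows "f \<zero>\<^bsub>M\<^esub> = \<zero>\<^bsub>V\<^esub>"
 using linearD(1,3)[OF assms, of "\<zero>\<^bsub>M\<^esub>"] M.sc_zero_right[of 0] by (metis M.M.zero_closed V.sc_zero)

lemma linear_lc:
 assumes f: "linear f" and "finite I" "b \<in> I \<rightarrow> carrier M"
 shows "f (M.lc I b c) = V.lc I (\<lambda>i. f (b i)) c" using assms(2,3)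
proof (induction I rule: finite_induct)
 case empty then show ?case by (simp add: linear_zero[OF f])
next
 case (insert i I)
 then have b: "b i \<in> carrier M" "b \<in> I \<rightarrow> carrier M" by auto
 have "f (M.lc (insert i I) b c) = f (M.sc (c i) (b i) \<oplus>\<^bsub>M\<^esub> M.lc I b c)" using insert b by (simp add: M.lc_insert)
 also have "... = V.sc (c i) (f (b i)) \<oplus>\<^bsub>V\<^esub> V.lc I (\<lambda>i. f (b i)) c"
  using insert.IH b by (simp add: linearD[OF f] M.lc_closed)
 also have "... = V.lc (insert i I) (\<lambda>i. f (b i)) c"
  using insert.hyps b linearD(1)[OF f] by (subst V.lc_insert) (auto simp: Pi_iff)
 finally show ?case .
qed

definition qhom :: "('m => 'v) => bool" where
 "qhom f \<longleftrightarrow> linear f \<and> (\<forall>x\<in>carrier M. f (M.opk x) = V.opk (f x) \<and> f (M.opkh x) = V.opkh (f x) \<and>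
  f (M.opE x) = V.opE (f x) \<and> f (M.opF x) = V.opF (f x))"

lemma qhomI:
 assumes "f \<in> carrier M \<rightarrow> carrier V" "\<And>x y. [|x \<in> carrier M; y \<in> carrier M|] ==> f (x \<oplus>\<^bsub>M\<^esub> y) = f x \<oplus>\<^bsub>V\<^esub> f y"
  and "\<And>a x. [|a \<in> carrier A; x \<in> carrier M|] ==> f (a \<odot>\<^bsub>M\<^esub> x) = a \<odot>\<^bsub>V\<^esub> f x"
 shows "qhom f" using assms by (auto simp: qhom_def linear_def M.sc_def V.sc_def M.op_defs V.op_defs)

lemma qhomD:
 assumes "qhom f" "x \<in> carrier M"
 shows "f (M.opk x) = V.opk (f x)" "f (M.opkh x) = V.opkh (f x)" "f (M.opE x) = V.opE (f x)" "f (M.opF x) = V.opF (f x)"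
 using assms by (auto simp: qhom_def)

lemma qhom_linear: "qhom f ==> linear f" by (simp add: qhom_def)

lemma qhom_act:
 assumes f: "qhom f" and a: "a \<in> carrier A"
 shows "\<forall>x\<in>carrier M. f (a \<odot>\<^bsub>M\<^esub> x) = a \<odot>\<^bsub>V\<^esub> f x" using a
proof (induction a rule: qu_induct)
 case (scalar c) then show ?case using linearD(3)[OF qhom_linear[OF f]] by (auto simp: M.sc_def V.sc_def)
next
 case kappa then show ?case using qhomD(1)[OF f] by (auto simp: M.op_defs V.op_defs)
next
 case kappa_hat then show ?case using qhomD(2)[OF f] by (auto simp: M.op_defs V.op_defs)
next
 case E then show ?case using qhomD(3)[OF f] by (auto simp: M.op_defs V.op_defs)
next
 case F then show ?case using qhomD(4)[OF f] by (auto simp: M.op_defs V.op_defs)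
next
 case (add u v) then show ?case using linearD[OF qhom_linear[OF f]] by (auto simp: M.act_l_distr V.act_l_distr)
next
 case (mult u v) then show ?case using linearD[OF qhom_linear[OF f]] by (auto simp: M.act_assoc V.act_assoc)
qed

lemma qhom_pow: assumes f: "qhom f" and x: "x \<in> carrier M" shows "f ((M.opE ^^ r) x) = (V.opE ^^ r) (f x)"
 by (induction r) (simp_all add: qhomD(3)[OF f] x)

lemma qhom_wt: assumes f: "qhom f" and x: "M.wt s x v" shows "V.wt s x (f v)"
 using x qhomD(1,2)[OF f M.wt_closed[OF x]] linearD[OF qhom_linear[OF f] M.wt_closed[OF x]]
 unfolding M.wt_def V.wt_def by metis

lemma qhom_ppair: assumes f: "qhom f" and p: "M.ppair i s al ga" shows "V.ppair i s (f al) (f ga)"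
proof -
 note cl = M.ppair_closed[OF p]
 show ?thesis using p qhom_wt[OF f] unfolding M.ppair_def V.ppair_def
  by (metis qhomD(4)[OF f] cl qhom_pow[OF f] linear_zero[OF qhom_linear[OF f]])
qed

text \<open>The action on the basis is determined by the data \<open>i\<close> and \<open>s\<close>.\<close>

lemma pdec_iso:
 assumes "M.pdec T i s" "V.pdec T i s"
 shows "module_isomorphic A M V"
proof -
 obtain al ga where p: "M.pfamily T i s al ga" and b: "M.kbasis (M.pidx T) (M.pfam al ga)"
  using assms(1) unfolding M.pdec_def by blast
 obtain al' ga' where p': "V.pfamily T i s al' ga'" and b': "V.kbasis (V.pidx T) (V.pfam al' ga')"
  using assms(2) unfolding V.pdec_def by blast
 let ?I = "M.pidx T" and ?b = "M.pfam al ga" and ?b' = "V.pfam al' ga'"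
 note bc = M.kbasisD(2)[OF b] and bc' = V.kbasisD(2)[OF b']
 have fin: "finite ?I" by (rule M.kbasisD(1)[OF b])
 define f where "f x = V.lc ?I ?b' (M.coord ?I ?b x)" for x
 have f_lc: "f (M.lc ?I ?b c) = V.lc ?I ?b' c" for c unfolding f_def by (rule V.lc_cong[OF bc']) (rule M.coord_lc[OF b])
 have f_b: "f (?b j) = ?b' j" if j: "j \<in> ?I" for j
 proof -
  have "?b j = M.lc ?I ?b (\<lambda>i. if i = j then 1 else 0)" using bc j by (subst M.lc_single[OF fin bc j]) (simp add: Pi_iff)
  then have "f (?b j) = V.sc 1 (?b' j)" by (simp only: f_lc V.lc_single[OF fin bc' j])
  then show ?thesis using bc' j by (simp add: Pi_iff)
 qed
 have lin: "linear f" unfolding linear_def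
 proof (intro conjI ballI allI)
  show "f \<in> carrier M \<rightarrow> carrier V" using bc' by (auto simp: f_def)
  show "f (x \<oplus>\<^bsub>M\<^esub> y) = f x \<oplus>\<^bsub>V\<^esub> f y" if "x \<in> carrier M" "y \<in> carrier M" for x y
  proof -
   have "f (x \<oplus>\<^bsub>M\<^esub> y) = V.lc ?I ?b' (\<lambda>i. M.coord ?I ?b x i + M.coord ?I ?b y i)"
    unfolding f_def by (rule V.lc_cong[OF bc']) (rule M.coord_add[OF b that])
   then show ?thesis by (simp add: f_def V.lc_add[OF fin bc'])
  qed
  show "f (M.sc c x) = V.sc c (f x)" if "x \<in> carrier M" for c x
  proof -
   have "f (M.sc c x) = V.lc ?I ?b' (\<lambda>i. c * M.coord ?I ?b x i)"
    unfolding f_def by (rule V.lc_cong[OF bc']) (rule M.coord_sc[OF b that])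
   then show ?thesis by (simp add: f_def V.lc_sc[OF fin bc'])
  qed
 qed
 have act: "f (a \<odot>\<^bsub>M\<^esub> x) = a \<odot>\<^bsub>V\<^esub> f x"
  if a: "a \<in> carrier A" and x: "x \<in> carrier M" and ab: "\<And>j. j \<in> ?I ==> f (a \<odot>\<^bsub>M\<^esub> ?b j) = a \<odot>\<^bsub>V\<^esub> ?b' j" for a x
 proof -
  obtain c where c: "x = M.lc ?I ?b c" using M.kbasisD(3)[OF b x] by blast
  have "f (a \<odot>\<^bsub>M\<^esub> x) = V.lc ?I (\<lambda>j. f (a \<odot>\<^bsub>M\<^esub> ?b j)) c"
   unfolding c M.lc_act[OF fin bc a] by (rule linear_lc[OF lin fin]) (use bc a in auto)
  also have "... = V.lc ?I (\<lambda>j. a \<odot>\<^bsub>V\<^esub> ?b' j) c"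
   by (rule V.lc_cong2) (use bc' a ab in auto)
  finally show ?thesis unfolding c f_lc V.lc_act[OF fin bc' a] .
 qed
 have "qhom f" unfolding qhom_def
 proof (intro conjI ballI lin)
  fix x assume x: "x \<in> carrier M"
  have w: "M.wt (s t) ((if g then - int (i t) else int (i t) - 1) - int l) (?b (t, g, l))"
   "V.wt (s t) ((if g then - int (i t) else int (i t) - 1) - int l) (?b' (t, g, l))" if "(t, g, l) \<in> ?I" for t g l
   using that M.pfam_wt[OF p] V.pfam_wt[OF p'] by auto
  have f_sc: "f (M.sc c (?b j)) = V.sc c (?b' j)" if "j \<in> ?I" for c j
   using linearD(3)[OF lin, of "?b j" c] f_b[OF that] bc that by auto
  show "f (M.opk x) = V.opk (f x)" unfolding M.opk_def V.opk_def
  proof (rule act[OF _ x])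
   fix j assume j: "j \<in> ?I"
   then obtain t g l where jj: "j = (t, g, l)" by (cases j) auto
   show "f (\<kappa> \<odot>\<^bsub>M\<^esub> ?b j) = \<kappa> \<odot>\<^bsub>V\<^esub> ?b' j"
    using w[OF j[unfolded jj]] f_sc[OF j] by (simp add: M.wt_def V.wt_def M.opk_def V.opk_def jj)
  qed simp
  show "f (M.opkh x) = V.opkh (f x)" unfolding M.opkh_def V.opkh_def
  proof (rule act[OF _ x])
   fix j assume j: "j \<in> ?I"
   then obtain t g l where jj: "j = (t, g, l)" by (cases j) auto
   show "f (\<kappa>h \<odot>\<^bsub>M\<^esub> ?b j) = \<kappa>h \<odot>\<^bsub>V\<^esub> ?b' j"
    using w[OF j[unfolded jj]] f_sc[OF j] by (simp add: M.wt_def V.wt_def M.opkh_def V.opkh_def jj)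
  qed simp
  show "f (M.opE x) = V.opE (f x)" unfolding M.opE_def V.opE_def
  proof (rule act[OF _ x])
   fix j assume j: "j \<in> ?I"
   then obtain t g l where jj: "j = (t, g, l)" "t \<in> T" "l < N" by (cases j) (auto simp: M.pidx_def)
   have b1: "E \<odot>\<^bsub>M\<^esub> ?b j = ?b (t, g, Suc l)" "E \<odot>\<^bsub>V\<^esub> ?b' j = ?b' (t, g, Suc l)"
    by (simp_all add: jj M.pfam_def V.pfam_def M.opE_def V.opE_def)
   show "f (E \<odot>\<^bsub>M\<^esub> ?b j) = E \<odot>\<^bsub>V\<^esub> ?b' j"
   proof (cases "Suc l < N")
    case True then show ?thesis unfolding b1 by (intro f_b) (use jj in \<open>auto simp: M.pidx_def\<close>)
   next
    case False
    have "M.ppair (i t) (s t) (al t) (ga t)" "V.ppair (i t) (s t) (al' t) (ga' t)"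
     using p p' jj by (auto simp: M.pfamily_def V.pfamily_def)
    then have "?b (t, g, Suc l) = \<zero>\<^bsub>M\<^esub>" "?b' (t, g, Suc l) = \<zero>\<^bsub>V\<^esub>"
     using False M.opE_pow_zero[of _ "Suc l"] V.opE_pow_zero[of _ "Suc l"] M.ppair_closed V.ppair_closed
     by (simp_all add: M.pfam_def V.pfam_def del: funpow.simps)
    then show ?thesis unfolding b1 using linear_zero[OF lin] by simp
   qed
  qed simp
  obtain c where c: "x = M.lc ?I ?b c" using M.kbasisD(3)[OF b x] by blast
  show "f (M.opF x) = V.opF (f x)" unfolding c M.opF_pfam[OF p] f_lc by (rule V.opF_pfam[OF p', symmetric])
 qed
 note hom = qhom_act[OF this]
 have "bij_betw f (carrier M) (carrier V)"
 proof (rule bij_betwI')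
  fix x y assume "x \<in> carrier M" "y \<in> carrier M"
  then obtain c d where c: "x = M.lc ?I ?b c" "y = M.lc ?I ?b d" using M.kbasisD(3)[OF b] by meson
  have "x = y" if "V.lc ?I ?b' c = V.lc ?I ?b' d" unfolding c by (rule M.lc_cong[OF bc]) (rule V.kbasis_unique[OF b' that])
  then show "f x = f y \<longleftrightarrow> x = y" using f_lc c by metis
 next
  fix y assume "y \<in> carrier V"
  then obtain c where "y = V.lc ?I ?b' c" using V.kbasisD(3)[OF b'] by blast
  then show "\<exists>x\<in>carrier M. y = f x" by (intro bexI[of _ "M.lc ?I ?b c"]) (auto simp: f_lc bc)
 qed (use linearD(1)[OF lin] in auto)
 then show ?thesis unfolding module_isomorphic_def using linearD(2)[OF lin] hom by blast
qed

end

lemma (in kmod) lc_span: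
 assumes I: "finite I" "b \<in> I \<rightarrow> carrier M" and J: "finite J" "\<And>j. j \<in> J ==> \<exists>d. b' j = lc I b d"
 shows "\<exists>d. lc J b' c = lc I b d"
proof -
 have "\<exists>a. \<forall>j\<in>J. b' j = lc I b (a j)" using J(2) by (intro bchoice ballI)
 then obtain a where "\<And>j. j \<in> J ==> b' j = lc I b (\<lambda>i. a j i)" by auto
 from lc_matrix[OF I(1) J(1) I(2), of b' "\<lambda>i j. a j i", OF this] show ?thesis by blast
qed

lemma (in kmod) lc_basis_span:
 assumes "finite I" "b \<in> I \<rightarrow> carrier M" "j \<in> I" shows "\<exists>d. sc c (b j) = lc I b d"
 using lc_single[OF assms, of c, symmetric] by blast

context qmod
begin

lemma wt_lc:
 assumes "finite I" "\<And>i. i \<in> I ==> wt s x (b i)" shows "wt s x (lc I b c)"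
 using assms
proof (induction I rule: finite_induct)
 case empty then show ?case by (simp add: wt_def)
next
 case (insert i I)
 then have "lc (insert i I) b c = sc (c i) (b i) \<oplus> lc I b c" by (intro lc_insert) auto
 then show ?case using insert by (simp add: wt_add wt_sc)
qed

lemma span_act:
 assumes I: "finite I" "b \<in> I \<rightarrow> carrier M"
  and gen: "\<And>j. j \<in> I ==> \<exists>d. opk (b j) = lc I b d" "\<And>j. j \<in> I ==> \<exists>d. opkh (b j) = lc I b d"
   "\<And>j. j \<in> I ==> \<exists>d. opE (b j) = lc I b d" "\<And>j. j \<in> I ==> \<exists>d. opF (b j) = lc I b d"
  and a: "a \<in> carrier A"
 shows "\<forall>c. \<exists>d. a \<odot> lc I b c = lc I b d"
proof -
 have gen': "\<forall>c. \<exists>d. a \<odot> lc I b c = lc I b d"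
  if "a \<in> carrier A" "\<And>j. j \<in> I ==> \<exists>d. a \<odot> b j = lc I b d" for a
  unfolding lc_act[OF I that(1)] by (intro allI lc_span[OF I I(1) that(2)])
 show ?thesis using a
 proof (induction a rule: qu_induct)
  case (scalar c) then show ?case using lc_sc[OF I, of c, symmetric] by (auto simp: sc_def)
 next
  case (add u v)
  then show ?case using I by (simp add: act_l_distr lc_closed) (metis lc_add[OF I])
 next
  case (mult u v)
  then show ?case using I by (simp add: act_assoc lc_closed) metis
 qed (rule gen'; simp add: gen[unfolded op_defs])+
qed

lemma pfam_span_act:
 assumes p: "pfamily T i s al ga" and a: "a \<in> carrier A"
 shows "\<forall>c. \<exists>d. a \<odot> lc (pidx T) (pfam al ga) c = lc (pidx T) (pfam al ga) d"
proof (rule span_act[OF _ pfam_closed[OF p] _ _ _ _ a])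
 let ?I = "pidx T" and ?b = "pfam al ga"
 note b = pfam_closed[OF p]
 show fin: "finite ?I" using p by (simp add: pfamily_def)
 fix j assume j: "j \<in> ?I"
 then obtain t g l where jj: "j = (t, g, l)" "t \<in> T" "l < N" by (cases j) (auto simp: pidx_def)
 show "\<exists>d. opk (?b j) = lc ?I ?b d" "\<exists>d. opkh (?b j) = lc ?I ?b d"
  using pfam_wt[OF p, of t g l] j jj lc_basis_span[OF fin b j] by (simp_all add: wt_def)
 have b1: "opE (?b j) = ?b (t, g, Suc l)" by (simp add: jj pfam_def)
 show "\<exists>d. opE (?b j) = lc ?I ?b d"
 proof (cases "Suc l < N")
  case True
  then have j': "(t, g, Suc l) \<in> ?I" using jj by (auto simp: pidx_def)
  then have "?b (t, g, Suc l) \<in> carrier M" using b by blast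
  then show ?thesis unfolding b1 using lc_basis_span[OF fin b j', of 1] by simp
 next
  case False
  have "ppair (i t) (s t) (al t) (ga t)" using p jj by (auto simp: pfamily_def)
  then have "?b (t, g, Suc l) = \<zero>" using False opE_pow_zero[of _ "Suc l"] ppair_closed
   by (simp add: pfam_def del: funpow.simps)
  then show ?thesis unfolding b1 using lc_zero[OF b, symmetric] by metis
 qed
 have "?b j \<in> carrier M" using b j by blast
 then obtain d where "?b j = lc ?I ?b d" using lc_basis_span[OF fin b j, of 1] by auto
 then show "\<exists>d. opF (?b j) = lc ?I ?b d" using opF_pfam[OF p, of d] by auto
qed

text \<open>By \<open>pfam_independent\<close> only \<alpha> and \<open>E^(2i-1) \<alpha>\<close>
  have to be separated. \<open>E^(N-1)\<close> kills the latter but not the former, and afterwards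
  \<open>E^(N-2i)\<close> detects the latter.\<close>

lemma pfam_single_independent:
 assumes p: "ppair i s al ga" and nz: "(opE ^^ (N - 1)) al \<noteq> \<zero>"
  and c: "lc (pidx {t}) (pfam (\<lambda>_. al) (\<lambda>_. ga)) c = \<zero>" and x: "x \<in> pidx {t}"
 shows "c x = 0"
proof (rule pfam_independent[OF _ _ c x])
 show "pfamily {t} (\<lambda>_. i) (\<lambda>_. s) (\<lambda>_. al) (\<lambda>_. ga)" using p by (simp add: pfamily_def)
 fix c x assume 0: "lc ({t} \<times> UNIV) (kfam (\<lambda>_. i) (\<lambda>_. al)) c = \<zero>" and x: "x \<in> {t} \<times> (UNIV :: bool set)"
 note cl = ppair_closed[OF p]
 have i: "1 \<le> i" "2 * i \<le> N" using p by (auto simp: ppair_def)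
 let ?w = "(opE ^^ (2 * i - 1)) al" and ?a = "c (t, False)" and ?b = "c (t, True)"
 have set: "{t} \<times> UNIV = {(t, False), (t, True)}" by (auto simp: UNIV_bool)
 have eq: "sc ?a al \<oplus> sc ?b ?w = \<zero>" using 0 cl unfolding set by (simp add: lc_insert kfam_def)
 have "(opE ^^ (N - 1)) ?w = (opE ^^ (N - 1 + (2 * i - 1))) al" by (simp add: Nat.funpow_add)
 also have "... = \<zero>" by (rule opE_pow_zero) (use cl i N_pos in auto)
 finally have "(opE ^^ (N - 1)) (sc ?a al \<oplus> sc ?b ?w) = sc ?a ((opE ^^ (N - 1)) al)"
  using cl by (simp add: funpow_add funpow_sc)
 then have a: "?a = 0" using eq nz cl sc_cancel[of "(opE ^^ (N - 1)) al" ?a] by auto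
 have "(opE ^^ (N - 2 * i)) ?w = (opE ^^ (N - 2 * i + (2 * i - 1))) al" unfolding Nat.funpow_add by simp
 also have "N - 2 * i + (2 * i - 1) = N - 1" using i by simp
 finally have w: "(opE ^^ (N - 2 * i)) ?w = (opE ^^ (N - 1)) al" .
 have "sc ?b ?w = \<zero>" using eq cl a by simp
 then have "sc ?b ((opE ^^ (N - 1)) al) = \<zero>" using funpow_sc[of ?w "N - 2 * i" ?b] cl w by simp
 then have "?b = 0" using nz cl sc_cancel[of "(opE ^^ (N - 1)) al" ?b] by auto
 then show "c x = 0" using a x set by auto
qed

text \<open>One F leads from \<gamma> to \<open>E^(2i-2) \<alpha>\<close>, and the remaining 2i - 2
  run down to \<alpha> below the zero at 2i - 1. So \<alpha> belongs to the submodule generated by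
  \<gamma>.\<close>

lemma alpha_from_gamma:
 assumes p: "ppair i s al ga"
 shows "\<exists>c. al = sc c ((opF ^^ (2 * i - 1)) ga)"
proof -
 have i: "1 \<le> i" "2 * i \<le> N" using p by (auto simp: ppair_def)
 note cl = ppair_closed[OF p]
 define P where "P = (\<Prod>r<2 * i - 2. cc (int i - 1) (2 * i - 2 - r))"
 have "2 * i - 1 = (2 * i - 2) + 1" using i by simp
 then have "(opF ^^ (2 * i - 1)) ga = (opF ^^ (2 * i - 2)) (opF ga)" by (simp add: funpow_swap1)
 also have "... = sc P al" using p opF_pow_alpha[OF p, of "2 * i - 2" "2 * i - 2"] by (simp add: ppair_def P_def)
 finally have "(opF ^^ (2 * i - 1)) ga = sc P al" .
 moreover have "P \<noteq> 0" unfolding P_def using i cc_alpha_0_iff[OF i] by auto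
 ultimately show ?thesis using cl by (intro exI[of _ "inverse P"]) simp
qed

lemma restrict_qmod:
 assumes H: "H \<subseteq> carrier M" "\<zero> \<in> H" "\<And>x y. [|x \<in> H; y \<in> H|] ==> x \<oplus> y \<in> H"
  "\<And>a x. [|a \<in> carrier A; x \<in> H|] ==> a \<odot> x \<in> H"
 shows "qmod n q (M\<lparr>carrier := H\<rparr>)"
proof (intro qmod.intro qparam_axioms kmod.intro kmod_axioms.intro qu.kalg_axioms abelian_groupI)
 show "\<exists>y\<in>carrier (M\<lparr>carrier := H\<rparr>). y \<oplus>\<^bsub>M\<lparr>carrier := H\<rparr>\<^esub> x = \<zero>\<^bsub>M\<lparr>carrier := H\<rparr>\<^esub>" if "x \<in> carrier (M\<lparr>carrier := H\<rparr>)" for x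
 proof (rule bexI[of _ "sc (- 1) x"])
  show "sc (- 1) x \<in> carrier (M\<lparr>carrier := H\<rparr>)" using that H(4)[of "\<eta> (- 1)"] by (simp add: sc_def)
  show "sc (- 1) x \<oplus>\<^bsub>M\<lparr>carrier := H\<rparr>\<^esub> x = \<zero>\<^bsub>M\<lparr>carrier := H\<rparr>\<^esub>"
   using that H(1) by (auto simp: sc_minus_one M.l_neg subset_iff)
 qed
qed (use H in \<open>auto simp: subset_iff M.a_ac act_l_distr act_r_distr act_assoc\<close>)

end

section \<open>The elements \<alpha> and \<gamma> of A and the modules that they span\<close>

context qparam
begin

context
 fixes i j :: nat
 assumes ij: "1 \<le> i" "2 * i \<le> N" "j \<le> 1"
begin

private abbreviation "s \<equiv> sgn_ij i j"
private abbreviation "e \<equiv> qu_e_idem n q (2 * i) j"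
private abbreviation "\<alpha> \<equiv> qu_alpha n q (2 * i) j"
private abbreviation "\<gamma> \<equiv> qu_gamma n q (2 * i) j"

lemma alpha_F: "\<alpha> = (R.opF ^^ (N - 1)) e" and alpha_closed: "\<alpha> \<in> carrier A"
proof -
 show "\<alpha> = (R.opF ^^ (N - 1)) e" using R.pow_act[of F e "N - 1"] by (simp add: qu_alpha_def R.opF_fun)
 show "\<alpha> \<in> carrier A" by (simp add: qu_alpha_def)
qed

lemma alpha_wt: "R.wt s (int i - 1) \<alpha>"
proof -
 have "R.wt s (int i + int (N - 1)) \<alpha>" unfolding alpha_F by (rule R.wt_opF_pow[OF e_wt[OF ij(3)]])
 moreover have "int (N div 2) dvd (int i + int (N - 1)) - (int i - 1)" using N_pos hN by (intro dvdI[of _ _ 2]) linarith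
 ultimately show ?thesis using R.wt_cong by blast
qed

lemma alpha_killed: "R.opF \<alpha> = \<zero>\<^bsub>A\<^esub>"
proof -
 have "R.opF \<alpha> = (R.opF ^^ Suc (N - 1)) e" unfolding alpha_F by simp
 then show ?thesis using R.opF_pow_N[of e] N_pos by (simp del: funpow.simps)
qed

lemma N_half: "int N = int (N div 2) * 2"
 using arg_cong[OF hN(1), of int] unfolding hN(3) by (simp only: of_nat_mult mult.commute of_nat_numeral)

text \<open>Because 2i - 2 < N - 1, every term of \<open>E^(2i-2) F^(N-1) e\<close>, rewritten with
  the powers of F in front, still starts with an F. Deleting one F gives an element of the lower
  span that F maps to \<beta>; by uniqueness it is \<gamma>, and its weight is visible from its
  terms.\<close>

lemma gamma_props: "R.opF \<gamma> = (R.opE ^^ (2 * i - 2)) \<alpha>" "R.wt s (- int i) \<gamma>"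
proof -
 have le: "2 * i - 2 \<le> N - 1" using ij by linarith
 obtain c where c: "(R.opE ^^ (2 * i - 2)) ((R.opF ^^ (N - 1)) e)
   = R.lc {..2 * i - 2} (\<lambda>r. (R.opF ^^ (N - 1 - r)) ((R.opE ^^ (2 * i - 2 - r)) e)) c"
  using R.opE_pow_opF_pow[OF e_wt[OF ij(3), of i] sgn_ij_nz le] by blast
 define t where "t r = (R.opF ^^ (N - 2 - r)) ((R.opE ^^ (2 * i - 2 - r)) e)" for r
 define g where "g = R.lc {..2 * i - 2} t c"
 have ec: "e \<in> carrier (regular_module A)" by simp
 have tc: "t r \<in> carrier (regular_module A)" for r using ec by (simp only: t_def R.funpow_closed)
 have gc: "g \<in> carrier A" using tc unfolding g_def using R.lc_closed[of t] by auto
 have "R.opF g = R.lc {..2 * i - 2} (\<lambda>r. R.opF (t r)) c" unfolding g_def R.opF_def using tc by (intro R.lc_act) auto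
 also have "... = R.lc {..2 * i - 2} (\<lambda>r. (R.opF ^^ (N - 1 - r)) ((R.opE ^^ (2 * i - 2 - r)) e)) c"
 proof (rule R.lc_cong2)
  fix r assume "r \<in> {..2 * i - 2}"
  then have "N - 1 - r = Suc (N - 2 - r)" using ij by auto
  then show "R.opF (t r) = (R.opF ^^ (N - 1 - r)) ((R.opE ^^ (2 * i - 2 - r)) e)" by (simp add: t_def)
 qed (use ec R.funpow_closed in auto)
 finally have Fg: "R.opF g = (R.opE ^^ (2 * i - 2)) \<alpha>" unfolding alpha_F c .
 have low: "R.sc d (t r) \<in> qu_lower_span n q" for d r
 proof -
  obtain u where u: "u \<in> u0" "(R.opE ^^ (2 * i - 2 - r)) e = u \<cdot> E \<up> (2 * i - 2 - r)"
   using u0_E_pow[OF e_u0] by blast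
  have uc: "u \<in> carrier A" using u0_subset u by blast
  have "t r = F \<up> (N - 2 - r) \<cdot> (u \<cdot> E \<up> (2 * i - 2 - r))"
   unfolding t_def u(2) using R.pow_act[of F "u \<cdot> E \<up> (2 * i - 2 - r)" "N - 2 - r"] uc by (simp add: R.opF_fun)
  then have "R.sc d (t r) = F \<up> (N - 2 - r) \<cdot> (\<eta> d \<cdot> u) \<cdot> E \<up> (2 * i - 2 - r)"
   using uc by (simp add: R.sc_def qu.m_assoc qu.unit_left_comm)
  then show ?thesis using u ij by (simp only:) (intro lower_span_monomial u0_mult u0_unit, auto)
 qed
 have "R.lc I t c \<in> qu_lower_span n q" if "finite I" for I using that
 proof (induction I rule: finite_induct)
  case empty
  then show ?case using low[of 0 0] tc[of 0] by simp
 next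
  case (insert r I)
  then have "R.lc (insert r I) t c = R.sc (c r) (t r) \<oplus>\<^bsub>A\<^esub> R.lc I t c" using tc by (subst R.lc_insert) auto
  then show ?case using lower_span_add[OF low insert.IH] by simp
 qed
 then have g: "g \<in> qu_lower_span n q" by (simp add: g_def)
 have beta: "qu_beta n q (2 * i) j = (R.opE ^^ (2 * i - 2)) \<alpha>"
  using R.pow_act[of E \<alpha> "2 * i - 2"] alpha_closed by (simp add: qu_beta_def R.opE_fun)
 have "\<gamma> = g" unfolding qu_gamma_def
 proof (rule the_equality)
  show "g \<in> qu_lower_span n q \<and> F \<cdot> g = qu_beta n q (2 * i) j" using g Fg beta by (simp add: R.opF_def)
  fix g' assume "g' \<in> qu_lower_span n q \<and> F \<cdot> g' = qu_beta n q (2 * i) j"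
  then show "g' = g" using lower_span_unique[of g' g] g Fg beta by (simp add: R.opF_def)
 qed
 moreover have "R.wt s (- int i) g" unfolding g_def
 proof (rule R.wt_lc)
  fix r assume r: "r \<in> {..2 * i - 2}"
  have "R.wt s (int i - int (2 * i - 2 - r) + int (N - 2 - r)) (t r)" unfolding t_def
   by (intro R.wt_opF_pow R.wt_opE_pow e_wt[OF ij(3)])
  moreover have "(int i - int (2 * i - 2 - r) + int (N - 2 - r)) - (- int i) = int (N div 2) * 2"
   using r ij N_half by (simp add: of_nat_diff)
  ultimately show "R.wt s (- int i) (t r)" using R.wt_cong dvd_triv_left by metis
 qed simp
 ultimately show "R.opF \<gamma> = (R.opE ^^ (2 * i - 2)) \<alpha>" "R.wt s (- int i) \<gamma>" using Fg by auto
qed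

lemma alpha_gamma_pair: "R.ppair i s \<alpha> \<gamma>"
 unfolding R.ppair_def using ij alpha_wt gamma_props alpha_killed by simp

text \<open>Converse to \<open>e_wt\<close>: on this weight K and \<open>gsgn\<close> have exactly
  the eigenvalues that the two factors of e select.\<close>

lemma e_act:
 fixes M :: "('k free_qu set, 'm) module"
 assumes M: "qmod n q M" and v: "qmod.wt n q M s (int i) v"
 shows "e \<odot>\<^bsub>M\<^esub> v = v"
proof -
 interpret M: qmod n q M by fact
 have vc: "v \<in> carrier M" using v by (rule M.wt_closed)
 have K: "K \<odot>\<^bsub>M\<^esub> v = M.sc (q ^ (2 * i)) v"
  using M.wt_opK[OF v sgn_ij_nz] power_int_of_nat[of q "2 * i"] by (simp add: M.opK_def)
 have "(q ^ (2 * i)) ^ hN = 1" using q2_root[of i] by (simp add: power_inverse flip: power_mult)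
 then have phi: "qu_phi n q (2 * i) \<odot>\<^bsub>M\<^esub> v = v"
  unfolding phi_proj using M.proj_act[OF _ vc K _ q2_root] hN(2) by (simp flip: power_mult_distrib add: power_inverse)
 let ?m = "n div 2" and ?c = "s * q powi ((2 - int n) * int i)"
 have m: "int n = 2 * int ?m" using n_even by (auto elim: evenE)
 have qh: "q powi int hN = - 1" using q_half hN(3) by (simp add: zdiv_int)
 have "s ^ ?m = 1" using sgn_ij_cases[of i j] n_half_even by (auto simp: minus_one_power_iff)
 then have "?c ^ ?m = q powi ((2 - int n) * int i * int ?m)" by (simp add: power_mult_distrib power_int_power')
 then have "?c ^ ?m * (s * q powi (- int n * int i)) = s * q powi ((2 - int n) * int i * int ?m + (- int n * int i))"
  by (simp only: q_add mult_ac)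
 also have "(2 - int n) * int i * int ?m + (- int n * int i) = int hN * (- int i)"
  unfolding hN_def of_nat_mult m by (simp add: algebra_simps)
 also have "s * q powi (int hN * (- int i)) = (- 1) ^ j"
  unfolding power_int_mult qh by (simp add: power_int_minus sgn_ij_def power_add power_inverse)
 finally have val: "?c ^ ?m * (s * q powi (- int n * int i)) = (- 1) ^ j" .
 have "(\<kappa>h \<up> ?m) \<odot>\<^bsub>M\<^esub> v = M.sc (?c ^ ?m) v"
  using v vc by (intro M.pow_act_eigen) (auto simp: M.wt_def M.opkh_def)
 then have g: "gsgn \<odot>\<^bsub>M\<^esub> v = M.sc ((- 1) ^ j) v"
  unfolding gsgn_def val[symmetric] using v vc by (simp add: M.act_assoc M.act_sc M.wt_def M.opk_def)
 have sq: "(if j = 0 then 1 else - 1) * (- 1) ^ j = (1 :: 'k)" using ij(3) by (cases j) auto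
 have "(\<one>\<^bsub>A\<^esub> \<oplus>\<^bsub>A\<^esub> \<eta> (if j = 0 then 1 else - 1) \<cdot> gsgn) \<odot>\<^bsub>M\<^esub> v = M.sc (1 + 1) v"
  unfolding M.sc_add[OF vc] using vc g by (simp only: M.act_l_distr M.unit_act qu.one_closed qu.m_closed gsgn_closed qu.unit_closed M.sc_sc sq M.act_one M.sc_one)
 then have "qu_bold_one n q j \<odot>\<^bsub>M\<^esub> v = M.sc (1 / 2 * (1 + 1)) v"
  unfolding bold_one_alt using vc by (simp only: M.unit_act M.sc_sc qu.a_closed qu.m_closed qu.one_closed gsgn_closed qu.unit_closed)
 then show ?thesis unfolding qu_e_idem_def using vc phi by (simp add: M.act_assoc)
qed

text \<open>In the module induced from weight i the idempotent fixes the generator z. E keeps the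
  top power \<open>F^(N-1)\<close> only by commuting past it, so the component of
  \<open>E^(N-1) F^(N-1) z\<close> at \<open>F^(N-1) E^(N-1) z\<close> is a power of q.\<close>

lemma E_pow_alpha_nz: "(R.opE ^^ (N - 1)) \<alpha> \<noteq> \<zero>\<^bsub>A\<^esub>"
proof
 assume 0: "(R.opE ^^ (N - 1)) \<alpha> = \<zero>\<^bsub>A\<^esub>"
 obtain M :: "('k free_qu set, 'k vec) module" where M: "qmod n q M" "carrier M = UNIV"
  "\<And>v w. v \<oplus>\<^bsub>M\<^esub> w = (\<lambda>p. v p + w p)" "\<zero>\<^bsub>M\<^esub> = (\<lambda>p. 0)" "\<And>c v. \<eta> c \<odot>\<^bsub>M\<^esub> v = (\<lambda>p. c * v p)"
  "\<And>v. \<kappa> \<odot>\<^bsub>M\<^esub> v = vdiag (vk s) (int i) v" "\<And>v. \<kappa>h \<odot>\<^bsub>M\<^esub> v = vdiag (vkh s) (int i) v"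
  "\<And>v. E \<odot>\<^bsub>M\<^esub> v = vE (int i) v" "\<And>v. F \<odot>\<^bsub>M\<^esub> v = vF v"
  using v_module[OF sgn_ij_cases[of i j], of "int i"] by blast
 interpret M: qmod n q M by fact
 have "vdiag f (int i) (delta 0 0) = (\<lambda>p. f (int i) * delta 0 0 p)" for f
  using N_pos by (auto simp: vdiag_def delta_def fun_eq_iff)
 then have "M.wt s (int i) (delta 0 0)" unfolding M.wt_def M.opk_def M.opkh_def M.sc_def M(2,5,6,7) vk_def vkh_def by simp
 then have e: "e \<odot>\<^bsub>M\<^esub> delta 0 0 = delta 0 0" by (rule e_act[OF M(1)])
 have "(R.opE ^^ (N - 1)) \<alpha> = E \<up> (N - 1) \<cdot> (F \<up> (N - 1) \<cdot> e)"
  using R.pow_act[of E \<alpha> "N - 1"] alpha_closed by (simp add: R.opE_fun qu_alpha_def)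
 then have "\<zero>\<^bsub>M\<^esub> = (E \<up> (N - 1) \<cdot> (F \<up> (N - 1) \<cdot> e)) \<odot>\<^bsub>M\<^esub> delta 0 0"
  using 0 M(2) by (simp add: M.act_zero_left)
 also have "... = (vE (int i) ^^ (N - 1)) ((vF ^^ (N - 1)) (delta 0 0))"
  using M.pow_act[of F _ "N - 1"] M.pow_act[of E _ "N - 1"] M(2) by (simp add: M.act_assoc e M(8,9))
 also have "(vF ^^ (N - 1)) (delta 0 0) = delta (N - 1) 0" by (rule vF_delta) (use N_pos in auto)
 finally have "(vE (int i) ^^ (N - 1)) (delta (N - 1) 0) (N - 1, N - 1) = 0" by (simp add: M(4) fun_eq_iff)
 then show False using vE_delta_top[of "N - 1" "N - 1" "int i"] N_pos by simp
qed

text \<open>\<open>A \<gamma>\<close> contains \<alpha> and hence both strings; conversely the span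
  of the two strings contains \<gamma> and is stable under A.\<close>

lemma qu_P_pdec: "qmod n q (qu_P n q (2 * i) j)" "qmod.pdec n q (qu_P n q (2 * i) j) {()} (\<lambda>_. i) (\<lambda>_. s)"
proof -
 note p = alpha_gamma_pair
 note cl = alpha_closed R.ppair_closed(2)[OF p, simplified]
 let ?b = "R.pfam (\<lambda>_. \<alpha>) (\<lambda>_. \<gamma>)" and ?I = "R.pidx {()}"
 have pf: "R.pfamily {()} (\<lambda>_. i) (\<lambda>_. s) (\<lambda>_. \<alpha>) (\<lambda>_. \<gamma>)" using p by (simp add: R.pfamily_def)
 note b = R.pfam_closed[OF pf]
 have fin: "finite ?I" by simp
 define H where "H = {a \<cdot> \<gamma> | a. a \<in> carrier A}"
 have Hc: "H \<subseteq> carrier A" using cl by (auto simp: H_def)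
 have Hadd: "x \<oplus>\<^bsub>A\<^esub> y \<in> H" if "x \<in> H" "y \<in> H" for x y
  using that cl unfolding H_def by (auto simp: qu.l_distr[symmetric])
 have Hact: "a \<cdot> x \<in> H" if "x \<in> H" "a \<in> carrier A" for a x
  using that cl unfolding H_def by (auto simp: qu.m_assoc[symmetric])
 have Hg: "\<gamma> \<in> H" unfolding H_def using cl by (intro CollectI exI[of _ "\<one>\<^bsub>A\<^esub>"]) simp
 have H0: "\<zero>\<^bsub>A\<^esub> \<in> H" using Hact[OF Hg, of "\<zero>\<^bsub>A\<^esub>"] cl by simp
 have Hpow: "(R.opE ^^ r) x \<in> H" "(R.opF ^^ r) x \<in> H" "R.sc c x \<in> H" if "x \<in> H" for r x c
  using that Hact by (induction r) (auto simp: R.op_defs R.sc_def)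
 have Ha: "\<alpha> \<in> H" using R.alpha_from_gamma[OF p] Hpow(2,3) Hg by metis
 have P: "qu_P n q (2 * i) j = (regular_module A)\<lparr>carrier := H\<rparr>" by (simp add: qu_P_def H_def)
 have Q: "qmod n q ((regular_module A)\<lparr>carrier := H\<rparr>)" by (rule R.restrict_qmod) (use Hc H0 Hadd Hact in auto)
 then show "qmod n q (qu_P n q (2 * i) j)" unfolding P .
 let ?P = "(regular_module A)\<lparr>carrier := H\<rparr>"
 interpret P: qmod n q ?P by (rule Q)
 interpret PR: qpair n q ?P "regular_module A" by unfold_locales
 have id: "PR.qhom (\<lambda>x. x)" by (rule PR.qhomI) (use Hc in auto)
 have ops: "P.opE = R.opE" "P.opF = R.opF" by (simp_all add: fun_eq_iff P.op_defs R.op_defs)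
 have bP: "P.pfam (\<lambda>_. \<alpha>) (\<lambda>_. \<gamma>) = ?b" by (simp add: P.pfam_def R.pfam_def ops)
 have bH: "?b \<in> ?I \<rightarrow> H" using Hpow(1) Ha Hg by (auto simp: R.pfam_def)
 have lc: "P.lc ?I ?b c = R.lc ?I ?b c" for c using PR.linear_lc[OF PR.qhom_linear[OF id] fin, of ?b c] bH by simp
 have "P.ppair i s \<alpha> \<gamma>" using p Ha Hg unfolding P.ppair_def R.ppair_def P.wt_def R.wt_def ops
  by (simp add: P.op_defs R.op_defs P.sc_def R.sc_def)
 then have "P.pfamily {()} (\<lambda>_. i) (\<lambda>_. s) (\<lambda>_. \<alpha>) (\<lambda>_. \<gamma>)" by (simp add: P.pfamily_def)
 moreover have "P.kbasis ?I ?b" unfolding P.kbasis_def lc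
 proof (intro conjI fin ballI allI impI)
  show "?b \<in> ?I \<rightarrow> carrier ?P" using bH by simp
  fix x assume "x \<in> carrier ?P"
  then obtain a where a: "a \<in> carrier A" "x = a \<cdot> \<gamma>" by (auto simp: H_def)
  have "((), True, 0) \<in> ?I" using N_pos by (simp add: R.pidx_def)
  from R.lc_basis_span[OF fin b this, of 1] obtain c where c: "R.lc ?I ?b c = \<gamma>"
   using cl R.sc_one[of \<gamma>] by (auto simp: R.pfam_def)
  show "\<exists>c. x = R.lc ?I ?b c" using spec[OF R.pfam_span_act[OF pf a(1)], of c] unfolding c a(2) by simp
 next
  fix c x assume "R.lc ?I ?b c = \<zero>\<^bsub>?P\<^esub>" "x \<in> ?I"
  then show "c x = 0" using R.pfam_single_independent[OF p, of "()" c x] E_pow_alpha_nz by simp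
 qed
 ultimately show "qmod.pdec n q (qu_P n q (2 * i) j) {()} (\<lambda>_. i) (\<lambda>_. s)"
  unfolding P P.pdec_def bP[symmetric] by blast
qed

end

end

section \<open>The socle of a single pair\<close>

context qmod
begin

text \<open>The module S as one string of length N - 2i + 1. Its bottom vector w stands for
  \<open>E^(2i-1) \<alpha>\<close>, whose weight is (i - 1) - (2i - 1) = -i.\<close>

definition sdec :: "nat => 'k => bool" where
 "sdec i s \<longleftrightarrow> (\<exists>w. wt s (- int i) w \<and> opF w = \<zero> \<and> (opE ^^ (N - 2 * i + 1)) w = \<zero> \<and>
  kbasis {..<N - 2 * i + 1} (\<lambda>m. (opE ^^ m) w))"

lemma submodule_iff:
 "submodule H A M \<longleftrightarrow> H \<subseteq> carrier M \<and> \<zero> \<in> H \<and> (\<forall>x\<in>H. \<forall>y\<in>H. x \<oplus> y \<in> H) \<and>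
  (\<forall>a\<in>carrier A. \<forall>x\<in>H. a \<odot> x \<in> H)" (is "_ \<longleftrightarrow> ?R")
proof
 assume "submodule H A M"
 then interpret H: submodule H A M .
 show ?R using H.subset H.one_closed H.m_closed H.smult_closed by simp
next
 assume R: ?R
 have "inv\<^bsub>add_monoid M\<^esub> x \<in> H" if "x \<in> H" for x
 proof -
  have "inv\<^bsub>add_monoid M\<^esub> x = sc (- 1) x" using that R sc_minus_one[of x] by (auto simp: a_inv_def)
  then show ?thesis using R that by (simp add: sc_def)
 qed
 then show "submodule H A M" using R by (intro submodule.intro subgroup.intro submodule_axioms.intro) auto
qed

lemma lc_in_submodule:
 assumes H: "submodule H A M" and I: "finite I" "b \<in> I \<rightarrow> H"
 shows "lc I b c \<in> H" using I
proof (induction I rule: finite_induct)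
 case (insert i I)
 then have "lc (insert i I) b c = sc (c i) (b i) \<oplus> lc I b c" using H by (intro lc_insert) (auto simp: submodule_iff)
 then show ?case using insert H by (simp add: submodule_iff sc_def)
qed (use H in \<open>simp add: submodule_iff\<close>)

text \<open>Every nonzero submodule contains \<open>w = E^(2i-1) \<alpha>\<close>. The span of its
  string is therefore the least nonzero submodule, the only simple one, and equal to the
  socle.\<close>

lemma socle_pdec:
 assumes dec: "pdec {()} (\<lambda>_. i) (\<lambda>_. s)"
 shows "qmod n q (M\<lparr>carrier := socle A M\<rparr>)" "qmod.sdec n q (M\<lparr>carrier := socle A M\<rparr>) i s"
proof -
 obtain al ga where p: "pfamily {()} (\<lambda>_. i) (\<lambda>_. s) al ga" and B: "kbasis (pidx {()}) (pfam al ga)"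
  using dec unfolding pdec_def by blast
 have pp: "ppair i s (al ()) (ga ())" using p by (simp add: pfamily_def)
 note cl = ppair_closed[OF pp]
 have i: "1 \<le> i" "2 * i \<le> N" and s: "s \<noteq> 0" and wal: "wt s (int i - 1) (al ())" using pp by (auto simp: ppair_def)
 define w where "w = (opE ^^ (2 * i - 1)) (al ())"
 define d where "d = N - 2 * i + 1"
 define b where "b m = (opE ^^ m) w" for m
 have wc: "w \<in> carrier M" and bc: "\<And>m. b m \<in> carrier M" using cl by (simp_all add: w_def b_def)
 have w_wt: "wt s (- int i) w" using wt_opE_pow[OF wal, of "2 * i - 1"] i by (simp add: w_def of_nat_diff)
 have Fw: "opF w = \<zero>"
  using opF_alpha[OF pp, of "2 * i - 1"] cc_alpha_0_iff[OF i, of "2 * i - 1"] i cl by (simp add: w_def)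
 have bE: "b m = (opE ^^ (m + (2 * i - 1))) (al ())" for m by (simp add: b_def w_def Nat.funpow_add)
 have bd: "b d = \<zero>" unfolding bE by (rule opE_pow_zero) (use i cl d_def in auto)
 let ?I = "{..<d}"
 have b: "b \<in> ?I \<rightarrow> carrier M" using bc by simp
 have span: "\<forall>c. \<exists>e. a \<odot> lc ?I b c = lc ?I b e" if a: "a \<in> carrier A" for a
 proof (rule span_act[OF _ b _ _ _ _ a])
  fix m assume m: "m \<in> {..<d}"
  have "wt s (- int i - int m) (b m)" unfolding b_def by (rule wt_opE_pow[OF w_wt])
  then show "\<exists>e. opk (b m) = lc ?I b e" "\<exists>e. opkh (b m) = lc ?I b e"
   using lc_basis_span[OF _ b m] by (simp_all add: wt_def)
  show "\<exists>e. opE (b m) = lc ?I b e"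
  proof (cases "Suc m = d")
   case True
   then have "opE (b m) = \<zero>" using bd by (auto simp: b_def)
   then show ?thesis using lc_zero[OF b] by metis
  next
   case False
   then have "Suc m \<in> ?I" using m by auto
   from lc_basis_span[OF _ b this, of 1] show ?thesis using bc[of "Suc m"] by (simp add: b_def)
  qed
  have "opF (b m) = sc (cc (- int i) m) (b (m - 1))"
   using opF_opE_pow[OF w_wt s, of m] bc[of "m - 1"] by (simp add: Fw b_def)
  then show "\<exists>e. opF (b m) = lc ?I b e" using lc_basis_span[OF _ b, of "m - 1"] m by auto
 qed simp
 define H where "H = range (lc ?I b)"
 have Hsub: "submodule H A M" unfolding submodule_iff H_def
 proof (intro conjI ballI)
  show "\<zero> \<in> range (lc ?I b)" using lc_zero[OF b] by (metis rangeI)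
  show "x \<oplus> y \<in> range (lc ?I b)" if "x \<in> range (lc ?I b)" "y \<in> range (lc ?I b)" for x y
   using that lc_add[OF _ b, symmetric] by auto
  show "a \<odot> x \<in> range (lc ?I b)" if "a \<in> carrier A" "x \<in> range (lc ?I b)" for a x
   using that span[OF that(1)] by auto
 qed (use bc in auto)
 have Hmin: "H \<subseteq> K" if K: "submodule K A M" and x: "x \<in> K" "x \<noteq> \<zero>" for K x
 proof -
  have act: "a \<odot> x \<in> K" if "a \<in> carrier A" "x \<in> K" for a x using that K unfolding submodule_iff by blast
  have "w \<in> K" unfolding w_def using submodule_contains_socle_vector[OF p B _ act x] K by (simp add: submodule_iff)
  then have "b m \<in> K" for m by (induction m) (auto simp: b_def opE_def act)
  then show ?thesis unfolding H_def using lc_in_submodule[OF K, of ?I b] by auto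
 qed
 \<comment> \<open>The string of w is the tail of the string of \<alpha> from position 2i - 1 on, so
   it inherits independence from the basis of the module.\<close>
 have lc_pfam: "lc ?I b c = lc (pidx {()}) (pfam al ga) (\<lambda>(t, g, l). if \<not> g \<and> 2 * i - 1 \<le> l then c (l - (2 * i - 1)) else 0)" (is "_ = lc _ _ ?c'") for c
 proof -
  let ?h = "\<lambda>m. ((), False, m + (2 * i - 1))"
  have sub: "?h ` ?I \<subseteq> pidx {()}" using i by (auto simp: pidx_def d_def)
  have "lc (pidx {()}) (pfam al ga) ?c' = lc (?h ` ?I) (pfam al ga) ?c'"
  proof (rule lc_mono_neutral[OF _ sub pfam_closed[OF p]])
   fix x assume x: "x \<in> pidx {()} - ?h ` ?I"
   then obtain g l where gl: "x = ((), g, l)" "l < N" by (auto simp: pidx_def)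
   have False if "\<not> g" "2 * i - 1 \<le> l"
   proof -
    have "x = ?h (l - (2 * i - 1))" "l - (2 * i - 1) \<in> ?I" using gl that i by (auto simp: d_def)
    then show False using x by blast
   qed
   then show "?c' x = 0" using gl by auto
  qed simp
  also have "... = lc ?I (\<lambda>m. pfam al ga (?h m)) (\<lambda>m. ?c' (?h m))"
   by (rule lc_reindex) (use sub pfam_closed[OF p] in \<open>auto simp: inj_on_def\<close>)
  also have "... = lc ?I b c" by (rule lc_cong2[OF b]) (auto simp: pfam_def bE)
  finally show ?thesis ..
 qed
 have ind: "c m = 0" if "lc ?I b c = \<zero>" "m \<in> ?I" for c m
 proof -
  have "((), False, m + (2 * i - 1)) \<in> pidx {()}" using that i by (auto simp: pidx_def d_def)
  from kbasisD(4)[OF B that(1)[unfolded lc_pfam] this] show ?thesis by simp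
 qed
 have w_H: "b m \<in> H" if "m \<in> ?I" for m using lc_basis_span[OF _ b that, of 1] bc[of m] by (auto simp: H_def)
 have w_nz: "b 0 \<noteq> \<zero>"
 proof
  assume "b 0 = \<zero>"
  moreover have "lc ?I b (\<lambda>m. if m = 0 then 1 else 0) = sc 1 (b 0)" by (rule lc_single[OF _ b]) (auto simp: d_def)
  ultimately show False using ind[of "\<lambda>m. if m = 0 then 1 else 0" 0] by (auto simp: d_def)
 qed
 have simple: "simple_submodule K A M \<longleftrightarrow> K = H" for K
 proof
  assume K: "simple_submodule K A M"
  then have "submodule K A M" "K \<noteq> {\<zero>}" by (auto simp: simple_submodule_def)
  then obtain x where "x \<in> K" "x \<noteq> \<zero>" by (auto simp: submodule_iff)
  then have "H \<subseteq> K" using Hmin K by (auto simp: simple_submodule_def)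
  then have "H = {\<zero>} \<or> H = K" using K Hsub by (auto simp: simple_submodule_def)
  then show "K = H" using w_nz w_H[of 0] by (auto simp: d_def)
 next
  assume K: "K = H"
  have "L = {\<zero>} \<or> L = H" if L: "submodule L A M" "L \<subseteq> H" for L
  proof (cases "\<exists>x\<in>L. x \<noteq> \<zero>")
   case True then show ?thesis using Hmin[OF L(1)] L(2) by blast
  next
   case False then show ?thesis using L(1) by (auto simp: submodule_iff)
  qed
  then show "simple_submodule K A M" using Hsub w_nz w_H[of 0] unfolding K simple_submodule_def by (auto simp: d_def)
 qed
 then have soc: "socle A M = H" using Hsub unfolding socle_def by auto
 have Q: "qmod n q (M\<lparr>carrier := H\<rparr>)"
  by (rule restrict_qmod) (use Hsub in \<open>auto simp: submodule_iff\<close>)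
 then show "qmod n q (M\<lparr>carrier := socle A M\<rparr>)" unfolding soc .
 let ?S = "M\<lparr>carrier := H\<rparr>"
 interpret S: qmod n q ?S by (rule Q)
 interpret SM: qpair n q ?S M by unfold_locales
 have id: "SM.qhom (\<lambda>x. x)" by (rule SM.qhomI) (use Hsub in \<open>auto simp: submodule_iff\<close>)
 have ops: "S.opE = opE" "S.opF = opF" by (simp_all add: fun_eq_iff S.op_defs op_defs)
 have lc: "S.lc ?I b c = lc ?I b c" for c using SM.linear_lc[OF SM.qhom_linear[OF id], of ?I b c] w_H by simp
 have "S.wt s (- int i) w"
  using w_wt w_H[of 0] unfolding S.wt_def wt_def by (simp add: S.op_defs op_defs S.sc_def sc_def b_def d_def)
 moreover have "S.kbasis ?I b" unfolding S.kbasis_def lc using ind w_H by (auto simp: H_def)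
 ultimately have "S.sdec i s" unfolding S.sdec_def ops using Fw bd by (intro exI[of _ w]) (simp add: b_def[abs_def] d_def)
 then show "qmod.sdec n q (M\<lparr>carrier := socle A M\<rparr>) i s" unfolding soc .
qed

end

lemma (in qparam) qu_S_sdec:
 assumes "1 \<le> i" "2 * i \<le> N" "j \<le> 1"
 shows "qmod n q (qu_S n q (2 * i) j)" "qmod.sdec n q (qu_S n q (2 * i) j) i (sgn_ij i j)"
proof -
 interpret P: qmod n q "qu_P n q (2 * i) j" by (rule qu_P_pdec[OF assms])
 have "(qu_P n q (2 * i) j)\<lparr>carrier := socle A (qu_P n q (2 * i) j)\<rparr> = qu_S n q (2 * i) j"
  by (simp add: qu_S_def qu_P_def)
 then show "qmod n q (qu_S n q (2 * i) j)" "qmod.sdec n q (qu_S n q (2 * i) j) i (sgn_ij i j)"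
  using P.socle_pdec[OF qu_P_pdec(2)[OF assms]] by simp_all
qed

context qmod
begin

lemma F_pow_E_pow_zero:
 assumes v: "wt s x v" "s \<noteq> 0" "opF v = \<zero>" and "l < m"
 shows "(opF ^^ m) ((opE ^^ l) v) = \<zero>" using \<open>l < m\<close>
proof (induction l arbitrary: m)
 case (Suc l)
 obtain m' where m': "m = Suc m'" using Suc.prems by (cases m) auto
 have vc: "v \<in> carrier M" using v by auto
 have "opF ((opE ^^ Suc l) v) = sc (cc x (Suc l)) ((opE ^^ l) v)"
  using opF_opE_pow[OF v(1,2), of "Suc l"] v(3) vc by (simp del: funpow.simps)
 then have "(opF ^^ m) ((opE ^^ Suc l) v) = (opF ^^ m') (sc (cc x (Suc l)) ((opE ^^ l) v))"
  unfolding m' funpow_Suc_right o_apply by simp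
 also have "... = sc (cc x (Suc l)) ((opF ^^ m') ((opE ^^ l) v))" by (rule funpow_sc(2)) (use vc in simp)
 finally show ?case using Suc m' by simp
next
 case 0
 then obtain m' where "m = Suc m'" by (cases m) auto
 then show ?case using v(3) by (simp add: funpow_Suc_right del: funpow.simps(2))
qed

text \<open>A preimage under F need not be a weight vector. Its component of weight x is still a
  preimage, because F respects weight components and \<open>opF y\<close> has only the one of weight
  x + 1.\<close>

lemma wt_lift:
 assumes y: "y \<in> carrier M" and z: "wt s (x + 1) (opF y)" and s: "s = 1 \<or> s = - 1"
 shows "\<exists>y'. wt s x y' \<and> opF y' = opF y"
proof -
 \<comment> \<open>Inverse eigenvalues of \<kappa> and \<kappa>-hat for weight x, since
   \<open>proj\<close> selects the inverse of its argument.\<close>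
 define c1 c2 where c: "c1 = s * q powi (int n * x)" "c2 = s * q powi ((int n - 2) * x)"
 have ss: "s * s = 1" "inverse s = s" "s ^ n = 1" "s ^ N = 1" "s \<noteq> 0" using s n_even by auto
 have pw: "(q powi (int n * a)) ^ n = 1" "(q powi a) ^ N = 1" "(q powi (- int n * a)) ^ n = 1" for a
  unfolding q_pow q_powi_eq_1_iff by (simp_all add: power2_eq_square)
 have c_root: "c1 ^ n = 1" "c2 ^ N = 1" "c1 \<noteq> 0" "c2 \<noteq> 0" using pw[of x] pw[of "(int n - 2) * x"] ss
  by (simp_all add: c power_mult_distrib)
 have kN: "\<kappa>h \<up> N = \<one>\<^bsub>A\<^esub>"
 proof -
  have "\<kappa> \<up> (2::nat) \<cdot> \<kappa>h = \<kappa>h \<cdot> \<kappa> \<up> (2::nat)"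
   by (rule qu.group_commutes_pow) (use qu.kappa_comm in simp_all)
  then have comm: "\<kappa>h \<up> n \<cdot> \<kappa> \<up> (2::nat) = \<kappa> \<up> (2::nat) \<cdot> \<kappa>h \<up> n"
   by (intro qu.group_commutes_pow) simp_all
  have inv: "\<kappa>h \<up> n \<cdot> \<kappa> \<up> (2::nat) = \<one>\<^bsub>A\<^esub>" using qu.kappa_hat_pow by simp
  have "(\<kappa>h \<up> n \<cdot> \<kappa> \<up> (2::nat)) \<up> n = (\<kappa>h \<up> n) \<up> n \<cdot> (\<kappa> \<up> (2::nat)) \<up> n"
   by (rule qu.pow_mult_distrib) (use comm in simp_all)
  also have "(\<kappa> \<up> (2::nat)) \<up> n = (\<kappa> \<up> n) \<up> (2::nat)"
   by (simp only: qu.nat_pow_pow mult.commute gens_closed)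
  also have "... = \<one>\<^bsub>A\<^esub>" using qu.kappa_pow by simp
  finally show ?thesis unfolding inv by (simp add: qu.nat_pow_pow power2_eq_square)
 qed
 let ?p = "qu.proj n \<kappa> c1" and ?ph = "qu.proj N \<kappa>h c2"
 \<comment> \<open>The projections for weight x + 1, to which F carries those for weight x.\<close>
 let ?p' = "qu.proj n \<kappa> (c1 * q ^ n)" and ?ph' = "qu.proj N \<kappa>h (c2 * (q ^ n * inverse (q ^ 2)))"
 define y' where "y' = ?p \<odot> (?ph \<odot> y)"
 have pc: "?p \<in> carrier A" "?ph \<in> carrier A" "?p' \<in> carrier A" "?ph' \<in> carrier A" by simp_all
 have y'c: "y' \<in> carrier M" unfolding y'_def using y pc by blast
 have "opk y' = (\<kappa> \<cdot> ?p) \<odot> (?ph \<odot> y)" using y pc by (simp only: opk_def y'_def act_assoc act_closed gens_closed)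
 also have "... = sc (inverse c1) y'"
  using qu.proj_eigen[OF gens_closed(1) _ c_root(1,3)] qu.kappa_pow y pc by (simp add: unit_act y'_def)
 finally have k: "opk y' = sc (inverse c1) y'" .
 have "\<kappa>h \<cdot> ?p = ?p \<cdot> \<kappa>h" by (rule qu.proj_comm) (use qu.kappa_comm in simp_all)
 then have "opkh y' = (?p \<cdot> (\<kappa>h \<cdot> ?ph)) \<odot> y"
  using y pc by (simp only: opkh_def y'_def act_assoc[symmetric] qu.m_closed gens_closed qu.m_assoc[symmetric])
 also have "... = sc (inverse c2) y'"
  using qu.proj_eigen[OF gens_closed(2) kN c_root(2,4)] y pc by (simp add: act_assoc act_sc[unfolded sc_def] sc_def y'_def)
 finally have kh: "opkh y' = sc (inverse c2) y'" .
 have inv: "inverse c1 = s * q powi (- int n * x)" "inverse c2 = s * q powi ((2 - int n) * x)"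
  by (simp_all add: c ss(2) power_int_minus[symmetric] algebra_simps)
 have w: "wt s x y'" unfolding wt_def using y'c k kh inv by simp
 have twist: "F \<cdot> g = \<eta> d \<cdot> (g \<cdot> F)"
  if "g \<in> carrier A" "g \<cdot> F = \<eta> (inverse d) \<cdot> F \<cdot> g" "d \<noteq> 0" for g d
  using that by (simp add: qu.m_assoc qu.unit_mult_left qu.unit_one)
 have F1: "F \<cdot> ?p = ?p' \<cdot> F" by (intro qu.proj_twist twist) (use qu.kappa_F in simp_all)
 have F2: "F \<cdot> ?ph = ?ph' \<cdot> F" by (intro qu.proj_twist twist) (use qu.kappa_hat_F in simp_all)
 have zc: "opF y \<in> carrier M" using y by simp
 have zk: "\<kappa> \<odot> opF y = sc (s * q powi (- int n * (x + 1))) (opF y)"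
  "\<kappa>h \<odot> opF y = sc (s * q powi ((2 - int n) * (x + 1))) (opF y)" using z by (simp_all add: wt_def opk_def opkh_def)
 have r: "(s * q powi (- int n * (x + 1))) ^ n = 1" "(s * q powi ((2 - int n) * (x + 1))) ^ N = 1"
  by (simp_all only: power_mult_distrib ss pw mult_1_left)
 have qn: "q ^ n = q powi int n" "inverse (q ^ 2) = q powi (- 2)" by (simp_all add: power_int_minus)
 have e: "int n * (x + 1) = int n * x + int n" "(int n - 2) * (x + 1) = (int n - 2) * x + (int n + - 2)"
  by (simp_all add: algebra_simps)
 have cq: "c1 * q ^ n = s * q powi (int n * (x + 1))" "c2 * (q ^ n * inverse (q ^ 2)) = s * q powi ((int n - 2) * (x + 1))"
  unfolding c qn e q_add by (simp_all only: mult_ac)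
 have cancel: "s * q powi a * (s * q powi b) = 1" if "a + b = 0" for a b
 proof -
  have "s * q powi a * (s * q powi b) = (s * s) * q powi (a + b)" by (simp only: q_add mult_ac)
  then show ?thesis using that ss by simp
 qed
 have cx: "- int n * (x + 1) + int n * (x + 1) = 0" "(2 - int n) * (x + 1) + (int n - 2) * (x + 1) = 0"
  by (simp_all add: algebra_simps)
 have ph': "?ph' \<odot> opF y = opF y" unfolding cq by (subst proj_act[OF gens_closed(2) zc zk(2) r(2)])
   (use N_pos in \<open>simp_all only: power_mult_distrib ss pw mult_1_left of_nat_eq_0_iff cancel[OF cx(2)] if_True, simp\<close>)
 have p': "?p' \<odot> opF y = opF y" unfolding cq by (subst proj_act[OF gens_closed(1) zc zk(1) r(1)])
   (use n_pos in \<open>simp_all only: power_mult_distrib ss pw mult_1_left of_nat_eq_0_iff cancel[OF cx(1)] if_True, simp\<close>)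
 have "opF y' = ((F \<cdot> ?p) \<cdot> ?ph) \<odot> y" using y pc by (simp add: opF_def y'_def act_assoc)
 also have "... = ?p' \<odot> ((F \<cdot> ?ph) \<odot> y)" unfolding F1 using y pc by (simp add: act_assoc)
 also have "... = ?p' \<odot> (?ph' \<odot> opF y)" unfolding F2 using y pc by (simp add: act_assoc opF_def)
 finally have "opF y' = opF y" unfolding ph' p' .
 with w show ?thesis by blast
qed

end

section \<open>Bases and components of tensor products\<close>

context tensmod
begin

lemma ptW: "[|x \<in> carrier M; y \<in> carrier N|] ==> pt x y \<in> carrier W"
 by (simp add: tensor_module_simps)

lemma lc_pt_left:
 assumes "finite I" "b \<in> I \<rightarrow> carrier M" "y \<in> carrier N"
 shows "pt (M.lc I b c) y = W.lc I (\<lambda>i. pt (b i) y) c" using assms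
proof (induction I rule: finite_induct)
 case (insert i I)
 then have b: "b i \<in> carrier M" "b \<in> I \<rightarrow> carrier M" by auto
 have "pt (M.lc (insert i I) b c) y = W.sc (c i) (pt (b i) y) \<oplus>\<^bsub>W\<^esub> pt (M.lc I b c) y"
  using insert b by (subst M.lc_insert) (simp_all only: pt_sum_left sc_pt M.sc_closed M.lc_closed not_False_eq_True)
 also have "... = W.lc (insert i I) (\<lambda>i. pt (b i) y) c"
  unfolding insert.IH[OF b(2) insert.prems(2)] using insert.hyps insert.prems b
  by (intro W.lc_insert[symmetric]) (auto intro: ptW)
 finally show ?case .
qed simp

lemma tensor_lc:
 assumes I: "finite I" "b \<in> I \<rightarrow> carrier M" and J: "finite J" "s \<in> J \<rightarrow> carrier N"
 shows "W.lc (I \<times> J) (\<lambda>(i, j). pt (b i) (s j)) c = finsum W (\<lambda>j. pt (M.lc I b (\<lambda>i. c (i, j))) (s j)) J"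
 using J
proof (induction J rule: finite_induct)
 case empty
 show ?case by (simp only: Sigma_empty2 W.lc_empty W.M.finsum_empty)
next
 case (insert j J)
 let ?f = "\<lambda>(i, j). pt (b i) (s j)"
 have s: "s j \<in> carrier N" "s \<in> J \<rightarrow> carrier N" using insert by auto
 have fc: "?f \<in> I \<times> insert j J \<rightarrow> carrier W" using I insert by (auto simp: Pi_iff intro!: ptW)
 have inj: "inj_on (\<lambda>i. (i, j)) I" by (auto simp: inj_on_def)
 have set: "I \<times> insert j J = (\<lambda>i. (i, j)) ` I \<union> I \<times> J" by auto
 have "W.lc (I \<times> insert j J) ?f c = W.lc ((\<lambda>i. (i, j)) ` I) ?f c \<oplus>\<^bsub>W\<^esub> W.lc (I \<times> J) ?f c"
  unfolding set W.lc_def using I insert.hyps fc by (intro W.M.finsum_Un_disjoint) (auto simp: Pi_iff intro!: W.sc_closed)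
 also have "W.lc ((\<lambda>i. (i, j)) ` I) ?f c = pt (M.lc I b (\<lambda>i. c (i, j))) (s j)"
  unfolding lc_pt_left[OF I s(1)] using I s by (subst W.lc_reindex[OF inj]) (auto simp: Pi_iff intro!: ptW)
 finally have "W.lc (I \<times> insert j J) ?f c = pt (M.lc I b (\<lambda>i. c (i, j))) (s j) \<oplus>\<^bsub>W\<^esub> W.lc (I \<times> J) ?f c" .
 moreover have "finsum W (\<lambda>j. pt (M.lc I b (\<lambda>i. c (i, j))) (s j)) (insert j J)
  = pt (M.lc I b (\<lambda>i. c (i, j))) (s j) \<oplus>\<^bsub>W\<^esub> finsum W (\<lambda>j. pt (M.lc I b (\<lambda>i. c (i, j))) (s j)) J"
  using I s insert.hyps by (intro W.M.finsum_insert) (auto simp: Pi_iff intro!: ptW)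
 ultimately show ?case using insert.IH s by simp
qed

lemma tensor_kbasis:
 assumes b: "M.kbasis I b" and s: "N.kbasis J s"
 shows "W.kbasis (I \<times> J) (\<lambda>(i, j). pt (b i) (s j))"
proof -
 note I = M.kbasisD(1,2)[OF b] and J = N.kbasisD(1,2)[OF s]
 show ?thesis unfolding W.kbasis_def tensor_lc[OF I J]
 proof (intro conjI ballI allI impI)
  show "finite (I \<times> J)" using I J by simp
  show "(\<lambda>(i, j). pt (b i) (s j)) \<in> I \<times> J \<rightarrow> carrier W" using I J by (auto simp: Pi_iff intro!: ptW)
  fix T assume "T \<in> carrier W"
  then obtain U where U: "U \<in> J \<rightarrow> carrier M" "T = finsum W (\<lambda>j. pt (U j) (s j)) J" using tensor_expand[OF s] by blast
  have "T = finsum W (\<lambda>j. pt (M.lc I b (\<lambda>i. M.coord I b (U j) i)) (s j)) J"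
   unfolding U(2) using U J by (intro W.M.finsum_cong') (auto simp: M.lc_coord[OF b] Pi_iff intro!: ptW)
  then show "\<exists>c. T = finsum W (\<lambda>j. pt (M.lc I b (\<lambda>i. c (i, j))) (s j)) J"
   by (intro exI[of _ "\<lambda>(i, j). M.coord I b (U j) i"]) simp
 next
  fix c x assume 0: "finsum W (\<lambda>j. pt (M.lc I b (\<lambda>i. c (i, j))) (s j)) J = \<zero>\<^bsub>W\<^esub>" and x: "x \<in> I \<times> J"
  have "M.lc I b (\<lambda>i. c (i, snd x)) = \<zero>\<^bsub>M\<^esub>"
   using tensor_expand_unique[OF s _ 0, of "snd x"] x I by auto
  from M.kbasisD(4)[OF b this, of "fst x"] show "c x = 0" using x by auto
 qed
qed

text \<open>The component in M at one basis vector of the second factor, as a linear map. It is used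
  at the bottom vector of S, where leading terms are read off.\<close>

lemma tensor_coeff:
 assumes s: "N.kbasis J s" and i: "i \<in> J"
 shows "\<exists>\<phi>. (\<forall>T\<in>carrier W. \<phi> T \<in> carrier M) \<and> (\<forall>T\<in>carrier W. \<forall>T'\<in>carrier W. \<phi> (T \<oplus>\<^bsub>W\<^esub> T') = \<phi> T \<oplus>\<^bsub>M\<^esub> \<phi> T') \<and>
  (\<forall>T\<in>carrier W. \<forall>c. \<phi> (W.sc c T) = M.sc c (\<phi> T)) \<and>
  (\<forall>U\<in>J \<rightarrow> carrier M. \<phi> (finsum W (\<lambda>j. pt (U j) (s j)) J) = U i)"
proof -
 have J: "finite J" and sJ: "s \<in> J \<rightarrow> carrier N" using N.kbasisD[OF s] by auto
 let ?S = "\<lambda>U. finsum W (\<lambda>j. pt (U j) (s j)) J"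
 have ptJ: "(\<lambda>j. pt (U j) (s j)) \<in> J \<rightarrow> carrier W" if "U \<in> J \<rightarrow> carrier M" for U
  using that sJ by (auto simp: Pi_iff intro!: ptW)
 have add: "?S (\<lambda>j. U j \<oplus>\<^bsub>M\<^esub> U' j) = ?S U \<oplus>\<^bsub>W\<^esub> ?S U'" if "U \<in> J \<rightarrow> carrier M" "U' \<in> J \<rightarrow> carrier M" for U U'
 proof -
  have "?S (\<lambda>j. U j \<oplus>\<^bsub>M\<^esub> U' j) = finsum W (\<lambda>j. pt (U j) (s j) \<oplus>\<^bsub>W\<^esub> pt (U' j) (s j)) J"
   using that sJ by (intro W.M.finsum_cong') (auto simp: pt_sum_left Pi_iff intro!: ptW W.M.add.m_closed)
  also have "... = ?S U \<oplus>\<^bsub>W\<^esub> ?S U'" by (rule W.M.finsum_addf[OF ptJ ptJ]) (use that in auto)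
  finally show ?thesis .
 qed
 have sc: "?S (\<lambda>j. M.sc c (U j)) = W.sc c (?S U)" if "U \<in> J \<rightarrow> carrier M" for U c
  unfolding W.sc_finsum[OF J ptJ[OF that]] using that sJ by (intro W.M.finsum_cong') (auto simp: sc_pt Pi_iff intro!: ptW)
 define \<phi> where "\<phi> T = (SOME u. \<exists>U\<in>J \<rightarrow> carrier M. T = ?S U \<and> u = U i)" for T
 have \<phi>: "\<phi> (?S U) = U i" if U: "U \<in> J \<rightarrow> carrier M" for U
 proof -
  have "\<exists>u. \<exists>U'\<in>J \<rightarrow> carrier M. ?S U = ?S U' \<and> u = U' i" using U by blast
  from someI_ex[OF this, folded \<phi>_def] obtain U' where U': "U' \<in> J \<rightarrow> carrier M" "?S U = ?S U'" "\<phi> (?S U) = U' i" by blast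
  have "?S (\<lambda>j. U j \<oplus>\<^bsub>M\<^esub> M.sc (- 1) (U' j)) = ?S U' \<oplus>\<^bsub>W\<^esub> W.sc (- 1) (?S U')"
   using U U' by (subst add) (auto simp only: sc U'(2)[symmetric] Pi_iff M.sc_closed)
  also have "... = \<zero>\<^bsub>W\<^esub>" using ptJ[OF U'(1)] by (simp only: W.sc_minus_one W.M.finsum_closed W.M.r_neg)
  finally have "U i \<oplus>\<^bsub>M\<^esub> M.sc (- 1) (U' i) = \<zero>\<^bsub>M\<^esub>"
   using tensor_expand_unique[OF s, of "\<lambda>j. U j \<oplus>\<^bsub>M\<^esub> M.sc (- 1) (U' j)" i] U U' i by (auto simp: Pi_iff)
  moreover have c: "U i \<in> carrier M" "U' i \<in> carrier M" using U U' i by auto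
  moreover have "U i = (U i \<oplus>\<^bsub>M\<^esub> M.sc (- 1) (U' i)) \<oplus>\<^bsub>M\<^esub> U' i"
   using c by (simp add: M.sc_minus_one M.M.a_assoc M.M.l_neg)
  ultimately show ?thesis unfolding U'(3) by simp
 qed
 show ?thesis
 proof (intro exI[of _ \<phi>] conjI ballI allI)
  fix T assume T: "T \<in> carrier W"
  then obtain U where U: "U \<in> J \<rightarrow> carrier M" "T = ?S U" using tensor_expand[OF s] by blast
  show "\<phi> T \<in> carrier M" using U i by (auto simp: \<phi>)
  show "\<phi> (W.sc c T) = M.sc c (\<phi> T)" for c
  proof -
   have "(\<lambda>j. M.sc c (U j)) \<in> J \<rightarrow> carrier M" using U by auto
   from \<phi>[OF this] show ?thesis unfolding sc[OF U(1)] U(2) \<phi>[OF U(1)] .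
  qed
  fix T' assume "T' \<in> carrier W"
  then obtain U' where U': "U' \<in> J \<rightarrow> carrier M" "T' = ?S U'" using tensor_expand[OF s] by blast
  show "\<phi> (T \<oplus>\<^bsub>W\<^esub> T') = \<phi> T \<oplus>\<^bsub>M\<^esub> \<phi> T'"
  proof -
   have "(\<lambda>j. U j \<oplus>\<^bsub>M\<^esub> U' j) \<in> J \<rightarrow> carrier M" using U U' by auto
   from \<phi>[OF this] show ?thesis unfolding add[OF U(1) U'(1)] U(2) U'(2) \<phi>[OF U(1)] \<phi>[OF U'(1)] .
  qed
 qed (rule \<phi>)
qed

end

text \<open>As \<open>q^(n (n/2)) = -1\<close>, the sign of a weight is absorbed into the
  \<kappa>-exponent as a shift by n/2. This supplies the integers needed for twisted
  tensors.\<close>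

lemma (in qmod) wt_kev:
 assumes s: "s = 1 \<or> s = - 1" and w: "wt s z u"
 shows "kev ((if s = 1 then 0 else int (n div 2)) - z) u"
proof -
 have "n = 2 * (n div 2)" using n_even by simp
 then have "int N div 2 = int n * int (n div 2)"
  by (metis (no_types, lifting) div_mult2_eq mult.assoc nonzero_mult_div_cancel_left of_nat_mult of_nat_numeral power2_eq_square zdiv_int zero_neq_numeral mult.commute)
 then have h: "q powi (int n * int (n div 2)) = - 1" using q_half by simp
 have "s * q powi (- int n * z) = q powi (int n * ((if s = 1 then 0 else int (n div 2)) - z))"
 proof (cases "s = 1")
  case False
  have "q powi (int n * (int (n div 2) - z)) = q powi (int n * int (n div 2) + - int n * z)" by (simp add: algebra_simps)
  also have "... = s * q powi (- int n * z)" unfolding q_add h using s False by simp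
  finally show ?thesis using False by simp
 qed simp
 then show ?thesis using w unfolding kev_def wt_def by simp
qed

lemma (in abelian_monoid) finsum_shift:
 assumes "\<And>m. f m \<in> carrier G"
 shows "finsum G f {..<Suc k} = finsum G (\<lambda>m. f (Suc m)) {..<k} \<oplus> f 0"
proof (cases k)
 case (Suc k')
 then show ?thesis using finsum_Suc2[of f k'] assms by (simp add: lessThan_Suc_atMost)
qed (use assms in \<open>simp add: lessThan_Suc\<close>)

section \<open>Lifting leading terms to the tensor product with S\<close>

locale core = qtens n q M L
 for n :: nat and q :: "'k::field_char_0" and M :: "('k free_qu set, 'm) module" and L :: "('k free_qu set, 'l) module" +
 fixes s1 s2 :: 'k and i2 :: nat and w :: 'l
 assumes s1: "s1 = 1 \<or> s1 = - 1" and s2: "s2 = 1 \<or> s2 = - 1" and i2: "1 \<le> i2" "2 * i2 \<le> N"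
  and w_wt: "L.wt s2 (- int i2) w" and w_killed: "L.opF w = \<zero>\<^bsub>L\<^esub>"
  and w_top: "(L.opE ^^ (N - 2 * i2 + 1)) w = \<zero>\<^bsub>L\<^esub>"
  and w_basis: "L.kbasis {..<N - 2 * i2 + 1} (\<lambda>m. (L.opE ^^ m) w)"
begin

definition "d = N - 2 * i2 + 1"
definition sv where "sv m = (L.opE ^^ m) w"
definition "e1 = (if s1 = 1 then 0 else int (n div 2))"
definition "e2 = (if s2 = 1 then 0 else int (n div 2))"
definition D where "D m = e2 + int i2 + int m"
text \<open>Meant for u of weight y + m, so that the tensor with \<open>E^m w\<close>, of weight -i2
  - m, has total weight y - i2 whatever m is. The parameters of the twist are the \<kappa>-exponents
  of the two factors.\<close>

definition T where "T y m u = tw (e1 - (y + int m)) (D m) u (sv m)"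
definition kc where "kc y m = q powi (- (int n * (e1 - (y + int m)) * (D m div int n)))"

lemma s_nz: "s1 \<noteq> 0" "s2 \<noteq> 0" using s1 s2 by auto

lemma sv_closed [simp]: "sv m \<in> carrier L" using w_wt by (auto simp: sv_def)
lemma sv_wt: "L.wt s2 (- int i2 - int m) (sv m)" unfolding sv_def by (rule L.wt_opE_pow[OF w_wt])
lemma sv_basis: "L.kbasis {..<d} sv" using w_basis by (simp add: d_def sv_def[abs_def])
lemma sv_Suc: "L.opE (sv m) = sv (Suc m)" by (simp add: sv_def)
lemma sv_d: "sv d = \<zero>\<^bsub>L\<^esub>" using w_top by (simp add: sv_def d_def)
lemma sv_kev: "L.kev (D m) (sv m)"
proof -
 have "(if s2 = 1 then 0 else int (n div 2)) - (- int i2 - int m) = D m" by (simp add: D_def e2_def)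
 then show ?thesis using L.wt_kev[OF s2 sv_wt[of m]] by (simp only:)
qed
lemma opF_sv: "L.opF (sv m) = L.sc (cc (- int i2) m) (sv (m - 1))"
 using L.opF_opE_pow[OF w_wt s_nz(2), of m] sv_closed[of "m - 1"] by (simp add: sv_def w_killed)

lemma T_closed [simp]: "u \<in> carrier M ==> T y m u \<in> carrier V" by (simp add: T_def V_W(1))
lemma T_add: "[|u \<in> carrier M; v \<in> carrier M|] ==> T y m (u \<oplus>\<^bsub>M\<^esub> v) = T y m u \<oplus>\<^bsub>V\<^esub> T y m v"
 by (simp add: T_def V_W(2) tw_add_left)
lemma T_sc: "u \<in> carrier M ==> T y m (M.sc c u) = Q.W.sc c (T y m u)"
 by (simp add: T_def V_W(4) tw_sc_left)
lemma T_zero [simp]: "T y m \<zero>\<^bsub>M\<^esub> = \<zero>\<^bsub>V\<^esub>" by (simp add: T_def V_W(3))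
lemma T_d [simp]: "u \<in> carrier M ==> T y d u = \<zero>\<^bsub>V\<^esub>" by (simp add: T_def V_W(3) sv_d)
lemma T_pt: "u \<in> carrier M ==> T y m u = pt (M.sc (kc y m) u) (sv m)"
 by (simp add: T_def tw_def kc_def pt_sc_left)

lemma E_T:
 assumes u: "M.wt s1 (y + int m) u"
 shows "V.opE (T y m u) = Q.W.sc (q powi D m) (T (y - 1) m (M.opE u)) \<oplus>\<^bsub>V\<^esub> T (y - 1) (Suc m) u"
proof -
 have k: "M.kev (e1 - (y + int m)) u" using M.wt_kev[OF s1 u] by (simp add: e1_def)
 have e: "e1 - (y + int m) + 1 = e1 - (y - 1 + int m)" "e1 - (y + int m) = e1 - (y - 1 + int (Suc m))" "D m + 1 = D (Suc m)"
  by (simp_all add: D_def)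
 show ?thesis using dE_tw[OF k sv_kev, folded e(3)] unfolding V_ops(3) tactE_def T_def V_W(2,4) sv_Suc e(1)
  by (simp only: e(2,3))
qed

lemma F_T:
 assumes u: "M.wt s1 (y + int m) u"
 shows "V.opF (T y m u) = Q.W.sc (q powi (- D m)) (T (y + 1) m (M.opF u))
  \<oplus>\<^bsub>V\<^esub> T (y + 1) (m - 1) (M.sc (cc (- int i2) m * q powi (2 * (y + int m))) u)"
proof -
 have k: "M.kev (e1 - (y + int m)) u" using M.wt_kev[OF s1 u] by (simp add: e1_def)
 have uc: "u \<in> carrier M" using u by auto
 have e: "e1 - (y + int m) - 1 = e1 - (y + 1 + int m)" by simp
 have "tw (e1 - (y + int m)) (D m - 1) (M.opK u) (L.opF (sv m)) = T (y + 1) (m - 1) (M.sc (cc (- int i2) m * q powi (2 * (y + int m))) u)"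
 proof (cases m)
  case 0
  then show ?thesis using uc opF_sv[of 0] by (simp add: T_def M.wt_opK[OF u s_nz(1)] V_W(3))
 next
  case (Suc m')
  have e2: "e1 - (y + int m) = e1 - (y + 1 + int (m - 1))" "D m - 1 = D (m - 1)" by (simp_all add: D_def Suc)
  show ?thesis unfolding T_def opF_sv M.wt_opK[OF u s_nz(1)] e2 using uc by (simp add: tw_sc_left tw_sc_right mult.commute)
 qed
 then show ?thesis using dF_tw[OF k sv_kev] unfolding V_ops(4) tactF_def T_def[of y m] V_W(2,4) e
  by (simp add: T_def[of "y + 1" m])
qed

definition Xs :: "int => (nat => 'm) => ('m \<times> 'l \<Rightarrow>\<^sub>0 'k) set" where
 "Xs y U = finsum V (\<lambda>m. T y m (U m)) {..<d}"

text \<open>Coefficients of a tensor of total weight y - i2. The value zero from d on makes the top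
  index d - 1 obey the same formulas as the others.\<close>

definition hom :: "int => (nat => 'm) => bool" where
 "hom y U \<longleftrightarrow> (\<forall>m. M.wt s1 (y + int m) (U m)) \<and> (\<forall>m\<ge>d. U m = \<zero>\<^bsub>M\<^esub>)"

lemma d_pos: "d > 0" by (simp add: d_def)
lemma wt0: "M.wt s x \<zero>\<^bsub>M\<^esub>" by (simp add: M.wt_def)
lemma homD: assumes "hom y U" shows "M.wt s1 (y + int m) (U m)" "U m \<in> carrier M" "m \<ge> d ==> U m = \<zero>\<^bsub>M\<^esub>"
 using assms by (auto simp: hom_def)

lemma X_closed [simp]: "(\<And>m. U m \<in> carrier M) ==> Xs y U \<in> carrier V"
 unfolding Xs_def by (rule Q.W.M.finsum_closed) (simp add: Pi_iff)

lemma X_add: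
 assumes "\<And>m. U m \<in> carrier M" "\<And>m. U' m \<in> carrier M"
 shows "Xs y (\<lambda>m. U m \<oplus>\<^bsub>M\<^esub> U' m) = Xs y U \<oplus>\<^bsub>V\<^esub> Xs y U'"
 unfolding Xs_def using assms by (simp only: T_add) (rule Q.W.M.finsum_addf, simp_all add: Pi_iff)

lemma X_sc:
 assumes "\<And>m. U m \<in> carrier M" shows "Xs y (\<lambda>m. M.sc c (U m)) = Q.W.sc c (Xs y U)"
 unfolding Xs_def using assms by (simp only: T_sc) (rule Q.W.sc_finsum[symmetric], simp_all add: Pi_iff)

lemma X_zero: "(\<And>m. m < d ==> U m = \<zero>\<^bsub>M\<^esub>) ==> Xs y U = \<zero>\<^bsub>V\<^esub>"
proof -
 assume "\<And>m. m < d ==> U m = \<zero>\<^bsub>M\<^esub>"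
 then have "Xs y U = finsum V (\<lambda>m. \<zero>\<^bsub>V\<^esub>) {..<d}" unfolding Xs_def
  by (intro Q.W.M.finsum_cong') (simp_all only: T_zero lessThan_iff Pi_iff Q.W.M.zero_closed, simp_all)
 then show ?thesis by (simp only: Q.W.M.finsum_zero)
qed

lemma X_pt: "(\<And>m. U m \<in> carrier M) ==> Xs y U = finsum V (\<lambda>m. pt (M.sc (kc y m) (U m)) (sv m)) {..<d}"
 unfolding Xs_def by (simp only: T_pt)

lemma X_eq_0D:
 assumes U: "\<And>m. U m \<in> carrier M" and 0: "Xs y U = \<zero>\<^bsub>V\<^esub>" and m: "m < d"
 shows "U m = \<zero>\<^bsub>M\<^esub>"
proof -
 have "M.sc (kc y m) (U m) = \<zero>\<^bsub>M\<^esub>"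
  by (rule Q.tensor_expand_unique[OF sv_basis, of "\<lambda>m. M.sc (kc y m) (U m)"]) (use U 0 m X_pt in auto)
 then show ?thesis using M.sc_cancel[OF U, of "kc y m" m] by (simp add: kc_def)
qed

lemma X_wt: assumes U: "hom y U" shows "V.wt (s1 * s2) (y - int i2) (Xs y U)"
proof -
 have T: "V.wt (s1 * s2) (y - int i2) (T y m (U m))" for m
 proof -
  note u = homD[OF U, of m]
  have e: "- int n * (y - int i2) = - int n * (y + int m) + - int n * (- int i2 - int m)"
   "(2 - int n) * (y - int i2) = (2 - int n) * (y + int m) + (2 - int n) * (- int i2 - int m)" by (simp_all add: algebra_simps)
  show ?thesis unfolding V.wt_def V_ops(1,2) T_def dK_tw[OF u(2) sv_closed] e q_add
   using u(1,2) sv_wt[of m] T_closed[OF u(2), of y m]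
   by (simp add: M.wt_def L.wt_def tw_sc_left tw_sc_right V_W(4) mult_ac T_def V_W(1))
 qed
 have "V.wt (s1 * s2) (y - int i2) (finsum V (\<lambda>m. T y m (U m)) I)" if "finite I" for I using that
 proof (induction I rule: finite_induct)
  case (insert m I)
  then show ?case using homD(2)[OF U] T by (subst Q.W.M.finsum_insert) (auto intro!: V.wt_add)
 qed (simp add: V.wt_def)
 then show ?thesis by (simp add: Xs_def)
qed

text \<open>No other component contributes to the one at index 0, so E acts there as on M up to a
  power of q. This is the reason for taking leading terms at the bottom vector of S.\<close>

lemma E_X:
 assumes U: "hom y U"
 shows "\<exists>U'. hom (y - 1) U' \<and> V.opE (Xs y U) = Xs (y - 1) U' \<and> U' 0 = M.sc (q powi D 0) (M.opE (U 0))"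
proof -
 note u = homD[OF U]
 define a where "a m = M.sc (q powi D m) (M.opE (U m))" for m
 define b where "b m = (if m < d then (case m of 0 => \<zero>\<^bsub>M\<^esub> | Suc k => U k) else \<zero>\<^bsub>M\<^esub>)" for m
 have ac: "a m \<in> carrier M" and bc: "b m \<in> carrier M" for m using u by (simp_all add: a_def b_def split: nat.split)
 have sum: "finsum V (\<lambda>m. T (y - 1) (Suc m) (U m)) {..<d} = Xs (y - 1) b"
 proof -
  obtain k where k: "d = Suc k" using d_pos by (cases d) auto
  have "finsum V (\<lambda>m. T (y - 1) (Suc m) (U m)) {..<d} = finsum V (\<lambda>m. T (y - 1) (Suc m) (U m)) {..<k}"
   unfolding k lessThan_Suc using u(2) T_d[OF u(2), of "y - 1" k] by (subst Q.W.M.finsum_insert) (auto simp: k)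
  also have "... = finsum V (\<lambda>m. T (y - 1) (Suc m) (b (Suc m))) {..<k}"
   using bc u(2) by (intro Q.W.M.finsum_cong') (auto simp: b_def k)
  also have "... = Xs (y - 1) b" unfolding Xs_def k using bc by (subst Q.W.M.finsum_shift) (simp_all add: b_def)
  finally show ?thesis .
 qed
 have "V.opE (Xs y U) = finsum V (\<lambda>m. V.opE (T y m (U m))) {..<d}"
  unfolding Xs_def V.opE_def using u by (intro Q.W.act_finsum) auto
 also have "... = finsum V (\<lambda>m. T (y - 1) m (a m) \<oplus>\<^bsub>V\<^esub> T (y - 1) (Suc m) (U m)) {..<d}"
  using u ac by (intro Q.W.M.finsum_cong') (auto simp: E_T a_def T_sc)
 also have "... = Xs (y - 1) a \<oplus>\<^bsub>V\<^esub> Xs (y - 1) b"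
  unfolding sum[symmetric] Xs_def[of _ a] using u ac by (intro Q.W.M.finsum_addf) auto
 also have "... = Xs (y - 1) (\<lambda>m. a m \<oplus>\<^bsub>M\<^esub> b m)" by (rule X_add[OF ac bc, symmetric])
 finally have eq: "V.opE (Xs y U) = Xs (y - 1) (\<lambda>m. a m \<oplus>\<^bsub>M\<^esub> b m)" .
 have "M.wt s1 (y - 1 + int m) (a m \<oplus>\<^bsub>M\<^esub> b m)" for m
 proof (rule M.wt_add)
  have e: "y - 1 + int m = y + int m - 1" by simp
  show "M.wt s1 (y - 1 + int m) (a m)" unfolding a_def e by (rule M.wt_sc[OF M.wt_opE[OF u(1)]])
  have "y - 1 + int (Suc k) = y + int k" for k by simp
  then show "M.wt s1 (y - 1 + int m) (b m)" unfolding b_def using u(1) wt0 by (auto split: nat.split)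
 qed
 moreover have "a m \<oplus>\<^bsub>M\<^esub> b m = \<zero>\<^bsub>M\<^esub>" if "m \<ge> d" for m using that u(3) by (simp add: a_def b_def)
 moreover have "a 0 \<oplus>\<^bsub>M\<^esub> b 0 = M.sc (q powi D 0) (M.opE (U 0))" using u by (simp add: a_def b_def)
 ultimately show ?thesis using eq unfolding hom_def by (intro exI[of _ "\<lambda>m. a m \<oplus>\<^bsub>M\<^esub> b m"] conjI) simp_all
qed

text \<open>The components of the image under F: F on the first factor keeps the index, F on the
  second lowers it by one.\<close>

definition Fs :: "int => (nat => 'm) => nat => 'm" where
 "Fs y U m = M.sc (q powi (- D m)) (M.opF (U m)) \<oplus>\<^bsub>M\<^esub> M.sc (cc (- int i2) (Suc m) * q powi (2 * (y + int (Suc m)))) (U (Suc m))"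

lemma F_X:
 assumes U: "hom y U"
 shows "hom (y + 1) (Fs y U)" "V.opF (Xs y U) = Xs (y + 1) (Fs y U)"
proof -
 note u = homD[OF U]
 have "M.wt s1 (y + 1 + int m) (Fs y U m)" for m
 proof -
  have "y + 1 + int m = y + int m + 1" "y + 1 + int m = y + int (Suc m)" by simp_all
  then show ?thesis unfolding Fs_def by (metis M.wt_add M.wt_sc M.wt_opF u(1))
 qed
 then show "hom (y + 1) (Fs y U)" unfolding hom_def using u(3) by (simp add: Fs_def)
 define a where "a m = M.sc (q powi (- D m)) (M.opF (U m))" for m
 define b where "b m = M.sc (cc (- int i2) m * q powi (2 * (y + int m))) (U m)" for m
 have ac: "a m \<in> carrier M" and bc: "b m \<in> carrier M" for m using u by (simp_all add: a_def b_def)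
 have b0: "b 0 = \<zero>\<^bsub>M\<^esub>" and bd: "b d = \<zero>\<^bsub>M\<^esub>" using u(2)[of 0] u(3)[of d] by (simp_all add: b_def)
 have sum: "finsum V (\<lambda>m. T (y + 1) (m - 1) (b m)) {..<d} = Xs (y + 1) (\<lambda>m. b (Suc m))"
 proof -
  obtain k where k: "d = Suc k" using d_pos by (cases d) auto
  have "finsum V (\<lambda>m. T (y + 1) (m - 1) (b m)) {..<d} = finsum V (\<lambda>m. T (y + 1) m (b (Suc m))) {..<k}"
   unfolding k using bc by (subst Q.W.M.finsum_shift) (simp_all add: b0)
  also have "... = Xs (y + 1) (\<lambda>m. b (Suc m))"
   unfolding Xs_def k lessThan_Suc using bc bd by (subst Q.W.M.finsum_insert) (auto simp: k)
  finally show ?thesis .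
 qed
 have "V.opF (Xs y U) = finsum V (\<lambda>m. V.opF (T y m (U m))) {..<d}"
  unfolding Xs_def V.opF_def using u by (intro Q.W.act_finsum) auto
 also have "... = finsum V (\<lambda>m. T (y + 1) m (a m) \<oplus>\<^bsub>V\<^esub> T (y + 1) (m - 1) (b m)) {..<d}"
  using u ac bc by (intro Q.W.M.finsum_cong') (auto simp: F_T a_def b_def T_sc)
 also have "... = Xs (y + 1) a \<oplus>\<^bsub>V\<^esub> Xs (y + 1) (\<lambda>m. b (Suc m))"
  unfolding sum[symmetric] Xs_def[of _ a] using bc ac by (intro Q.W.M.finsum_addf) auto
 also have "... = Xs (y + 1) (\<lambda>m. a m \<oplus>\<^bsub>M\<^esub> b (Suc m))" by (rule X_add[OF ac bc, symmetric])
 finally show "V.opF (Xs y U) = Xs (y + 1) (Fs y U)" by (simp add: Fs_def[abs_def] a_def b_def)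
qed

lemma E_pow_X:
 assumes U: "hom y U"
 shows "\<exists>U'. hom (y - int r) U' \<and> (V.opE ^^ r) (Xs y U) = Xs (y - int r) U' \<and> U' 0 = M.sc ((q powi D 0) ^ r) ((M.opE ^^ r) (U 0))"
proof (induction r)
 case 0
 then show ?case using U homD(2)[OF U, of 0] by auto
next
 case (Suc r)
 then obtain U' where U': "hom (y - int r) U'" "(V.opE ^^ r) (Xs y U) = Xs (y - int r) U'"
  "U' 0 = M.sc ((q powi D 0) ^ r) ((M.opE ^^ r) (U 0))" by blast
 have e: "y - int r - 1 = y - int (Suc r)" by simp
 show ?case using E_X[OF U'(1)] U'(2,3) homD(2)[OF U, of 0] unfolding e by (auto simp: M.op_sc mult_ac)
qed

text \<open>For F the situation is reversed: the component at the largest occurring index receives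
  nothing from the others.\<close>

lemma F_pow_X:
 assumes U: "hom y U" and k: "k < d" and top: "\<And>m. m > k ==> U m = \<zero>\<^bsub>M\<^esub>"
 shows "\<exists>U'. hom (y + int r) U' \<and> (V.opF ^^ r) (Xs y U) = Xs (y + int r) U' \<and> (\<forall>m>k. U' m = \<zero>\<^bsub>M\<^esub>)
  \<and> U' k = M.sc ((q powi (- D k)) ^ r) ((M.opF ^^ r) (U k))"
proof (induction r)
 case 0
 then show ?case using U top homD(2)[OF U, of k] by auto
next
 case (Suc r)
 then obtain U' where U': "hom (y + int r) U'" "(V.opF ^^ r) (Xs y U) = Xs (y + int r) U'" "\<forall>m>k. U' m = \<zero>\<^bsub>M\<^esub>"
  "U' k = M.sc ((q powi (- D k)) ^ r) ((M.opF ^^ r) (U k))" by blast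
 have e: "y + int r + 1 = y + int (Suc r)" by simp
 have "Fs (y + int r) U' k = M.sc ((q powi (- D k)) ^ Suc r) ((M.opF ^^ Suc r) (U k))"
  using U'(3,4) homD(2)[OF U, of k] by (simp add: Fs_def M.op_sc mult_ac)
 moreover have "\<forall>m>k. Fs (y + int r) U' m = \<zero>\<^bsub>M\<^esub>" using U'(3) by (simp add: Fs_def)
 ultimately show ?case using F_X[OF U'(1)] U'(2) unfolding e by auto
qed

text \<open>Exactness of \<open>F\<close> is lifted from \<open>M\<close> along the filtration by the index of the second factor.\<close>

lemma X_F_exact:
 assumes exact: "\<And>u. [|u \<in> carrier M; (M.opF ^^ (N - 1)) u = \<zero>\<^bsub>M\<^esub>|] ==> \<exists>v\<in>carrier M. M.opF v = u"
  and "hom (y + 1) U" "\<And>m. m \<ge> k ==> U m = \<zero>\<^bsub>M\<^esub>" "k \<le> d" "(V.opF ^^ (N - 1)) (Xs (y + 1) U) = \<zero>\<^bsub>V\<^esub>"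
 shows "\<exists>z\<in>carrier V. V.opF z = Xs (y + 1) U" using assms(2-)
proof (induction k arbitrary: U)
 case 0
 then have "Xs (y + 1) U = \<zero>\<^bsub>V\<^esub>" by (intro X_zero) simp
 then show ?case by (intro bexI[of _ "\<zero>\<^bsub>V\<^esub>"]) simp_all
next
 case (Suc k)
 have k: "k < d" using Suc.prems by simp
 note u = homD[OF Suc.prems(1)]
 obtain U' where U': "hom (y + 1 + int (N - 1)) U'" "(V.opF ^^ (N - 1)) (Xs (y + 1) U) = Xs (y + 1 + int (N - 1)) U'"
  "U' k = M.sc ((q powi (- D k)) ^ (N - 1)) ((M.opF ^^ (N - 1)) (U k))"
  using F_pow_X[OF Suc.prems(1) k, of "N - 1"] Suc.prems(2) by auto
 \<comment> \<open>Component k of the vanishing tensor \<open>F^(N-1) X\<close>, which is a nonzero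
   multiple of \<open>F^(N-1) U_k\<close>.\<close>
 have "U' k = \<zero>\<^bsub>M\<^esub>" by (rule X_eq_0D[OF homD(2)[OF U'(1)] _ k]) (use U'(2) Suc.prems(4) in simp)
 then have "(M.opF ^^ (N - 1)) (U k) = \<zero>\<^bsub>M\<^esub>"
  using U'(3) M.sc_cancel[of "(M.opF ^^ (N - 1)) (U k)" "(q powi (- D k)) ^ (N - 1)"] u(2) by simp
 then obtain v0 where v0: "v0 \<in> carrier M" "M.opF v0 = U k" using exact u(2) by blast
 have "M.wt s1 (y + int k + 1) (M.opF v0)" using u(1)[of k] v0 by (simp add: algebra_simps)
 then obtain v where v: "M.wt s1 (y + int k) v" "M.opF v = U k" using M.wt_lift[OF v0(1) _ s1] v0(2) by metis
 have vc: "v \<in> carrier M" using v by auto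
 \<comment> \<open>F turns this tensor into one with component \<open>U k\<close> at k and otherwise
   only one at k - 1. Subtracting it lowers the largest index.\<close>
 define U1 where "U1 m = (if m = k then M.sc (q powi D k) v else \<zero>\<^bsub>M\<^esub>)" for m
 have U1: "hom y U1" using v(1) wt0 k by (auto simp: hom_def U1_def M.wt_sc)
 note F1 = F_X[OF U1]
 define U2 where "U2 m = U m \<oplus>\<^bsub>M\<^esub> M.sc (- 1) (Fs y U1 m)" for m
 note f = homD[OF F1(1)]
 have Fk: "Fs y U1 k = U k" using vc v(2) u(2)[of k] by (simp add: Fs_def U1_def M.op_sc flip: q_add)
 have U2: "hom (y + 1) U2" unfolding hom_def U2_def using u(3) f(3) M.wt_add[OF u(1) M.wt_sc[OF f(1)]] by simp
 have X2: "Xs (y + 1) U2 = Xs (y + 1) U \<oplus>\<^bsub>V\<^esub> Q.W.sc (- 1) (V.opF (Xs y U1))"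
  unfolding U2_def[abs_def] F1(2) using u(2) f(2) by (subst X_add) (simp_all add: X_sc)
 have c: "Xs y U1 \<in> carrier V" "Xs (y + 1) U \<in> carrier V" using homD(2)[OF U1] u(2) by simp_all
 have "\<exists>z\<in>carrier V. V.opF z = Xs (y + 1) U2"
 proof (rule Suc.IH[OF U2])
  show "U2 m = \<zero>\<^bsub>M\<^esub>" if m: "m \<ge> k" for m
  proof (cases "m = k")
   case True
   then show ?thesis using u(2)[of k] by (simp add: U2_def Fk M.sc_minus_one M.M.r_neg)
  next
   case False
   then have "Fs y U1 m = \<zero>\<^bsub>M\<^esub>" using m by (simp add: Fs_def U1_def)
   then show ?thesis using Suc.prems(2)[of m] m False by (simp add: U2_def)
  qed
  have "(V.opF ^^ (N - 1)) (V.opF (Xs y U1)) = (V.opF ^^ Suc (N - 1)) (Xs y U1)" by (simp only: funpow_Suc_right o_apply)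
  also have "... = \<zero>\<^bsub>V\<^esub>" using V.opF_pow_N[OF c(1)] N_pos by (simp del: funpow.simps)
  finally show "(V.opF ^^ (N - 1)) (Xs (y + 1) U2) = \<zero>\<^bsub>V\<^esub>"
   unfolding X2 using c Suc.prems(4) by (simp add: V.funpow_add V.funpow_sc)
 qed (use k in simp)
 then obtain z where z: "z \<in> carrier V" "V.opF z = Xs (y + 1) U2" by blast
 have "V.opF (z \<oplus>\<^bsub>V\<^esub> Xs y U1) = Xs (y + 1) U2 \<oplus>\<^bsub>V\<^esub> V.opF (Xs y U1)" using z c by (simp add: V.op_add)
 also have "... = Xs (y + 1) U" unfolding X2 using c by (simp add: Q.W.sc_minus_one Q.W.M.a_assoc Q.W.M.l_neg)
 finally show ?case using z c by (intro bexI[of _ "z \<oplus>\<^bsub>V\<^esub> Xs y U1"]) auto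
qed

text \<open>The recursion that makes the two contributions to each component of F X cancel when
  \<open>U m = aa y m F^m b\<close>. For indices m + 1 up to d the denominator vanishes only at d,
  and there \<open>F^d b = 0\<close> is used instead.\<close>

primrec aa :: "int => nat => 'k" where
 "aa y 0 = 1"
| "aa y (Suc m) = - (q powi (- D m) * aa y m / (cc (- int i2) (Suc m) * q powi (2 * (y + int (Suc m)))))"

definition lift :: "int => 'm => nat => 'm" where
 "lift y b m = (if m < d then M.sc (aa y m) ((M.opF ^^ m) b) else \<zero>\<^bsub>M\<^esub>)"

lemma lift:
 assumes b: "M.wt s1 y b" "(M.opF ^^ d) b = \<zero>\<^bsub>M\<^esub>"
 shows "hom y (lift y b)" "lift y b 0 = b" "V.opF (Xs y (lift y b)) = \<zero>\<^bsub>V\<^esub>"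
proof -
 have bc: "b \<in> carrier M" using b by auto
 show h: "hom y (lift y b)" unfolding hom_def lift_def using M.wt_opF_pow[OF b(1)] wt0 by (auto intro: M.wt_sc)
 show "lift y b 0 = b" using bc d_pos by (simp add: lift_def)
 have "Fs y (lift y b) m = \<zero>\<^bsub>M\<^esub>" if m: "m < d" for m
 proof -
  let ?f = "(M.opF ^^ Suc m) b" and ?c = "cc (- int i2) (Suc m) * q powi (2 * (y + int (Suc m)))"
  have fc: "?f \<in> carrier M" using bc M.funpow_closed(2)[of b "Suc m"] by simp
  show ?thesis
  proof (cases "Suc m < d")
   case True
   then have "cc (- int i2) (Suc m) \<noteq> 0" using cc_gamma_0_iff[OF i2, of "Suc m"] i2 by (simp add: d_def)
   then have c: "q powi (- D m) * aa y m + ?c * aa y (Suc m) = 0" by simp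
   have "Fs y (lift y b) m = M.sc (q powi (- D m) * aa y m) ?f \<oplus>\<^bsub>M\<^esub> M.sc (?c * aa y (Suc m)) ?f"
    using True m bc fc by (simp add: Fs_def lift_def M.op_sc del: aa.simps)
   also have "... = \<zero>\<^bsub>M\<^esub>" unfolding M.sc_add[OF fc, symmetric] c using fc by simp
   finally show ?thesis .
  next
   case False
   then have "Suc m = d" using m by simp
   then have "?f = \<zero>\<^bsub>M\<^esub>" using b(2) by simp
   then show ?thesis using False m bc by (simp add: Fs_def lift_def M.op_sc)
  qed
 qed
 then show "V.opF (Xs y (lift y b)) = \<zero>\<^bsub>V\<^esub>" unfolding F_X(2)[OF h] by (rule X_zero)
qed

text \<open>The lift of b serves as \<alpha>. Since F kills it and 2i - 2 < N - 1,
  \<open>F^(N-1)\<close> kills \<open>E^(2i-2) \<alpha>\<close>; exactness yields a preimage under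
  F, and \<open>wt_lift\<close> gives it the right weight. The divisibility matches the weight y -
  i2 of the lift with i - 1 modulo N/2.\<close>

lemma lift_pair:
 assumes exact: "\<And>u. [|u \<in> carrier M; (M.opF ^^ (N - 1)) u = \<zero>\<^bsub>M\<^esub>|] ==> \<exists>v\<in>carrier M. M.opF v = u"
  and b: "M.wt s1 y b" "(M.opF ^^ d) b = \<zero>\<^bsub>M\<^esub>"
  and i: "1 \<le> i" "2 * i \<le> N" "int (N div 2) dvd (y - int i2) - (int i - 1)"
 shows "\<exists>ga. V.ppair i (s1 * s2) (Xs y (lift y b)) ga"
proof -
 note l = lift[OF b]
 let ?al = "Xs y (lift y b)" and ?r = "2 * i - 2"
 have s: "s1 * s2 = 1 \<or> s1 * s2 = - 1" "s1 * s2 \<noteq> 0" using s1 s2 by auto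
 have w: "V.wt (s1 * s2) (int i - 1) ?al" using X_wt[OF l(1)] V.wt_cong[OF i(3)] by blast
 obtain U where U: "hom (y - int ?r) U" "(V.opE ^^ ?r) ?al = Xs (y - int ?r) U" using E_pow_X[OF l(1), of ?r] by blast
 have "(V.opF ^^ (N - 1)) ((V.opE ^^ ?r) ?al) = \<zero>\<^bsub>V\<^esub>"
  by (rule V.F_pow_E_pow_zero[OF w s(2) l(3)]) (use i in linarith)
 then obtain z where z: "z \<in> carrier V" "V.opF z = (V.opE ^^ ?r) ?al"
  using X_F_exact[OF exact, of "y - int ?r - 1" U d] U homD(3)[OF U(1)] by auto
 have "V.wt (s1 * s2) (int i - 1 - int ?r) ((V.opE ^^ ?r) ?al)" by (rule V.wt_opE_pow[OF w])
 also have "int i - 1 - int ?r = - int i + 1" using i by (simp add: of_nat_diff)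
 finally have "V.wt (s1 * s2) (- int i + 1) (V.opF z)" unfolding z(2) .
 then obtain ga where "V.wt (s1 * s2) (- int i) ga" "V.opF ga = (V.opE ^^ ?r) ?al"
  using V.wt_lift[OF z(1) _ s(1)] z(2) by metis
 then show ?thesis unfolding V.ppair_def using w s i l(3) by auto
qed

end

lemma (in kmod) scaled_subfamily_independent:
 assumes B: "kbasis I b" and T: "finite T" "inj_on h T" "h ` T \<subseteq> I"
  and b': "\<And>t. t \<in> T ==> b' t = sc (k t) (b (h t))" and k: "\<And>t. t \<in> T ==> k t \<noteq> 0"
  and 0: "lc T b' c = \<zero>\<^bsub>M\<^esub>" and t: "t \<in> T"
 shows "c t = 0"
proof -
 note I = kbasisD(1,2)[OF B]
 have bh: "b (h t) \<in> carrier M" if "t \<in> T" for t using that I(2) T(3) by auto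
 define c' where "c' x = (if x \<in> h ` T then let t = the_inv_into T h x in c t * k t else 0)" for x
 have "lc I b c' = lc (h ` T) b c'" by (rule lc_mono_neutral[OF I(1) T(3) I(2)]) (simp add: c'_def)
 also have "... = lc T (\<lambda>t. b (h t)) (\<lambda>t. c' (h t))" by (rule lc_reindex[OF T(2)]) (use bh in auto)
 also have "... = lc T b' c"
  unfolding lc_def using bh by (intro M.finsum_cong') (auto simp: b' c'_def the_inv_into_f_f[OF T(2)])
 finally have "c' (h t) = 0" using kbasisD(4)[OF B, of c' "h t"] 0 t T(3) by auto
 then show ?thesis using t k by (simp add: c'_def the_inv_into_f_f[OF T(2)])
qed

context core
begin

text \<open>The leading term t is the vector at position \<open>l t\<close> on the string of
  \<gamma> (if \<open>g t\<close>) or of \<alpha>. \<open>wt\<close> fits its weight to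
  \<open>i t\<close>, \<open>ker\<close> says that \<open>F^d\<close> kills it, and
  \<open>inj\<close> says that the leading positions of the lifts and of their images under
  \<open>E^(2 i t - 1)\<close> are all distinct. With d pairs the count is 2N d, the dimension of
  the tensor product.\<close>

theorem tensor_pdec:
 assumes p: "M.pfamily {()} (\<lambda>_. i1) (\<lambda>_. s1) al ga" and B: "M.kbasis (M.pidx {()}) (M.pfam al ga)"
  and I: "finite I" "card I = d"
  and i: "\<And>t. t \<in> I ==> 1 \<le> i t \<and> 2 * i t \<le> N \<and> l t + (2 * i t - 1) < N"
  and wt: "\<And>t. t \<in> I ==> int (N div 2) dvd (if g t then - int i1 else int i1 - 1) - int (l t) - int i2 - (int (i t) - 1)"
  and ker: "\<And>t. t \<in> I ==> if g t then l t + 2 * i1 \<le> d \<or> N - 2 * i1 + 1 \<le> l t \<and> l t < d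
   else l t < d \<or> 2 * i1 - 1 \<le> l t \<and> l t < d + (2 * i1 - 1)"
  and inj: "inj_on (\<lambda>(t, u). (g t, l t + (if u then 2 * i t - 1 else 0))) (I \<times> UNIV)"
 shows "V.pdec I i (\<lambda>_. s1 * s2)"
proof -
 let ?B = "M.pfam al ga"
 have pp: "M.ppair i1 s1 (al ()) (ga ())" using p by (simp add: M.pfamily_def)
 note cl = M.ppair_closed[OF pp]
 define b where "b t = ?B ((), g t, l t)" for t
 define y where "y t = (if g t then - int i1 else int i1 - 1) - int (l t)" for t
 have lt: "l t < N" if "t \<in> I" for t using i[OF that] by linarith
 have bw: "M.wt s1 (y t) (b t)" if "t \<in> I" for t
  using M.pfam_wt[OF p, of "()" "g t" "l t"] lt[OF that] by (simp add: y_def b_def M.pidx_def)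
 have bF: "(M.opF ^^ d) (b t) = \<zero>\<^bsub>M\<^esub>" if t: "t \<in> I" for t
 proof (cases "g t")
  case True
  show ?thesis
  proof (cases "l t + 2 * i1 \<le> d")
   case False
   then have gl: "N - 2 * i1 + 1 \<le> l t" "l t < d" using ker[OF t] True by auto
   have "2 * i1 \<le> N" using pp by (simp add: M.ppair_def)
   then show ?thesis using M.opF_pow_gamma_zero'[OF pp, of "l t - (N - 2 * i1 + 1)" d] gl lt[OF t] True
    by (simp add: b_def M.pfam_def)
  qed (use M.opF_pow_gamma_zero[OF pp] True in \<open>simp add: b_def M.pfam_def\<close>)
 next
  case False
  show ?thesis
  proof (cases "l t < d")
   case True
   then show ?thesis using M.opF_pow_alpha_zero[OF pp] False by (simp add: b_def M.pfam_def)
  next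
   case F: False
   then show ?thesis using M.opF_pow_alpha_zero'[OF pp, of "l t" d] ker[OF t] False lt[OF t] by (simp add: b_def M.pfam_def)
  qed
 qed
 define A where "A t = Xs (y t) (lift (y t) (b t))" for t
 have "\<exists>ga. V.ppair (i t) (s1 * s2) (A t) ga" if t: "t \<in> I" for t
  unfolding A_def by (rule lift_pair[OF M.F_exact[OF p B] bw[OF t] bF[OF t]]) (use i[OF t] wt[OF t] in \<open>auto simp: y_def\<close>)
 then have "\<exists>G. \<forall>t\<in>I. V.ppair (i t) (s1 * s2) (A t) (G t)" by (intro bchoice ballI)
 then obtain G where G: "\<And>t. t \<in> I ==> V.ppair (i t) (s1 * s2) (A t) (G t)" by blast
 have pf: "V.pfamily I i (\<lambda>_. s1 * s2) A G" using G I(1) by (simp add: V.pfamily_def)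
 have d0: "0 \<in> {..<d}" using d_pos by simp
 \<comment> \<open>The component at the bottom vector of S maps the vectors of \<open>kfam\<close>
   to nonzero multiples of distinct basis vectors of P. Their independence, the only one that
   \<open>pfam_independent\<close> asks for, follows.\<close>
 obtain \<phi> where \<phi>: "\<forall>T\<in>carrier V. \<phi> T \<in> carrier M"
  "\<forall>T\<in>carrier V. \<forall>T'\<in>carrier V. \<phi> (T \<oplus>\<^bsub>V\<^esub> T') = \<phi> T \<oplus>\<^bsub>M\<^esub> \<phi> T'"
  "\<forall>T\<in>carrier V. \<forall>c. \<phi> (Q.W.sc c T) = M.sc c (\<phi> T)"
  "\<forall>U\<in>{..<d} \<rightarrow> carrier M. \<phi> (finsum V (\<lambda>j. pt (U j) (sv j)) {..<d}) = U 0"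
  using Q.tensor_coeff[OF sv_basis d0] by blast
 interpret VM: qpair n q V M by unfold_locales
 have lin: "VM.linear \<phi>" unfolding VM.linear_def using \<phi>(1-3) by auto
 define h where "h = (\<lambda>(t, u). ((), g t, l t + (if u then 2 * i t - 1 else 0)))"
 have "\<exists>k. k \<noteq> 0 \<and> \<phi> (V.kfam i A z) = M.sc k (?B (h z))" if z: "z \<in> I \<times> UNIV" for z
 proof -
  obtain t u where tu: "z = (t, u)" "t \<in> I" using z by auto
  let ?r = "if u then 2 * i t - 1 else 0"
  have bc: "b t \<in> carrier M" using bw[OF tu(2)] by auto
  note lf = lift[OF bw[OF tu(2)] bF[OF tu(2)]]
  obtain U where U: "hom (y t - int ?r) U" "(V.opE ^^ ?r) (A t) = Xs (y t - int ?r) U"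
   "U 0 = M.sc ((q powi D 0) ^ ?r) ((M.opE ^^ ?r) (b t))" using E_pow_X[OF lf(1), of ?r] unfolding A_def lf(2) by blast
  have "(M.opE ^^ ?r) (b t) = (M.opE ^^ (?r + l t)) (if g t then ga () else al ())"
   unfolding Nat.funpow_add by (simp add: b_def M.pfam_def)
  also have "... = ?B (h z)" by (simp add: h_def tu M.pfam_def add.commute)
  finally have e: "(M.opE ^^ ?r) (b t) = ?B (h z)" .
  have hc: "?B (h z) \<in> carrier M" unfolding e[symmetric] by (rule M.funpow_closed(1)[OF bc])
  have "\<phi> (V.kfam i A z) = M.sc (kc (y t - int ?r) 0) (U 0)"
   unfolding V.kfam_def tu(1) prod.case U(2) X_pt[OF homD(2)[OF U(1)]] by (rule bspec[OF \<phi>(4)]) (use homD(2)[OF U(1)] in auto)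
  also have "... = M.sc (kc (y t - int ?r) 0 * (q powi D 0) ^ ?r) (?B (h z))" unfolding U(3) e by (rule M.sc_sc[OF hc])
  finally have "\<phi> (V.kfam i A z) = M.sc (kc (y t - int ?r) 0 * (q powi D 0) ^ ?r) (?B (h z))" .
  moreover have "kc z 0 * (q powi D 0) ^ r \<noteq> 0" for z r by (simp add: kc_def)
  ultimately show ?thesis by blast
 qed
 then have "\<exists>k. \<forall>z\<in>I \<times> UNIV. k z \<noteq> 0 \<and> \<phi> (V.kfam i A z) = M.sc (k z) (?B (h z))" by (intro bchoice ballI)
 then obtain k where k0: "\<forall>z\<in>I \<times> UNIV. k z \<noteq> 0 \<and> \<phi> (V.kfam i A z) = M.sc (k z) (?B (h z))" ..
 have k: "k z \<noteq> 0" "\<phi> (V.kfam i A z) = M.sc (k z) (?B (h z))" if "z \<in> I \<times> UNIV" for z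
  using bspec[OF k0 that] by simp_all
 have kc: "V.kfam i A \<in> I \<times> UNIV \<rightarrow> carrier V"
  using V.ppair_closed(1)[OF G] by (auto simp: V.kfam_def)
 have fin: "finite (I \<times> (UNIV :: bool set))" using I(1) by simp
 have ind: "c z = 0" if c: "Q.W.lc (I \<times> UNIV) (V.kfam i A) c = \<zero>\<^bsub>V\<^esub>" and z: "z \<in> I \<times> UNIV" for c z
 proof (rule M.scaled_subfamily_independent[OF B fin, of h _ k c])
  show "inj_on h (I \<times> UNIV)"
   by (rule inj_on_imageI2[of snd]) (use inj in \<open>simp add: h_def o_def case_prod_unfold\<close>)
  show "h ` (I \<times> UNIV) \<subseteq> M.pidx {()}"
  proof (intro image_subsetI)
   fix z assume "z \<in> I \<times> (UNIV :: bool set)"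
   then obtain t u where "z = (t, u)" "t \<in> I" by blast
   then show "h z \<in> M.pidx {()}" using i[of t] by (cases u) (simp_all add: h_def M.pidx_def, arith)
  qed
  show "M.lc (I \<times> UNIV) (\<lambda>z. \<phi> (V.kfam i A z)) c = \<zero>\<^bsub>M\<^esub>"
   using VM.linear_lc[OF lin fin kc, of c] c VM.linear_zero[OF lin] by simp
 qed (use k z in auto)
 have "Q.W.kbasis (V.pidx I) (V.pfam A G)"
 proof (rule Q.W.kbasis_card[OF Q.tensor_kbasis[OF B sv_basis]])
  show "finite (V.pidx I)" using I(1) by (rule V.finite_pidx)
  show "card (V.pidx I) = card (M.pidx {()} \<times> {..<d})"
   using I M.card_pidx[of "{()}"] V.card_pidx[OF I(1)] by (simp add: card_cartesian_product)
  show "c x = 0" if "Q.W.lc (V.pidx I) (V.pfam A G) c = \<zero>\<^bsub>V\<^esub>" "x \<in> V.pidx I" for c x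
   by (rule V.pfam_independent[OF pf _ that]) (rule ind)
 qed (rule V.pfam_closed[OF pf])
 then show ?thesis unfolding V.pdec_def using pf by blast
qed

end

section \<open>Direct sums of decomposed modules\<close>

lemma (in kmod) lc_restrict:
 assumes "finite I" "inj_on h J" "h ` J \<subseteq> I" "b' \<in> J \<rightarrow> carrier M"
  and "\<And>j. j \<in> J ==> b (h j) = b' j" "\<And>i. i \<in> I - h ` J ==> b i = \<zero>\<^bsub>M\<^esub>"
 shows "lc I b c = lc J b' (\<lambda>j. c (h j))"
proof -
 have bc: "b x \<in> carrier M" if "x \<in> I" for x using assms that by (cases "x \<in> h ` J") auto
 have "lc I b c = lc (h ` J) b c" unfolding lc_def using assms bc by (intro M.add.finprod_mono_neutral_cong_right) auto
 also have "... = lc J (\<lambda>j. b (h j)) (\<lambda>j. c (h j))" by (rule lc_reindex[OF assms(2)]) (use assms in auto)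
 also have "... = lc J b' (\<lambda>j. c (h j))" by (rule lc_cong2) (use assms in auto)
 finally show ?thesis .
qed

lemma dsum_simps:
 "carrier (M \<boxplus> M') = carrier M \<times> carrier M'" "\<zero>\<^bsub>M \<boxplus> M'\<^esub> = (\<zero>\<^bsub>M\<^esub>, \<zero>\<^bsub>M'\<^esub>)"
 "x \<oplus>\<^bsub>M \<boxplus> M'\<^esub> y = (fst x \<oplus>\<^bsub>M\<^esub> fst y, snd x \<oplus>\<^bsub>M'\<^esub> snd y)" "a \<odot>\<^bsub>M \<boxplus> M'\<^esub> x = (a \<odot>\<^bsub>M\<^esub> fst x, a \<odot>\<^bsub>M'\<^esub> snd x)"
 by (simp_all add: dsum_def case_prod_beta)

lemma dsum_family_simps:
 "carrier (dsum_family I P) = (\<Pi>\<^sub>E i\<in>I. carrier (P i))" "\<zero>\<^bsub>dsum_family I P\<^esub> = (\<lambda>i\<in>I. \<zero>\<^bsub>P i\<^esub>)"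
 "f \<oplus>\<^bsub>dsum_family I P\<^esub> g = (\<lambda>i\<in>I. f i \<oplus>\<^bsub>P i\<^esub> g i)" "a \<odot>\<^bsub>dsum_family I P\<^esub> f = (\<lambda>i\<in>I. a \<odot>\<^bsub>P i\<^esub> f i)"
 by (simp_all add: dsum_family_def)

context qpair
begin

lemma dsum_qmod: "qmod n q (M \<boxplus> V)"
proof (intro qmod.intro qparam_axioms kmod.intro kmod_axioms.intro qu.kalg_axioms abelian_groupI)
 fix x assume "x \<in> carrier (M \<boxplus> V)"
 then show "\<exists>y\<in>carrier (M \<boxplus> V). y \<oplus>\<^bsub>M \<boxplus> V\<^esub> x = \<zero>\<^bsub>M \<boxplus> V\<^esub>"
  by (intro bexI[of _ "(\<ominus>\<^bsub>M\<^esub> fst x, \<ominus>\<^bsub>V\<^esub> snd x)"]) (auto simp: dsum_simps M.M.l_neg V.M.l_neg)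
qed (auto simp: dsum_simps M.M.a_ac V.M.a_ac M.act_l_distr V.act_l_distr M.act_r_distr V.act_r_distr M.act_assoc V.act_assoc)

lemma dsum_pdec:
 assumes "M.pdec T i s" "V.pdec T' i' s'"
 shows "qmod.pdec n q (M \<boxplus> V) (T <+> T') (case_sum i i') (case_sum s s')"
proof -
 interpret S: qmod n q "M \<boxplus> V" by (rule dsum_qmod)
 interpret MS: qpair n q M "M \<boxplus> V" by unfold_locales
 interpret VS: qpair n q V "M \<boxplus> V" by unfold_locales
 interpret SM: qpair n q "M \<boxplus> V" M by unfold_locales
 interpret SV: qpair n q "M \<boxplus> V" V by unfold_locales
 obtain al ga where p: "M.pfamily T i s al ga" and B: "M.kbasis (M.pidx T) (M.pfam al ga)"
  using assms(1) unfolding M.pdec_def by blast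
 obtain al' ga' where p': "V.pfamily T' i' s' al' ga'" and B': "V.kbasis (V.pidx T') (V.pfam al' ga')"
  using assms(2) unfolding V.pdec_def by blast
 have cl: "t \<in> T ==> al t \<in> carrier M \<and> ga t \<in> carrier M" "t' \<in> T' ==> al' t' \<in> carrier V \<and> ga' t' \<in> carrier V" for t t'
  using p p' M.ppair_closed V.ppair_closed unfolding M.pfamily_def V.pfamily_def by blast+
 have hom1: "MS.qhom (\<lambda>x. (x, \<zero>\<^bsub>V\<^esub>))" by (rule MS.qhomI) (auto simp: dsum_simps)
 have hom2: "VS.qhom (\<lambda>x. (\<zero>\<^bsub>M\<^esub>, x))" by (rule VS.qhomI) (auto simp: dsum_simps)
 have hom3: "SM.qhom fst" by (rule SM.qhomI) (auto simp: dsum_simps)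
 have hom4: "SV.qhom snd" by (rule SV.qhomI) (auto simp: dsum_simps)
 define A where "A = case_sum (\<lambda>t. (al t, \<zero>\<^bsub>V\<^esub>)) (\<lambda>t. (\<zero>\<^bsub>M\<^esub>, al' t))"
 define G where "G = case_sum (\<lambda>t. (ga t, \<zero>\<^bsub>V\<^esub>)) (\<lambda>t. (\<zero>\<^bsub>M\<^esub>, ga' t))"
 let ?I = "S.pidx (T <+> T')"
 have pf: "S.pfamily (T <+> T') (case_sum i i') (case_sum s s') A G"
  using p p' MS.qhom_ppair[OF hom1] VS.qhom_ppair[OF hom2]
  unfolding S.pfamily_def M.pfamily_def V.pfamily_def A_def G_def by auto
 note b = S.pfam_closed[OF pf]
 have fin: "finite ?I" using pf by (simp add: S.pfamily_def)
 have inl: "S.pfam A G (Inl t, g, l) = (M.pfam al ga (t, g, l), \<zero>\<^bsub>V\<^esub>)" if "t \<in> T" for t g l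
  using MS.qhom_pow[OF hom1, of "al t" l] MS.qhom_pow[OF hom1, of "ga t" l] cl(1)[OF that]
  by (cases g) (simp_all add: S.pfam_def M.pfam_def A_def G_def)
 have inr: "S.pfam A G (Inr t, g, l) = (\<zero>\<^bsub>M\<^esub>, V.pfam al' ga' (t, g, l))" if "t \<in> T'" for t g l
  using VS.qhom_pow[OF hom2, of "al' t" l] VS.qhom_pow[OF hom2, of "ga' t" l] cl(2)[OF that]
  by (cases g) (simp_all add: S.pfam_def V.pfam_def A_def G_def)
 have lc: "S.lc ?I (S.pfam A G) c = (M.lc (M.pidx T) (M.pfam al ga) (\<lambda>(t, g, l). c (Inl t, g, l)),
  V.lc (V.pidx T') (V.pfam al' ga') (\<lambda>(t, g, l). c (Inr t, g, l)))" for c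
 proof (rule prod_eqI; unfold fst_conv snd_conv)
  let ?h = "\<lambda>(t, g, l). (Inl t, g, l)" and ?h' = "\<lambda>(t, g, l). (Inr t, g, l)"
  have "fst (S.lc ?I (S.pfam A G) c) = M.lc ?I (\<lambda>x. fst (S.pfam A G x)) c"
   by (rule SM.linear_lc[OF SM.qhom_linear[OF hom3] fin b])
  also have "... = M.lc (M.pidx T) (M.pfam al ga) (\<lambda>j. c (?h j))"
  proof (rule M.lc_restrict[OF fin _ _ M.kbasisD(2)[OF B]])
   fix x assume "x \<in> ?I - ?h ` M.pidx T"
   then show "fst (S.pfam A G x) = \<zero>\<^bsub>M\<^esub>" by (auto simp: M.pidx_def image_iff inr)
  qed (auto simp: M.pidx_def inj_on_def inl)
  finally show "fst (S.lc ?I (S.pfam A G) c) = M.lc (M.pidx T) (M.pfam al ga) (\<lambda>(t, g, l). c (Inl t, g, l))"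
   by (simp add: case_prod_unfold)
  have "snd (S.lc ?I (S.pfam A G) c) = V.lc ?I (\<lambda>x. snd (S.pfam A G x)) c"
   by (rule SV.linear_lc[OF SV.qhom_linear[OF hom4] fin b])
  also have "... = V.lc (V.pidx T') (V.pfam al' ga') (\<lambda>j. c (?h' j))"
  proof (rule V.lc_restrict[OF fin _ _ V.kbasisD(2)[OF B']])
   fix x assume "x \<in> ?I - ?h' ` V.pidx T'"
   then show "snd (S.pfam A G x) = \<zero>\<^bsub>V\<^esub>" by (auto simp: V.pidx_def image_iff inl)
  qed (auto simp: V.pidx_def inj_on_def inr)
  finally show "snd (S.lc ?I (S.pfam A G) c) = V.lc (V.pidx T') (V.pfam al' ga') (\<lambda>(t, g, l). c (Inr t, g, l))"
   by (simp add: case_prod_unfold)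
 qed
 have "S.kbasis ?I (S.pfam A G)" unfolding S.kbasis_def
 proof (intro conjI fin b ballI allI impI)
  fix x assume "x \<in> carrier (M \<boxplus> V)"
  then have "fst x \<in> carrier M" "snd x \<in> carrier V" by (auto simp: dsum_simps)
  then obtain c c' where c: "fst x = M.lc (M.pidx T) (M.pfam al ga) c" "snd x = V.lc (V.pidx T') (V.pfam al' ga') c'"
   using M.kbasisD(3)[OF B] V.kbasisD(3)[OF B'] by meson
  then show "\<exists>c. x = S.lc ?I (S.pfam A G) c" unfolding lc
   by (intro exI[of _ "\<lambda>(t, g, l). case t of Inl t => c (t, g, l) | Inr t => c' (t, g, l)"]) (simp add: prod_eq_iff case_prod_unfold)
 next
  fix c x assume 0: "S.lc ?I (S.pfam A G) c = \<zero>\<^bsub>M \<boxplus> V\<^esub>" and x: "x \<in> ?I"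
  obtain t g l where xx: "x = (t, g, l)" by (cases x)
  show "c x = 0"
  proof (cases t)
   case (Inl a)
   then show ?thesis using M.kbasisD(4)[OF B, of "\<lambda>(t, g, l). c (Inl t, g, l)" "(a, g, l)"] 0[unfolded lc] x by (auto simp: xx dsum_simps M.pidx_def)
  next
   case (Inr a)
   then show ?thesis using V.kbasisD(4)[OF B', of "\<lambda>(t, g, l). c (Inr t, g, l)" "(a, g, l)"] 0[unfolded lc] x by (auto simp: xx dsum_simps V.pidx_def)
  qed
 qed
 then show ?thesis unfolding S.pdec_def using pf by blast
qed

end

context qparam
begin

lemma dsum_family_qmod:
 assumes P: "\<And>l. l \<in> I ==> qmod n q (P l)"
 shows "qmod n q (dsum_family I P)"
proof -
 have k: "kmod A \<eta> (P l)" if "l \<in> I" for l using P[OF that] by (simp add: qmod_def)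
 then have g: "abelian_group (P l)" and m: "abelian_monoid (P l)" if "l \<in> I" for l
  using that abelian_group.axioms(1) by (auto simp: kmod_def)
 show ?thesis
 proof (intro qmod.intro qparam_axioms kmod.intro kmod_axioms.intro qu.kalg_axioms abelian_groupI)
  fix x assume x: "x \<in> carrier (dsum_family I P)"
  then show "\<exists>y\<in>carrier (dsum_family I P). y \<oplus>\<^bsub>dsum_family I P\<^esub> x = \<zero>\<^bsub>dsum_family I P\<^esub>"
   by (intro bexI[of _ "\<lambda>l\<in>I. \<ominus>\<^bsub>P l\<^esub> x l"])
    (auto simp: dsum_family_simps PiE_mem[OF x[unfolded dsum_family_simps]] abelian_group.l_neg[OF g] abelian_group.a_inv_closed[OF g])
  show "\<zero>\<^bsub>dsum_family I P\<^esub> \<oplus>\<^bsub>dsum_family I P\<^esub> x = x" "\<one>\<^bsub>A\<^esub> \<odot>\<^bsub>dsum_family I P\<^esub> x = x"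
  proof -
   have xc: "x l \<in> carrier (P l)" if "l \<in> I" for l using x that by (auto simp: dsum_family_simps)
   have xe: "x l = undefined" if "l \<notin> I" for l using x that by (auto simp: dsum_family_simps)
   show "\<zero>\<^bsub>dsum_family I P\<^esub> \<oplus>\<^bsub>dsum_family I P\<^esub> x = x" "\<one>\<^bsub>A\<^esub> \<odot>\<^bsub>dsum_family I P\<^esub> x = x"
    by (auto simp: dsum_family_simps restrict_def fun_eq_iff xe abelian_monoid.l_zero[OF m xc] kmod.act_one[OF k xc])
  qed
  fix y assume y: "y \<in> carrier (dsum_family I P)"
  show "x \<oplus>\<^bsub>dsum_family I P\<^esub> y = y \<oplus>\<^bsub>dsum_family I P\<^esub> x"
   using x y by (auto simp: dsum_family_simps PiE_mem intro!: restrict_ext abelian_monoid.a_comm[OF m])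
  fix z assume z: "z \<in> carrier (dsum_family I P)"
  show "x \<oplus>\<^bsub>dsum_family I P\<^esub> y \<oplus>\<^bsub>dsum_family I P\<^esub> z = x \<oplus>\<^bsub>dsum_family I P\<^esub> (y \<oplus>\<^bsub>dsum_family I P\<^esub> z)"
   using x y z by (auto simp: dsum_family_simps PiE_mem intro!: restrict_ext abelian_monoid.a_assoc[OF m])
 qed (auto simp: dsum_family_simps PiE_mem intro!: restrict_ext abelian_monoid.a_closed[OF m] abelian_monoid.zero_closed[OF m]
   kmod.act_closed[OF k] kmod.act_l_distr[OF k] kmod.act_r_distr[OF k] kmod.act_assoc[OF k])
qed

lemma dsum_family_pdec:
 fixes T :: "'i => 't set" and P :: "'i => ('k free_qu set, 'm) module"
 assumes I: "finite I" and P: "\<And>l. l \<in> I ==> qmod n q (P l)" and dec: "\<And>l. l \<in> I ==> qmod.pdec n q (P l) (T l) (i l) (s l)"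
 shows "qmod.pdec n q (dsum_family I P) (Sigma I T) (\<lambda>(l, t). i l t) (\<lambda>(l, t). s l t)"
proof -
 interpret D: qmod n q "dsum_family I P" by (rule dsum_family_qmod[OF P])
 have "\<exists>x. qmod.pfamily n q (P l) (T l) (i l) (s l) (fst x) (snd x) \<and>
   kmod.kbasis \<eta> (P l) (D.pidx (T l)) (qmod.pfam n q (P l) (fst x) (snd x))" if "l \<in> I" for l
  using dec[OF that] unfolding qmod.pdec_def[OF P[OF that]] by auto
 then have "\<exists>x. \<forall>l\<in>I. qmod.pfamily n q (P l) (T l) (i l) (s l) (fst (x l)) (snd (x l)) \<and>
   kmod.kbasis \<eta> (P l) (D.pidx (T l)) (qmod.pfam n q (P l) (fst (x l)) (snd (x l)))" by (intro bchoice ballI)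
 then obtain x where x: "\<forall>l\<in>I. qmod.pfamily n q (P l) (T l) (i l) (s l) (fst (x l)) (snd (x l)) \<and>
   kmod.kbasis \<eta> (P l) (D.pidx (T l)) (qmod.pfam n q (P l) (fst (x l)) (snd (x l)))" ..
 let ?al = "\<lambda>l. fst (x l)" and ?ga = "\<lambda>l. snd (x l)"
 define inj where "inj l y = (\<lambda>l'\<in>I. if l' = l then y else \<zero>\<^bsub>P l'\<^esub>)" for l y
 define Al where "Al = (\<lambda>(l, t). inj l (?al l t))"
 define Ga where "Ga = (\<lambda>(l, t). inj l (?ga l t))"
 let ?S = "Sigma I T" and ?D = "dsum_family I P"
 let ?I = "D.pidx ?S" and ?b = "D.pfam Al Ga"
 have main: "(t \<in> T l \<longrightarrow> D.ppair (i l t) (s l t) (Al (l, t)) (Ga (l, t))) \<and>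
   (t \<in> T l \<longrightarrow> ?b ((l, t), g, m) = inj l (qmod.pfam n q (P l) (?al l) (?ga l) (t, g, m)))" if l: "l \<in> I" for l t g m
 proof -
  interpret P: qmod n q "P l" by (rule P[OF l])
  interpret PD: qpair n q "P l" ?D by unfold_locales
  have z: "\<zero>\<^bsub>P l'\<^esub> \<in> carrier (P l')" "\<zero>\<^bsub>P l'\<^esub> \<oplus>\<^bsub>P l'\<^esub> \<zero>\<^bsub>P l'\<^esub> = \<zero>\<^bsub>P l'\<^esub>" "a \<in> carrier A ==> a \<odot>\<^bsub>P l'\<^esub> \<zero>\<^bsub>P l'\<^esub> = \<zero>\<^bsub>P l'\<^esub>"
   if "l' \<in> I" for l' a
  proof -
   interpret P': qmod n q "P l'" by (rule P[OF that])
   show "\<zero>\<^bsub>P l'\<^esub> \<in> carrier (P l')" "\<zero>\<^bsub>P l'\<^esub> \<oplus>\<^bsub>P l'\<^esub> \<zero>\<^bsub>P l'\<^esub> = \<zero>\<^bsub>P l'\<^esub>"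
    "a \<in> carrier A ==> a \<odot>\<^bsub>P l'\<^esub> \<zero>\<^bsub>P l'\<^esub> = \<zero>\<^bsub>P l'\<^esub>" by simp_all
  qed
  have hom: "PD.qhom (inj l)" by (rule PD.qhomI) (auto simp: inj_def dsum_family_simps z intro!: restrict_ext)
  have pf: "P.pfamily (T l) (i l) (s l) (?al l) (?ga l)" using x l by blast
  then have pp: "P.ppair (i l t) (s l t) (?al l t) (?ga l t)" if "t \<in> T l" using that by (simp add: P.pfamily_def)
  show ?thesis
  proof (intro conjI impI)
   assume t: "t \<in> T l"
   show "D.ppair (i l t) (s l t) (Al (l, t)) (Ga (l, t))"
    using PD.qhom_ppair[OF hom pp[OF t]] by (simp add: Al_def Ga_def)
   show "?b ((l, t), g, m) = inj l (P.pfam (?al l) (?ga l) (t, g, m))"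
    using PD.qhom_pow[OF hom, of "?al l t" m] PD.qhom_pow[OF hom, of "?ga l t" m] P.ppair_closed[OF pp[OF t]]
    by (cases g) (simp_all add: D.pfam_def P.pfam_def Al_def Ga_def)
  qed
 qed
 have finT: "finite (T l)" if "l \<in> I" for l using x that P[OF that] by (auto simp: qmod.pfamily_def)
 have pf: "D.pfamily ?S (\<lambda>(l, t). i l t) (\<lambda>(l, t). s l t) Al Ga"
  unfolding D.pfamily_def using I finT main by auto
 note b = D.pfam_closed[OF pf]
 have fin: "finite ?I" using pf by (simp add: D.pfamily_def)
 have lc: "D.lc ?I ?b c l = kmod.lc \<eta> (P l) (D.pidx (T l)) (qmod.pfam n q (P l) (?al l) (?ga l)) (\<lambda>(t, g, m). c ((l, t), g, m))"
  if l: "l \<in> I" for c l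
 proof -
  interpret P: qmod n q "P l" by (rule P[OF l])
  interpret DP: qpair n q ?D "P l" by unfold_locales
  have hom: "DP.qhom (\<lambda>y. y l)" by (rule DP.qhomI) (use l in \<open>auto simp: dsum_family_simps\<close>)
  have B: "P.kbasis (D.pidx (T l)) (P.pfam (?al l) (?ga l))" using x l by blast
  let ?h = "\<lambda>(t, g, m). ((l, t), g, m)"
  have "D.lc ?I ?b c l = P.lc ?I (\<lambda>y. ?b y l) c" by (rule DP.linear_lc[OF DP.qhom_linear[OF hom] fin b])
  also have "... = P.lc (D.pidx (T l)) (P.pfam (?al l) (?ga l)) (\<lambda>j. c (?h j))"
  proof (rule P.lc_restrict[OF fin _ _ P.kbasisD(2)[OF B]])
   show "inj_on ?h (D.pidx (T l))" "?h ` D.pidx (T l) \<subseteq> ?I" using l by (auto simp: inj_on_def D.pidx_def)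
   show "?b (?h j) l = P.pfam (?al l) (?ga l) j" if "j \<in> D.pidx (T l)" for j
    using that main[OF l] l by (auto simp: D.pidx_def inj_def)
   show "?b y l = \<zero>\<^bsub>P l\<^esub>" if y: "y \<in> ?I - ?h ` D.pidx (T l)" for y
   proof -
    obtain l' t g m where yy: "y = ((l', t), g, m)" "l' \<in> I" "t \<in> T l'" "m < N" using y by (auto simp: D.pidx_def)
    have "l' \<noteq> l" using y yy by (auto simp: D.pidx_def image_iff)
    then show ?thesis using main[OF yy(2), of t g m] yy l by (simp add: inj_def)
   qed
  qed
  finally show ?thesis by (simp add: case_prod_unfold)
 qed
 have "D.kbasis ?I ?b" unfolding D.kbasis_def
 proof (intro conjI fin b ballI allI impI)
  fix y assume y: "y \<in> carrier ?D"
  have "\<exists>c. y l = kmod.lc \<eta> (P l) (D.pidx (T l)) (qmod.pfam n q (P l) (?al l) (?ga l)) c" if l: "l \<in> I" for l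
  proof -
   interpret P: qmod n q "P l" by (rule P[OF l])
   have "y l \<in> carrier (P l)" using y l by (auto simp: dsum_family_simps)
   then show ?thesis using P.kbasisD(3) x l by blast
  qed
  then have "\<exists>c. \<forall>l\<in>I. y l = kmod.lc \<eta> (P l) (D.pidx (T l)) (qmod.pfam n q (P l) (?al l) (?ga l)) (c l)"
   by (intro bchoice ballI)
  then obtain c where c: "\<forall>l\<in>I. y l = kmod.lc \<eta> (P l) (D.pidx (T l)) (qmod.pfam n q (P l) (?al l) (?ga l)) (c l)" ..
  let ?c = "\<lambda>((l, t), g, m). c l (t, g, m)"
  have "D.lc ?I ?b ?c \<in> carrier ?D" by (rule D.lc_closed[OF b])
  then have "y = D.lc ?I ?b ?c" using y unfolding dsum_family_simps by (intro PiE_ext) (auto simp: lc c case_prod_unfold)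
  then show "\<exists>c. y = D.lc ?I ?b c" by blast
 next
  fix c y assume 0: "D.lc ?I ?b c = \<zero>\<^bsub>?D\<^esub>" and y: "y \<in> ?I"
  obtain l t g m where yy: "y = ((l, t), g, m)" "l \<in> I" "(t, g, m) \<in> D.pidx (T l)" using y by (auto simp: D.pidx_def)
  interpret P: qmod n q "P l" by (rule P[OF yy(2)])
  have "P.lc (D.pidx (T l)) (P.pfam (?al l) (?ga l)) (\<lambda>(t, g, m). c ((l, t), g, m)) = \<zero>\<^bsub>P l\<^esub>"
   using lc[OF yy(2), of c] 0 yy(2) by (simp add: dsum_family_simps)
  from P.kbasisD(4)[OF _ this yy(3)] show "c y = 0" using x yy by auto
 qed
 then show ?thesis unfolding D.pdec_def using pf by blast
qed

end

section \<open>The choice of leading terms in the four cases\<close>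

context qparam
begin

text \<open>A single sign suffices: all summands of a tensor product of P with S share the product
  of the two signs.\<close>

definition decomposes :: "'k => ('k free_qu set, 'm) module => 't set => ('t => nat) => bool" where
 "decomposes \<sigma> R I i \<longleftrightarrow> qmod n q R \<and> qmod.pdec n q R I i (\<lambda>_. \<sigma>)"

lemma decomposes_dsum:
 assumes "decomposes \<sigma> R I i" "decomposes \<sigma> R' I' i'"
 shows "decomposes \<sigma> (R \<boxplus> R') (I <+> I') (case_sum i i')"
proof -
 interpret M: qmod n q R using assms by (simp add: decomposes_def)
 interpret V: qmod n q R' using assms by (simp add: decomposes_def)
 interpret qpair n q R R' by unfold_locales
 have "case_sum (\<lambda>_. \<sigma>) (\<lambda>_. \<sigma>) = (\<lambda>_. \<sigma>)" by (auto simp: fun_eq_iff split: sum.split)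
 then show ?thesis
  using dsum_qmod dsum_pdec[of I i "\<lambda>_. \<sigma>" I' i' "\<lambda>_. \<sigma>"] assms by (simp add: decomposes_def)
qed

lemma decomposes_dsum_family:
 assumes "finite J" "\<And>l. l \<in> J ==> decomposes \<sigma> (R l) (I l) (i l)"
 shows "decomposes \<sigma> (dsum_family J R) (Sigma J I) (\<lambda>(l, t). i l t)"
 using dsum_family_qmod[of J R] dsum_family_pdec[of J R I i "\<lambda>_ _. \<sigma>"] assms by (simp add: decomposes_def case_prod_unfold)

text \<open>Each leading term occupies a lower end \<open>l t\<close> and an upper end
  \<open>l t + 2 i t - 1\<close> on its string. The conditions compare the ends pairwise, with the
  subtraction removed for the sake of linear arithmetic.\<close>

lemma inj_positions:
 fixes l i :: "'t => nat"
 assumes "\<And>t. t \<in> I ==> 1 \<le> i t"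
  and "\<And>t t'. [|t \<in> I; t' \<in> I; g t = g t'|] ==> l t = l t' \<or> l t + 2 * i t = l t' + 2 * i t' ==> t = t'"
  and "\<And>t t'. [|t \<in> I; t' \<in> I; g t = g t'|] ==> l t + 2 * i t \<noteq> l t' + 1"
 shows "inj_on (\<lambda>(t, u). (g t, l t + (if u then 2 * i t - 1 else 0))) (I \<times> UNIV)"
proof (rule inj_onI, clarify, rule conjI)
 fix t t' :: 't and u u' :: bool
 assume t: "t \<in> I" "t' \<in> I" "g t = g t'"
  and eq: "l t + (if u then 2 * i t - 1 else 0) = l t' + (if u' then 2 * i t' - 1 else 0)"
 have i: "1 \<le> i t" "1 \<le> i t'" using assms(1) t by blast+
 show uu: "u = u'" using assms(3)[OF t] assms(3)[OF t(2,1) t(3)[symmetric]] eq i by (cases u; cases u') auto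
 have "l t = l t' \<or> l t + 2 * i t = l t' + 2 * i t'" using eq i unfolding uu by (cases u') (simp_all, arith)
 then show "t = t'" by (rule assms(2)[OF t])
qed

context
 fixes i1 i2 j1 j2 :: nat
 assumes ij: "1 \<le> i1" "2 * i1 \<le> N" "1 \<le> i2" "2 * i2 \<le> N" "j1 \<le> 1" "j2 \<le> 1"
begin

private abbreviation "\<sigma> \<equiv> sgn_ij i1 j1 * sgn_ij i2 j2"

text \<open>The second index of a summand enters only through the sign \<open>(-1)^(i + r)\<close>,
  which must equal \<sigma>. This is the origin of the residues of j1 + j2 + l and j1 + j2 + l - 1
  in the statement.\<close>

lemma decomposes_P:
 assumes "k = 2 * i" "1 \<le> i" "2 * i \<le> N" "even (int i + r - (int i1 + int j1 + int i2 + int j2))"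
 shows "decomposes \<sigma> (qu_P n q k (residue2 r)) {()} (\<lambda>_. i)"
proof -
 have r: "residue2 r \<le> 1" "even (int (residue2 r) - r)" by (auto simp: residue2_def)
 have "even (int (i + residue2 r) - int (i1 + j1 + i2 + j2))" using assms(4) r(2) by simp
 then have "even (i + residue2 r) = even (i1 + j1 + i2 + j2)" by simp
 then have "sgn_ij i (residue2 r) = \<sigma>" by (auto simp: sgn_ij_def minus_one_power_iff)
 then show ?thesis using qu_P_pdec[OF assms(2,3) r(1)] assms(1) by (simp add: decomposes_def)
qed

text \<open>From here on a case of the theorem is a table of parameters \<open>i\<close>, strings
  \<open>g\<close> and positions \<open>l\<close>, subject to arithmetic conditions.\<close>

lemma tensor_iso:
 fixes R :: "('k free_qu set, 'r) module"
 assumes R: "decomposes \<sigma> R I i" and I: "finite I" "card I = N - 2 * i2 + 1"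
  and i: "\<And>t. t \<in> I ==> 1 \<le> i t \<and> 2 * i t \<le> N \<and> l t + (2 * i t - 1) < N"
  and wt: "\<And>t. t \<in> I ==> int (N div 2) dvd (if g t then - int i1 else int i1 - 1) - int (l t) - int i2 - (int (i t) - 1)"
  and ker: "\<And>t. t \<in> I ==> if g t then l t + 2 * i1 \<le> N - 2 * i2 + 1 \<or> N - 2 * i1 + 1 \<le> l t \<and> l t < N - 2 * i2 + 1
   else l t < N - 2 * i2 + 1 \<or> 2 * i1 - 1 \<le> l t \<and> l t < N - 2 * i2 + 1 + (2 * i1 - 1)"
  and inj: "inj_on (\<lambda>(t, u). (g t, l t + (if u then 2 * i t - 1 else 0))) (I \<times> UNIV)"
 shows "module_isomorphic A (qu_tensor n q (qu_P n q (2 * i1) j1) (qu_S n q (2 * i2) j2)) R"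
proof -
 note P = qu_P_pdec[OF ij(1,2,5)] and S = qu_S_sdec[OF ij(3,4,6)]
 interpret M: qmod n q "qu_P n q (2 * i1) j1" by (rule P)
 interpret L: qmod n q "qu_S n q (2 * i2) j2" by (rule S)
 interpret D: qmod n q R using R by (simp add: decomposes_def)
 obtain w where w: "L.wt (sgn_ij i2 j2) (- int i2) w" "L.opF w = \<zero>\<^bsub>qu_S n q (2 * i2) j2\<^esub>"
  "(L.opE ^^ (N - 2 * i2 + 1)) w = \<zero>\<^bsub>qu_S n q (2 * i2) j2\<^esub>" "L.kbasis {..<N - 2 * i2 + 1} (\<lambda>m. (L.opE ^^ m) w)"
  using S(2) unfolding L.sdec_def by blast
 interpret core n q "qu_P n q (2 * i1) j1" "qu_S n q (2 * i2) j2" "sgn_ij i1 j1" "sgn_ij i2 j2" i2 w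
  by (intro core.intro qtens.intro tens.intro core_axioms.intro qparam_axioms P(1) S(1) M.kmod_axioms L.kmod_axioms
    sgn_ij_cases ij w)
 obtain al ga where "M.pfamily {()} (\<lambda>_. i1) (\<lambda>_. sgn_ij i1 j1) al ga" "M.kbasis (M.pidx {()}) (M.pfam al ga)"
  using P(2) unfolding M.pdec_def by blast
 from tensor_pdec[OF this I(1) I(2)[folded d_def] i wt ker[folded d_def] inj]
 have V: "V.pdec I i (\<lambda>_. \<sigma>)" by blast
 interpret qpair n q V R by unfold_locales
 show ?thesis unfolding qu_tensor_eq using pdec_iso[OF V] R by (simp add: decomposes_def)
qed

text \<open>Evenness of N/2 matters: parameters are found modulo N/2, and adding N/2 must not change
  the sign \<open>(-1)^i\<close>.\<close>

lemma N_eq: obtains h where "N = 2 * h" "even h" "N div 2 = h"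
proof -
 obtain m where "n = 4 * m" using four_dvd by blast
 then have "N = 2 * (8 * m * m)" by (simp add: power2_eq_square)
 then show thesis using that[of "8 * m * m"] by simp
qed

lemma card_indices: "card (Sigma {0..a} (\<lambda>_. {()})) = Suc a" "card (Sigma {0..a} (\<lambda>_. {()} <+> {()})) = 2 * Suc a"
 by (simp_all add: card_cartesian_product card_Plus)

text \<open>All leading terms lie on the string of \<alpha>, at the positions l < d. The weight i1 -
  1 - l - i2 forces the parameter i1 - i2 - l modulo N/2, and as i1 \<le> i2 the summand N/2 is
  added. The intervals from l to l + 2i - 1 are nested around a common centre, so no end occurs
  twice.\<close>

lemma case_a:
 assumes c: "2 * i1 - 1 \<ge> N - 2 * i2 + 1" "i1 \<le> i2"
 shows "module_isomorphic A (qu_tensor n q (qu_P n q (2 * i1) j1) (qu_S n q (2 * i2) j2))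
    (DSUM l\<in>{0..N - 2 * i2}. qu_P n q (N + 2 * i1 - 2 * i2 - 2 * l) (residue2 (int j1 + int j2 + int l)))"
proof -
 obtain h where h: "N = 2 * h" "even h" "N div 2 = h" by (rule N_eq)
 let ?i = "\<lambda>l. h + i1 - i2 - l"
 have dec: "decomposes \<sigma> (DSUM l\<in>{0..N - 2 * i2}. qu_P n q (N + 2 * i1 - 2 * i2 - 2 * l) (residue2 (int j1 + int j2 + int l)))
  (Sigma {0..N - 2 * i2} (\<lambda>_. {()})) (\<lambda>(l, t). ?i l)"
  by (intro decomposes_dsum_family decomposes_P) (use ij c h(2) in \<open>auto simp: h(1)\<close>)
 show ?thesis by (rule tensor_iso[OF dec, where g = "\<lambda>_. False" and l = fst])
   (use ij c in \<open>auto simp: h card_indices inj_on_def split: if_splits\<close>)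
qed

text \<open>With a = i1 - i2 > 0, the positions l < a of the string of \<alpha> admit the parameter
  a - l without adding N/2; their intervals end at 2a - 1 - l. Next come intervals from 2a + l to N
  - 1 - l. The second copy of the first group lies on the string of \<gamma>, from its break N - 2
  i1 + 1 up to d - 1, a range that is nonempty because i1 > i2.\<close>

lemma case_b:
 assumes c: "2 * i1 - 1 \<ge> N - 2 * i2 + 1" "i1 > i2"
 shows "module_isomorphic A (qu_tensor n q (qu_P n q (2 * i1) j1) (qu_S n q (2 * i2) j2))
    ((DSUM l\<in>{0..i1 - i2 - 1}. (qu_P n q (2 * i1 - 2 * i2 - 2 * l) (residue2 (int j1 + int j2 + int l)) \<boxplus> qu_P n q (2 * i1 - 2 * i2 - 2 * l) (residue2 (int j1 + int j2 + int l)))) \<boxplus>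
     (DSUM l\<in>{0..N - 2 * i1}. qu_P n q (N - 2 * i1 + 2 * i2 - 2 * l) (residue2 (int j1 + int j2 + int l))))"
  (is "module_isomorphic A _ ?R")
proof -
 obtain h where h: "N = 2 * h" "even h" "N div 2 = h" by (rule N_eq)
 \<comment> \<open>Differences become independent variables, so that truncated subtraction
   disappears.\<close>
 obtain a b where ab: "i1 = i2 + a" "h = i1 + b" "b + 1 \<le> i2" "2 * h = N" "0 < a"
  using ij c h(1) by (intro that[of "i1 - i2" "h - i1"]) auto
 let ?I = "Sigma {0..i1 - i2 - 1} (\<lambda>_. {()} <+> {()}) <+> Sigma {0..N - 2 * i1} (\<lambda>_. {()})"
 define i :: "nat \<times> (unit + unit) + nat \<times> unit => nat" where "i = case_sum (\<lambda>(l, t). case_sum (\<lambda>_. i1 - i2 - l) (\<lambda>_. i1 - i2 - l) t) (\<lambda>(l, t). h - i1 + i2 - l)"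
 define g :: "nat \<times> (unit + unit) + nat \<times> unit => bool" where "g = case_sum (\<lambda>(l, t). case_sum (\<lambda>_. False) (\<lambda>_. True) t) (\<lambda>_. False)"
 define l :: "nat \<times> (unit + unit) + nat \<times> unit => nat" where "l = case_sum (\<lambda>(l, t). case_sum (\<lambda>_. l) (\<lambda>_. N - 2 * i1 + 1 + l) t) (\<lambda>(l, t). 2 * i1 - 2 * i2 + l)"
 have dec: "decomposes \<sigma> ?R ?I i" unfolding i_def
  by (intro decomposes_dsum decomposes_dsum_family decomposes_P) (use ij c h(2) in \<open>auto simp: h(1)\<close>)
 \<comment> \<open>The table of leading terms without subtraction: string, position and parameter
   for each kind of index.\<close>
 have desc: "(\<exists>x. t = Inl (x, Inl ()) \<and> \<not> g t \<and> l t = x \<and> i t + x = a \<and> x < a)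
  \<or> (\<exists>x. t = Inl (x, Inr ()) \<and> g t \<and> l t = 2 * b + 1 + x \<and> i t + x = a \<and> x < a)
  \<or> (\<exists>x. t = Inr (x, ()) \<and> \<not> g t \<and> l t = 2 * a + x \<and> i t + x = b + i2 \<and> x \<le> 2 * b)"
  if "t \<in> ?I" for t
 proof -
  have "(\<exists>x<a. t = Inl (x, Inl ())) \<or> (\<exists>x<a. t = Inl (x, Inr ())) \<or> (\<exists>x\<le>2 * b. t = Inr (x, ()))"
   using that ab(1,2,5) by (auto simp: h less_Suc_eq_le; linarith)
  then show ?thesis using ij ab by (elim disjE exE conjE; simp add: i_def g_def l_def h(1,3))
 qed
 show ?thesis
 proof (rule tensor_iso[OF dec, where g = g and l = l])
  show "finite ?I" by simp
  show "card ?I = N - 2 * i2 + 1" using ij c by (simp add: h card_indices card_Plus)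
  show "inj_on (\<lambda>(t, u). (g t, l t + (if u then 2 * i t - 1 else 0))) (?I \<times> UNIV)"
  proof (rule inj_positions)
   fix t t' assume t: "t \<in> ?I" "t' \<in> ?I" and gg: "g t = g t'"
   note d = desc[OF t(1)] desc[OF t(2)]
   show "t = t'" if "l t = l t' \<or> l t + 2 * i t = l t' + 2 * i t'"
    using d that gg by (elim disjE exE conjE; simp only: sum.inject prod.inject sum.distinct simp_thms; use ab ij in linarith)
   show "l t + 2 * i t \<noteq> l t' + 1"
    using d gg by (elim disjE exE conjE; simp only: simp_thms; use ab ij in linarith)
  next
   fix t assume "t \<in> ?I"
   from desc[OF this] show "1 \<le> i t" using ab by (elim disjE exE conjE; linarith)
  qed
 qed (use ij c in \<open>auto simp: h i_def g_def l_def\<close>)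
qed

text \<open>Now d exceeds 2 i1 - 1. Hence \<open>F^d\<close> also kills the beginning of the string
  of \<gamma>, where l + 2 i1 \<le> d, and positions of the string of \<alpha> past its break. The
  positions l of \<gamma> and 2 i1 - 1 + l of \<alpha> have the same weight and give the two copies
  with parameter N/2 - i1 - i2 + 1 - l.\<close>

lemma case_c:
 assumes c: "2 * i1 - 1 < N - 2 * i2 + 1" "i1 \<le> i2"
 shows "module_isomorphic A (qu_tensor n q (qu_P n q (2 * i1) j1) (qu_S n q (2 * i2) j2))
    ((DSUM l\<in>{0..2 * i1 - 2}. qu_P n q (N + 2 * i1 - 2 * i2 - 2 * l) (residue2 (int j1 + int j2 + int l))) \<boxplus>
     (DSUM l\<in>{0..N div 2 - i1 - i2}. (qu_P n q (N - 2 * i1 - 2 * i2 + 2 - 2 * l) (residue2 (int j1 + int j2 + int l - 1)) \<boxplus> qu_P n q (N - 2 * i1 - 2 * i2 + 2 - 2 * l) (residue2 (int j1 + int j2 + int l - 1)))))"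
  (is "module_isomorphic A _ ?R")
proof -
 obtain h where h: "N = 2 * h" "even h" "N div 2 = h" by (rule N_eq)
 obtain a b where ab: "i2 = i1 + a" "h = i1 + i2 + b" "2 * h = N"
  using ij c h(1) by (intro that[of "i2 - i1" "h - i1 - i2"]) auto
 let ?I = "Sigma {0..2 * i1 - 2} (\<lambda>_. {()}) <+> Sigma {0..N div 2 - i1 - i2} (\<lambda>_. {()} <+> {()})"
 define i :: "nat \<times> unit + nat \<times> (unit + unit) => nat" where "i = case_sum (\<lambda>(l, t). h + i1 - i2 - l) (\<lambda>(l, t). case_sum (\<lambda>_. h - i1 - i2 + 1 - l) (\<lambda>_. h - i1 - i2 + 1 - l) t)"
 define g :: "nat \<times> unit + nat \<times> (unit + unit) => bool" where "g = case_sum (\<lambda>_. False) (\<lambda>(l, t). case_sum (\<lambda>_. True) (\<lambda>_. False) t)"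
 define l :: "nat \<times> unit + nat \<times> (unit + unit) => nat" where "l = case_sum fst (\<lambda>(l, t). case_sum (\<lambda>_. l) (\<lambda>_. 2 * i1 - 1 + l) t)"
 have dec: "decomposes \<sigma> ?R ?I i" unfolding i_def
  by (intro decomposes_dsum decomposes_dsum_family decomposes_P) (use ij c h(2) in \<open>auto simp: h(1)\<close>)
 have desc: "(\<exists>x. t = Inl (x, ()) \<and> \<not> g t \<and> l t = x \<and> i t + x = 2 * i1 + b \<and> x + 2 \<le> 2 * i1)
  \<or> (\<exists>x. t = Inr (x, Inl ()) \<and> g t \<and> l t = x \<and> i t + x = b + 1 \<and> x \<le> b)
  \<or> (\<exists>x. t = Inr (x, Inr ()) \<and> \<not> g t \<and> l t + 1 = 2 * i1 + x \<and> i t + x = b + 1 \<and> x \<le> b)"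
  if "t \<in> ?I" for t
 proof -
  have "(\<exists>x\<le>2 * i1 - 2. t = Inl (x, ())) \<or> (\<exists>x\<le>b. t = Inr (x, Inl ())) \<or> (\<exists>x\<le>b. t = Inr (x, Inr ()))"
   using that ab(1,2) by (auto simp: h less_Suc_eq_le; linarith)
  then show ?thesis using ij ab by (elim disjE exE conjE; simp add: i_def g_def l_def h(1,3))
 qed
 show ?thesis
 proof (rule tensor_iso[OF dec, where g = g and l = l])
  show "finite ?I" by simp
  show "card ?I = N - 2 * i2 + 1" using ij c by (simp add: h card_indices card_Plus)
  show "inj_on (\<lambda>(t, u). (g t, l t + (if u then 2 * i t - 1 else 0))) (?I \<times> UNIV)"
  proof (rule inj_positions)
   fix t t' assume t: "t \<in> ?I" "t' \<in> ?I" and gg: "g t = g t'"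
   note d = desc[OF t(1)] desc[OF t(2)]
   show "t = t'" if "l t = l t' \<or> l t + 2 * i t = l t' + 2 * i t'"
    using d that gg by (elim disjE exE conjE; simp only: sum.inject prod.inject sum.distinct simp_thms; use ab ij in linarith)
   show "l t + 2 * i t \<noteq> l t' + 1"
    using d gg by (elim disjE exE conjE; simp only: simp_thms; use ab ij in linarith)
  next
   fix t assume "t \<in> ?I"
   from desc[OF this] show "1 \<le> i t" using ab by (elim disjE exE conjE; linarith)
  qed
 qed (use ij c in \<open>auto simp: h i_def g_def l_def\<close>)
qed

text \<open>The groups of cases (b) and (c) occur together. On the string of \<alpha> the lower ends
  are those below i1 - i2, those from 2(i1 - i2) to 2 i1 - 2, and those from 2 i1 - 1 on. On the
  string of \<gamma> one group of intervals fills the positions from 0 to 2b + 1, where b = N/2 - i1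
  - i2, and the other starts at the break N - 2 i1 + 1.\<close>

lemma case_d:
 assumes c: "2 * i1 - 1 < N - 2 * i2 + 1" "i1 > i2"
 shows "module_isomorphic A (qu_tensor n q (qu_P n q (2 * i1) j1) (qu_S n q (2 * i2) j2))
    ((DSUM l\<in>{0..i1 - i2 - 1}. (qu_P n q (2 * i1 - 2 * i2 - 2 * l) (residue2 (int j1 + int j2 + int l)) \<boxplus> qu_P n q (2 * i1 - 2 * i2 - 2 * l) (residue2 (int j1 + int j2 + int l)))) \<boxplus>
     (DSUM l\<in>{0..2 * i2 - 2}. qu_P n q (N - 2 * i1 + 2 * i2 - 2 * l) (residue2 (int j1 + int j2 + int l))) \<boxplus>
     (DSUM l\<in>{0..N div 2 - i1 - i2}. (qu_P n q (N - 2 * i1 - 2 * i2 + 2 - 2 * l) (residue2 (int j1 + int j2 + int l - 1)) \<boxplus> qu_P n q (N - 2 * i1 - 2 * i2 + 2 - 2 * l) (residue2 (int j1 + int j2 + int l - 1)))))"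
  (is "module_isomorphic A _ ?R")
proof -
 obtain h where h: "N = 2 * h" "even h" "N div 2 = h" by (rule N_eq)
 obtain a b where ab: "i1 = i2 + a" "h = i1 + i2 + b" "2 * h = N" "0 < a"
  using ij c h(1) by (intro that[of "i1 - i2" "h - i1 - i2"]) auto
 let ?I = "Sigma {0..i1 - i2 - 1} (\<lambda>_. {()} <+> {()}) <+> Sigma {0..2 * i2 - 2} (\<lambda>_. {()}) <+> Sigma {0..N div 2 - i1 - i2} (\<lambda>_. {()} <+> {()})"
 define i :: "nat \<times> (unit + unit) + nat \<times> unit + nat \<times> (unit + unit) => nat" where "i = case_sum (\<lambda>(l, t). case_sum (\<lambda>_. i1 - i2 - l) (\<lambda>_. i1 - i2 - l) t) (case_sum (\<lambda>(l, t). h - i1 + i2 - l) (\<lambda>(l, t). case_sum (\<lambda>_. h - i1 - i2 + 1 - l) (\<lambda>_. h - i1 - i2 + 1 - l) t))"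
 define g :: "nat \<times> (unit + unit) + nat \<times> unit + nat \<times> (unit + unit) => bool" where "g = case_sum (\<lambda>(l, t). case_sum (\<lambda>_. False) (\<lambda>_. True) t) (case_sum (\<lambda>_. False) (\<lambda>(l, t). case_sum (\<lambda>_. True) (\<lambda>_. False) t))"
 define l :: "nat \<times> (unit + unit) + nat \<times> unit + nat \<times> (unit + unit) => nat" where "l = case_sum (\<lambda>(l, t). case_sum (\<lambda>_. l) (\<lambda>_. N - 2 * i1 + 1 + l) t) (case_sum (\<lambda>(l, t). 2 * i1 - 2 * i2 + l) (\<lambda>(l, t). case_sum (\<lambda>_. l) (\<lambda>_. 2 * i1 - 1 + l) t))"
 have dec: "decomposes \<sigma> ?R ?I i" unfolding i_def
  by (intro decomposes_dsum decomposes_dsum_family decomposes_P) (use ij c h(2) in \<open>auto simp: h(1)\<close>)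
 have desc: "(\<exists>x. t = Inl (x, Inl ()) \<and> \<not> g t \<and> l t = x \<and> i t + x = a \<and> x < a)
  \<or> (\<exists>x. t = Inl (x, Inr ()) \<and> g t \<and> l t = 2 * i2 + 2 * b + 1 + x \<and> i t + x = a \<and> x < a)
  \<or> (\<exists>x. t = Inr (Inl (x, ())) \<and> \<not> g t \<and> l t = 2 * a + x \<and> i t + x = 2 * i2 + b \<and> x + 2 \<le> 2 * i2)
  \<or> (\<exists>x. t = Inr (Inr (x, Inl ())) \<and> g t \<and> l t = x \<and> i t + x = b + 1 \<and> x \<le> b)
  \<or> (\<exists>x. t = Inr (Inr (x, Inr ())) \<and> \<not> g t \<and> l t + 1 = 2 * i1 + x \<and> i t + x = b + 1 \<and> x \<le> b)"
  if "t \<in> ?I" for t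
 proof -
  have "(\<exists>x<a. t = Inl (x, Inl ())) \<or> (\<exists>x<a. t = Inl (x, Inr ())) \<or> (\<exists>x\<le>2 * i2 - 2. t = Inr (Inl (x, ())))
   \<or> (\<exists>x\<le>b. t = Inr (Inr (x, Inl ()))) \<or> (\<exists>x\<le>b. t = Inr (Inr (x, Inr ())))"
   using that ab(1,2,4) by (auto simp: h less_Suc_eq_le; linarith)
  then show ?thesis using ij ab by (elim disjE exE conjE; simp add: i_def g_def l_def h(1,3))
 qed
 show ?thesis
 proof (rule tensor_iso[OF dec, where g = g and l = l])
  show "finite ?I" by simp
  show "card ?I = N - 2 * i2 + 1" using ij c by (simp add: h card_indices card_Plus)
  show "inj_on (\<lambda>(t, u). (g t, l t + (if u then 2 * i t - 1 else 0))) (?I \<times> UNIV)"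
  proof (rule inj_positions)
   fix t t' assume t: "t \<in> ?I" "t' \<in> ?I" and gg: "g t = g t'"
   note d = desc[OF t(1)] desc[OF t(2)]
   show "t = t'" if "l t = l t' \<or> l t + 2 * i t = l t' + 2 * i t'"
    using d that gg by (elim disjE exE conjE; simp only: sum.inject prod.inject sum.distinct simp_thms; use ab ij in linarith)
   show "l t + 2 * i t \<noteq> l t' + 1"
    using d gg by (elim disjE exE conjE; simp only: simp_thms; use ab ij in linarith)
  next
   fix t assume "t \<in> ?I"
   from desc[OF this] show "1 \<le> i t" using ab by (elim disjE exE conjE; linarith)
  qed
 qed (use ij c in \<open>auto simp: h i_def g_def l_def\<close>)
qed

end

end

theorem theorem4p2:
 fixes n :: nat and q :: "'k :: {alg_closed_field, field_char_0}"
  and i1 i2 j1 j2 :: nat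
 assumes "n > 0" and "4 dvd n"
  and "primitive_root_of_unity (n ^ 2) q"
  and "1 \<le> i1" and "i1 \<le> n ^ 2 div 2"
  and "1 \<le> i2" and "i2 \<le> n ^ 2 div 2"
  and "j1 \<le> 1" and "j2 \<le> 1"
 shows
  "(2 * i1 - 1 \<ge> n ^ 2 - 2 * i2 + 1 \<and> i1 \<le> i2 \<longrightarrow>
   module_isomorphic (qu n q) (qu_tensor n q (qu_P n q (2 * i1) j1) (qu_S n q (2 * i2) j2))
    (DSUM l\<in>{0..n ^ 2 - 2 * i2}.
      qu_P n q (n ^ 2 + 2 * i1 - 2 * i2 - 2 * l) (residue2 (int j1 + int j2 + int l))))
  \<and>
  (2 * i1 - 1 \<ge> n ^ 2 - 2 * i2 + 1 \<and> i1 > i2 \<longrightarrow>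
   module_isomorphic (qu n q) (qu_tensor n q (qu_P n q (2 * i1) j1) (qu_S n q (2 * i2) j2))
    ((DSUM l\<in>{0..i1 - i2 - 1}.
      (qu_P n q (2 * i1 - 2 * i2 - 2 * l) (residue2 (int j1 + int j2 + int l)) \<boxplus>
       qu_P n q (2 * i1 - 2 * i2 - 2 * l) (residue2 (int j1 + int j2 + int l)))) \<boxplus>
     (DSUM l\<in>{0..n ^ 2 - 2 * i1}.
      qu_P n q (n ^ 2 - 2 * i1 + 2 * i2 - 2 * l) (residue2 (int j1 + int j2 + int l)))))
  \<and>
  (2 * i1 - 1 < n ^ 2 - 2 * i2 + 1 \<and> i1 \<le> i2 \<longrightarrow>
   module_isomorphic (qu n q) (qu_tensor n q (qu_P n q (2 * i1) j1) (qu_S n q (2 * i2) j2))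
    ((DSUM l\<in>{0..2 * i1 - 2}.
      qu_P n q (n ^ 2 + 2 * i1 - 2 * i2 - 2 * l) (residue2 (int j1 + int j2 + int l))) \<boxplus>
     (DSUM l\<in>{0..n ^ 2 div 2 - i1 - i2}.
      (qu_P n q (n ^ 2 - 2 * i1 - 2 * i2 + 2 - 2 * l)
        (residue2 (int j1 + int j2 + int l - 1)) \<boxplus>
       qu_P n q (n ^ 2 - 2 * i1 - 2 * i2 + 2 - 2 * l)
        (residue2 (int j1 + int j2 + int l - 1))))))
  \<and>
  (2 * i1 - 1 < n ^ 2 - 2 * i2 + 1 \<and> i1 > i2 \<longrightarrow>
   module_isomorphic (qu n q) (qu_tensor n q (qu_P n q (2 * i1) j1) (qu_S n q (2 * i2) j2))
    ((DSUM l\<in>{0..i1 - i2 - 1}.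
      (qu_P n q (2 * i1 - 2 * i2 - 2 * l) (residue2 (int j1 + int j2 + int l)) \<boxplus>
       qu_P n q (2 * i1 - 2 * i2 - 2 * l) (residue2 (int j1 + int j2 + int l)))) \<boxplus>
     (DSUM l\<in>{0..2 * i2 - 2}.
      qu_P n q (n ^ 2 - 2 * i1 + 2 * i2 - 2 * l) (residue2 (int j1 + int j2 + int l))) \<boxplus>
     (DSUM l\<in>{0..n ^ 2 div 2 - i1 - i2}.
      (qu_P n q (n ^ 2 - 2 * i1 - 2 * i2 + 2 - 2 * l)
        (residue2 (int j1 + int j2 + int l - 1)) \<boxplus>
       qu_P n q (n ^ 2 - 2 * i1 - 2 * i2 + 2 - 2 * l)
        (residue2 (int j1 + int j2 + int l - 1))))))"
proof -
 interpret qparam n q by (rule qparam.intro[OF assms(1-3)])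
 have "2 * i1 \<le> n ^ 2" "2 * i2 \<le> n ^ 2" using assms(5,7) by linarith+
 note ij = assms(4) this(1) assms(6) this(2) assms(8,9)
 show ?thesis
 proof (intro conjI impI; elim conjE)
  assume "2 * i1 - 1 \<ge> n ^ 2 - 2 * i2 + 1" "i1 \<le> i2"
  then show "module_isomorphic A (qu_tensor n q (qu_P n q (2 * i1) j1) (qu_S n q (2 * i2) j2))
    (DSUM l\<in>{0..n ^ 2 - 2 * i2}.
      qu_P n q (n ^ 2 + 2 * i1 - 2 * i2 - 2 * l) (residue2 (int j1 + int j2 + int l)))"
   by (rule case_a[OF ij])
 qed (erule (1) case_b[OF ij] case_c[OF ij] case_d[OF ij])+
qed

end
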